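(* Let $\alpha\in\mathbb{R}$ and $\beta\in(\beta_\alpha,\infty)$ be such that $\mathcal{Z}_{\alpha,\beta}=\emptyset$, let $v_0\in\mathcal{M}^2_{\alpha,\beta}$, let $v$ be the unique solution with initial condition $v_0$ of the constrained phase-field flow described in the context, and let $\mu:=-\Delta v+W'(v)$. Then the map $$t\longmapsto E[v(t)]=\frac12\|\mu(t)\|_2^2$$ is non-increasing on $[0,\infty)$.
   Context: $\Omega$ is a smooth bounded connected open subset of $\mathbb{R}^d$, $1\le d\le 3$, with outward unit normal $\mathbf{n}$ on $\partial\Omega$; $\|\cdot\|_p$ is the norm of $L^p(\Omega)$; $\overline{w}:=\frac{1}{|\Omega|}\int_\Omega w\,dx$ is the spatial average. $a>0$ is a fixed real number and $W(r):=\frac a4(r^2-1)^2$. For $w\in H^1(\Omega)$, $F[w]:=\frac12\|\nabla w\|_2^2+\int_\Omega W(w)\,dx$; for $w\in H^2(\Omega)$, $E[w]:=\frac12\int_\Omega[-\Delta w+W'(w)]^2\,dx$. $H^2_N(\Omega):=\{w\in H^2(\Omega):\nabla w\cdot\mathbf{n}=0\text{ on }\partial\Omega\}$. For $\alpha\in\mathbb{R}$, $\beta_\alpha:=\inf\{F[w]: w\in H^1(\Omega),\ \overline{w}=\alpha\}$. For $\beta\ge 0$, $\mathcal{M}^2_{\alpha,\beta}:=\{w\in H^2_N(\Omega):\overline{w}=\alpha,\ F[w]=\beta\}$ and $\mathcal{Z}_{\alpha,\beta}:=\{w\in\mathcal{M}^2_{\alpha,\beta}: -\Delta w+W'(w)-\overline{W'(w)}=0\text{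 in }\Omega\}$. Solution of the constrained phase-field flow: when $\mathcal{Z}_{\alpha,\beta}=\emptyset$ and $v_0\in\mathcal{M}^2_{\alpha,\beta}$, there is a unique function $v\in\mathcal{C}([0,\infty)\times\overline{\Omega})\cap L^\infty(0,\infty;H^2(\Omega))$ with $v(0)=v_0$ such that, for all $t>0$, $v(t)\in\mathcal{M}^2_{\alpha,\beta}$, $\mu:=-\Delta v+W'(v)\in L^2(0,t;H^2_N(\Omega))$, and there are functions $A,B\in L^2(0,t)$ of time only with $\partial_t v=\Delta\mu-W''(v)\mu+A+B\mu$ a.e. in $(0,t)\times\Omega$. It moreover satisfies $A+B\overline{\mu}=\overline{W''(v)\mu}$, $B\|\mu-\overline{\mu}\|_2^2=\|\nabla\mu\|_2^2+\int_\Omega W''(v)\mu^2\,dx-\overline{W''(v)\mu}\int_\Omega\mu\,dx$, and, for each $t>0$, $\inf_{s\in[0,t]}\|(\mu-\overline{\mu})(s)\|_2>0$. *)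

theory Defs
  imports "HOL-Analysis.Analysis"
begin

section \<open>Smooth functions, smooth domains, surface measure\<close>

text \<open>To be used on open sets only, where \<^term>\<open>at x within S\<close> and \<^term>\<open>at x\<close> agree.\<close>

primrec Ck_on :: "nat \<Rightarrow> 'a::euclidean_space set \<Rightarrow> ('a \<Rightarrow> real) \<Rightarrow> bool" where
  "Ck_on 0 S f \<longleftrightarrow> continuous_on S f"
| "Ck_on (Suc k) S f \<longleftrightarrow>
     f differentiable_on S \<and> (\<forall>b\<in>Basis. Ck_on k S (\<lambda>x. frechet_derivative f (at x) b))"

definition smooth_on :: "'a::euclidean_space set \<Rightarrow> ('a \<Rightarrow> real) \<Rightarrow> bool" where
  "smooth_on S f \<longleftrightarrow> (\<forall>k. Ck_on k S f)"

definition boundary_defining ::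
    "'a::euclidean_space set \<Rightarrow> 'a \<Rightarrow> 'a set \<Rightarrow> ('a \<Rightarrow> real) \<Rightarrow> bool" where
  "boundary_defining \<Omega> p U \<rho> \<longleftrightarrow>
     open U \<and> p \<in> U \<and> smooth_on U \<rho> \<and>
     \<Omega> \<inter> U = {x\<in>U. \<rho> x < 0} \<and> frontier \<Omega> \<inter> U = {x\<in>U. \<rho> x = 0} \<and>
     (\<forall>x\<in>U. frechet_derivative \<rho> (at x) \<noteq> (\<lambda>_. 0))"

definition smooth_domain :: "'a::euclidean_space set \<Rightarrow> bool" where
  "smooth_domain \<Omega> \<longleftrightarrow>
     open \<Omega> \<and> bounded \<Omega> \<and> connected \<Omega> \<and> \<Omega> \<noteq> {} \<and>
     (\<forall>p\<in>frontier \<Omega>. \<exists>U \<rho>. boundary_defining \<Omega> p U \<rho>)"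

text \<open>The normalized gradient of a local defining function (which is negative inside); it does not
  depend on the choice of that function.\<close>

definition outward_normal :: "'a::euclidean_space set \<Rightarrow> 'a \<Rightarrow> 'a" where
  "outward_normal \<Omega> p =
     (THE n. norm n = 1 \<and>
        (\<exists>U \<rho> c. boundary_defining \<Omega> p U \<rho> \<and> c > 0 \<and> GDERIV \<rho> p :> c *\<^sub>R n))"

text \<open>The \<open>s\<close>-dimensional Hausdorff measure, for natural \<open>s\<close>, with the normalization that makes it
  the usual surface measure on smooth \<open>s\<close>-dimensional surfaces. The empty set gets weight \<open>0\<close>
  also for \<open>s = 0\<close>, where any other set has weight \<open>1\<close>. Borel sets are Caratheodory
  measurable for this metric outer measure, so that \<^const>\<open>measure_of\<close> yields its
  restriction to the Borel sets.\<close>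

definition hausdorff_weight :: "nat \<Rightarrow> 'a::euclidean_space set \<Rightarrow> ennreal" where
  "hausdorff_weight s C =
     (if C = {} then 0 else ennreal (unit_ball_vol (real s) * (diameter C / 2) ^ s))"

definition hausdorff_outer :: "nat \<Rightarrow> 'a::euclidean_space set \<Rightarrow> ennreal" where
  "hausdorff_outer s A =
     (SUP \<delta>\<in>{0<..}. INF C\<in>{C :: nat \<Rightarrow> 'a set.
          A \<subseteq> (\<Union>i. C i) \<and> (\<forall>i. bounded (C i) \<and> diameter (C i) \<le> \<delta>)}.
        (\<Sum>i. hausdorff_weight s (C i)))"

definition hausdorff_measure :: "nat \<Rightarrow> 'a::euclidean_space measure" where
  "hausdorff_measure s = measure_of UNIV (sets borel) (hausdorff_outer s)"

definition surface :: "'a::euclidean_space set \<Rightarrow> 'a measure" where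
  "surface \<Omega> = restrict_space (hausdorff_measure (DIM('a) - 1)) (frontier \<Omega>)"

section \<open>Sobolev spaces\<close>

text \<open>Elements of function spaces are represented by functions on the whole type, of which only
  the almost everywhere class on \<open>\<Omega>\<close> matters.\<close>

definition L2 :: "'a::euclidean_space set \<Rightarrow> ('a \<Rightarrow> real) set" where
  "L2 \<Omega> = {w \<in> borel_measurable (lebesgue_on \<Omega>). integrable (lebesgue_on \<Omega>) (\<lambda>x. (w x)\<^sup>2)}"

definition L2norm :: "'a::euclidean_space set \<Rightarrow> ('a \<Rightarrow> real) \<Rightarrow> real" where
  "L2norm \<Omega> w = sqrt (\<integral>x. (w x)\<^sup>2 \<partial>lebesgue_on \<Omega>)"

definition loc_integrable :: "'a::euclidean_space set \<Rightarrow> ('a \<Rightarrow> real) \<Rightarrow> bool" where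
  "loc_integrable \<Omega> w \<longleftrightarrow> (\<forall>K. compact K \<and> K \<subseteq> \<Omega> \<longrightarrow> integrable (lebesgue_on K) w)"

definition test_fun :: "'a::euclidean_space set \<Rightarrow> ('a \<Rightarrow> real) set" where
  "test_fun \<Omega> = {\<phi>. smooth_on UNIV \<phi> \<and> (\<exists>K. compact K \<and> K \<subseteq> \<Omega> \<and> (\<forall>x. x \<notin> K \<longrightarrow> \<phi> x = 0))}"

definition has_weak_deriv ::
    "'a::euclidean_space set \<Rightarrow> 'a \<Rightarrow> ('a \<Rightarrow> real) \<Rightarrow> ('a \<Rightarrow> real) \<Rightarrow> bool" where
  "has_weak_deriv \<Omega> b w g \<longleftrightarrow>
     loc_integrable \<Omega> w \<and> loc_integrable \<Omega> g \<and>
     (\<forall>\<phi>\<in>test_fun \<Omega>. (\<integral>x. w x * frechet_derivative \<phi> (at x) b \<partial>lebesgue_on \<Omega>)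
        = - (\<integral>x. g x * \<phi> x \<partial>lebesgue_on \<Omega>))"

text \<open>Some representative of the weak derivative in direction \<open>b\<close>, which is unique up to null
  sets when it exists.\<close>

definition wderiv :: "'a::euclidean_space set \<Rightarrow> 'a \<Rightarrow> ('a \<Rightarrow> real) \<Rightarrow> 'a \<Rightarrow> real" where
  "wderiv \<Omega> b w = (SOME g. has_weak_deriv \<Omega> b w g)"

definition wlaplacian :: "'a::euclidean_space set \<Rightarrow> ('a \<Rightarrow> real) \<Rightarrow> 'a \<Rightarrow> real" where
  "wlaplacian \<Omega> w x = (\<Sum>b\<in>Basis. wderiv \<Omega> b (wderiv \<Omega> b w) x)"

definition H1 :: "'a::euclidean_space set \<Rightarrow> ('a \<Rightarrow> real) set" where
  "H1 \<Omega> = {w \<in> L2 \<Omega>. \<forall>b\<in>Basis. \<exists>g\<in>L2 \<Omega>. has_weak_deriv \<Omega> b w g}"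

definition H1norm :: "'a::euclidean_space set \<Rightarrow> ('a \<Rightarrow> real) \<Rightarrow> real" where
  "H1norm \<Omega> w = sqrt ((L2norm \<Omega> w)\<^sup>2 + (\<Sum>b\<in>Basis. (L2norm \<Omega> (wderiv \<Omega> b w))\<^sup>2))"

definition H2 :: "'a::euclidean_space set \<Rightarrow> ('a \<Rightarrow> real) set" where
  "H2 \<Omega> = {w \<in> H1 \<Omega>. \<forall>b\<in>Basis. wderiv \<Omega> b w \<in> H1 \<Omega>}"

definition H2norm :: "'a::euclidean_space set \<Rightarrow> ('a \<Rightarrow> real) \<Rightarrow> real" where
  "H2norm \<Omega> w = sqrt ((L2norm \<Omega> w)\<^sup>2 + (\<Sum>b\<in>Basis. (H1norm \<Omega> (wderiv \<Omega> b w))\<^sup>2))"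

text \<open>\<open>h\<close> is the trace on the boundary of \<open>w \<in> H1 \<Omega>\<close>: the limit in \<open>L\<^sup>2\<close> of the surface of the
  boundary values of functions that are smooth up to the boundary and converge to \<open>w\<close> in
  \<open>H1 \<Omega>\<close>.\<close>

definition has_trace :: "'a::euclidean_space set \<Rightarrow> ('a \<Rightarrow> real) \<Rightarrow> ('a \<Rightarrow> real) \<Rightarrow> bool" where
  "has_trace \<Omega> w h \<longleftrightarrow>
     w \<in> H1 \<Omega> \<and> h \<in> borel_measurable (surface \<Omega>) \<and>
     (\<exists>u :: nat \<Rightarrow> 'a \<Rightarrow> real. (\<forall>k. smooth_on UNIV (u k)) \<and>
        (\<lambda>k. H1norm \<Omega> (\<lambda>x. u k x - w x)) \<longlonglongrightarrow> 0 \<and>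
        (\<lambda>k. \<integral>\<^sup>+x. ennreal ((u k x - h x)\<^sup>2) \<partial>surface \<Omega>) \<longlonglongrightarrow> 0)"

text \<open>\<open>H\<^sup>2\<close> functions whose normal derivative vanishes on the boundary in the sense of traces.\<close>

definition H2N :: "'a::euclidean_space set \<Rightarrow> ('a \<Rightarrow> real) set" where
  "H2N \<Omega> = {w \<in> H2 \<Omega>. \<exists>h :: 'a \<Rightarrow> 'a \<Rightarrow> real.
     (\<forall>b\<in>Basis. has_trace \<Omega> (wderiv \<Omega> b w) (h b)) \<and>
     (AE x in surface \<Omega>. (\<Sum>b\<in>Basis. h b x * (outward_normal \<Omega> x \<bullet> b)) = 0)}"

section \<open>Functions of time with values in a function space\<close>

text \<open>Bochner measurability of a map from \<open>I\<close> to the function space \<open>X\<close> with norm \<open>nrm\<close>: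
  almost everywhere limit of simple functions.\<close>

definition strongly_measurable ::
    "real set \<Rightarrow> ('a \<Rightarrow> real) set \<Rightarrow> (('a \<Rightarrow> real) \<Rightarrow> real) \<Rightarrow> (real \<Rightarrow> 'a \<Rightarrow> real) \<Rightarrow> bool" where
  "strongly_measurable I X nrm u \<longleftrightarrow>
     (\<exists>s :: nat \<Rightarrow> real \<Rightarrow> 'a \<Rightarrow> real.
        (\<forall>k. finite (s k ` I) \<and> s k ` I \<subseteq> X \<and> (\<forall>f. {t\<in>I. s k t = f} \<in> sets lebesgue)) \<and>
        (AE t in lebesgue_on I. u t \<in> X \<and> (\<lambda>k. nrm (\<lambda>x. s k t x - u t x)) \<longlonglongrightarrow> 0))"

definition L2_time ::
    "real set \<Rightarrow> ('a \<Rightarrow> real) set \<Rightarrow> (('a \<Rightarrow> real) \<Rightarrow> real) \<Rightarrow> (real \<Rightarrow> 'a \<Rightarrow> real) set" where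
  "L2_time I X nrm =
     {u. strongly_measurable I X nrm u \<and> integrable (lebesgue_on I) (\<lambda>t. (nrm (u t))\<^sup>2)}"

definition Linf_time ::
    "real set \<Rightarrow> ('a \<Rightarrow> real) set \<Rightarrow> (('a \<Rightarrow> real) \<Rightarrow> real) \<Rightarrow> (real \<Rightarrow> 'a \<Rightarrow> real) set" where
  "Linf_time I X nrm =
     {u. strongly_measurable I X nrm u \<and> (\<exists>C. AE t in lebesgue_on I. nrm (u t) \<le> C)}"

section \<open>The phase-field functionals and the constrained flow\<close>

definition avg :: "'a::euclidean_space set \<Rightarrow> ('a \<Rightarrow> real) \<Rightarrow> real" where
  "avg \<Omega> w = (\<integral>x. w x \<partial>lebesgue_on \<Omega>) / measure lebesgue \<Omega>"

definition W :: "real \<Rightarrow> real \<Rightarrow> real" where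
  "W a r = a / 4 * (r\<^sup>2 - 1)\<^sup>2"

definition F :: "'a::euclidean_space set \<Rightarrow> real \<Rightarrow> ('a \<Rightarrow> real) \<Rightarrow> real" where
  "F \<Omega> a w = 1 / 2 * (\<Sum>b\<in>Basis. (L2norm \<Omega> (wderiv \<Omega> b w))\<^sup>2) + (\<integral>x. W a (w x) \<partial>lebesgue_on \<Omega>)"

definition mu :: "'a::euclidean_space set \<Rightarrow> real \<Rightarrow> ('a \<Rightarrow> real) \<Rightarrow> 'a \<Rightarrow> real" where
  "mu \<Omega> a w x = - wlaplacian \<Omega> w x + deriv (W a) (w x)"

definition E :: "'a::euclidean_space set \<Rightarrow> real \<Rightarrow> ('a \<Rightarrow> real) \<Rightarrow> real" where
  "E \<Omega> a w = 1 / 2 * (\<integral>x. (- wlaplacian \<Omega> w x + deriv (W a) (w x))\<^sup>2 \<partial>lebesgue_on \<Omega>)"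

definition beta_min :: "'a::euclidean_space set \<Rightarrow> real \<Rightarrow> real \<Rightarrow> real" where
  "beta_min \<Omega> a \<alpha> = Inf {F \<Omega> a w | w. w \<in> H1 \<Omega> \<and> avg \<Omega> w = \<alpha>}"

definition M2 :: "'a::euclidean_space set \<Rightarrow> real \<Rightarrow> real \<Rightarrow> real \<Rightarrow> ('a \<Rightarrow> real) set" where
  "M2 \<Omega> a \<alpha> \<beta> = {w \<in> H2N \<Omega>. avg \<Omega> w = \<alpha> \<and> F \<Omega> a w = \<beta>}"

definition Z :: "'a::euclidean_space set \<Rightarrow> real \<Rightarrow> real \<Rightarrow> real \<Rightarrow> ('a \<Rightarrow> real) set" where
  "Z \<Omega> a \<alpha> \<beta> = {w \<in> M2 \<Omega> a \<alpha> \<beta>. AE x in lebesgue_on \<Omega>.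
     - wlaplacian \<Omega> w x + deriv (W a) (w x) - avg \<Omega> (\<lambda>y. deriv (W a) (w y)) = 0}"

text \<open>Solution \<open>v\<close> of the constrained flow starting from \<open>v0\<close>. The time derivative is the weak
  derivative in direction \<open>(1, 0)\<close> on the space-time cylinder. Since the representative of
  the weak Laplacian of each \<open>mu \<Omega> a (v s)\<close> is chosen separately for each \<open>s\<close>, the equation is
  stated for almost every \<open>s\<close> and then almost every \<open>x\<close>, for a jointly measurable
  version \<open>g\<close> of the time derivative.\<close>

definition flow_solution ::
    "'a::euclidean_space set \<Rightarrow> real \<Rightarrow> real \<Rightarrow> real \<Rightarrow> ('a \<Rightarrow> real) \<Rightarrow> (real \<Rightarrow> 'a \<Rightarrow> real) \<Rightarrow> bool"
  where
  "flow_solution \<Omega> a \<alpha> \<beta> v0 v \<longleftrightarrow>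
     continuous_on ({0..} \<times> closure \<Omega>) (\<lambda>(t, x). v t x) \<and>
     v \<in> Linf_time {0<..} (H2 \<Omega>) (H2norm \<Omega>) \<and>
     (AE x in lebesgue_on \<Omega>. v 0 x = v0 x) \<and>
     (\<forall>t>0.
        v t \<in> M2 \<Omega> a \<alpha> \<beta> \<and>
        (\<lambda>s. mu \<Omega> a (v s)) \<in> L2_time {0<..<t} (H2N \<Omega>) (H2norm \<Omega>) \<and>
        (\<exists>A\<in>L2 {0<..<t}. \<exists>B\<in>L2 {0<..<t}. \<exists>g.
           has_weak_deriv ({0<..<t} \<times> \<Omega>) (1, 0) (\<lambda>(s, x). v s x) g \<and>
           (AE s in lebesgue_on {0<..<t}. AE x in lebesgue_on \<Omega>.
              g (s, x) = wlaplacian \<Omega> (mu \<Omega> a (v s)) x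
                - deriv (deriv (W a)) (v s x) * mu \<Omega> a (v s) x
                + A s + B s * mu \<Omega> a (v s) x)))"

end

theory Submission
 imports Defs
begin

text \<open>Formally \<open>d/dt E[v] = - \<parallel>v'\<parallel>\<^sup>2\<close>: the multipliers \<open>A\<close> and \<open>B\<close> drop out because the mean and \<open>F\<close> are
  conserved. The solution is too weak to differentiate \<open>E\<close>, so the computation is done with the
  difference quotient of \<open>E\<close> in a time step \<open>h\<close>, averaged over time: self-adjointness of the
  Laplacian on \<open>H2N\<close> and \<open>F[v(t)] = F[v(t - h)]\<close> give
  \<open>E[v(t)] - E[v(t - h)] \<le> - 1/2 <v'(t) + v'(t - h), v(t) - v(t - h)> + o(h)\<close> in the mean, and by the
  continuity of translations in \<open>L\<^sup>2\<close> the first term is at most \<open>o(h)\<close> as well. So the averages of \<open>E\<close> over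
  short intervals decrease. Since \<open>E\<close> is lower semicontinuous along the flow, and its average just
  after a time \<open>s\<close> exceeds \<open>E[v(s)]\<close> by at most \<open>o(1)\<close>, this passes to every pair of times.\<close>

text \<open>Why two times and not one: \<open>B\<close> is merely square integrable in time, so a
  term of size |B| times the increment is not negligible. Let x and y be the pairings of the
  increment with \<open>mu\<close> at the two times. Conservation of \<open>F\<close> makes x + y
  quadratic in the increment, and what is left, (B1 - B2)(x - y), is small because a short
  translation moves \<open>B\<close> little in L2. The main obstacle is the boundary condition. It
  is given only through traces in L2 of a Hausdorff measure, while self-adjointness of the Laplacian
  needs Green's formula without boundary term. A cutoff that vanishes near the boundary has a
  gradient of order 1/eps on a strip of width eps; the error vanishes because the normal derivative
  has L2 norm of order eps there. This bound rests on comparing Lebesgue measure on strips with the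
  Hausdorff measure of the boundary, which must first be shown to be a Borel measure. In time, the
  weak derivative on the cylinder is square integrable in space-time, and increments of
  \<open>v\<close> are its time integrals. Hence an increment over a step h is h times a mean of the
  derivative, and the derivative at either end of the step is close to this mean.\<close>

abbreviation "fd == frechet_derivative"
abbreviation "leb == lebesgue_on"
type_synonym enn = ennreal
abbreviation "enn == ennreal"
abbreviation "lap == wlaplacian"
abbreviation "hwd == has_weak_deriv"
abbreviation "nni == nn_integral"
notation LIMSEQ (infixr "---->" 60)
abbreviation "ind == indicator"
abbreviation "bmeas == borel_measurable"

lemmas bochner_integral_cong = Bochner_Integration.integral_cong
lemmas bochner_integral_norm_bound_integral = Bochner_Integration.integral_norm_bound_integral
lemmas bochner_integrable_bound = Bochner_Integration.integrable_bound
lemmas bochner_integrable_add = Bochner_Integration.integrable_add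
lemmas bochner_integrable_diff = Bochner_Integration.integrable_diff
lemmas bochner_integral_add = Bochner_Integration.integral_add
lemmas bochner_integral_diff = Bochner_Integration.integral_diff
lemmas bochner_integral_sum = Bochner_Integration.integral_sum
lemmas bochner_integrable_sum = Bochner_Integration.integrable_sum

section \<open>Calculus of smooth functions\<close>

lemma has_derivative_cong_open:
 fixes f g :: "'a::euclidean_space => real"
 assumes "open S" "x : S" "!!x. x : S ==> f x = g x"
 shows "(f has_derivative D) (at x) \<longleftrightarrow> (g has_derivative D) (at x)"
proof
 show "(g has_derivative D) (at x)" if "(f has_derivative D) (at x)" by (rule has_derivative_transform_within_open[OF that assms(1,2)]) (rule assms(3))
 show "(f has_derivative D) (at x)" if "(g has_derivative D) (at x)" by (rule has_derivative_transform_within_open[OF that assms(1,2)]) (rule assms(3)[symmetric])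
qed

lemma frechet_derivative_cong_open:
 fixes f g :: "'a::euclidean_space => real"
 assumes "open S" "x : S" "!!x. x : S ==> f x = g x"
 shows "fd f (at x) = fd g (at x)" using has_derivative_cong_open[OF assms] unfolding frechet_derivative_def by simp

lemma Ck_on_cong:
 fixes f g :: "'a::euclidean_space => real"
 assumes "open S" "!!x. x : S ==> f x = g x"
 shows "Ck_on k S f \<longleftrightarrow> Ck_on k S g" using assms(2)
proof (induction k arbitrary: f g)
 case 0
 then show ?case using continuous_on_cong[OF refl, of S f g] by auto
next
 case (Suc k)
 have "f differentiable_on S \<longleftrightarrow> g differentiable_on S"
 proof -
	have "(f has_derivative D) (at x within S) \<longleftrightarrow> (g has_derivative D) (at x within S)"
	 if "x : S" for x D unfolding at_within_open[OF that assms(1)] by (rule has_derivative_cong_open[OF assms(1) that Suc.prems])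
	then show ?thesis unfolding differentiable_on_def differentiable_def by blast
 qed
 moreover have "Ck_on k S (%x. fd f (at x) b) \<longleftrightarrow>
	 Ck_on k S (%x. fd g (at x) b)" for b by (rule Suc.IH, rule fun_cong[OF frechet_derivative_cong_open[OF assms(1) _ Suc.prems]])
 ultimately show ?case by auto
qed

text \<open>Accepts any explicit derivative \<open>D\<close>: on an open set derivatives are unique,
  so \<open>D\<close> agrees with \<open>frechet_derivative\<close>, which is defined by choice and
  awkward to compute with.\<close>

lemma Ck_on_SucI:
 fixes f :: "'a::euclidean_space => real"
 assumes "open S" "!!x. x : S ==> (f has_derivative D x) (at x)"
	"!!b. b : Basis ==> Ck_on k S (%x. D x b)"
 shows "Ck_on (Suc k) S f"
proof -
 have "f differentiable_on S" using assms(2) by (auto simp: differentiable_on_def differentiable_def intro: has_derivative_at_withinI)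
 moreover have "Ck_on k S (%x. fd f (at x) b)" if "b : Basis" for b
 proof -
	have "fd f (at x) b = D x b" if "x : S" for x using frechet_derivative_at[OF assms(2)[OF that]] by simp
	then show ?thesis by (rule Ck_on_cong[OF assms(1), THEN iffD2]) (auto intro: assms(3) that)
 qed
 ultimately show ?thesis by simp
qed

lemma Ck_on_SucD:
 assumes "open S" "Ck_on (Suc k) S f"
 shows "x : S ==> (f has_derivative fd f (at x)) (at x)"
	and "b : Basis ==> Ck_on k S (%x. fd f (at x) b)" using assms
 by (auto simp: differentiable_on_def at_within_open[OF _ assms(1)] intro: frechet_derivative_works[THEN iffD1])

lemma Ck_on_Suc_imp:
 assumes "open S" "Ck_on (Suc k) S f"
 shows "Ck_on k S f" using assms(2)
proof (induction k arbitrary: f)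
 case 0
 then show ?case by (simp add: differentiable_imp_continuous_on)
next
 case (Suc k)
 then show ?case by (metis Ck_on.simps(2))
qed


lemma Ck_on_subset:
 assumes "Ck_on k S f" "T \<subseteq> S"
 shows "Ck_on k T f" using assms
proof (induction k arbitrary: f)
 case 0
 then show ?case by (simp add: continuous_on_subset)
next
 case (Suc k)
 then show ?case by (auto intro: differentiable_on_subset)
qed

lemma Ck_on_Un:
 fixes f :: "'a::euclidean_space => real"
 assumes "open S" "open T" "Ck_on k S f" "Ck_on k T f"
 shows "Ck_on k (S \<union> T) f" using assms(3,4)
proof (induction k arbitrary: f)
 case 0
 then show ?case using assms by (simp add: continuous_on_open_Un)
next
 case (Suc k)
 have "f differentiable_on (S \<union> T)" unfolding differentiable_on_def
 proof
	fix x assume x: "x : S \<union> T"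
	then have "f differentiable at x" using Suc.prems assms(1,2) at_within_open[of x S] at_within_open[of x T] by (auto simp: differentiable_on_def)
	then show "f differentiable at x within S \<union> T" by (rule differentiable_at_withinI)
 qed
 with Suc show ?case by auto
qed

lemma Ck_on_const: "open S ==> Ck_on k S (%x::'a::euclidean_space. c::real)"
proof (induction k arbitrary: c)
 case 0
 then show ?case by simp
next
 case (Suc k)
 show ?case by (rule Ck_on_SucI[where D="%x h. 0"]) (use Suc in auto)
qed

lemma Ck_on_add:
 fixes f g :: "'a::euclidean_space => real"
 assumes "open S" "Ck_on k S f" "Ck_on k S g"
 shows "Ck_on k S (%x. f x + g x)" using assms(2,3)
proof (induction k arbitrary: f g)
 case 0
 then show ?case by (simp add: continuous_on_add)
next
 case (Suc k)
 show ?case by (rule Ck_on_SucI[OF assms(1), where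
		 D="%x h. fd f (at x) h + fd g (at x) h"]) (auto intro!: has_derivative_add Suc.IH Ck_on_SucD[OF assms(1)] Suc.prems simp del: Ck_on.simps)
qed

lemma Ck_on_mult:
 fixes f g :: "'a::euclidean_space => real"
 assumes "open S" "Ck_on k S f" "Ck_on k S g"
 shows "Ck_on k S (%x. f x * g x)" using assms(2,3)
proof (induction k arbitrary: f g)
 case 0
 then show ?case by (simp add: continuous_on_mult)
next
 case (Suc k)
 note imp = Ck_on_Suc_imp[OF assms(1) Suc.prems(1)] Ck_on_Suc_imp[OF assms(1) Suc.prems(2)]
 show ?case by (rule Ck_on_SucI[OF assms(1), where
		 D="%x h. f x * fd g (at x) h + fd f (at x) h * g x"]) (auto intro!: has_derivative_mult Ck_on_add Suc.IH imp assms(1) Ck_on_SucD[OF assms(1)]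
		Suc.prems simp del: Ck_on.simps)
qed

lemma Ck_on_sum:
 fixes f :: "'i => 'a::euclidean_space => real"
 assumes "open S" "!!i. i : I ==> Ck_on k S (f i)"
 shows "Ck_on k S (%x. SUM i:I. f i x)" using assms(2) by (induction I rule: infinite_finite_induct) (auto simp: Ck_on_const Ck_on_add assms(1))

text \<open>\<open>Ck_on\<close> only speaks of partial derivatives, so \<open>L h\<close> from the
  chain rule is expanded in the basis. The result is a sum of constants times partial derivatives of
  \<open>f\<close> composed with the same affine map, which is what the induction needs.\<close>

lemma Ck_on_compose_affine:
 fixes f :: "'b::euclidean_space => real" and L :: "'a::euclidean_space => 'b"
 assumes "open S" "open T" "bounded_linear L" "Ck_on k T f" "!!x. x : S ==> c + L x : T"
 shows "Ck_on k S (%x. f (c + L x))" using assms(4)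
proof (induction k arbitrary: f)
 case 0
 have "continuous_on S (%x. c + L x)" by (intro continuous_intros linear_continuous_on assms)
 then show ?case using 0 continuous_on_compose2[of T f S "%x. c + L x"] assms(5) by auto
next
 case (Suc k)
 have der: "((%x. f (c + L x)) has_derivative
	 (%h. SUM b:Basis. (L h \<bullet> b) * fd f (at (c + L x)) b)) (at x)" if "x : S" for x
 proof -
	have f: "(f has_derivative fd f (at (c + L x))) (at (c + L x))" using Ck_on_SucD(1)[OF assms(2) Suc.prems] assms(5) that by blast
	have L: "((%x. c + L x) has_derivative L) (at x)" by (auto intro!: derivative_eq_intros bounded_linear_imp_has_derivative assms)
	have "fd f (at (c + L x)) (L h) =
		(SUM b:Basis. (L h \<bullet> b) * fd f (at (c + L x)) b)" for h
	proof -
	 interpret bounded_linear "fd f (at (c + L x))" using f by (rule has_derivative_bounded_linear)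
	 have "fd f (at (c + L x)) (L h) =
		 fd f (at (c + L x)) (SUM b:Basis. (L h \<bullet> b) *\<^sub>R b)" by (simp add: euclidean_representation)
	 then show ?thesis by (simp add: sum scale)
	qed
	with has_derivative_compose[OF L f] show ?thesis by simp
 qed
 show ?case by (rule Ck_on_SucI[OF assms(1) der]) (auto intro!: Ck_on_sum Ck_on_mult Ck_on_const Suc.IH assms(1,2) Ck_on_SucD(2)[OF assms(2) Suc.prems]
		simp del: Ck_on.simps)
qed

lemma Ck_on_compose_real:
 fixes f :: "'a::euclidean_space => real" and g :: "real => real"
 assumes "open S" "open T" "Ck_on k S f" "Ck_on k T g" "!!x. x : S ==> f x : T"
 shows "Ck_on k S (%x. g (f x))" using assms(3,4)
proof (induction k arbitrary: g)
 case 0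
 then show ?case using continuous_on_compose2[of T g S f] assms(5) by auto
next
 case (Suc k)
 have der: "((%x. g (f x)) has_derivative
	 (%h. fd g (at (f x)) 1 * fd f (at x) h)) (at x)"
	if "x : S" for x
 proof -
	have g: "(g has_derivative fd g (at (f x))) (at (f x))" using Ck_on_SucD(1)[OF assms(2) Suc.prems(2)] assms(5) that by blast
	have eq: "fd g (at (f x)) r = fd g (at (f x)) 1 * r" for r using linear_scale[OF has_derivative_linear[OF g], of r 1] by (simp add: mult.commute)
	show ?thesis using has_derivative_compose[OF Ck_on_SucD(1)[OF assms(1) Suc.prems(1) that] g] by (subst eq[symmetric])
 qed
 have k: "Ck_on k S f" "Ck_on k T g" using Ck_on_Suc_imp Suc.prems assms(1,2) by blast+
 have g': "Ck_on k T (%y. fd g (at y) 1)" by (rule Ck_on_SucD(2)[OF assms(2) Suc.prems(2)]) simp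
 show ?case by (rule Ck_on_SucI[OF assms(1) der], assumption) (rule Ck_on_mult[OF assms(1) Suc.IH[OF k(1) g'] Ck_on_SucD(2)[OF assms(1) Suc.prems(1)]])
qed

lemma smooth_on_Ck: "smooth_on S f ==> Ck_on k S f" by (simp add: smooth_on_def)

lemma smooth_on_const: "open S ==> smooth_on S (%x. c)" by (simp add: smooth_on_def Ck_on_const)

lemma smooth_on_add: "open S ==> smooth_on S f ==> smooth_on S g ==> smooth_on S (%x. f x + g x)" by (simp add: smooth_on_def Ck_on_add)

lemma smooth_on_mult: "open S ==> smooth_on S f ==> smooth_on S g ==> smooth_on S (%x. f x * g x)" by (simp add: smooth_on_def Ck_on_mult)

lemma smooth_on_diff:
 assumes "open S" "smooth_on S f" "smooth_on S g"
 shows "smooth_on S (%x. f x - g x)"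
proof -
 have "smooth_on S (%x. f x + (- 1) * g x)" by (intro smooth_on_add smooth_on_mult smooth_on_const assms)
 then show ?thesis by simp
qed

lemma smooth_on_sum:
 "open S ==> (!!i. i : I ==> smooth_on S (f i)) ==> smooth_on S (%x. SUM i:I. f i x)" by (simp add: smooth_on_def Ck_on_sum)

lemma smooth_on_compose_affine:
 assumes "open S" "open T" "bounded_linear L" "smooth_on T f" "!!x. x : S ==> c + L x : T"
 shows "smooth_on S (%x. f (c + L x))" using assms Ck_on_compose_affine by (fastforce simp: smooth_on_def)

lemma smooth_on_compose_real:
 assumes "open S" "open T" "smooth_on S f" "smooth_on T g" "!!x. x : S ==> f x : T"
 shows "smooth_on S (%x. g (f x))" using assms Ck_on_compose_real by (fastforce simp: smooth_on_def)

lemma smooth_on_subset: "smooth_on S f ==> T \<subseteq> S ==> smooth_on T f" unfolding smooth_on_def by (blast intro: Ck_on_subset)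

lemma smooth_on_cong:
 fixes f g :: "'a::euclidean_space => real"
 assumes "open S" "!!x. x : S ==> f x = g x"
 shows "smooth_on S f \<longleftrightarrow> smooth_on S g" using Ck_on_cong[OF assms] by (auto simp: smooth_on_def)

lemma smooth_on_continuous: "smooth_on S f ==> continuous_on S f" using smooth_on_Ck[of S f 0] by simp

lemma smooth_on_has_derivative:
 assumes "open S" "smooth_on S f" "x : S"
 shows "(f has_derivative fd f (at x)) (at x)" using Ck_on_SucD(1)[OF assms(1) smooth_on_Ck[OF assms(2)] assms(3)] .

lemma smooth_on_frechet_derivative:
 assumes "open S" "smooth_on S f" "b : Basis"
 shows "smooth_on S (%x. fd f (at x) b)" using Ck_on_SucD(2)[OF assms(1) smooth_on_Ck[OF assms(2)] assms(3)] by (simp add: smooth_on_def)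

lemma smooth_on_linear:
 fixes L :: "'a::euclidean_space => real"
 assumes "open S" "bounded_linear L"
 shows "smooth_on S L" unfolding smooth_on_def
proof
 fix k
 show "Ck_on k S L"
 proof (cases k)
	case 0
	then show ?thesis by (simp add: assms linear_continuous_on)
 next
	case (Suc j)
	show ?thesis unfolding Suc by (rule Ck_on_SucI[OF assms(1), where D="%x. L"]) (auto intro: bounded_linear_imp_has_derivative assms Ck_on_const)
 qed
qed

lemma smooth_on_Un:
 fixes f :: "'a::euclidean_space => real"
 assumes "open S" "open T" "smooth_on S f" "smooth_on T f"
 shows "smooth_on (S \<union> T) f" using assms unfolding smooth_on_def by (blast intro: Ck_on_Un)

text \<open>The open sets \<open>S\<close> and \<open>- C\<close> cover the space, and the function
  is smooth on the first and zero on the second.\<close>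

lemma smooth_on_extend_zero:
 fixes f :: "'a::euclidean_space => real"
 assumes "open S" "smooth_on S f" "closed C" "C \<subseteq> S" "!!x. x ~: C ==> f x = 0"
 shows "smooth_on UNIV f"
proof -
 have "smooth_on (- C) f" by (rule smooth_on_cong[THEN iffD2, rotated 2, OF smooth_on_const]) (use assms in auto)
 then have "smooth_on (S \<union> - C) f" using smooth_on_Un[of S "- C" f] assms by auto
 moreover have "S \<union> - C = UNIV" using assms by auto
 ultimately show ?thesis by simp
qed

text \<open>The derivative is minus the square of the function itself, so the induction closes
  through the product rule.\<close>

lemma smooth_on_inverse: "smooth_on {0<..} (inverse :: real => real)" unfolding smooth_on_def
proof
 fix k
 show "Ck_on k {0<..} (inverse :: real => real)"
 proof (induction k)
	case 0
	then show ?case by (auto intro!: continuous_intros)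
 next
	case (Suc k)
	have "Ck_on k {0<..} (%x::real. (- 1) * (inverse x * inverse x))" by (intro Ck_on_mult Suc Ck_on_const) auto
	then show ?case by (intro Ck_on_SucI[where D="%x h. - (inverse x * h * inverse x)"]) (auto intro!: derivative_eq_intros)
 qed
qed

text \<open>The norm is not smooth at \<open>p\<close>; its square is a polynomial in the
  coordinates. For this reason radial cutoffs are built from squared distances.\<close>

lemma smooth_on_norm_sq: "smooth_on UNIV (%x::'a::euclidean_space. (norm (x - p))^2)"
proof -
 have "smooth_on UNIV (%x::'a. SUM b:Basis. (- (p \<bullet> b) + x \<bullet> b) * (- (p \<bullet> b) + x \<bullet> b))"
	by (intro smooth_on_sum smooth_on_mult smooth_on_add smooth_on_const smooth_on_linear
		bounded_linear_inner_left) auto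
 moreover have "(norm (x - p))^2 = (SUM b:Basis. (- (p \<bullet> b) + x \<bullet> b) * (- (p \<bullet> b) + x \<bullet> b))" for x :: 'a
	unfolding power2_norm_eq_inner by (subst euclidean_inner) (auto simp: inner_diff_left intro!: sum.cong)
 ultimately show ?thesis by simp
qed

subsection \<open>Smooth cutoff functions\<close>

lemma poly_exp_tendsto_0: "((%y. poly p y * exp (- y)) \<longlongrightarrow> (0::real)) at_top"
proof -
 have "((%y. \<Sum>i\<le>degree p. coeff p i * (y ^ i / exp y)) \<longlongrightarrow> (\<Sum>i\<le>degree p. coeff p i * 0)) at_top"
	by (intro tendsto_sum tendsto_mult tendsto_const tendsto_power_div_exp_0)
 then show ?thesis by (simp add: poly_altdef sum_divide_distrib exp_minus field_simps)
qed

text \<open>The flat function exp(-1/x) with a polynomial in 1/x as factor. The factor makes the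
  family closed under differentiation.\<close>

definition exp_bump :: "real poly => real => real" where
 "exp_bump p x = (if x > 0 then poly p (inverse x) * exp (- inverse x) else 0)"

text \<open>With y = 1/x one has d/dx = - y^2 d/dy, which maps p(y) exp(-y) to y^2 (p - p')(y)
  exp(-y); \<open>monom 1 2\<close> is the factor y^2.\<close>

lemma exp_bump_deriv:
 "(exp_bump p has_real_derivative exp_bump (monom 1 2 * (p - pderiv p)) x) (at x)"
proof -
 consider "x > 0" | "x < 0" | "x = 0" by linarith
 then show ?thesis
 proof cases
	case 1
	have "((%x. poly p (inverse x) * exp (- inverse x)) has_real_derivative
		exp_bump (monom 1 2 * (p - pderiv p)) x) (at x)" using 1 by (auto intro!: derivative_eq_intros DERIV_chain2[OF poly_DERIV]
		 simp: exp_bump_def poly_monom algebra_simps power2_eq_square)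
	then show ?thesis by (rule DERIV_cong_ev[THEN iffD1, rotated -1, OF _ refl _ refl])
		(auto simp: exp_bump_def intro: eventually_mono[OF eventually_nhds_in_open[of "{0<..}"]] 1)
 next
	case 2
	have "((%x. 0) has_real_derivative exp_bump (monom 1 2 * (p - pderiv p)) x) (at x)" using 2 by (simp add: exp_bump_def)
	then show ?thesis by (rule DERIV_cong_ev[THEN iffD1, rotated -1, OF _ refl _ refl]) (use eventually_nhds_in_open[of "{..<0}" x] 2 in
		 \<open>auto simp: exp_bump_def elim!: eventually_mono\<close>)
 next
	case 3
	\<comment> \<open>The difference quotient at 0 has an extra factor 1/h, which is absorbed into the
	  polynomial by multiplying with \<open>[:0, 1:]\<close>.\<close>
	have "((%h. poly (p * [:0, 1:]) (inverse h) * exp (- inverse h)) \<longlongrightarrow> 0) (at_right 0)"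
	 by (rule filterlim_compose[OF poly_exp_tendsto_0 filterlim_inverse_at_top_right])
	then have "((%h. (exp_bump p h - exp_bump p 0) / h) \<longlongrightarrow> 0) (at_right 0)" by (rule Lim_transform_eventually)
		(auto simp: eventually_at_filter exp_bump_def field_simps)
	moreover have "((%h. (exp_bump p h - exp_bump p 0) / h) \<longlongrightarrow> 0) (at_left 0)"
	 by (rule tendsto_eventually) (auto simp: eventually_at_filter exp_bump_def)
	ultimately have "((%h. (exp_bump p h - exp_bump p 0) / h) \<longlongrightarrow> 0) (at 0)" by (simp add: filterlim_split_at_real)
	then show ?thesis using 3 by (simp add: has_field_derivative_iff exp_bump_def)
 qed
qed

lemma smooth_on_exp_bump: "smooth_on UNIV (exp_bump p)" unfolding smooth_on_def
proof
 fix k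
 show "Ck_on k UNIV (exp_bump p)"
 proof (induction k arbitrary: p)
	case 0
	show ?case using exp_bump_deriv by (auto intro!: continuous_at_imp_continuous_on DERIV_isCont)
 next
	case (Suc k)
	show ?case by (rule Ck_on_SucI[where D="%x h. exp_bump (monom 1 2 * (p - pderiv p)) x * h"]) (use exp_bump_deriv Suc in "auto simp: has_field_derivative_def")
 qed
qed

text \<open>The usual quotient of flat functions, descending from 1 to 0 on the interval from 1 to
  2. Its denominator never vanishes because 2 - r and r - 1 add up to 1 and so are not both
  nonpositive.\<close>

definition smooth_step :: "real => real" where
 "smooth_step r = exp_bump 1 (2 - r) * inverse (exp_bump 1 (2 - r) + exp_bump 1 (r - 1))"

lemma smooth_step_denom: "exp_bump 1 (2 - r) + exp_bump 1 (r - 1) > 0" by (auto simp: exp_bump_def add_pos_pos)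

lemma smooth_step_smooth: "smooth_on UNIV smooth_step"
proof -
 have 1: "smooth_on UNIV (%r::real. exp_bump 1 (2 + - r))" by (rule smooth_on_compose_affine[where T=UNIV and L=uminus])
	 (auto intro: smooth_on_exp_bump bounded_linear_minus[OF bounded_linear_ident])
 have 2: "smooth_on UNIV (%r::real. exp_bump 1 (- 1 + r))" by (rule smooth_on_compose_affine[where T=UNIV and L="%r. r"])
	 (auto intro: smooth_on_exp_bump bounded_linear_ident)
 have "smooth_on UNIV (%r. exp_bump 1 (2 + - r) * inverse (exp_bump 1 (2 + - r) + exp_bump 1 (- 1 + r)))"
	by (rule smooth_on_mult[OF _ 1 smooth_on_compose_real[OF _ _ _ smooth_on_inverse]]) (use smooth_step_denom 1 2 in "auto intro!: smooth_on_add")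
 then show ?thesis by (simp add: smooth_step_def[abs_def])
qed

lemma smooth_step_bounds: "0 <= smooth_step r" "smooth_step r <= 1" using smooth_step_denom[of r] by (auto simp: smooth_step_def exp_bump_def field_simps)

lemma smooth_step_eq: "r <= 1 ==> smooth_step r = 1" "2 <= r ==> smooth_step r = 0" by (auto simp: smooth_step_def exp_bump_def)

lemma smooth_bump_exists:
 fixes p :: "'a::euclidean_space"
 assumes "0 < r"
 obtains zeta where "smooth_on UNIV zeta" "!!x. 0 <= zeta x" "!!x. zeta x <= 1"
	"!!x. norm (x - p) <= r ==> zeta x = 1" "!!x. norm (x - p) >= 2 * r ==> zeta x = 0"
proof
 let ?zeta = "%x. smooth_step ((norm (x - p))^2 * (1 / r^2))"
 show "smooth_on UNIV ?zeta" by (rule smooth_on_compose_real[OF open_UNIV open_UNIV _ smooth_step_smooth])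
	 (intro smooth_on_mult smooth_on_norm_sq smooth_on_const open_UNIV UNIV_I)+
 show "0 <= ?zeta x" "?zeta x <= 1" for x by (simp_all add: smooth_step_bounds)
 show "?zeta x = 1" if "norm (x - p) <= r" for x using that assms by (auto intro!: smooth_step_eq power_mono simp: divide_simps)
 show "?zeta x = 0" if "norm (x - p) >= 2 * r" for x
 proof -
	have "(2 * r)^2 <= (norm (x - p))^2" using that assms by (intro power_mono) auto
	then have "2 * r^2 <= (norm (x - p))^2" by (simp add: power_mult_distrib) (smt (verit) zero_le_power2)
	then show ?thesis using assms by (intro smooth_step_eq) (simp add: field_simps)
 qed
qed

text \<open>A bump that equals 1 on a ball has integral at least the volume of that ball, so it can
  be divided by its integral.\<close>

lemma mollifier_exists:
 assumes "0 < delta"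
 obtains K :: "'a::euclidean_space => real" where "smooth_on UNIV K" "!!x. 0 <= K x"
	"!!x. norm x >= delta ==> K x = 0" "integrable lborel K" "integral\<^sup>L lborel K = 1"
proof -
 have "0 < delta / 2" using assms by simp
 obtain zeta :: "'a => real" where zeta: "smooth_on UNIV zeta" "!!x. 0 <= zeta x" "!!x. zeta x <= 1"
	"!!x. norm (x - 0) <= delta / 2 ==> zeta x = 1" "!!x. norm (x - 0) >= 2 * (delta / 2) ==> zeta x = 0"
	by (rule smooth_bump_exists[OF \<open>0 < delta / 2\<close>, of 0]) blast
 have cont: "continuous_on UNIV zeta" by (rule smooth_on_continuous[OF zeta(1)])
 have int: "integrable lborel zeta"
 proof -
	have "integrable lborel (%x. ind (cball 0 delta) x *\<^sub>R zeta x)" by (rule borel_integrable_compact) (auto intro: continuous_on_subset[OF cont])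
	moreover have "ind (cball 0 delta) x *\<^sub>R zeta x = zeta x" for x using zeta(5)[of x] by (cases "norm x <= delta") (simp_all add: indicator_def)
	ultimately show ?thesis by (simp only:)
 qed
 define c where "c = integral\<^sup>L lborel zeta"
 have "integral\<^sup>L lborel (%x. ind (cball (0::'a) (delta/2)) x :: real) <= c" unfolding c_def
 proof (rule integral_mono[OF _ int])
	show "integrable lborel (%x. ind (cball (0::'a) (delta/2)) x :: real)" using emeasure_lborel_cball_finite[of "0::'a" "delta/2"]
	 by (intro integrable_real_indicator) (simp_all add: top.not_eq_extremum)
	show "ind (cball 0 (delta/2)) x <= zeta x" for x using zeta(2)[of x] zeta(4)[of x] by (simp add: indicator_def)
 qed
 then have "measure lborel (cball (0::'a) (delta/2)) <= c" by simp
 then have c: "c > 0" using content_cball_pos[of "delta/2" "0::'a"] assms by linarith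
 show ?thesis
 proof (rule that[of "%x. zeta x * (1 / c)"])
	show "smooth_on UNIV (%x. zeta x * (1 / c))" by (intro smooth_on_mult smooth_on_const zeta) auto
	show "0 <= zeta x * (1 / c)" for x using zeta(2)[of x] c by simp
	show "zeta x * (1 / c) = 0" if "norm x >= delta" for x using zeta(5)[of x] that by simp
	show "integrable lborel (%x. zeta x * (1 / c))" using int by simp
	show "(LBINT x. zeta x * (1 / c)) = 1" using c c_def int by simp
 qed
qed

section \<open>Square integrable functions\<close>

text \<open>Square integrability over an arbitrary measure, so that the same facts serve functions
  on the domain, on the time axis and on space-time. On \<open>leb Om\<close> it is membership in
  \<open>L2\<close>.\<close>

definition sqint :: "'b measure => ('b => real) => bool" where
 "sqint M f \<longleftrightarrow> f : bmeas M & integrable M (%x. (f x)^2)"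

definition l2norm :: "'b measure => ('b => real) => real" where
 "l2norm M f = sqrt (LINT x|M. (f x)^2)"

lemma sqint_measurable: "sqint M f ==> f : bmeas M"
 and sqint_integrable: "sqint M f ==> integrable M (%x. (f x)^2)" by (auto simp: sqint_def)

lemma sqint_mult_integrable:
 assumes "sqint M f" "sqint M g"
 shows "integrable M (%x. f x * g x)"
proof (rule bochner_integrable_bound)
 show "integrable M (%x. (f x)^2 + (g x)^2)" using assms by (intro bochner_integrable_add sqint_integrable)
 show "(%x. f x * g x) : bmeas M" using assms by (intro borel_measurable_times sqint_measurable)
 have "\<bar>a * b\<bar> <= a^2 + b^2" for a b :: real
 proof -
	have "2 * (abs a * abs b) <= a^2 + b^2" using sum_squares_bound[of "abs a" "abs b"] by (simp add: mult.assoc)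
	moreover have "0 <= abs a * abs b" by simp
	ultimately show ?thesis unfolding abs_mult by linarith
 qed
 then show "AE x in M. norm (f x * g x) <= norm ((f x)^2 + (g x)^2)" by (intro AE_I2) auto
qed

lemma sqint_add:
 assumes "sqint M f" "sqint M g"
 shows "sqint M (%x. f x + g x)"
proof -
 have "integrable M (%x. (f x)^2 + (g x)^2 + 2 * (f x * g x))" using assms by (intro bochner_integrable_add sqint_integrable integrable_mult_right
		sqint_mult_integrable)
 then show ?thesis using assms by (auto simp: sqint_def power2_sum mult.assoc)
qed

lemma sqint_scale:
 assumes "sqint M f"
 shows "sqint M (%x. c * f x)" using assms by (auto simp: sqint_def power_mult_distrib)

lemma sqint_diff:
 assumes "sqint M f" "sqint M g"
 shows "sqint M (%x. f x - g x)" using sqint_add[OF assms(1) sqint_scale[OF assms(2), of "-1"]] by simp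

lemma sqint_sum:
 "(!!i. i : I ==> sqint M (f i)) ==> sqint M (%x. SUM i:I. f i x)"
proof (induction I rule: infinite_finite_induct)
 case (insert i I)
 then show ?case by (simp add: sqint_add)
qed (simp_all add: sqint_def)

lemma sqint_bounded_mult:
 assumes "sqint M f" "h : bmeas M" "!!x. x : space M ==> \<bar>h x\<bar> <= c"
 shows "sqint M (%x. h x * f x)" unfolding sqint_def
proof
 show "(%x. h x * f x) : bmeas M" using assms sqint_measurable by (intro borel_measurable_times)
 show "integrable M (%x. (h x * f x)^2)"
 proof (rule bochner_integrable_bound)
	show "integrable M (%x. c^2 * (f x)^2)" using assms by (intro integrable_mult_right sqint_integrable)
	show "(%x. (h x * f x)^2) : bmeas M" using assms sqint_measurable by (intro borel_measurable_times borel_measurable_power)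
	have "(h x)^2 <= c^2" if "x : space M" for x using assms(3)[OF that] by (simp add: abs_le_square_iff[symmetric])
	then show "AE x in M. norm ((h x * f x)^2) <= norm (c^2 * (f x)^2)" by (intro AE_I2) (auto simp: power_mult_distrib mult_right_mono)
 qed
qed

lemma l2norm_nonneg: "0 <= l2norm M f" by (simp add: l2norm_def)

lemma l2norm_sq: "(l2norm M f)^2 = (LINT x|M. (f x)^2)" by (simp add: l2norm_def)

lemma l2norm_scale: "l2norm M (%x. c * f x) = abs c * l2norm M f" by (simp add: l2norm_def power_mult_distrib real_sqrt_mult)

text \<open>The quadratic A + 2 t B + t^2 C is the integral of (f + t g)^2 and hence nonnegative.
  Its value at t = - B / C gives the claim; if C = 0 it is affine in t, which forces B = 0.\<close>

lemma l2_Cauchy_Schwarz: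
 assumes f: "sqint M f" and g: "sqint M g"
 shows "\<bar>\<integral>x. f x * g x \<partial>M\<bar> <= l2norm M f * l2norm M g"
proof -
 define A where "A = (LINT x|M. (f x)^2)"
 define B where "B = (LINT x|M. f x * g x)"
 define C where "C = (LINT x|M. (g x)^2)"
 have nonneg: "0 <= A" "0 <= C" by (simp_all add: A_def C_def)
 have quad: "0 <= A + 2 * t * B + t^2 * C" for t
 proof -
	have "0 <= (LINT x|M. (f x + t * g x)^2)" by simp
	also have "... = (LINT x|M. (f x)^2 + 2 * t * (f x * g x) + t^2 * (g x)^2)" by (intro bochner_integral_cong) (auto simp: power2_eq_square algebra_simps)
	also have "... = A + 2 * t * B + t^2 * C" using sqint_integrable[OF f] sqint_integrable[OF g] sqint_mult_integrable[OF f g] by (simp add: A_def B_def C_def)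
	finally show ?thesis .
 qed
 have "B^2 <= A * C"
 proof (cases "C = 0")
	case True
	have "B = 0"
	proof (rule ccontr)
	 assume "B \<noteq> 0"
	 then have "A + 2 * (- (A + 1) / (2 * B)) * B = -1" by (simp add: field_simps)
	 then show False using quad[of "- (A + 1) / (2 * B)"] True by simp
	qed
	then show ?thesis using nonneg by simp
 next
	case False
	then have "C > 0" using nonneg by simp
	then have "A + 2 * (- B / C) * B + (- B / C)^2 * C = A - B^2 / C" by (simp add: power2_eq_square field_simps)
	then have "B^2 / C <= A" using quad[of "- B / C"] by linarith
	then show ?thesis using \<open>C > 0\<close> by (simp add: field_simps)
 qed
 then have "sqrt (B^2) <= sqrt (A * C)" by (rule real_sqrt_le_mono)
 then show ?thesis by (simp add: A_def B_def C_def l2norm_def real_sqrt_mult)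
qed

lemma l2norm_triangle:
 assumes f: "sqint M f" and g: "sqint M g"
 shows "l2norm M (%x. f x + g x) <= l2norm M f + l2norm M g"
proof (rule power2_le_imp_le)
 have "(l2norm M (%x. f x + g x))^2 = (LINT x|M. (f x)^2 + 2 * (f x * g x) + (g x)^2)" unfolding l2norm_sq
	by (intro bochner_integral_cong) (auto simp: power2_eq_square algebra_simps)
 also have "... = (l2norm M f)^2 + 2 * (LINT x|M. f x * g x) + (l2norm M g)^2" unfolding l2norm_sq
	using sqint_integrable[OF f] sqint_integrable[OF g] sqint_mult_integrable[OF f g] by simp
 also have "... <= (l2norm M f + l2norm M g)^2" using l2_Cauchy_Schwarz[OF f g] by (simp add: power2_sum)
 finally show "(l2norm M (%x. f x + g x))^2 <= (l2norm M f + l2norm M g)^2" .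
qed (simp add: l2norm_nonneg)

lemma l2norm_triangle_diff:
 assumes f: "sqint M f" and g: "sqint M g"
 shows "\<bar>l2norm M f - l2norm M g\<bar> <= l2norm M (%x. f x - g x)"
proof -
 have "l2norm M f <= l2norm M (%x. f x - g x) + l2norm M g" using l2norm_triangle[OF sqint_diff[OF f g] g] by simp
 moreover have "l2norm M g <= l2norm M (%x. g x - f x) + l2norm M f" using l2norm_triangle[OF sqint_diff[OF g f] f] by simp
 moreover have "l2norm M (%x. g x - f x) = l2norm M (%x. f x - g x)" by (simp add: l2norm_def power2_commute)
 ultimately show ?thesis by linarith
qed

lemma l2_inner_tendsto:
 assumes "!!n. sqint M (f n)" "sqint M f'" "sqint M g"
	"(%n. l2norm M (%x. f n x - f' x)) ----> 0"
 shows "(%n. (LINT x|M. f n x * g x)) ----> (LINT x|M. f' x * g x)"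
proof (rule LIM_zero_cancel, rule Lim_null_comparison)
 show "\<forall>\<^sub>F n in sequentially. norm ((LINT x|M. f n x * g x) - (LINT x|M. f' x * g x))
	 <= l2norm M (%x. f n x - f' x) * l2norm M g"
 proof (rule always_eventually, rule)
	fix n
	have "(LINT x|M. f n x * g x) - (LINT x|M. f' x * g x) = (LINT x|M. (f n x - f' x) * g x)"
	 using sqint_mult_integrable[OF assms(1) assms(3), of n] sqint_mult_integrable[OF assms(2) assms(3)] by (simp add: left_diff_distrib)
	then show "norm ((LINT x|M. f n x * g x) - (LINT x|M. f' x * g x))
	 <= l2norm M (%x. f n x - f' x) * l2norm M g" using l2_Cauchy_Schwarz[OF sqint_diff[OF assms(1) assms(2)] assms(3), of n] by simp
 qed
 show "(%n. l2norm M (%x. f n x - f' x) * l2norm M g) ----> 0" using tendsto_mult_right[OF assms(4), of "l2norm M g"] by simp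
qed

lemma l2_dominated_convergence:
 assumes "sqint M w" "f : bmeas M" "!!n. f' n : bmeas M"
	"AE x in M. (%n. f' n x) ----> f x"
	"!!n. AE x in M. \<bar>f' n x - f x\<bar> <= w x"
 shows "(%n. (LINT x|M. (f' n x - f x)^2)) ----> 0"
proof -
 have "(%n. (LINT x|M. (f' n x - f x)^2)) ----> (LINT x|M. 0)"
 proof (rule integral_dominated_convergence[where w="%x. (w x)^2"])
	show "AE x in M. (%n. (f' n x - f x)^2) ----> 0"
	proof (use assms(4) in eventually_elim)
	 case (elim x)
	 then have "(%n. (f' n x - f x)^2) ----> (f x - f x)^2" by (intro tendsto_power tendsto_diff tendsto_const)
	 then show ?case by simp
	qed
	show "AE x in M. norm ((f' n x - f x)^2) <= (w x)^2" for n
	proof (use assms(5)[of n] in eventually_elim)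
	 case (elim x)
	 then have "\<bar>f' n x - f x\<bar>\<^sup>2 <= (w x)^2" by (intro power_mono) auto
	 then show ?case by simp
	qed
 qed (use assms(1-3) in "auto intro: sqint_integrable")
 then show ?thesis by simp
qed

lemma sum3_sq_le: "(a + b + c)^2 <= 3 * (a^2 + b^2 + (c::real)^2)"
proof -
 have "0 <= (a - b)^2 + (a - c)^2 + (b - c)^2" by simp
 then show ?thesis by (simp add: power2_eq_square algebra_simps)
qed

subsection \<open>Continuity of translations\<close>

lemma integral_lborel_shift:
 fixes f :: "'a::euclidean_space => real"
 assumes "f : bmeas borel"
 shows "(LBINT x. f (x + c)) = integral\<^sup>L lborel f"
	and "integrable lborel (%x. f (x + c)) \<longleftrightarrow> integrable lborel f"
proof -
 have 1: "integral\<^sup>L (distr lborel borel ((+) c)) f = (LBINT x. f (c + x))" by (rule integral_distr) (use assms in auto)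
 have 2: "integrable (distr lborel borel ((+) c)) f \<longleftrightarrow> integrable lborel (%x. f (c + x))" by (rule integrable_distr_eq) (use assms in auto)
 show "(LBINT x. f (x + c)) = integral\<^sup>L lborel f"
	"integrable lborel (%x. f (x + c)) \<longleftrightarrow> integrable lborel f" using 1 2 by (simp_all add: lborel_distr_plus add.commute)
qed

lemma nn_integral_lborel_shift:
 fixes f :: "'a::euclidean_space => enn"
 assumes "f : bmeas borel"
 shows "(nni lborel (%x. f (x + c))) = integral\<^sup>N lborel f"
proof -
 have "integral\<^sup>N (distr lborel borel ((+) c)) f = (nni lborel (%x. f (c + x)))" by (rule nn_integral_distr) (use assms in auto)
 then show ?thesis by (simp add: lborel_distr_plus add.commute)
qed

lemma sqint_shift:
 fixes f :: "'a::euclidean_space => real"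
 assumes "sqint lborel f"
 shows "sqint lborel (%x. f (x + c))"
proof -
 have m: "f : bmeas borel" using sqint_measurable[OF assms] by simp
 have "integrable lborel (%x. (f (x + c))^2)" using integral_lborel_shift(2)[of "%x. (f x)^2" c] m sqint_integrable[OF assms] by simp
 with m show ?thesis by (simp add: sqint_def)
qed

section \<open>Truncation, cutoff and approximation by continuous functions of bounded
  support\<close>

definition tent :: "real => 'a::real_normed_vector => real" where
 "tent r x = max 0 (min 1 (r + 1 - norm x))"

lemma tent_bounds: "0 <= tent r x" "tent r x <= 1"
 and tent_eq: "norm x <= r ==> tent r x = 1" "norm x >= r + 1 ==> tent r x = 0" by (auto simp: tent_def)

lemma continuous_on_tent: "continuous_on S (tent r)" unfolding tent_def[abs_def] by (intro continuous_intros)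

definition clip :: "real => real => real" where
 "clip m r = max (- m) (min m r)"

lemma abs_clip: "m >= 0 ==> \<bar>clip m r\<bar> <= m" "m >= 0 ==> \<bar>clip m r\<bar> <= abs r"
 and clip_eq: "abs r <= m ==> clip m r = r"
 and abs_clip_diff: "m >= 0 ==> \<bar>clip m r - r\<bar> <= abs r" by (auto simp: clip_def)

lemma continuous_on_clip: "continuous_on S (clip m)" unfolding clip_def[abs_def] by (intro continuous_intros)

lemma clip_measurable [measurable]: "clip m : bmeas borel" by (intro borel_measurable_continuous_onI continuous_on_clip)

lemma tent_measurable [measurable]: "tent m : bmeas borel" by (intro borel_measurable_continuous_onI continuous_on_tent)

lemma sqint_bounded_support:
 fixes f :: "'a::euclidean_space => real"
 assumes "f : bmeas borel" "!!x. \<bar>f x\<bar> <= c * ind (cball 0 r) x"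
 shows "sqint lborel f" "integrable lborel f"
proof -
 have fin: "emeasure lborel (cball (0::'a) r) < top" using emeasure_lborel_cball_finite[of "0::'a" r] by (simp add: top.not_eq_extremum)
 have iind: "integrable lborel (%x. k * ind (cball (0::'a) r) x :: real)" for k by (intro integrable_mult_right integrable_real_indicator) (use fin in auto)
 show "integrable lborel f" by (rule bochner_integrable_bound[OF iind[of c]]) (use assms in "auto intro!: AE_I2 intro: order_trans[OF _ abs_ge_self]")
 have "(f x)^2 <= c^2 * ind (cball 0 r) x" for x using assms(2)[of x] abs_le_square_iff[of "f x" c] by (auto simp: indicator_def split: if_splits)
 then have "integrable lborel (%x. (f x)^2)" by (intro bochner_integrable_bound[OF iind[of "c^2"]]) (use assms in "auto intro!: AE_I2")
 then show "sqint lborel f" using assms by (simp add: sqint_def)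
qed

lemma sqint_approx_bounded_support:
 fixes f :: "'a::euclidean_space => real"
 assumes f: "sqint lborel f"
 shows "(%n. (LBINT x. (clip n (f x) * tent n x - f x)^2)) ----> 0"
proof (rule l2_dominated_convergence)
 have m: "f : bmeas borel" using sqint_measurable[OF f] by simp
 show "(%x. clip n (f x) * tent n x) : bmeas lborel" for n using m by measurable
 show "sqint lborel (%x. \<bar>f x\<bar>)" using f by (auto simp: sqint_def)
 have "(%n. clip n (f x) * tent n x) ----> f x" for x
 proof (rule tendsto_eventually, rule eventually_sequentiallyI)
	fix n assume "n >= nat \<lceil>max \<bar>f x\<bar> (norm x)\<rceil>"
	then have "\<bar>f x\<bar> <= n" "norm x <= n" by linarith+
	then show "clip n (f x) * tent n x = f x" by (simp add: clip_eq tent_eq)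
 qed
 then show "AE x in lborel. (%n. clip n (f x) * tent n x) ----> f x" by simp
 have "\<bar>c * t - r\<bar> <= abs r" if "0 <= t" "t <= 1" "abs c <= abs r" "\<bar>c - r\<bar> <= abs r" for c t r :: real
 proof -
	\<comment> \<open>A convex combination of two numbers of modulus at most |r|; so the error of
	  truncation and cutoff together is still dominated by |f|.\<close>
	have "c * t - r = t * (c - r) + (1 - t) * (- r)" by (simp add: algebra_simps)
	then have "\<bar>c * t - r\<bar> <= t * \<bar>c - r\<bar> + (1 - t) * abs r" using that abs_triangle_ineq[of "t * (c - r)" "(1 - t) * (- r)"] by (simp add: abs_mult)
	also have "... <= t * abs r + (1 - t) * abs r" using that by (intro add_mono mult_left_mono) auto
	finally show ?thesis by (simp add: algebra_simps)
 qed
 then show "AE x in lborel. \<bar>clip n (f x) * tent n x - f x\<bar> <= \<bar>f x\<bar>" for n :: nat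
	by (intro AE_I2) (auto simp: tent_bounds abs_clip abs_clip_diff)
qed (use sqint_measurable[OF f] in auto)

text \<open>Two steps: truncate \<open>f\<close> in size and in support, then approximate the
  bounded result almost everywhere by continuous functions and use dominated convergence. Each step
  costs \<open>eps / 4\<close>, doubled when the two squares are added.\<close>

lemma sqint_approx_continuous:
 fixes f :: "'a::euclidean_space => real"
 assumes f: "sqint lborel f" and "eps > 0"
 obtains g r c where "continuous_on UNIV g" "!!x. \<bar>g x\<bar> <= c * ind (cball 0 r) x"
	"(LBINT x. (g x - f x)^2) < eps"
proof -
 have m: "f : bmeas borel" using sqint_measurable[OF f] by simp
 have "\<forall>\<^sub>F n in sequentially. (LBINT x. (clip (real n) (f x) * tent (real n) x - f x)^2) < eps / 4"
	using order_tendstoD(2)[OF sqint_approx_bounded_support[OF f], of "eps / 4"] \<open>eps > 0\<close> by simp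
 then obtain n where n: "(LBINT x. (clip (real n) (f x) * tent (real n) x - f x)^2) < eps / 4" by (meson eventually_sequentially order_refl)
 define h where "h x = clip n (f x) * tent n x" for x
 have hm: "h : bmeas borel" unfolding h_def[abs_def] using m by measurable
 have habs: "\<bar>h x\<bar> <= real n" for x
 proof -
	have "\<bar>clip n (f x)\<bar> * tent n x <= real n * 1" by (intro mult_mono abs_clip tent_bounds) auto
	then show ?thesis by (simp add: h_def abs_mult tent_bounds)
 qed
 have "h : bmeas lebesgue" using hm by (simp add: measurable_completion)
 \<comment> \<open>\<open>measurable_on\<close> provides continuous functions that converge to
   \<open>h\<close> off a negligible set; they are neither bounded nor of bounded support.\<close>
 then have "h measurable_on UNIV" by (rule lebesgue_measurable_imp_measurable_on_real) simp
 then obtain N g where N: "negligible N" and g: "!!k. continuous_on UNIV (g k)"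
	and lim: "!!x. x ~: N ==> (%k. g k x) ----> h x" unfolding measurable_on_def by auto
 \<comment> \<open>Truncation and cutoff restore a common bound. The cutoff radius is one larger
   than for \<open>h\<close>, so the cutoff is 1 wherever \<open>h\<close> is nonzero and the limit
   stays \<open>h\<close>.\<close>
 define g' where "g' k x = clip n (g k x) * tent (n + 1) x" for k :: nat and x
 have g'c: "continuous_on UNIV (g' k)" for k unfolding g'_def[abs_def]
	by (intro continuous_on_mult continuous_on_compose2[OF continuous_on_clip g] continuous_on_tent)
	 auto
 have g'b: "\<bar>g' k x\<bar> <= real n * ind (cball 0 (real n + 2)) x" for k x
 proof (cases "norm x <= real n + 2")
	case True
	have "\<bar>clip n (g k x)\<bar> * tent (real (n + 1)) x <= real n * 1" by (intro mult_mono abs_clip tent_bounds) auto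
	then show ?thesis using True by (simp add: g'_def abs_mult tent_bounds)
 next
	case False
	then show ?thesis by (simp add: g'_def tent_eq)
 qed
 have "(%k. (LBINT x. (g' k x - h x)^2)) ----> 0"
 proof (rule l2_dominated_convergence)
	show "sqint lborel (%x::'a. 2 * real n * ind (cball 0 (real n + 2)) x)"
	 by (rule sqint_bounded_support[where c="2 * real n" and r="real n + 2"]) (auto simp: indicator_def)
	show "g' k : bmeas lborel" for k using g'c by (simp add: borel_measurable_continuous_onI)
	have "(%k. g' k x) ----> h x" if "x ~: N" for x
	proof -
	 have "(%k. clip n (g k x)) ----> clip n (h x)" by (rule continuous_on_tendsto_compose[OF continuous_on_clip[of UNIV] lim[OF that]]) auto
	 then have "(%k. g' k x) ----> clip n (h x) * tent (n + 1) x" unfolding g'_def by (intro tendsto_mult tendsto_const)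
	 moreover have "clip n (h x) * tent (n + 1) x = h x"
	 proof (cases "norm x <= real n + 1")
		case True
		then show ?thesis using habs[of x] by (simp add: tent_eq clip_eq)
	 next
		case False
		then have "h x = 0" by (simp add: h_def tent_eq)
		then show ?thesis by (simp add: clip_def)
	 qed
	 ultimately show ?thesis by simp
	qed
	then have "AE x in lebesgue. (%k. g' k x) ----> h x" by (intro AE_I'[of N]) (use N in "auto simp: negligible_iff_null_sets")
	then show "AE x in lborel. (%k. g' k x) ----> h x" by (simp add: AE_completion_iff)
	have "\<bar>g' k x - h x\<bar> <= 2 * real n * ind (cball 0 (real n + 2)) x" for k x
	proof (cases "norm x <= real n + 2")
	 case True
	 then show ?thesis using g'b[of k x] habs[of x] by simp
	next
	 case False
	 then show ?thesis by (simp add: g'_def h_def tent_eq)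
	qed
	then show "AE x in lborel. \<bar>g' k x - h x\<bar> <= 2 * real n * ind (cball 0 (real n + 2)) x" for k by (intro AE_I2)
 qed (use hm in auto)
 then have "\<forall>\<^sub>F k in sequentially. (LBINT x. (g' k x - h x)^2) < eps / 4" using \<open>eps > 0\<close> by (intro order_tendstoD(2)) auto
 then obtain k where k: "(LBINT x. (g' k x - h x)^2) < eps / 4" by (meson eventually_sequentially order_refl)
 have g's: "sqint lborel (g' k)" by (rule sqint_bounded_support[OF _ g'b]) (use g'c in "simp add: borel_measurable_continuous_onI")
 have "\<bar>h x\<bar> <= real n * ind (cball 0 (real n + 1)) x" for x using habs[of x] by (cases "norm x <= real n + 1") (auto simp: h_def tent_eq)
 then have hs: "sqint lborel h" by (rule sqint_bounded_support[OF hm])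
 have "(LBINT x. (g' k x - f x)^2) <= (LBINT x. 2 * (g' k x - h x)^2 + 2 * (h x - f x)^2)"
 proof (rule integral_mono)
	show "integrable lborel (%x. (g' k x - f x)^2)" by (intro sqint_integrable sqint_diff g's f)
	show "integrable lborel (%x. 2 * (g' k x - h x)^2 + 2 * (h x - f x)^2)" by (intro bochner_integrable_add integrable_mult_right sqint_integrable sqint_diff g's f hs)
	show "(g' k x - f x)^2 <= 2 * (g' k x - h x)^2 + 2 * (h x - f x)^2" for x
	 using sum_squares_bound[of "g' k x - h x" "h x - f x"] power2_sum[of "g' k x - h x" "h x - f x"] by simp
 qed
 also have "... = 2 * (LBINT x. (g' k x - h x)^2) + 2 * (LBINT x. (h x - f x)^2)"
	using sqint_integrable[OF sqint_diff[OF g's hs]] sqint_integrable[OF sqint_diff[OF hs f]] by simp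
 also have "... < eps" using k n by (simp add: h_def)
 finally show ?thesis by (rule that[OF g'c g'b])
qed

lemma uniform_translation_compact_support:
 fixes g :: "'a::euclidean_space => real"
 assumes g: "continuous_on UNIV g" and supp: "!!x. norm x > r ==> g x = 0" and "eps > 0"
 obtains delta where "delta > 0" "!!x y. norm y < delta ==> \<bar>g (x + y) - g x\<bar> < eps"
proof -
 \<comment> \<open>The margin of 2 keeps both points in the ball when x has norm at most |r| + 1 and
   the shift is shorter than 1; for all other x both values are zero.\<close>
 have "uniformly_continuous_on (cball 0 (abs r + 2)) g" by (intro compact_uniformly_continuous continuous_on_subset[OF g]) auto
 then obtain d where d: "d > 0"
	"!!x x'. x : cball 0 (abs r + 2) ==> x' : cball 0 (abs r + 2) ==> dist x' x < d ==> dist (g x') (g x) < eps"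
	unfolding uniformly_continuous_on_def using \<open>eps > 0\<close> by metis
 show ?thesis
 proof (rule that[of "min d 1"])
	show "min d 1 > 0" using d by simp
	fix x y :: 'a assume y: "norm y < min d 1"
	have t: "norm (x + y) <= norm x + norm y" "norm x <= norm (x + y) + norm y" using norm_triangle_ineq[of x y] norm_triangle_ineq4[of "x + y" y] by auto
	show "\<bar>g (x + y) - g x\<bar> < eps"
	proof (cases "norm x <= abs r + 1")
	 case True
	 then have "x : cball 0 (abs r + 2)" "x + y : cball 0 (abs r + 2)" "dist (x + y) x < d" using y t by (auto simp: dist_norm mem_cball_0 simp del: mem_cball)
	 from d(2)[OF this] show ?thesis by (simp add: dist_norm)
	next
	 case False
	 then have "norm x > r" "norm (x + y) > r" using t y by linarith+
	 then show ?thesis using supp \<open>eps > 0\<close> by simp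
	qed
 qed
qed

text \<open>Clear for a continuous function of bounded support, and passed on by density, because
  the translated approximation error has the same norm. The three squared errors are at most
  \<open>eps / 12\<close> each, and \<open>sum3_sq_le\<close> costs a factor 3, which leaves at most
  3/4 of \<open>eps\<close>.\<close>

lemma l2_translation_continuous:
 fixes f :: "'a::euclidean_space => real"
 assumes f: "sqint lborel f" and "eps > 0"
 obtains delta where "delta > 0" "!!y. norm y < delta ==> (LBINT x. (f (x + y) - f x)^2) < eps"
proof -
 have m: "f : bmeas borel" using sqint_measurable[OF f] by simp
 obtain g r c where g: "continuous_on UNIV g" and gb: "!!x. \<bar>g x\<bar> <= c * ind (cball 0 r) x"
	and gf: "(LBINT x. (g x - f x)^2) < eps / 12"
 proof -
	have "eps / 12 > 0" using \<open>eps > 0\<close> by simp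
	show thesis by (rule sqint_approx_continuous[OF f \<open>eps / 12 > 0\<close>]) (rule that)
 qed
 have gm: "g : bmeas borel" using g by (rule borel_measurable_continuous_onI)
 have gs: "sqint lborel g" by (rule sqint_bounded_support[OF gm gb])
 have g0: "g x = 0" if "norm x > r" for x using gb[of x] that by simp
 define V where "V = measure lborel (cball (0::'a) (abs r + 1))"
 \<comment> \<open>Chosen so that \<open>eta\<close> squared times the volume of a ball containing
   the supports of \<open>g\<close> and of its translates by less than 1 is at most
   \<open>eps / 12\<close>.\<close>
 define eta where "eta = sqrt (eps / (12 * (V + 1)))"
 have V: "V >= 0" by (simp add: V_def)
 have eta: "eta > 0" using V \<open>eps > 0\<close> by (simp add: eta_def)
 have etaV: "eta\<^sup>2 * V <= eps / 12"
 proof -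
	have "eta\<^sup>2 * V = eps / 12 * (V / (V + 1))" using V \<open>eps > 0\<close> by (simp add: eta_def)
	also have "... <= eps / 12 * 1" using V \<open>eps > 0\<close> by (intro mult_left_mono) auto
	finally show ?thesis by simp
 qed
 obtain d where d: "d > 0" "!!x y. norm y < d ==> \<bar>g (x + y) - g x\<bar> < eta" using uniform_translation_compact_support[OF g g0 eta] by metis
 show ?thesis
 proof (rule that[of "min d 1"])
	show "min d 1 > 0" using d by simp
	fix y :: 'a assume y: "norm y < min d 1"
	have sh: "sqint lborel (%x. f (x + y))" "sqint lborel (%x. g (x + y))" using f gs by (auto intro: sqint_shift)
	have fin: "emeasure lborel (cball (0::'a) (abs r + 1)) < top" using emeasure_lborel_cball_finite[of "0::'a" "abs r + 1"] by (simp add: top.not_eq_extremum)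
	have iind: "integrable lborel (%x. eta\<^sup>2 * ind (cball (0::'a) (abs r + 1)) x :: real)"
	 by (intro integrable_mult_right integrable_real_indicator) (use fin in auto)
	have "(LBINT x. (g (x + y) - g x)^2) <= (LBINT x. eta\<^sup>2 * ind (cball (0::'a) (abs r + 1)) x)"
	proof (rule integral_mono[OF sqint_integrable[OF sqint_diff[OF sh(2) gs]] iind])
	 fix x :: 'a
	 show "(g (x + y) - g x)^2 <= eta\<^sup>2 * ind (cball 0 (abs r + 1)) x"
	 proof (cases "norm x <= abs r + 1")
		case True
		have "\<bar>g (x + y) - g x\<bar>\<^sup>2 <= eta\<^sup>2" using d(2)[of y x] y by (intro power_mono) auto
		then show ?thesis using True by simp
	 next
		case False
		have "norm x <= norm (x + y) + norm y" using norm_triangle_ineq4[of "x + y" y] by simp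
		then have "norm x > r" "norm (x + y) > r" using False y by linarith+
		then show ?thesis using g0 by simp
	 qed
	qed
	also have "... = eta\<^sup>2 * V" by (simp add: V_def)
	finally have 2: "(LBINT x. (g (x + y) - g x)^2) <= eps / 12" using etaV by simp
	have 1: "(LBINT x. (f (x + y) - g (x + y))^2) = (LBINT x. (g x - f x)^2)" using integral_lborel_shift(1)[of "%x. (f x - g x)^2" y] m gm by (simp add: power2_commute)
	have "(LBINT x. (f (x + y) - f x)^2) <=
		(LBINT x. 3 * ((f (x + y) - g (x + y))^2 + (g (x + y) - g x)^2 + (g x - f x)^2))"
	proof (rule integral_mono)
	 show "(f (x + y) - f x)^2 <= 3 * ((f (x + y) - g (x + y))^2 + (g (x + y) - g x)^2 + (g x - f x)^2)" for x
		using sum3_sq_le[of "f (x + y) - g (x + y)" "g (x + y) - g x" "g x - f x"] by simp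
	qed (intro integrable_mult_right bochner_integrable_add sqint_integrable sqint_diff sh f gs)+
	also have "... = 3 * ((LBINT x. (f (x + y) - g (x + y))^2) + (LBINT x. (g (x + y) - g x)^2)
		+ (LBINT x. (g x - f x)^2))" using sqint_integrable[OF sqint_diff[OF sh]] sqint_integrable[OF sqint_diff[OF sh(2) gs]]
		sqint_integrable[OF sqint_diff[OF gs f]] by simp
	also have "... < eps" using 1 2 gf \<open>eps > 0\<close> by simp
	finally show "(LBINT x. (f (x + y) - f x)^2) < eps" .
 qed
qed


subsection \<open>Mollification\<close>

definition moll :: "nat => 'a::euclidean_space => real" where
 "moll n = (SOME K. smooth_on UNIV K & (ALL x. 0 <= K x) &
	 (ALL x. norm x >= 1 / real (Suc n) --> K x = 0) & integrable lborel K & integral\<^sup>L lborel K = 1)"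

lemma moll:
 fixes x :: "'a::euclidean_space"
 shows moll_smooth: "smooth_on UNIV (moll n :: 'a => real)"
	and moll_nonneg: "0 <= moll n x"
	and moll_eq_0: "norm x >= 1 / real (Suc n) ==> moll n x = 0"
	and moll_integrable: "integrable lborel (moll n :: 'a => real)"
	and moll_integral: "integral\<^sup>L lborel (moll n :: 'a => real) = 1"
proof -
 have pos: "0 < 1 / real (Suc n)" by simp
 have ex: "EX K::'a => real. smooth_on UNIV K & (ALL x. 0 <= K x) &
	 (ALL x. norm x >= 1 / real (Suc n) --> K x = 0) & integrable lborel K & integral\<^sup>L lborel K = 1" by (rule mollifier_exists[OF pos]) blast
 note * = someI_ex[OF ex, folded moll_def]
 show "smooth_on UNIV (moll n :: 'a => real)" "0 <= moll n x"
	"norm x >= 1 / real (Suc n) ==> moll n x = 0"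
	"integrable lborel (moll n :: 'a => real)" "integral\<^sup>L lborel (moll n :: 'a => real) = 1" using * by blast+
qed

definition conv :: "('a::euclidean_space => real) => ('a => real) => 'a => real" where
 "conv K f x = (LBINT y. K (x - y) * f y)"

lemma continuous_compact_support_bounded:
 fixes K :: "'a::euclidean_space => real"
 assumes "continuous_on UNIV K" "!!x. norm x > r ==> K x = 0"
 obtains C where "C > 0" "!!x. \<bar>K x\<bar> <= C"
proof -
 have "compact (K ` cball 0 r)" by (intro compact_continuous_image continuous_on_subset[OF assms(1)]) auto
 then obtain B where B: "!!y. y : K ` cball 0 r ==> norm y <= B" using compact_imp_bounded bounded_iff by metis
 show ?thesis
 proof (rule that[of "max B 0 + 1"])
	show "\<bar>K x\<bar> <= max B 0 + 1" for x
	proof (cases "norm x <= r")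
	 case True
	 then have "norm (K x) <= B" by (intro B) auto
	 then show ?thesis by simp
	next
	 case False
	 then show ?thesis using assms(2)[of x] by simp
	qed
 qed simp
qed

lemma conv_integrable:
 fixes K f :: "'a::euclidean_space => real"
 assumes K: "continuous_on UNIV K" and supp: "!!x. norm x > r ==> K x = 0" and f: "integrable lborel f"
 shows "integrable lborel (%y. K (x - y) * f y)"
proof -
 obtain C where C: "C > 0" "!!x. \<bar>K x\<bar> <= C" using continuous_compact_support_bounded[OF K supp] by metis
 have Km: "K : bmeas borel" using K by (rule borel_measurable_continuous_onI)
 have fm: "f : bmeas borel" using borel_measurable_integrable[OF f] by simp
 show ?thesis
 proof (rule bochner_integrable_bound)
	show "integrable lborel (%y. C * \<bar>f y\<bar>)" using f by simp
	show "(%y. K (x - y) * f y) : bmeas lborel" using Km fm by simp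
	have "\<bar>K (x - y)\<bar> * \<bar>f y\<bar> <= C * \<bar>f y\<bar>" for y by (intro mult_right_mono C) auto
	then show "AE y in lborel. norm (K (x - y) * f y) <= norm (C * \<bar>f y\<bar>)" using C by (intro AE_I2) (simp add: abs_mult)
 qed
qed

text \<open>The partial derivatives have bounded support and are therefore uniformly continuous, so
  the linearization error is uniform in the base point. This permits differentiation under the
  integral against functions that are only integrable.\<close>

lemma uniform_linearization:
 fixes K :: "'a::euclidean_space => real"
 assumes K: "smooth_on UNIV K" and supp: "!!x. norm x > r ==> K x = 0" and "eps > 0"
 obtains delta where "delta > 0"
	"!!z h. norm h < delta ==> \<bar>K (z + h) - K z - fd K (at z) h\<bar> <= eps * norm h"
proof -
 define D where "D b z = fd K (at z) b" for b z
 have Ds: "smooth_on UNIV (D b)" if "b : Basis" for b unfolding D_def[abs_def] by (rule smooth_on_frechet_derivative[OF open_UNIV K that])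
 have D0: "D b z = 0" if "norm z > r" for b z
 proof -
	have "fd K (at z) = fd (%_. 0) (at z)" by (rule frechet_derivative_cong_open[of "{z. norm z > r}"])
		(use that supp in "auto intro!: open_Collect_less continuous_intros")
	then show ?thesis by (simp add: D_def)
 qed
 \<comment> \<open>Each of the DIM partial derivatives may vary by this much, so that their sum
   contributes at most \<open>eps\<close> to the operator norm.\<close>
 define eta where "eta = eps / DIM('a)"
 have eta: "eta > 0" using \<open>eps > 0\<close> by (simp add: eta_def)
 have "ALL b:Basis. EX d>0. ALL x y. norm y < d --> \<bar>D b (x + y) - D b x\<bar> < eta"
 proof
	fix b :: 'a assume b: "b : Basis"
	show "EX d>0. ALL x y. norm y < d --> \<bar>D b (x + y) - D b x\<bar> < eta"
	 by (rule uniform_translation_compact_support[OF smooth_on_continuous[OF Ds[OF b]] D0 eta]) auto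
 qed
 then obtain d where d: "!!b. b : Basis ==> d b > 0"
	"!!b x y. b : Basis ==> norm y < d b ==> \<bar>D b (x + y) - D b x\<bar> < eta" by metis
 define delta where "delta = Min (d ` Basis)"
 have delta: "delta > 0" "!!b. b : Basis ==> delta <= d b" by (auto simp: delta_def d(1))
 have der: "(K has_derivative (%h. SUM b:Basis. (h \<bullet> b) * D b z)) (at z)" for z
 proof -
	have f: "(K has_derivative fd K (at z)) (at z)" by (rule smooth_on_has_derivative[OF open_UNIV K]) simp
	interpret bounded_linear "fd K (at z)" using f by (rule has_derivative_bounded_linear)
	have "fd K (at z) h = (SUM b:Basis. (h \<bullet> b) * D b z)" for h
	proof -
	 have "fd K (at z) (SUM b:Basis. (h \<bullet> b) *\<^sub>R b) = (SUM b:Basis. (h \<bullet> b) * D b z)" by (simp add: sum scale D_def)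
	 then show ?thesis by (simp add: euclidean_representation)
	qed
	then have "fd K (at z) = (%h. SUM b:Basis. (h \<bullet> b) * D b z)" by (rule ext)
	with f show ?thesis by metis
 qed
 show ?thesis
 proof (rule that[OF delta(1)])
	fix z h :: 'a assume h: "norm h < delta"
	let ?D = "%z h. SUM b:Basis. (h \<bullet> b) * D b z"
	have "norm (K (z + h) - K z - ?D z (z + h - z)) <= norm (z + h - z) * eps"
	proof (rule differentiable_bound_linearization[where S="ball z delta"])
	 show "z + t *\<^sub>R (z + h - z) : ball z delta" if "t : {0..1}" for t
	 proof -
		have "norm (t *\<^sub>R h) <= norm h" using that by (simp add: mult_left_le_one_le)
		then show ?thesis using h by (simp add: dist_norm)
	 qed
	 show "(K has_derivative ?D x) (at x within ball z delta)" for x by (rule has_derivative_at_withinI[OF der])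
	 show "z : ball z delta" using delta by simp
	 show "onorm (?D x - ?D z) <= eps" if x: "x : ball z delta" for x
	 proof (rule onorm_le)
		fix k :: 'a
		have "\<bar>D b x - D b z\<bar> <= eta" if b: "b : Basis" for b
		proof -
		 have "norm (x - z) < d b" using x delta(2)[OF b] by (simp add: dist_norm norm_minus_commute)
		 from d(2)[OF b this, of z] show ?thesis by simp
		qed
		then have "\<bar>(k \<bullet> b) * (D b x - D b z)\<bar> <= norm k * eta" if "b : Basis" for b
		 unfolding abs_mult using that eta by (intro mult_mono Basis_le_norm) auto
		then have "\<bar>SUM b:Basis. (k \<bullet> b) * (D b x - D b z)\<bar> <= (SUM b:(Basis::'a set). norm k * eta)" by (intro order_trans[OF sum_abs] sum_mono)
		also have "... = eps * norm k" by (simp add: eta_def)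
		finally show "norm ((?D x - ?D z) k) <= eps * norm k" by (simp add: right_diff_distrib sum_subtractf)
	 qed
	qed
	moreover have "fd K (at z) = ?D z" using frechet_derivative_at[OF der[of z]] by simp
	ultimately show "\<bar>K (z + h) - K z - fd K (at z) h\<bar> <= eps * norm h" by (simp add: mult.commute)
 qed
qed

lemma frechet_derivative_support:
 fixes K :: "'a::euclidean_space => real"
 assumes "!!x. norm x > r ==> K x = 0" "norm z > r"
 shows "fd K (at z) b = 0"
proof -
 have "fd K (at z) = fd (%_. 0) (at z)" by (rule frechet_derivative_cong_open[of "{z. norm z > r}"]) (use assms in "auto intro!: open_Collect_less continuous_intros")
 then show ?thesis by simp
qed

lemma conv_has_derivative:
 fixes K f :: "'a::euclidean_space => real"
 assumes K: "smooth_on UNIV K" and supp: "!!x. norm x > r ==> K x = 0" and f: "integrable lborel f"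
 shows "(conv K f has_derivative
	 (%h. SUM b:Basis. (h \<bullet> b) * conv (%z. fd K (at z) b) f x)) (at x)"
proof (rule has_derivativeI_sandwich[where e=1 and H="%y. norm (conv K f y - conv K f x -
	 (SUM b:Basis. ((y - x) \<bullet> b) * conv (%z. fd K (at z) b) f x)) / norm (y - x)"])
 let ?D = "%b z. fd K (at z) b"
 let ?L = "%h. SUM b:Basis. (h \<bullet> b) * conv (?D b) f x"
 show "bounded_linear ?L" by (intro bounded_linear_sum bounded_linear_mult_const bounded_linear_inner_left)
 define B where "B = (LBINT y. \<bar>f y\<bar>) + 1"
 have B: "B > 0" by (simp add: B_def add_nonneg_pos)
 have Kc: "continuous_on UNIV K" by (rule smooth_on_continuous[OF K])
 have Dc: "continuous_on UNIV (?D b)" if "b : Basis" for b by (rule smooth_on_continuous[OF smooth_on_frechet_derivative[OF open_UNIV K that]])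
 have iK: "integrable lborel (%z. K (y - z) * f z)" for y by (rule conv_integrable[OF Kc _ f]) (rule supp)
 have iD: "integrable lborel (%z. ?D b (y - z) * f z)" if "b : Basis" for b y
	by (rule conv_integrable[OF Dc[OF that] _ f]) (rule frechet_derivative_support[of r], rule supp)
 have lin: "fd K (at z) h = (SUM b:Basis. (h \<bullet> b) * ?D b z)" for z h
 proof -
	have f: "(K has_derivative fd K (at z)) (at z)" by (rule smooth_on_has_derivative[OF open_UNIV K]) simp
	interpret bounded_linear "fd K (at z)" using f by (rule has_derivative_bounded_linear)
	have "fd K (at z) (SUM b:Basis. (h \<bullet> b) *\<^sub>R b) = (SUM b:Basis. (h \<bullet> b) * ?D b z)" by (simp add: sum scale)
	then show ?thesis by (simp add: euclidean_representation)
 qed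
 show "((%y. norm (conv K f y - conv K f x - ?L (y - x)) / norm (y - x)) \<longlongrightarrow> 0) (at x)"
 proof (rule tendstoI)
	fix e :: real assume "e > 0"
	then have "e / (2 * B) > 0" using B by simp
	then obtain delta where delta: "delta > 0"
	 "!!z h. norm h < delta ==> \<bar>K (z + h) - K z - fd K (at z) h\<bar> <= e / (2 * B) * norm h" using uniform_linearization[OF K supp] by metis
	have "norm (conv K f y - conv K f x - ?L (y - x)) / norm (y - x) < e"
	 if y: "dist y x < delta" "y \<noteq> x" for y
	proof -
	 define h where "h = y - x"
	 have h: "norm h < delta" "norm h > 0" using y by (auto simp: h_def dist_norm)
	 have "(\<integral>z. (SUM b:Basis. (h \<bullet> b) * (?D b (x - z) * f z)) \<partial>lborel) =
		 (SUM b:Basis. (LBINT z. (h \<bullet> b) * (?D b (x - z) * f z)))" by (rule bochner_integral_sum) (intro integrable_mult_right iD)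
	 then have "?L h = (\<integral>z. (SUM b:Basis. (h \<bullet> b) * (?D b (x - z) * f z)) \<partial>lborel)" by (simp add: conv_def)
	 also have "... = (LBINT z. fd K (at (x - z)) h * f z)" by (simp add: lin[of _ h] sum_distrib_right mult.assoc)
	 finally have L: "?L h = (LBINT z. fd K (at (x - z)) h * f z)" .
	 have iL: "integrable lborel (%z. fd K (at (x - z)) h * f z)" unfolding lin[of _ h] sum_distrib_right mult.assoc
		by (intro bochner_integrable_sum integrable_mult_right iD)
	 have "conv K f y - conv K f x - ?L h =
		(LBINT z. (K (y - z) * f z - K (x - z) * f z) - fd K (at (x - z)) h * f z)" unfolding L using iK[of y] iK[of x] iL by (simp add: conv_def)
	 also have "... = (LBINT z. (K (x - z + h) - K (x - z) - fd K (at (x - z)) h) * f z)" by (simp add: h_def algebra_simps)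
	 also have "norm ... <= (LBINT z. e / (2 * B) * norm h * \<bar>f z\<bar>)"
	 proof (rule bochner_integral_norm_bound_integral)
		show "integrable lborel (%z. (K (x - z + h) - K (x - z) - fd K (at (x - z)) h) * f z)" unfolding left_diff_distrib
		 using iK[of y] iK[of x] iL by (simp add: h_def algebra_simps)
		show "integrable lborel (%z. e / (2 * B) * norm h * \<bar>f z\<bar>)" using f by simp
		show "norm ((K (x - z + h) - K (x - z) - fd K (at (x - z)) h) * f z)
			<= e / (2 * B) * norm h * \<bar>f z\<bar>" for z using delta(2)[OF h(1), of "x - z"] by (simp only: real_norm_def abs_mult) (rule mult_right_mono, auto)
	 qed
	 also have "... <= e / (2 * B) * norm h * B" using \<open>e > 0\<close> B h by (simp only: integral_mult_right_zero) (intro mult_left_mono, auto simp: B_def)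
	 also have "... = e / 2 * norm h" using B by simp
	 finally have "norm (conv K f y - conv K f x - ?L h) / norm h <= e / 2" using h by (simp add: field_simps)
	 also have "... < e" using \<open>e > 0\<close> by simp
	 finally show ?thesis unfolding h_def .
	qed
	then show "\<forall>\<^sub>F y in at x. dist (norm (conv K f y - conv K f x - ?L (y - x)) / norm (y - x)) 0 < e"
	 unfolding eventually_at using delta(1) by (intro exI[of _ delta]) auto
 qed
qed auto

lemma conv_frechet_derivative:
 fixes K f :: "'a::euclidean_space => real"
 assumes K: "smooth_on UNIV K" and supp: "!!x. norm x > r ==> K x = 0" and f: "integrable lborel f"
	and b: "b : Basis"
 shows "fd (conv K f) (at x) b = conv (%z. fd K (at z) b) f x"
proof -
 have "fd (conv K f) (at x) b =
	 (SUM c:Basis. (b \<bullet> c) * conv (%z. fd K (at z) c) f x)"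
 proof -
	have "(conv K f has_derivative
	  (%h. SUM b:Basis. (h \<bullet> b) * conv (%z. fd K (at z) b) f x)) (at x)" by (rule conv_has_derivative[OF K _ f]) (rule supp)
	from frechet_derivative_at[OF this] show ?thesis by (metis (no_types))
 qed
 also have "... = (SUM c:Basis. if c = b then conv (%z. fd K (at z) c) f x else 0)" by (rule sum.cong) (use b in "auto simp: inner_Basis")
 also have "... = conv (%z. fd K (at z) b) f x" using b by (subst sum.delta) auto
 finally show ?thesis .
qed

text \<open>Derivatives fall on the kernel, and a partial derivative of the kernel is again smooth
  with the same bound on its support. Hence the induction is over all kernels with \<open>f\<close>
  fixed.\<close>

lemma conv_smooth:
 fixes K f :: "'a::euclidean_space => real"
 assumes K: "smooth_on UNIV K" and supp: "!!x. norm x > r ==> K x = 0" and f: "integrable lborel f"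
 shows "smooth_on UNIV (conv K f)" unfolding smooth_on_def
proof
 fix k
 show "Ck_on k UNIV (conv K f)" using K supp
 proof (induction k arbitrary: K)
	case 0
	show ?case
	proof -
	 have "isCont (conv K f) x" for x by (rule has_derivative_continuous[OF conv_has_derivative[OF 0(1) _ f]]) (rule 0(2))
	 then show ?thesis by (simp add: continuous_at_imp_continuous_on)
	qed
 next
	case (Suc k)
	show ?case
	proof (rule Ck_on_SucI[OF open_UNIV])
	 show "(conv K f has_derivative
	  (%h. SUM b:Basis. (h \<bullet> b) * conv (%z. fd K (at z) b) f x)) (at x)" for x by (rule conv_has_derivative[OF Suc.prems(1) _ f]) (rule Suc.prems(2))
	 fix b :: 'a
	 show "Ck_on k UNIV (%x. SUM c:Basis. (b \<bullet> c) * conv (%z. fd K (at z) c) f x)" by (intro Ck_on_sum Ck_on_mult Ck_on_const open_UNIV Suc.IH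
			smooth_on_frechet_derivative Suc.prems(1) frechet_derivative_support[of r K]) (use Suc.prems(2) in auto)
	qed
 qed
qed


lemma integral_lborel_reflect:
 fixes f :: "'a::euclidean_space => real"
 assumes "f : bmeas borel"
 shows "(LBINT x. f (- x)) = integral\<^sup>L lborel f"
	and "integrable lborel (%x. f (- x)) \<longleftrightarrow> integrable lborel f"
proof -
 have eq: "distr lborel borel uminus = (lborel :: 'a measure)" using lborel_affine[of "-1" "0::'a"] by (simp add: density_1)
 have 1: "integral\<^sup>L (distr lborel borel uminus) f = (LBINT x. f (- x))" by (rule integral_distr) (use assms in auto)
 have 2: "integrable (distr lborel borel uminus) f \<longleftrightarrow> integrable lborel (%x. f (- x))" by (rule integrable_distr_eq) (use assms in auto)
 show "(LBINT x. f (- x)) = integral\<^sup>L lborel f"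
	"integrable lborel (%x. f (- x)) \<longleftrightarrow> integrable lborel f" using 1 2 unfolding eq by simp_all
qed

text \<open>Cauchy-Schwarz for sqrt K and sqrt K times f, where K is a probability density. The
  right side is an extended integral, so no integrability of \<open>f\<close> has to be known
  beforehand.\<close>

lemma jensen_square:
 assumes K: "!!x. 0 <= K x" "integrable M K" "integral\<^sup>L M K = (1::real)"
	and f: "f : bmeas M"
 shows "enn ((LINT x|M. K x * f x)^2) <= (\<integral>\<^sup>+x. enn (K x * (f x)^2) \<partial>M)"
proof (cases "(\<integral>\<^sup>+x. enn (K x * (f x)^2) \<partial>M) = top")
 case False
 have Km: "K : bmeas M" using K(2) by (rule borel_measurable_integrable)
 have i: "integrable M (%x. K x * (f x)^2)" by (rule integrableI_nonneg) (use Km f K False in "auto simp: top.not_eq_extremum")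
 have 1: "sqint M (%x. sqrt (K x))" using Km K by (simp add: sqint_def)
 have 2: "sqint M (%x. sqrt (K x) * f x)" using Km f K i by (auto simp: sqint_def power_mult_distrib)
 have "\<bar>\<integral>x. sqrt (K x) * (sqrt (K x) * f x) \<partial>M\<bar> <= 1 * sqrt (LINT x|M. K x * (f x)^2)"
	using l2_Cauchy_Schwarz[OF 1 2] K by (simp add: l2norm_def power_mult_distrib)
 then have "\<bar>\<integral>x. K x * f x \<partial>M\<bar> <= sqrt (LINT x|M. K x * (f x)^2)" using K(1) by (simp add: mult.assoc[symmetric])
 then have "\<bar>\<integral>x. K x * f x \<partial>M\<bar>\<^sup>2 <= (sqrt (LINT x|M. K x * (f x)^2))^2" by (intro power_mono) auto
 then have "(LINT x|M. K x * f x)^2 <= (LINT x|M. K x * (f x)^2)" using K(1) by simp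
 then show ?thesis using nn_integral_eq_integral[OF i] K(1) by (simp add: ennreal_leI)
qed simp

lemma conv_alt:
 fixes K f :: "'a::euclidean_space => real"
 assumes "K : bmeas borel" "f : bmeas borel"
 shows "conv K f x = (LBINT u. K (- u) * f (u + x))"
	and "integrable lborel (%u. K (- u) * f (u + x)) \<longleftrightarrow> integrable lborel (%y. K (x - y) * f y)"
 using integral_lborel_shift[of "%y. K (x - y) * f y" x] assms by (auto simp: conv_def)

lemma conv_bound:
 fixes K f :: "'a::euclidean_space => real"
 assumes K: "!!x. 0 <= K x" "integrable lborel K" "integral\<^sup>L lborel K = 1"
	and f: "f : bmeas borel" "!!x. \<bar>f x\<bar> <= M"
 shows "\<bar>conv K f x\<bar> <= M"
proof -
 have Km: "K : bmeas borel" using borel_measurable_integrable[OF K(2)] by simp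
 have Ki: "integrable lborel (%u. K (- u))" "(LBINT u. K (- u)) = 1" using integral_lborel_reflect[OF Km] K by simp_all
 have "norm (K (- u) * f (u + x)) <= M * K (- u)" for u using mult_left_mono[OF f(2)[of "u + x"] K(1)[of "- u"]] K(1)[of "- u"] by (simp add: abs_mult mult.commute)
 note le = this
 have i: "integrable lborel (%u. M * K (- u))" using Ki(1) by simp
 have "norm (LBINT u. K (- u) * f (u + x)) <= (LBINT u. M * K (- u))"
 proof (rule bochner_integral_norm_bound_integral[OF _ i le])
	have "norm (K (- u) * f (u + x)) <= norm (M * K (- u))" for u using le[of u] by (simp only: real_norm_def)
	then show "integrable lborel (%u. K (- u) * f (u + x))" by (intro bochner_integrable_bound[OF i]) (use Km f in auto)
 qed
 then show ?thesis unfolding conv_alt(1)[OF Km f(1)] using Ki by simp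
qed

lemma conv_support:
 assumes "!!x. norm x >= delta ==> K x = 0" "!!y. y ~: A ==> f y = 0" "!!y. y : A ==> norm (x - y) >= delta"
 shows "conv K f x = 0"
proof -
 have "K (x - y) * f y = 0" for y using assms by (cases "y : A") auto
 then have "(%y. K (x - y) * f y) = (%y. 0)" by (rule ext)
 then show ?thesis by (simp only: conv_def) simp
qed

text \<open>\<open>conv K f - f\<close> is an average of translation differences of \<open>f\<close>
  with weight K(-u). Jensen and Tonelli bound its squared norm by the same average of squared
  translation norms, in which only shifts shorter than \<open>delta\<close> count.\<close>

lemma conv_l2_bound:
 fixes K f :: "'a::euclidean_space => real"
 assumes K: "!!x. 0 <= K x" "integrable lborel K" "integral\<^sup>L lborel K = 1" "continuous_on UNIV K"
	and supp: "!!x. norm x >= delta ==> K x = 0"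
	and f: "sqint lborel f" "integrable lborel f"
	and bound: "!!y. norm y < delta ==> (LBINT x. (f (x + y) - f x)^2) <= eps"
	and m: "conv K f : bmeas borel" and "eps >= 0"
 shows "sqint lborel (conv K f)" "(LBINT x. (conv K f x - f x)^2) <= eps"
proof -
 have Km: "K : bmeas borel" using borel_measurable_integrable[OF K(2)] by simp
 have fm [measurable]: "f : bmeas borel" using borel_measurable_integrable[OF f(2)] by simp
 have Km' [measurable]: "(%u. K (- u)) : bmeas borel" using Km by simp
 have Ki: "integrable lborel (%u. K (- u))" "(LBINT u. K (- u)) = 1" using integral_lborel_reflect[OF Km] K by simp_all
 have diff: "conv K f x - f x = (LBINT u. K (- u) * (f (u + x) - f x))" for x
 proof -
	have "integrable lborel (%y. K (x - y) * f y)" by (rule conv_integrable[OF K(4) _ f(2)]) (rule supp, erule less_imp_le)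
	then have "integrable lborel (%u. K (- u) * f (u + x))" by (simp add: conv_alt(2)[OF Km fm])
	then show ?thesis unfolding conv_alt(1)[OF Km fm] using Ki by (simp add: right_diff_distrib)
 qed
 have sh: "sqint lborel (%x. f (x + u) - f x)" for u by (intro sqint_diff sqint_shift f)
 have "(nni lborel (%x. enn ((conv K f x - f x)^2))) <=
	 (nni lborel (%x. (nni lborel (%u. enn (K (- u) * (f (u + x) - f x)^2)))))" unfolding diff by (intro nn_integral_mono jensen_square) (use K Ki in auto)
 also have "... = (nni lborel (%u. (nni lborel (%x. enn (K (- u) * (f (u + x) - f x)^2)))))" by (rule lborel_pair.Fubini') measurable
 also have "... <= (nni lborel (%u. enn (K (- u)) * enn eps))"
 proof (rule nn_integral_mono)
	fix u :: 'a
	have "(nni lborel (%x. enn (K (- u) * (f (u + x) - f x)^2))) =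
		enn (K (- u)) * (nni lborel (%x. enn ((f (x + u) - f x)^2)))" by (subst nn_integral_cmult[symmetric]) (auto simp: ennreal_mult K add.commute)
	also have "(nni lborel (%x. enn ((f (x + u) - f x)^2))) =
		enn (LBINT x. (f (x + u) - f x)^2)" by (rule nn_integral_eq_integral[OF sqint_integrable[OF sh]]) simp
	also have "enn (K (- u)) * ... <= enn (K (- u)) * enn eps" using bound[of u] supp[of "- u"] by (cases "norm u < delta") (auto intro!: mult_left_mono ennreal_leI)
	finally show "(nni lborel (%x. enn (K (- u) * (f (u + x) - f x)^2))) <= enn (K (- u)) * enn eps" .
 qed
 also have "... = enn eps" using nn_integral_eq_integral[OF Ki(1)] Ki(2) K(1) by (simp add: nn_integral_multc)
 finally have le: "(nni lborel (%x. enn ((conv K f x - f x)^2))) <= enn eps" .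
 have i: "integrable lborel (%x. (conv K f x - f x)^2)" by (rule integrableI_nonneg) (use m le in "auto intro: le_less_trans[OF _ ennreal_less_top]")
 then have "sqint lborel (%x. conv K f x - f x)" using m by (simp add: sqint_def)
 from sqint_add[OF this f(1)] show "sqint lborel (conv K f)" by simp
 show "(LBINT x. (conv K f x - f x)^2) <= eps" using le nn_integral_eq_integral[OF i] \<open>eps >= 0\<close> by simp
qed

lemma conv_moll_smooth:
 assumes "integrable lborel f"
 shows "smooth_on UNIV (conv (moll n) f)" by (rule conv_smooth[OF moll_smooth _ assms]) (rule moll_eq_0, erule less_imp_le)

lemma conv_moll_measurable:
 assumes "integrable lborel f"
 shows "conv (moll n) f : bmeas borel" by (intro borel_measurable_continuous_onI smooth_on_continuous conv_moll_smooth assms)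

lemma sqint_conv_moll:
 fixes f :: "'a::euclidean_space => real"
 assumes f: "sqint lborel f" "integrable lborel f"
 shows "sqint lborel (conv (moll n) f)"
proof (rule conv_l2_bound(1)[OF moll_nonneg moll_integrable moll_integral
	 smooth_on_continuous[OF moll_smooth] moll_eq_0 f _ conv_moll_measurable[OF f(2)]])
 have fm: "f : bmeas borel" using borel_measurable_integrable[OF f(2)] by simp
 \<comment> \<open>A crude bound valid for shifts of any length; it suffices to conclude that the
   mollification is square integrable.\<close>
 show "(LBINT x. (f (x + y) - f x)^2) <= 4 * (LBINT x. (f x)^2)" for y
 proof -
	have i: "integrable lborel (%x. 2 * (f (x + y))^2)" "integrable lborel (%x. 2 * (f x)^2)"
	 using sqint_integrable[OF f(1)] sqint_integrable[OF sqint_shift[OF f(1)]] by auto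
	have "(LBINT x. (f (x + y) - f x)^2) <= (LBINT x. 2 * (f (x + y))^2 + 2 * (f x)^2)"
	proof (rule integral_mono)
	 show "integrable lborel (%x. (f (x + y) - f x)^2)" by (intro sqint_integrable sqint_diff sqint_shift f)
	 show "(f (x + y) - f x)^2 <= 2 * (f (x + y))^2 + 2 * (f x)^2" for x using sum_squares_bound[of "f (x + y)" "- f x"] power2_diff[of "f (x + y)" "f x"] by simp
	qed (use i in simp)
	also have "... = 4 * (LBINT x. (f x)^2)" using i integral_lborel_shift(1)[of "%x. (f x)^2" y] fm by simp
	finally show ?thesis .
 qed
qed auto

lemma conv_moll_tendsto:
 fixes f :: "'a::euclidean_space => real"
 assumes f: "sqint lborel f" "integrable lborel f"
 shows "(%n. (LBINT x. (conv (moll n) f x - f x)^2)) ----> 0"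
proof (rule LIMSEQ_I)
 fix e :: real assume "e > 0"
 then have "e / 2 > 0" by simp
 obtain delta where delta: "delta > 0" "!!y. norm y < delta ==> (LBINT x. (f (x + y) - f x)^2) < e / 2"
	by (rule l2_translation_continuous[OF f(1) \<open>e / 2 > 0\<close>]) blast
 obtain N where N: "1 / real (Suc N) < delta" using delta(1) nat_approx_posE by blast
 have "(LBINT x. (conv (moll n) f x - f x)^2) < e" if "n >= N" for n
 proof -
	have "1 / real (Suc n) <= 1 / real (Suc N)" using that by (intro divide_left_mono) auto
	then have bd: "(LBINT x. (f (x + y) - f x)^2) <= e / 2" if "norm y < 1 / real (Suc n)" for y using delta(2)[of y] N that by simp
	have "(LBINT x. (conv (moll n) f x - f x)^2) <= e / 2" by (rule conv_l2_bound(2)[OF moll_nonneg moll_integrable moll_integral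
		smooth_on_continuous[OF moll_smooth] moll_eq_0 f bd conv_moll_measurable[OF f(2)]]) (use \<open>e > 0\<close> in auto)
	then show ?thesis using \<open>e > 0\<close> by simp
 qed
 then show "EX no. ALL n>=no. norm ((LBINT x. (conv (moll n) f x - f x)^2) - 0) < e" by auto
qed

lemma compact_neighbourhood:
 fixes K :: "'a::euclidean_space set"
 assumes "compact K" "open S" "K \<subseteq> S"
 obtains K' delta where "compact K'" "K' \<subseteq> S" "delta > 0" "!!x y. x ~: K' ==> y : K ==> norm (x - y) >= delta"
proof -
 obtain e where e: "e > 0" "(\<Union>x\<in>K. cball x e) \<subseteq> S" using compact_subset_open_imp_cball_epsilon_subset[OF assms] by auto
 have "compact {x + y | x y. x : K & y : cball 0 e}" using assms(1) by (intro compact_sums) auto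
 moreover have "{x + y | x y. x : K & y : cball 0 e} = (\<Union>x\<in>K. cball x e)"
 proof (intro equalityI subsetI)
	fix z assume "z : (\<Union>x\<in>K. cball x e)"
	then obtain x where "x : K" "norm (z - x) <= e" by (auto simp: dist_norm norm_minus_commute)
	then show "z : {x + y | x y. x : K & y : cball 0 e}" by (intro CollectI exI[of _ x] exI[of _ "z - x"]) auto
 next
	fix z assume "z : {x + y | x y. x : K & y : cball 0 e}"
	then obtain x y where "x : K" "norm y <= e" "z = x + y" by auto
	then show "z : (\<Union>x\<in>K. cball x e)" by (intro UN_I[of x]) (auto simp: dist_norm)
 qed
 ultimately have c: "compact (\<Union>x\<in>K. cball x e)" by simp
 show ?thesis
 proof (rule that[OF c e(2,1)])
	fix x y assume "x ~: (\<Union>x\<in>K. cball x e)" "y : K"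
	then show "norm (x - y) >= e" by (auto simp: dist_norm norm_minus_commute)
 qed
qed

lemma test_fun_conv_moll:
 fixes f :: "'a::euclidean_space => real"
 assumes "compact K'" "K' \<subseteq> S" "!!x y. x ~: K' ==> y : K ==> norm (x - y) >= delta"
	"!!y. y ~: K ==> f y = 0" "integrable lborel f" "1 / real (Suc n) <= delta"
 shows "conv (moll n) f : test_fun S" "x ~: K' ==> conv (moll n) f x = 0"
proof -
 have 0: "conv (moll n) f x = 0" if "x ~: K'" for x by (rule conv_support[OF moll_eq_0 assms(4)]) (use assms(3)[OF that] assms(6) in force)+
 then show "x ~: K' ==> conv (moll n) f x = 0" .
 show "conv (moll n) f : test_fun S" using 0 assms(1,2) conv_moll_smooth[OF assms(5)] unfolding test_fun_def by blast
qed

text \<open>Mollifications converge in L2, hence almost everywhere along a subsequence. The common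
  bound \<open>M\<close> and the common compact support are recorded so that dominated convergence
  also works against functions that are only locally integrable.\<close>

lemma test_approx:
 fixes h :: "'a::euclidean_space => real"
 assumes "open S" "compact K" "K \<subseteq> S" and hm: "h : bmeas borel"
	and hb: "!!x. \<bar>h x\<bar> <= M" and h0: "!!x. x ~: K ==> h x = 0"
 obtains phi K' where "compact K'" "K' \<subseteq> S" "!!n. phi n : test_fun S" "!!n x. \<bar>phi n x\<bar> <= M"
	"!!n x. x ~: K' ==> phi n x = 0" "AE x in lborel. (%n. phi n x) ----> h x"
	"(%n::nat. (LBINT x. (phi n x - h x)^2)) ----> 0"
proof -
 obtain K' delta where K': "compact K'" "K' \<subseteq> S" "delta > 0" "!!x y. x ~: K' ==> y : K ==> norm (x - y) >= delta"
	by (rule compact_neighbourhood[OF assms(2,1,3)]) blast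
 obtain R where R: "!!x. x : K ==> norm x <= R" using compact_imp_bounded[OF assms(2)] bounded_iff by metis
 have hb': "\<bar>h x\<bar> <= M * ind (cball 0 R) x" for x using hb[of x] h0[of x] R[of x] by (cases "x : K") (auto simp: indicator_def)
 note h = sqint_bounded_support[OF hm hb']
 obtain N where N: "1 / real (Suc N) < delta" using K'(3) nat_approx_posE by blast
 \<comment> \<open>Starting at index \<open>N\<close> keeps all kernels narrower than
   \<open>delta\<close>, so every support lies in \<open>K'\<close>.\<close>
 define psi where "psi n = conv (moll (n + N)) h" for n
 have le: "1 / real (Suc (n + N)) <= delta" for n
 proof -
	have "1 / real (Suc (n + N)) <= 1 / real (Suc N)" by (intro divide_left_mono) auto
	then show ?thesis using N by simp
 qed
 have t: "psi n : test_fun S" and t0: "x ~: K' ==> psi n x = 0" for n x unfolding psi_def by (rule test_fun_conv_moll[OF K'(1,2,4) h0 h(2) le]; assumption)+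
 have b: "\<bar>psi n x\<bar> <= M" for n x unfolding psi_def by (rule conv_bound[OF moll_nonneg moll_integrable moll_integral hm hb])
 have lim: "(%n. (LBINT x. (psi n x - h x)^2)) ----> 0" unfolding psi_def by (rule LIMSEQ_ignore_initial_segment[OF conv_moll_tendsto[OF h]])
 have "EX r. strict_mono r & (AE x in lborel. (%n. (psi (r n) x - h x)^2) ----> 0)"
 proof (rule tendsto_L1_AE_subseq)
	show "integrable lborel (%x. (psi n x - h x)^2)" for n unfolding psi_def by (intro sqint_integrable sqint_diff sqint_conv_moll h)
	show "(%n. (LBINT x. norm ((psi n x - h x)^2))) ----> 0" using lim by simp
 qed
 then obtain r where r: "strict_mono r" "AE x in lborel. (%n. (psi (r n) x - h x)^2) ----> 0" by blast
 have ae: "AE x in lborel. (%n. psi (r n) x) ----> h x"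
 proof (use r(2) in eventually_elim)
	case (elim x)
	then have "(%n. sqrt ((psi (r n) x - h x)^2)) ----> sqrt 0" by (rule tendsto_real_sqrt)
	then have "(%n. psi (r n) x - h x) ----> 0" by (simp add: tendsto_rabs_zero_iff)
	then show ?case by (rule LIM_zero_cancel)
 qed
 have lim': "(%n. (LBINT x. (psi (r n) x - h x)^2)) ----> 0" using LIMSEQ_subseq_LIMSEQ[OF lim r(1)] by (simp add: o_def)
 show ?thesis by (rule that[of K' "%n. psi (r n)", OF K'(1,2) t b t0 ae lim'])
qed

section \<open>Weak derivatives\<close>

subsection \<open>Restrictions of Lebesgue measure\<close>

lemma lebesgue_on_indicator:
 fixes f :: "'a::euclidean_space => real"
 assumes "A : sets lebesgue"
 shows "integral\<^sup>L (leb A) f = (LINT x|lebesgue. ind A x * f x)"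
	and "integrable (leb A) f \<longleftrightarrow> integrable lebesgue (%x. ind A x * f x)"
	and "f : bmeas (leb A) \<longleftrightarrow> (%x. ind A x * f x) : bmeas lebesgue"
 using assms integral_restrict_space[of A lebesgue f] integrable_restrict_space[of A lebesgue f]
	borel_measurable_restrict_space_iff[of A lebesgue f] by simp_all

lemma lebesgue_on_support:
 fixes f :: "'a::euclidean_space => real"
 assumes "A : sets lebesgue" "B : sets lebesgue" "!!x. x : A ==> x ~: B ==> f x = 0"
	"!!x. x : B ==> x ~: A ==> f x = 0"
 shows "integral\<^sup>L (leb A) f = integral\<^sup>L (leb B) f"
	and "integrable (leb A) f \<longleftrightarrow> integrable (leb B) f"
	and "f : bmeas (leb A) \<longleftrightarrow> f : bmeas (leb B)"
proof -
 have "(%x. ind A x * f x) = (%x. ind B x * f x)"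
 proof
	fix x show "ind A x * f x = ind B x * f x" using assms(3,4)[of x] by (cases "x : A"; cases "x : B") simp_all
 qed
 then show "integral\<^sup>L (leb A) f = integral\<^sup>L (leb B) f"
	"integrable (leb A) f \<longleftrightarrow> integrable (leb B) f"
	"f : bmeas (leb A) \<longleftrightarrow> f : bmeas (leb B)" by (simp_all only: lebesgue_on_indicator[OF assms(1)] lebesgue_on_indicator[OF assms(2)])
qed

lemma AE_lebesgue_on_iff:
 assumes "A : sets lebesgue"
 shows "(AE x in leb A. P x) \<longleftrightarrow> (AE x in lborel. x : A --> P x)" using assms by (subst AE_restrict_space_iff) (simp_all add: AE_completion_iff)

text \<open>The bridge between the two settings: the notions of the theorem use
  \<open>lebesgue_on\<close>, while translations, convolutions and Fubini are available on
  \<open>lborel\<close> for Borel functions extended by zero.\<close>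

lemma lebesgue_on_borel:
 fixes f :: "'a::euclidean_space => real"
 assumes A: "A : sets lebesgue" and f: "f : bmeas borel" "!!x. x ~: A ==> f x = 0"
 shows "integral\<^sup>L (leb A) f = integral\<^sup>L lborel f"
	and "integrable (leb A) f \<longleftrightarrow> integrable lborel f"
	and "f : bmeas (leb A)"
proof -
 have m: "f : bmeas lborel" using f by simp
 have "integral\<^sup>L (leb A) f = integral\<^sup>L (leb UNIV) f"
	"integrable (leb A) f \<longleftrightarrow> integrable (leb UNIV) f"
	"f : bmeas (leb A) \<longleftrightarrow> f : bmeas (leb UNIV)" by (rule lebesgue_on_support[OF A, of UNIV]; use f(2) in simp)+
 then show "integral\<^sup>L (leb A) f = integral\<^sup>L lborel f"
	"integrable (leb A) f \<longleftrightarrow> integrable lborel f"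
	"f : bmeas (leb A)" using integral_completion[OF m] integrable_completion[OF m] measurable_completion[OF m] by (simp_all add: lebesgue_on_UNIV_eq)
qed

lemma borel_representative:
 fixes f :: "'a::euclidean_space => real"
 assumes A: "A : sets borel" and f: "f : bmeas (leb A)"
 obtains f' where "f' : bmeas borel" "!!x. x ~: A ==> f' x = 0"
	"AE x in leb A. f x = f' x"
proof -
 have A': "A : sets lebesgue" using A by simp
 have "(%x. ind A x * f x) : bmeas lebesgue" using f lebesgue_on_indicator(3)[OF A'] by simp
 from completion_ex_borel_measurable_real[OF this]
 obtain h where h: "h : bmeas lborel" "AE x in lborel. ind A x * f x = h x" by blast
 show ?thesis
 proof (rule that[of "%x. ind A x * h x"])
	show "(%x. ind A x * h x) : bmeas borel" using h(1) A by (intro borel_measurable_times borel_measurable_indicator) auto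
	show "AE x in leb A. f x = ind A x * h x" unfolding AE_lebesgue_on_iff[OF A'] using h(2) by eventually_elim auto
 qed simp
qed

lemma borel_measurable_lebesgue_on:
 fixes f :: "'a::euclidean_space => real"
 shows "f : bmeas borel ==> f : bmeas (leb A)" by (intro measurable_restrict_space1 measurable_completion) simp

lemma compact_sets_lebesgue: "compact K ==> K : sets lebesgue" using borel_compact[of K] by simp

lemma open_compact_exhaustion:
 fixes S :: "'a::euclidean_space set"
 assumes "open S"
 obtains K :: "nat => 'a set" where "!!n. compact (K n)" "!!n. K n \<subseteq> S" "(\<Union>n. K n) = S"
	"!!n. K n \<subseteq> K (Suc n)"
proof (rule open_Union_compact_subsets[OF assms])
 fix C :: "nat => 'a set"
 assume C: "!!n. compact (C n)" "!!n. C n \<subseteq> S" "!!n. C n \<subseteq> interior (C (Suc n))" "\<Union> (range C) = S"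
 have "C n \<subseteq> C (Suc n)" for n using C(3)[of n] interior_subset by blast
 with C(1,2,4) show ?thesis by (intro that[of C]) auto
qed

lemma AE_on_open_iff_compact:
 fixes S :: "'a::euclidean_space set"
 assumes S: "open S"
	and P: "!!K. compact K ==> K \<subseteq> S ==> AE x in leb K. P x"
 shows "AE x in leb S. P x"
proof -
 obtain K where K: "!!n. compact (K n)" "!!n. K n \<subseteq> S" "(\<Union>n::nat. K n) = S" "!!n. K n \<subseteq> K (Suc n)"
	by (rule open_compact_exhaustion[OF S]) blast
 have "AE x in lborel. x : K n --> P x" for n
 proof -
	have "K n : sets lebesgue" using K(1)[of n] by (rule compact_sets_lebesgue)
	then show ?thesis using P[OF K(1,2), of n] AE_lebesgue_on_iff by blast
 qed
 then have "AE x in lborel. ALL n. x : K n --> P x" by (intro AE_all_countable[THEN iffD2] allI)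
 then have "AE x in lborel. x : S --> P x" by eventually_elim (use K(3) in blast)
 then show ?thesis using S by (simp add: AE_lebesgue_on_iff)
qed

lemma measurable_on_open_compact:
 fixes f :: "'a::euclidean_space => real"
 assumes S: "open S"
	and f: "!!K. compact K ==> K \<subseteq> S ==> f : bmeas (leb K)"
 shows "f : bmeas (leb S)"
proof -
 obtain K where K: "!!n. compact (K n)" "!!n. K n \<subseteq> S" "(\<Union>n::nat. K n) = S" "!!n. K n \<subseteq> K (Suc n)"
	by (rule open_compact_exhaustion[OF S]) blast
 have Kl: "K n : sets lebesgue" for n using K(1)[of n] by (rule compact_sets_lebesgue)
 show ?thesis
 proof (rule measurable_piecewise_restrict2[of K])
	show "K n : sets (leb S)" for n using Kl[of n] K(2)[of n] S by (auto simp: sets_restrict_space_iff)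
	show "space (leb S) = (\<Union>n. K n)" using K(3) by simp
	show "EX h:bmeas (leb S). ALL x:K n. f x = h x" for n
	proof (rule bexI)
	 show "ALL x:K n. f x = ind (K n) x * f x" by simp
	 have "(%x. ind (K n) x * f x) : bmeas lebesgue" using f[OF K(1,2)] lebesgue_on_indicator(3)[OF Kl] by blast
	 then show "(%x. ind (K n) x * f x) : bmeas (leb S)" by (rule measurable_restrict_space1)
	qed
 qed
qed

lemma sqint_bounded_imp_integrable:
 fixes f :: "'a::euclidean_space => real"
 assumes A: "A : sets lebesgue" "bounded A" and f: "sqint (leb A) f"
 shows "integrable (leb A) f"
proof -
 interpret finite_measure "leb A" by (intro finite_measure_lebesgue_on bounded_set_imp_lmeasurable A)
 show ?thesis
 proof (rule bochner_integrable_bound)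
	show "integrable (leb A) (%x. 1 + (f x)^2)" using sqint_integrable[OF f] by simp
	show "f : bmeas (leb A)" using f by (rule sqint_measurable)
	have "abs t <= 1 + t^2" for t :: real using sum_squares_bound[of 1 "abs t"] by simp
	then show "AE x in leb A. norm (f x) <= norm (1 + (f x)^2)" by simp
 qed
qed

lemma sqint_subset:
 fixes f :: "'a::euclidean_space => real"
 assumes A: "A : sets lebesgue" "B : sets lebesgue" "B \<subseteq> A" and f: "sqint (leb A) f"
 shows "sqint (leb B) f"
proof -
 have m: "f : bmeas (leb B)" using measurable_restrict_mono[OF sqint_measurable[OF f] A(3)] by simp
 have "integrable lebesgue (%x. ind B x * (ind A x * (f x)^2))" using sqint_integrable[OF f] A integrable_mult_indicator[of B lebesgue "%x. ind A x * (f x)^2"]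
	by (simp add: lebesgue_on_indicator)
 moreover have "ind B x * (ind A x * (f x)^2) = ind B x * (f x)^2" for x using A(3) by (auto simp: indicator_def)
 ultimately show ?thesis using m A by (simp add: sqint_def lebesgue_on_indicator(2))
qed

lemma L2_eq_sqint: "w : L2 Om \<longleftrightarrow> sqint (leb Om) w" by (auto simp: L2_def sqint_def)

lemma L2norm_eq: "L2norm Om w = l2norm (leb Om) w" by (simp add: L2norm_def l2norm_def)

lemma sqint_cong_AE:
 assumes "f : bmeas M" "g : bmeas M" "AE x in M. f x = g x"
 shows "sqint M f \<longleftrightarrow> sqint M g"
proof -
 have "integrable M (%x. (f x)^2) \<longleftrightarrow> integrable M (%x. (g x)^2)" by (rule integrable_cong_AE) (use assms in "auto elim!: eventually_mono")
 then show ?thesis using assms by (simp add: sqint_def)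
qed

lemma l2norm_cong_AE:
 assumes "f : bmeas M" "g : bmeas M" "AE x in M. f x = g x"
 shows "l2norm M f = l2norm M g" unfolding l2norm_def by (rule arg_cong[of _ _ sqrt], rule integral_cong_AE) (use assms in "auto elim!: eventually_mono")

subsection \<open>Local integrability and the fundamental lemma\<close>

lemma loc_integrableD: "loc_integrable Om w ==> compact K ==> K \<subseteq> Om ==> integrable (leb K) w" by (simp add: loc_integrable_def)

lemma loc_integrable_measurable:
 assumes "open Om" "loc_integrable Om w"
 shows "w : bmeas (leb Om)" by (rule measurable_on_open_compact[OF assms(1)]) (rule borel_measurable_integrable, rule loc_integrableD[OF assms(2)])

lemma loc_integrable_L2:
 fixes w :: "'a::euclidean_space => real"
 assumes "open Om" "sqint (leb Om) w"
 shows "loc_integrable Om w" unfolding loc_integrable_def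
proof (intro allI impI)
 fix K :: "'a set" assume K: "compact K & K \<subseteq> Om"
 then have l: "K : sets lebesgue" by (auto intro: compact_sets_lebesgue)
 then show "integrable (leb K) w" using K assms by (intro sqint_bounded_imp_integrable sqint_subset[of Om K]) (auto intro: compact_imp_bounded)
qed

lemma loc_integrable_add:
 assumes "loc_integrable Om f" "loc_integrable Om g"
 shows "loc_integrable Om (%x. f x + g x)" using assms by (auto simp: loc_integrable_def)

lemma loc_integrable_scale:
 assumes "loc_integrable Om f"
 shows "loc_integrable Om (%x. c * f x)" using assms by (auto simp: loc_integrable_def)

lemma loc_integrable_mult_continuous:
 fixes f h :: "'a::euclidean_space => real"
 assumes f: "loc_integrable Om f" and h: "continuous_on UNIV h"
 shows "loc_integrable Om (%x. h x * f x)" unfolding loc_integrable_def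
proof (intro allI impI, elim conjE)
 fix K assume K: "compact K" "K \<subseteq> Om"
 have i: "integrable (leb K) f" by (rule loc_integrableD[OF f K])
 have "compact (h ` K)" by (intro compact_continuous_image continuous_on_subset[OF h] K) auto
 then obtain B where B: "!!x. x : K ==> norm (h x) <= B" using compact_imp_bounded bounded_iff by (metis image_eqI)
 have hm: "h : bmeas (leb K)" using borel_measurable_continuous_onI[OF h] by (intro measurable_restrict_space1 measurable_completion) simp
 show "integrable (leb K) (%x. h x * f x)"
 proof (rule bochner_integrable_bound)
	show "integrable (leb K) (%x. B * \<bar>f x\<bar>)" using i by simp
	show "(%x. h x * f x) : bmeas (leb K)" using hm borel_measurable_integrable[OF i] by simp
	have "norm (h x * f x) <= norm (B * \<bar>f x\<bar>)" if "x : K" for x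
	proof -
	 have "\<bar>h x\<bar> * \<bar>f x\<bar> <= B * \<bar>f x\<bar>" using B[OF that] by (intro mult_right_mono) auto
	 also have "... <= \<bar>B * \<bar>f x\<bar>\<bar>" by (rule abs_ge_self)
	 finally show ?thesis by (simp add: abs_mult)
	qed
	then show "AE x in leb K. norm (h x * f x) <= norm (B * \<bar>f x\<bar>)" by (intro AE_I2) simp
 qed
qed

lemma test_funE:
 assumes "phi : test_fun Om"
 obtains K where "smooth_on UNIV phi" "compact K" "K \<subseteq> Om" "!!x. x ~: K ==> phi x = 0" using assms by (auto simp: test_fun_def)

lemma frechet_derivative_zero_outside:
 fixes phi :: "'a::euclidean_space => real"
 assumes "closed K" "!!x. x ~: K ==> phi x = 0" "x ~: K"
 shows "fd phi (at x) b = 0"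
proof -
 have "fd phi (at x) = fd (%_. 0) (at x)" by (rule frechet_derivative_cong_open[of "- K"]) (use assms in auto)
 then show ?thesis by simp
qed

lemma test_fun_mult:
 assumes "phi : test_fun Om" "smooth_on UNIV h"
 shows "(%x. h x * phi x) : test_fun Om" using assms by (auto simp: test_fun_def intro!: smooth_on_mult)

lemma loc_integrable_times_support:
 fixes f h :: "'a::euclidean_space => real"
 assumes "open Om" "loc_integrable Om f" "continuous_on UNIV h" "compact K" "K \<subseteq> Om" "!!x. x ~: K ==> h x = 0"
 shows "integrable (leb Om) (%x. f x * h x)"
proof -
 have "integrable (leb K) (%x. f x * h x)" using loc_integrableD[OF loc_integrable_mult_continuous[OF assms(2,3)] assms(4,5)] by (simp add: mult.commute)
 then show ?thesis using assms compact_sets_lebesgue[of K] lebesgue_on_support(2)[of Om K "%x. f x * h x"] by auto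
qed

lemma test_fun_integrable:
 assumes "open Om" "loc_integrable Om f" "phi : test_fun Om"
 shows "integrable (leb Om) (%x. f x * phi x)"
	and "b : Basis ==> integrable (leb Om) (%x. f x * fd phi (at x) b)"
proof -
 obtain K where K: "smooth_on UNIV phi" "compact K" "K \<subseteq> Om" "!!x. x ~: K ==> phi x = 0" by (rule test_funE[OF assms(3)]) blast
 show "integrable (leb Om) (%x. f x * phi x)" by (rule loc_integrable_times_support[OF assms(1,2) smooth_on_continuous[OF K(1)] K(2-4)])
 assume b: "b : Basis"
 show "integrable (leb Om) (%x. f x * fd phi (at x) b)" by (rule loc_integrable_times_support[OF assms(1,2)
		 smooth_on_continuous[OF smooth_on_frechet_derivative[OF open_UNIV K(1) b]] K(2-3)]) (rule frechet_derivative_zero_outside[OF compact_imp_closed[OF K(2)] K(4)])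
qed

text \<open>On a compact set, test with smooth approximations of the sign of \<open>f\<close>. They
  are bounded by 1, so |f| dominates, and the limit says that the integral of |f| over this set
  vanishes.\<close>

lemma fundamental_lemma:
 fixes f :: "'a::euclidean_space => real"
 assumes S: "open S" and f: "loc_integrable S f"
	and 0: "!!phi. phi : test_fun S ==> (LINT x|leb S. f x * phi x) = 0"
 shows "AE x in leb S. f x = 0"
proof (rule AE_on_open_iff_compact[OF S])
 fix K assume K: "compact K" "K \<subseteq> S"
 have Kb: "K : sets borel" "K : sets lebesgue" using K(1) by (auto intro: borel_compact compact_sets_lebesgue)
 obtain f' where f': "f' : bmeas borel" "!!x. x ~: K ==> f' x = 0"
	"AE x in leb K. f x = f' x" by (rule borel_representative[OF Kb(1) borel_measurable_integrable[OF loc_integrableD[OF f K]]]) blast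
 define h where "h x = sgn (f' x)" for x
 have hm: "h : bmeas borel" unfolding h_def[abs_def] using f'(1) by measurable
 have hb: "\<bar>h x\<bar> <= 1" for x by (simp add: h_def sgn_real_def)
 have h0: "h x = 0" if "x ~: K" for x using f'(2)[OF that] by (simp add: h_def)
 obtain phi K'' where K'': "compact K''" "K'' \<subseteq> S" and phi: "!!n. phi n : test_fun S" "!!n x. \<bar>phi n x\<bar> <= 1"
	and phi0: "!!n x. x ~: K'' ==> phi n x = 0" and lim: "AE x in lborel. (%n::nat. phi n x) ----> h x"
	by (rule test_approx[OF S K hm hb]) (rule h0, assumption, (rule that; assumption))
 \<comment> \<open>The approximations live on \<open>K''\<close>, the sign function on
   \<open>K\<close>; both are integrated over one compact set on which \<open>f\<close> is
   integrable.\<close>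
 define K' where "K' = K'' \<union> K"
 have K': "compact K'" "K' \<subseteq> S" "K \<subseteq> K'" using K K'' by (auto simp: K'_def)
 have phi3: "phi n x = 0" if "x ~: K'" for n x using phi0 that by (simp add: K'_def)
 have K'b: "K' : sets lebesgue" using K'(1) by (rule compact_sets_lebesgue)
 have fi: "integrable (leb K') f" by (rule loc_integrableD[OF f K'(1,2)])
 have z: "(\<integral>x. f x * phi n x \<partial>leb K') = 0" for n using 0[OF phi(1)[of n]] lebesgue_on_support(1)[of S K' "%x. f x * phi n x"] phi3 S K' K'b by auto
 have "(%n. \<integral>x. f x * phi n x \<partial>leb K') ----> (\<integral>x. f x * h x \<partial>leb K')"
 proof (rule integral_dominated_convergence)
	show "integrable (leb K') (%x. \<bar>f x\<bar>)" using fi by simp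
	show "(%x. f x * h x) : bmeas (leb K')" using borel_measurable_integrable[OF fi] borel_measurable_lebesgue_on[OF hm] by simp
	have "phi n : bmeas borel" for n using phi(1)[of n] by (auto simp: test_fun_def intro!: borel_measurable_continuous_onI smooth_on_continuous)
	then show "(%x. f x * phi n x) : bmeas (leb K')" for n by (rule borel_measurable_times[OF borel_measurable_integrable[OF fi] borel_measurable_lebesgue_on])
	show "AE x in leb K'. (%n. f x * phi n x) ----> f x * h x" unfolding AE_lebesgue_on_iff[OF K'b] using lim by eventually_elim (intro impI tendsto_mult tendsto_const)
	have "\<bar>f x\<bar> * \<bar>phi n x\<bar> <= \<bar>f x\<bar> * 1" for n x by (intro mult_left_mono phi) auto
	then show "AE x in leb K'. norm (f x * phi n x) <= \<bar>f x\<bar>" for n by (simp add: abs_mult)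
 qed
 then have 1: "(\<integral>x. f x * h x \<partial>leb K') = 0" using z by (simp add: LIMSEQ_const_iff)
 have "(\<integral>x. f x * h x \<partial>leb K') = (LINT x|leb K. f x * h x)" by (rule lebesgue_on_support(1)) (use K'b Kb h0 K'(3) in auto)
 also have "... = (LINT x|leb K. \<bar>f x\<bar>)"
 proof (rule integral_cong_AE)
	have m: "f : bmeas (leb K) ==> (%x. f x * h x) : bmeas (leb K)" using borel_measurable_lebesgue_on[OF hm] by simp
	show "(%x. f x * h x) : bmeas (leb K)" by (rule m) (rule borel_measurable_integrable[OF loc_integrableD[OF f K]])
	show "(%x. \<bar>f x\<bar>) : bmeas (leb K)" using borel_measurable_integrable[OF loc_integrableD[OF f K]] by simp
	show "AE x in leb K. f x * h x = \<bar>f x\<bar>" using f'(3) by eventually_elim (simp add: h_def sgn_real_def)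
 qed
 finally have "(LINT x|leb K. \<bar>f x\<bar>) = 0" using 1 by simp
 moreover have "integrable (leb K) (%x. \<bar>f x\<bar>)" using loc_integrableD[OF f K] by simp
 ultimately have "AE x in leb K. \<bar>f x\<bar> = 0" by (subst (asm) integral_nonneg_eq_0_iff_AE) auto
 then show "AE x in leb K. f x = 0" by simp
qed

text \<open>Truncate in size and to a compact subset of \<open>S\<close>, then mollify, with error
  \<open>eps / 2\<close> each. The density is needed for the lower semicontinuity of the energy,
  where the function to be approximated is only in L2.\<close>

lemma sqint_dense_test_fun:
 fixes f :: "'a::euclidean_space => real"
 assumes S: "open S" and f: "sqint (leb S) f" and "eps > 0"
 obtains phi where "phi : test_fun S" "sqint (leb S) phi" "l2norm (leb S) (%x. phi x - f x) < eps"
proof -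
 have Sb: "S : sets borel" "S : sets lebesgue" using S by auto
 obtain f0 where f0: "f0 : bmeas borel" "!!x. x ~: S ==> f0 x = 0"
	"AE x in leb S. f x = f0 x" by (rule borel_representative[OF Sb(1) sqint_measurable[OF f]]) blast
 have f0m: "f0 : bmeas (leb S)" by (rule lebesgue_on_borel(3)[OF Sb(2) f0(1,2)])
 have "sqint (leb S) f0" using f sqint_cong_AE[OF sqint_measurable[OF f] f0m f0(3)] by simp
 then have f0s: "sqint lborel f0" using lebesgue_on_borel(2)[OF Sb(2), of "%x. (f0 x)^2"] f0(1,2) by (simp add: sqint_def)
 obtain K where K: "!!n. compact (K n)" "!!n. K n \<subseteq> S" "(\<Union>n::nat. K n) = S" "!!n. K n \<subseteq> K (Suc n)"
	by (rule open_compact_exhaustion[OF S]) blast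
 define h where "h n x = clip n (f0 x) * ind (K n) x" for n :: nat and x
 have hm: "h n : bmeas borel" for n unfolding h_def[abs_def] using f0(1) borel_compact[OF K(1)[of n]]
	by (intro borel_measurable_times borel_measurable_indicator measurable_compose[OF _ clip_measurable]) auto
 have hle: "\<bar>h n x - f0 x\<bar> <= \<bar>f0 x\<bar>" for n x by (cases "x : K n") (auto simp: h_def abs_clip_diff)
 have "(%n. (LBINT x. (h n x - f0 x)^2)) ----> 0"
 proof (rule l2_dominated_convergence)
	show "sqint lborel (%x. \<bar>f0 x\<bar>)" using f0s by (auto simp: sqint_def)
	have "(%n. h n x) ----> f0 x" for x
	proof (cases "x : S")
	 case True
	 then obtain m where m: "x : K m" using K(3) by auto
	 have mono: "K i \<subseteq> K j" if "i <= j" for i j using lift_Suc_mono_le[of K, OF K(4) that] .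
	 show ?thesis
	 proof (rule tendsto_eventually, rule eventually_sequentiallyI)
		fix n assume n: "n >= max m (nat \<lceil>\<bar>f0 x\<bar>\<rceil>)"
		then have "\<bar>f0 x\<bar> <= n" by linarith
		moreover have "x : K n" using mono[of m n] m n by auto
		ultimately show "h n x = f0 x" by (simp add: h_def clip_eq)
	 qed
	next
	 case False
	 then show ?thesis by (simp add: h_def f0(2) clip_def)
	qed
	then show "AE x in lborel. (%n. h n x) ----> f0 x" by simp
 qed (use hm f0(1) hle in auto)
 then have "\<forall>\<^sub>F n in sequentially. (LBINT x. (h n x - f0 x)^2) < (eps / 2)^2" using \<open>eps > 0\<close> by (intro order_tendstoD(2)) auto
 then obtain n where n: "(LBINT x. (h n x - f0 x)^2) < (eps / 2)^2" by (meson eventually_sequentially order_refl)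
 have hb: "\<bar>h n x\<bar> <= real n" for x by (auto simp: h_def abs_clip indicator_def)
 have h0: "h n x = 0" if "x ~: K n" for x using that by (simp add: h_def)
 obtain phi where phi: "!!k. phi k : test_fun S" "(%k::nat. (LBINT x. (phi k x - h n x)^2)) ----> 0"
	by (rule test_approx[OF S K(1)[of n] K(2)[of n] hm hb]) (rule h0, assumption, (rule that; assumption))
 have "\<forall>\<^sub>F k in sequentially. (LBINT x. (phi k x - h n x)^2) < (eps / 2)^2" using \<open>eps > 0\<close> phi(2) by (intro order_tendstoD(2)) auto
 then obtain k where k: "(LBINT x. (phi k x - h n x)^2) < (eps / 2)^2" by (meson eventually_sequentially order_refl)
 obtain K1 where K1: "smooth_on UNIV (phi k)" "compact K1" "K1 \<subseteq> S" "!!x. x ~: K1 ==> phi k x = 0" by (rule test_funE[OF phi(1)]) blast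
 have phis: "sqint lborel (phi k)"
 proof -
	obtain r where r: "!!x. x : K1 ==> norm x <= r" using compact_imp_bounded[OF K1(2)] bounded_iff by metis
	have 0: "phi k x = 0" if "norm x > r" for x using K1(4) r that by force
	obtain C where C: "C > 0" "!!x. \<bar>phi k x\<bar> <= C" by (rule continuous_compact_support_bounded[OF smooth_on_continuous[OF K1(1)] 0])
		(assumption, (rule that; assumption))
	show ?thesis by (rule sqint_bounded_support(1)[of _ C r]) (use C 0 smooth_on_continuous[OF K1(1)] in "auto simp: indicator_def borel_measurable_continuous_onI")
 qed
 have hs: "sqint lborel (h n)"
 proof -
	have "sqint lborel (%x. (h n x - f0 x) + f0 x)"
	proof (rule sqint_add[OF _ f0s])
	 have "integrable lborel (%x. (h n x - f0 x)^2)" by (rule bochner_integrable_bound[OF sqint_integrable[OF f0s]])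
		 (use hm f0(1) hle[of n] in "auto simp: abs_le_square_iff")
	 then show "sqint lborel (%x. h n x - f0 x)" using hm f0(1) by (simp add: sqint_def)
	qed
	then show ?thesis by simp
 qed
 have "l2norm lborel (%x. (phi k x - h n x) + (h n x - f0 x)) <=
	 l2norm lborel (%x. phi k x - h n x) + l2norm lborel (%x. h n x - f0 x)" by (rule l2norm_triangle[OF sqint_diff[OF phis hs] sqint_diff[OF hs f0s]])
 also have "... < eps / 2 + eps / 2" unfolding l2norm_def using \<open>eps > 0\<close> n k by (intro add_strict_mono real_less_lsqrt) auto
 finally have lt: "l2norm lborel (%x. phi k x - f0 x) < eps" by simp
 have phim: "phi k : bmeas borel" using sqint_measurable[OF phis] by simp
 have phiS: "phi k x = 0" if "x ~: S" for x using that K1 by auto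
 have m1: "phi k : bmeas (leb S)" by (rule lebesgue_on_borel(3)[OF Sb(2) phim phiS])
 show ?thesis
 proof (rule that[OF phi(1)[of k]])
	show "sqint (leb S) (phi k)" using phis m1 lebesgue_on_borel(2)[OF Sb(2), of "%x. (phi k x)^2"] phim phiS by (simp add: sqint_def)
	have "l2norm (leb S) (%x. phi k x - f x) = l2norm (leb S) (%x. phi k x - f0 x)" by (rule l2norm_cong_AE) (use m1 f0m f0(3) sqint_measurable[OF f] in auto)
	also have "... = l2norm lborel (%x. phi k x - f0 x)" unfolding l2norm_def by (subst lebesgue_on_borel(1)[OF Sb(2)]) (use phim f0 phiS in auto)
	finally show "l2norm (leb S) (%x. phi k x - f x) < eps" using lt by simp
 qed
qed

subsection \<open>Calculus of weak derivatives\<close>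

lemma weak_deriv_unique:
 assumes "open Om" "hwd Om b w g1" "hwd Om b w g2"
 shows "AE x in leb Om. g1 x = g2 x"
proof -
 have l: "loc_integrable Om g1" "loc_integrable Om g2" using assms by (auto simp: has_weak_deriv_def)
 have "AE x in leb Om. g1 x + (-1) * g2 x = 0"
 proof (rule fundamental_lemma[OF assms(1)])
	show "loc_integrable Om (%x. g1 x + (-1) * g2 x)" by (intro loc_integrable_add loc_integrable_scale l)
	fix phi assume phi: "phi : test_fun Om"
	have "(LINT x|leb Om. g1 x * phi x) = (LINT x|leb Om. g2 x * phi x)" using assms(2,3) phi unfolding has_weak_deriv_def by (metis neg_equal_iff_equal)
	then show "(LINT x|leb Om. (g1 x + (-1) * g2 x) * phi x) = 0" using test_fun_integrable(1)[OF assms(1) l(1) phi] test_fun_integrable(1)[OF assms(1) l(2) phi]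
	 by (simp add: left_diff_distrib)
 qed
 then show ?thesis by simp
qed

lemma has_weak_deriv_add:
 assumes "open Om" "b : Basis" "hwd Om b w g" "hwd Om b w' g'"
 shows "hwd Om b (%x. w x + w' x) (%x. g x + g' x)"
proof -
 have l: "loc_integrable Om w" "loc_integrable Om w'" "loc_integrable Om g" "loc_integrable Om g'" using assms by (auto simp: has_weak_deriv_def)
 have "(LINT x|leb Om. (w x + w' x) * fd phi (at x) b) =
	 - (LINT x|leb Om. (g x + g' x) * phi x)" if phi: "phi : test_fun Om" for phi
	using test_fun_integrable[OF assms(1) l(1) phi] test_fun_integrable[OF assms(1) l(2) phi]
	 test_fun_integrable[OF assms(1) l(3) phi] test_fun_integrable[OF assms(1) l(4) phi] assms(2-4) phi by (simp add: distrib_right has_weak_deriv_def)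
 then show ?thesis using l by (simp add: has_weak_deriv_def loc_integrable_add)
qed

lemma has_weak_deriv_scale:
 assumes "hwd Om b w g"
 shows "hwd Om b (%x. c * w x) (%x. c * g x)" using assms by (auto simp: has_weak_deriv_def loc_integrable_scale mult.assoc)

lemma has_weak_deriv_diff:
 assumes "open Om" "b : Basis" "hwd Om b w g" "hwd Om b w' g'"
 shows "hwd Om b (%x. w x - w' x) (%x. g x - g' x)" using has_weak_deriv_add[OF assms(1-3) has_weak_deriv_scale[OF assms(4), of "-1"]] by simp

lemma loc_integrable_cong_AE:
 assumes "open Om" "w : bmeas (leb Om)" "AE x in leb Om. w x = w' x"
	"loc_integrable Om w'"
 shows "loc_integrable Om w" unfolding loc_integrable_def
proof (intro allI impI, elim conjE)
 fix K assume K: "compact K" "K \<subseteq> Om"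
 have i: "integrable (leb K) w'" by (rule loc_integrableD[OF assms(4) K])
 have "w : bmeas (leb K)" using measurable_restrict_mono[OF assms(2) K(2)] .
 moreover have "AE x in leb K. w' x = w x" using assms(1,3) K unfolding AE_lebesgue_on_iff[OF compact_sets_lebesgue[OF K(1)]]
	by (subst (asm) AE_lebesgue_on_iff) (auto elim!: eventually_mono)
 ultimately show "integrable (leb K) w" using integrable_cong_AE_imp[OF i] by blast
qed

lemma has_weak_deriv_cong_AE:
 assumes "open Om" "w : bmeas (leb Om)" "w' : bmeas (leb Om)"
	"AE x in leb Om. w x = w' x" and b: "b : Basis"
 shows "hwd Om b w g \<longleftrightarrow> hwd Om b w' g"
proof -
 have ae': "AE x in leb Om. w' x = w x" using assms(4) by eventually_elim simp
 have "loc_integrable Om w \<longleftrightarrow> loc_integrable Om w'"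
	using loc_integrable_cong_AE[OF assms(1,2,4)] loc_integrable_cong_AE[OF assms(1,3) ae'] by blast
 moreover have "(LINT x|leb Om. w x * fd phi (at x) b) =
	 (LINT x|leb Om. w' x * fd phi (at x) b)" if phi: "phi : test_fun Om" for phi
 proof (rule integral_cong_AE)
	have "smooth_on UNIV phi" using phi by (simp add: test_fun_def)
	then have "(%x. fd phi (at x) b) : bmeas (leb Om)" by (intro measurable_restrict_space1 measurable_completion)
		(auto intro!: borel_measurable_continuous_onI smooth_on_continuous smooth_on_frechet_derivative b)
	then show "(%x. w x * fd phi (at x) b) : bmeas (leb Om)"
	 "(%x. w' x * fd phi (at x) b) : bmeas (leb Om)" using assms(2,3) by auto
	show "AE x in leb Om. w x * fd phi (at x) b = w' x * fd phi (at x) b" using assms(4) by eventually_elim simp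
 qed
 ultimately show ?thesis by (simp add: has_weak_deriv_def)
qed

lemma has_weak_deriv_cong_deriv_AE:
 assumes "open Om" "hwd Om b w g" "g' : bmeas (leb Om)"
	"AE x in leb Om. g' x = g x"
 shows "hwd Om b w g'"
proof -
 have l: "loc_integrable Om g" using assms(2) by (simp add: has_weak_deriv_def)
 have "(LINT x|leb Om. g' x * phi x) = (LINT x|leb Om. g x * phi x)" if phi: "phi : test_fun Om" for phi
 proof (rule integral_cong_AE)
	have "smooth_on UNIV phi" using phi by (simp add: test_fun_def)
	then have "phi : bmeas (leb Om)" by (intro measurable_restrict_space1 measurable_completion) (auto intro!: borel_measurable_continuous_onI smooth_on_continuous)
	then show "(%x. g' x * phi x) : bmeas (leb Om)"
	 "(%x. g x * phi x) : bmeas (leb Om)" using assms(3) loc_integrable_measurable[OF assms(1) l] by auto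
	show "AE x in leb Om. g' x * phi x = g x * phi x" using assms(4) by eventually_elim simp
 qed
 moreover have "loc_integrable Om g'" by (rule loc_integrable_cong_AE[OF assms(1,3,4) l])
 ultimately show ?thesis using assms(2) by (simp add: has_weak_deriv_def)
qed

lemma wderiv_weak_deriv:
 assumes "hwd Om b w g"
 shows "hwd Om b w (wderiv Om b w)" unfolding wderiv_def using someI[of "hwd Om b w", OF assms] .

lemma wderiv_AE:
 assumes "open Om" "hwd Om b w g"
 shows "AE x in leb Om. wderiv Om b w x = g x" by (rule weak_deriv_unique[OF assms(1) wderiv_weak_deriv[OF assms(2)] assms(2)])

lemma wderiv_measurable:
 assumes "open Om" "hwd Om b w g"
 shows "wderiv Om b w : bmeas (leb Om)" using wderiv_weak_deriv[OF assms(2)] loc_integrable_measurable[OF assms(1)] by (auto simp: has_weak_deriv_def)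

lemma H1_sqint:
 assumes "open Om" "w : H1 Om" "b : Basis"
 shows "sqint (leb Om) w" "sqint (leb Om) (wderiv Om b w)"
	"hwd Om b w (wderiv Om b w)"
proof -
 obtain g where g: "sqint (leb Om) g" "hwd Om b w g" using assms(2,3) by (auto simp: H1_def L2_eq_sqint)
 show "sqint (leb Om) w" using assms(2) by (simp add: H1_def L2_eq_sqint)
 show "hwd Om b w (wderiv Om b w)" by (rule wderiv_weak_deriv[OF g(2)])
 show "sqint (leb Om) (wderiv Om b w)" using sqint_cong_AE[OF wderiv_measurable[OF assms(1) g(2)] sqint_measurable[OF g(1)] wderiv_AE[OF assms(1) g(2)]] g(1) by simp
qed

lemma H2_sqint:
 assumes "open Om" "w : H2 Om"
 shows "w : H1 Om" "b : Basis ==> wderiv Om b w : H1 Om" "sqint (leb Om) (lap Om w)"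
proof -
 show "w : H1 Om" and d: "b : Basis ==> wderiv Om b w : H1 Om" for b using assms(2) by (simp_all add: H2_def)
 then show "sqint (leb Om) (lap Om w)" unfolding wlaplacian_def[abs_def] by (intro sqint_sum H1_sqint(2)[OF assms(1)])
qed

text \<open>By translation invariance a difference quotient of \<open>K\<close> has integral zero.
  It is uniformly within \<open>eps / (V + 1)\<close> of the derivative and both vanish outside a
  ball of volume \<open>V\<close>, so the integral of the derivative is at most
  \<open>eps\<close>.\<close>

lemma integral_derivative_compact_support:
 fixes K :: "'a::euclidean_space => real"
 assumes K: "smooth_on UNIV K" and supp: "!!x. norm x > r ==> K x = 0" and b: "b : Basis"
 shows "(LBINT x. fd K (at x) b) = 0"
proof -
 define D where "D x = fd K (at x) b" for x
 \<comment> \<open>Steps t of length at most 1 keep the support of the translated function in this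
   ball.\<close>
 define R where "R = abs r + 1"
 have D0: "D x = 0" if "norm x > r" for x unfolding D_def by (rule frechet_derivative_support[OF supp that])
 have Kc: "continuous_on UNIV K" by (rule smooth_on_continuous[OF K])
 have Dc: "continuous_on UNIV D" unfolding D_def[abs_def] by (rule smooth_on_continuous[OF smooth_on_frechet_derivative[OF open_UNIV K b]])
 have int: "integrable lborel f" if fc: "continuous_on UNIV f" and f0: "!!x. norm x > r ==> f x = 0" for f :: "'a => real"
 proof -
	obtain C where C: "C > 0" "!!x. \<bar>f x\<bar> <= C" by (rule continuous_compact_support_bounded[OF fc f0]) (assumption, (rule that; assumption))
	show ?thesis by (rule sqint_bounded_support(2)[of _ C r]) (use C fc f0 in "auto simp: indicator_def borel_measurable_continuous_onI")
 qed
 have Ki: "integrable lborel K" and Di: "integrable lborel D" by (rule int[OF Kc supp] int[OF Dc D0]; assumption)+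
 have Km: "K : bmeas borel" using Kc by (rule borel_measurable_continuous_onI)
 define V where "V = measure lborel (cball (0::'a) R)"
 have V: "V >= 0" by (simp add: V_def)
 have fin: "emeasure lborel (cball (0::'a) R) < top" using emeasure_lborel_cball_finite[of "0::'a" R] by (simp add: top.not_eq_extremum)
 have "\<bar>\<integral>x. D x \<partial>lborel\<bar> <= eps" if "eps > 0" for eps
 proof -
	have e: "eps / (V + 1) > 0" using that V by simp
	obtain delta where delta: "delta > 0"
	 "!!z h. norm h < delta ==> \<bar>K (z + h) - K z - fd K (at z) h\<bar> <= eps / (V + 1) * norm h"
	 by (rule uniform_linearization[OF K supp e]) (assumption, (rule that; assumption))
	define t where "t = min (delta / 2) 1"
	have t: "t > 0" "t < delta" "t <= 1" using delta(1) by (auto simp: t_def)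
	have nb: "norm (t *\<^sub>R b) = t" using t b by simp
	have Ks: "integrable lborel (%x. K (x + t *\<^sub>R b))" "(LBINT x. K (x + t *\<^sub>R b)) = integral\<^sup>L lborel K" using integral_lborel_shift[OF Km] Ki by auto
	have fr: "fd K (at x) (t *\<^sub>R b) = t * D x" for x unfolding D_def
	 using linear_scale[OF has_derivative_linear[OF smooth_on_has_derivative[OF open_UNIV K, of x]], of t b] by simp
	have "t * (LBINT x. D x) = - (LBINT x. K (x + t *\<^sub>R b) - K x - t * D x)" using Ks Ki Di by simp
	then have "\<bar>t * (LBINT x. D x)\<bar> = norm (LBINT x. K (x + t *\<^sub>R b) - K x - t * D x)" by simp
	also have "... <= (LBINT x. eps / (V + 1) * t * ind (cball (0::'a) R) x)"
	proof (rule bochner_integral_norm_bound_integral)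
	 show "integrable lborel (%x. K (x + t *\<^sub>R b) - K x - t * D x)" using Ks Ki Di by simp
	 show "integrable lborel (%x::'a. eps / (V + 1) * t * ind (cball 0 R) x)" by (intro integrable_mult_right integrable_real_indicator) (use fin in auto)
	 fix x :: 'a
	 show "norm (K (x + t *\<^sub>R b) - K x - t * D x) <= eps / (V + 1) * t * ind (cball 0 R) x"
	 proof (cases "norm x <= R")
		case True
		then show ?thesis using delta(2)[of "t *\<^sub>R b" x] nb t fr by simp
	 next
		case False
		have "norm x <= norm (x + t *\<^sub>R b) + t" using norm_triangle_ineq4[of "x + t *\<^sub>R b" "t *\<^sub>R b"] nb by simp
		then have "norm x > r" "norm (x + t *\<^sub>R b) > r" using False t by (auto simp: R_def)
		then show ?thesis using supp D0 by (simp add: False)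
	 qed
	qed
	also have "... = t * (eps * (V / (V + 1)))" by (simp add: V_def)
	also have "... <= t * (eps * 1)" using V t that by (intro mult_left_mono) auto
	finally show ?thesis using t by (simp add: abs_mult)
 qed
 then have "\<bar>\<integral>x. D x \<partial>lborel\<bar> <= 0" by (rule field_le_epsilon[of _ 0, simplified])
 then show ?thesis by (simp add: D_def)
qed


lemma frechet_derivative_mult:
 fixes f g :: "'a::euclidean_space => real"
 assumes "open S" "smooth_on S f" "smooth_on S g" "x : S"
 shows "fd (%x. f x * g x) (at x) b =
	f x * fd g (at x) b + fd f (at x) b * g x" using fun_cong[OF frechet_derivative_at[OF has_derivative_mult[OF smooth_on_has_derivative[OF assms(1,2,4)]
		smooth_on_has_derivative[OF assms(1,3,4)]], symmetric], of b] .

lemma loc_integrable_continuous: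
 fixes h :: "'a::euclidean_space => real"
 assumes "continuous_on UNIV h"
 shows "loc_integrable Om h"
proof -
 have "loc_integrable Om (%x::'a. 1)" unfolding loc_integrable_def
 proof (intro allI impI)
	fix K :: "'a set" assume K: "compact K & K \<subseteq> Om"
	interpret finite_measure "leb K" using K by (intro finite_measure_lebesgue_on lmeasurable_compact) simp
	show "integrable (leb K) (%x. 1::real)" by simp
 qed
 from loc_integrable_mult_continuous[OF this assms] show ?thesis by simp
qed

text \<open>The product of \<open>u\<close> with a test function is smooth with compact support, so
  its derivative integrates to zero; the product rule then splits this integral.\<close>

lemma smooth_has_weak_deriv:
 fixes u :: "'a::euclidean_space => real"
 assumes Om: "open Om" and u: "smooth_on UNIV u" and b: "b : Basis"
 shows "hwd Om b u (%x. fd u (at x) b)"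
proof -
 have l: "loc_integrable Om u" "loc_integrable Om (%x. fd u (at x) b)"
	by (intro loc_integrable_continuous smooth_on_continuous u smooth_on_frechet_derivative b open_UNIV)+
 have "(LINT x|leb Om. u x * fd phi (at x) b) =
	 - (LINT x|leb Om. fd u (at x) b * phi x)" if phi: "phi : test_fun Om" for phi
 proof -
	obtain K where K: "smooth_on UNIV phi" "compact K" "K \<subseteq> Om" "!!x. x ~: K ==> phi x = 0" by (rule test_funE[OF phi]) blast
	obtain r where r: "!!x. x : K ==> norm x <= r" using compact_imp_bounded[OF K(2)] bounded_iff by metis
	have s: "smooth_on UNIV (%x. u x * phi x)" by (intro smooth_on_mult u K open_UNIV)
	have z: "u x * phi x = 0" if "x ~: K" for x using K(4)[OF that] by simp
	have "(LINT x|leb Om. u x * fd phi (at x) b + fd u (at x) b * phi x) =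
		(LINT x|leb Om. fd (%x. u x * phi x) (at x) b)" by (simp add: frechet_derivative_mult[OF open_UNIV u K(1) UNIV_I])
	also have "... = (LBINT x. fd (%x. u x * phi x) (at x) b)"
	proof (rule lebesgue_on_borel(1))
	 show "(%x. fd (%x. u x * phi x) (at x) b) : bmeas borel" by (intro borel_measurable_continuous_onI smooth_on_continuous smooth_on_frechet_derivative s b open_UNIV)
	 show "fd (%x. u x * phi x) (at x) b = 0" if "x ~: Om" for x by (rule frechet_derivative_zero_outside[of K]) (use K that z compact_imp_closed in auto)
	qed (use Om in simp)
	also have "... = 0"
	proof (rule integral_derivative_compact_support[OF s _ b])
	 show "u x * phi x = 0" if "norm x > r" for x using z r that by force
	qed
	finally show ?thesis using test_fun_integrable(2)[OF Om l(1) phi b] test_fun_integrable(1)[OF Om l(2) phi] by simp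
 qed
 then show ?thesis using l by (simp add: has_weak_deriv_def)
qed

lemma has_weak_deriv_mult_smooth:
 fixes w :: "'a::euclidean_space => real"
 assumes Om: "open Om" and h: "smooth_on UNIV h" and b: "b : Basis" and w: "hwd Om b w g"
 shows "hwd Om b (%x. h x * w x) (%x. h x * g x + fd h (at x) b * w x)"
proof -
 have l: "loc_integrable Om w" "loc_integrable Om g" using w by (auto simp: has_weak_deriv_def)
 have hc: "continuous_on UNIV h" "continuous_on UNIV (%x. fd h (at x) b)" by (intro smooth_on_continuous h smooth_on_frechet_derivative b open_UNIV)+
 have l': "loc_integrable Om (%x. h x * w x)" "loc_integrable Om (%x. h x * g x)"
	"loc_integrable Om (%x. fd h (at x) b * w x)" by (intro loc_integrable_mult_continuous l hc)+
 have "(LINT x|leb Om. h x * w x * fd phi (at x) b) =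
	 - (LINT x|leb Om. (h x * g x + fd h (at x) b * w x) * phi x)"
	if phi: "phi : test_fun Om" for phi
 proof -
	have s: "smooth_on UNIV phi" using phi by (simp add: test_fun_def)
	have t: "(%x. h x * phi x) : test_fun Om" by (rule test_fun_mult[OF phi h])
	have eq: "fd (%x. h x * phi x) (at x) b =
		h x * fd phi (at x) b + fd h (at x) b * phi x" for x by (rule frechet_derivative_mult[OF open_UNIV h s UNIV_I])
	note i1 = test_fun_integrable(2)[OF Om l'(1) phi b]
	note i2 = test_fun_integrable(1)[OF Om l'(3) phi]
	note i3 = test_fun_integrable(1)[OF Om l'(2) phi]
	have "(LINT x|leb Om. w x * fd (%x. h x * phi x) (at x) b) =
		- (LINT x|leb Om. g x * (h x * phi x))" using w t by (simp add: has_weak_deriv_def)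
	moreover have "(LINT x|leb Om. w x * fd (%x. h x * phi x) (at x) b) =
		(LINT x|leb Om. h x * w x * fd phi (at x) b) +
		(LINT x|leb Om. fd h (at x) b * w x * phi x)" unfolding eq bochner_integral_add[OF i1 i2, symmetric] by (intro bochner_integral_cong) (simp_all add: algebra_simps)
	moreover have "(LINT x|leb Om. (h x * g x + fd h (at x) b * w x) * phi x) =
		(LINT x|leb Om. h x * g x * phi x) + (LINT x|leb Om. fd h (at x) b * w x * phi x)" unfolding distrib_right by (rule bochner_integral_add[OF i3 i2])
	moreover have "(LINT x|leb Om. g x * (h x * phi x)) = (LINT x|leb Om. h x * g x * phi x)" by (simp add: mult_ac)
	ultimately show ?thesis by simp
 qed
 then show ?thesis using l' by (simp add: has_weak_deriv_def loc_integrable_add)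
qed

text \<open>Near \<open>K0\<close> the reflected kernel z -> moll n (x - z) is itself a test
  function on \<open>Om\<close>, so the definition of the weak derivative moves the derivative from
  the kernel to \<open>w\<close>. At points far from \<open>K0\<close> both sides vanish.\<close>

lemma conv_moll_weak_deriv:
 fixes w g :: "'a::euclidean_space => real"
 assumes Om: "open Om" and b: "b : Basis" and wd: "hwd Om b w g"
	and K0: "compact K0" "K0 \<subseteq> Om" "!!x. x ~: K0 ==> w x = 0" "!!x. x ~: K0 ==> g x = 0"
	and m: "w : bmeas borel" "g : bmeas borel" and w: "integrable lborel w"
 obtains N where "!!n x. n >= N ==> fd (conv (moll n) w) (at x) b = conv (moll n) g x"
	"!!n. n >= N ==> conv (moll n) w : test_fun Om"
proof -
 obtain K' delta where K': "compact K'" "K' \<subseteq> Om" "delta > 0" "!!x y. x ~: K' ==> y : K0 ==> norm (x - y) >= delta"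
	by (rule compact_neighbourhood[OF K0(1) Om K0(2)]) blast
 \<comment> \<open>Two kernel radii must fit into \<open>delta\<close>: one from \<open>K0\<close>
   to x, one from x to the edge of the kernel.\<close>
 obtain N where N: "1 / real (Suc N) < delta / 2" using K'(3) nat_approx_posE[of "delta / 2"] by auto
 show ?thesis
 proof (rule that[of N])
	fix n assume n: "n >= N"
	define r where "r = 1 / real (Suc n)"
	have "r <= 1 / real (Suc N)" unfolding r_def using n by (intro divide_left_mono) auto
	then have r: "2 * r <= delta" "r > 0" using N by (auto simp: r_def)
	have M: "smooth_on UNIV (moll n :: 'a => real)" by (rule moll_smooth)
	have M0: "moll n z = 0" if "norm z >= r" for z :: 'a using moll_eq_0 that by (simp add: r_def)
	show "conv (moll n) w : test_fun Om"
	proof (rule test_fun_conv_moll(1)[OF K'(1,2,4) K0(3) w])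
	 show "1 / real (Suc n) <= delta" using r unfolding r_def by linarith
	qed auto
	fix x
	have "fd (conv (moll n) w) (at x) b = conv (%z. fd (moll n) (at z) b) w x" by (rule conv_frechet_derivative[OF M _ w b, of r]) (use M0 in auto)
	also have "... = conv (moll n) g x"
	proof (cases "EX y:K0. norm (x - y) <= r")
	 case True
	 then obtain y where y: "y : K0" "norm (x - y) <= r" by blast
	 define psi where "psi z = moll n (x + - z)" for z
	 have bl: "bounded_linear (uminus :: 'a => 'a)" by (rule bounded_linear_minus[OF bounded_linear_ident])
	 have psis: "smooth_on UNIV psi" unfolding psi_def[abs_def] by (rule smooth_on_compose_affine[OF open_UNIV open_UNIV bl M UNIV_I])
	 have "psi z = 0" if "z ~: K'" for z
	 proof -
		have "delta <= norm (z - y)" by (rule K'(4)[OF that y(1)])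
		also have "... <= norm (x - z) + norm (x - y)" using norm_triangle_ineq4[of "x - y" "x - z"] by simp
		finally show ?thesis using y r M0 by (simp add: psi_def)
	 qed
	 then have psi: "psi : test_fun Om" using psis K'(1,2) by (auto simp: test_fun_def)
	 \<comment> \<open>The sign from the reflection cancels the sign in the definition of the weak
	   derivative.\<close>
	 have der: "fd psi (at z) b = - fd (moll n) (at (x - z)) b" for z
	 proof -
		have 1: "((%z. x + - z) has_derivative uminus) (at z)" by (auto intro!: derivative_eq_intros)
		have 2: "(moll n has_derivative fd (moll n) (at (x + - z))) (at (x + - z))" by (rule smooth_on_has_derivative[OF open_UNIV M UNIV_I])
		have "(psi has_derivative (%h. fd (moll n) (at (x + - z)) (- h))) (at z)" unfolding psi_def[abs_def] by (rule has_derivative_compose[OF 1 2])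
		from frechet_derivative_at[OF this] show ?thesis using linear_neg[OF has_derivative_linear[OF 2], of b] by (metis diff_conv_add_uminus)
	 qed
	 have Dm: "(%z. fd (moll n) (at (x - z)) b) : bmeas borel" by (intro measurable_compose[of "%z. x - z" borel borel "%z. fd (moll n) (at z) b"]
			borel_measurable_continuous_onI smooth_on_continuous smooth_on_frechet_derivative M b open_UNIV
			continuous_intros)
	 have psim: "psi : bmeas borel" by (intro borel_measurable_continuous_onI smooth_on_continuous psis)
	 have "(LINT z|leb Om. w z * fd psi (at z) b) = - (LINT z|leb Om. g z * psi z)" using wd psi by (simp add: has_weak_deriv_def)
	 moreover have "(LINT z|leb Om. w z * fd psi (at z) b) =
		 (LBINT z. w z * fd psi (at z) b)" by (rule lebesgue_on_borel(1)) (use Om m Dm K0 in "auto simp: der")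
	 moreover have "(LINT z|leb Om. g z * psi z) = (LBINT z. g z * psi z)" by (rule lebesgue_on_borel(1)) (use Om m psim K0 in auto)
	 ultimately show ?thesis by (simp add: conv_def der psi_def mult.commute)
	next
	 case False
	 have "fd (moll n) (at (x - y)) b * w y = 0" for y using False K0(3)[of y] frechet_derivative_support[of r "moll n" "x - y" b] M0 by (cases "y : K0") auto
	 moreover have "moll n (x - y) * g y = 0" for y using False K0(4)[of y] M0[of "x - y"] by (cases "y : K0") auto
	 ultimately show ?thesis unfolding conv_def by presburger
	qed
	finally show "fd (conv (moll n) w) (at x) b = conv (moll n) g x" .
 qed
qed

text \<open>Compact support of \<open>w\<close> makes boundary terms impossible: the mollifications
  of \<open>w\<close> are eventually test functions, to which the definition of the weak derivative
  of \<open>z\<close> applies, and they converge in L2 together with their derivatives.\<close>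

lemma weak_integration_by_parts:
 fixes z w :: "'a::euclidean_space => real"
 assumes Om: "open Om" and b: "b : Basis"
	and z: "hwd Om b z gz" "sqint (leb Om) z" "sqint (leb Om) gz"
	and w: "hwd Om b w gw" "sqint (leb Om) w" "sqint (leb Om) gw"
	and K0: "compact K0" "K0 \<subseteq> Om" "!!x. x : Om ==> x ~: K0 ==> w x = 0"
	 "!!x. x : Om ==> x ~: K0 ==> gw x = 0"
 shows "(LINT x|leb Om. z x * gw x) = - (LINT x|leb Om. gz x * w x)"
proof -
 let ?M = "leb Om"
 have Omb: "Om : sets borel" "Om : sets lebesgue" using Om by auto
 \<comment> \<open>Convolution integrates over the whole space, so \<open>w\<close> and
   \<open>gw\<close> are replaced by Borel versions that vanish outside \<open>K0\<close>.\<close>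
 have rep: "EX f'. f' : bmeas borel & (ALL x. x ~: K0 --> f' x = 0) & (AE x in ?M. f' x = f x) &
	 f' : bmeas ?M & sqint lborel f' & integrable lborel f'"
	if f: "sqint ?M f" "!!x. x : Om ==> x ~: K0 ==> f x = 0" for f
 proof -
	obtain f0 where f0: "f0 : bmeas borel" "!!x. x ~: Om ==> f0 x = 0" "AE x in ?M. f x = f0 x" by (rule borel_representative[OF Omb(1) sqint_measurable[OF f(1)]]) blast
	define f' where "f' x = ind K0 x * f0 x" for x
	have f'm: "f' : bmeas borel" unfolding f'_def[abs_def] using borel_compact[OF K0(1)] f0(1) by (intro borel_measurable_times) auto
	have f'0: "f' x = 0" if "x ~: K0" for x using that by (simp add: f'_def)
	have f'Om: "f' x = 0" if "x ~: Om" for x using that by (simp add: f'_def f0(2))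
	have ae: "AE x in ?M. f' x = f x" using f0(3) AE_space by eventually_elim (use f(2) in "auto simp: f'_def indicator_def")
	have mM: "f' : bmeas ?M" by (rule lebesgue_on_borel(3)[OF Omb(2) f'm f'Om])
	have sM: "sqint ?M f'" using sqint_cong_AE[OF mM sqint_measurable[OF f(1)] ae] f(1) by simp
	have "sqint (leb K0) f'" by (rule sqint_subset[OF Omb(2) compact_sets_lebesgue[OF K0(1)] K0(2) sM])
	then have "integrable (leb K0) f'" by (intro sqint_bounded_imp_integrable compact_sets_lebesgue compact_imp_bounded K0)
	then have i: "integrable lborel f'" using lebesgue_on_borel(2)[OF compact_sets_lebesgue[OF K0(1)] f'm f'0] by simp
	have "sqint lborel f'" using sM lebesgue_on_borel(2)[OF Omb(2), of "%x. (f' x)^2"] f'm f'Om by (simp add: sqint_def)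
	then show ?thesis using f'm f'0 ae mM i by blast
 qed
 obtain w' where w': "w' : bmeas borel" "!!x. x ~: K0 ==> w' x = 0" "AE x in ?M. w' x = w x"
	"w' : bmeas ?M" "sqint lborel w'" "integrable lborel w'" using rep[OF w(2) K0(3)] by blast
 obtain g' where g': "g' : bmeas borel" "!!x. x ~: K0 ==> g' x = 0" "AE x in ?M. g' x = gw x"
	"g' : bmeas ?M" "sqint lborel g'" "integrable lborel g'" using rep[OF w(3) K0(4)] by blast
 have "hwd Om b w' gw" using has_weak_deriv_cong_AE[OF Om w'(4) sqint_measurable[OF w(2)] w'(3) b] w(1) by simp
 then have wd: "hwd Om b w' g'" by (rule has_weak_deriv_cong_deriv_AE[OF Om _ g'(4,3)])
 obtain N where N: "!!n x. n >= N ==> fd (conv (moll n) w') (at x) b = conv (moll n) g' x"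
	"!!n. n >= N ==> conv (moll n) w' : test_fun Om" by (rule conv_moll_weak_deriv[OF Om b wd K0(1,2) w'(2) g'(2) w'(1) g'(1) w'(6)])
	 (assumption, assumption, (rule that; assumption))
 have conv: "(%n. (LINT x|?M. conv (moll n) f' x * y x)) ----> (LINT x|?M. f' x * y x)"
	if f': "f' : bmeas borel" "sqint lborel f'" "integrable lborel f'" and y: "sqint ?M y" for f' y
 proof (rule l2_inner_tendsto[OF _ _ y])
	have sub: "sqint ?M h" if "sqint lborel h" for h
	proof -
	 have "sqint lebesgue h" unfolding sqint_def
	 proof
		have m: "(%x. (h x)^2) : bmeas lborel" "h : bmeas lborel" using sqint_measurable[OF that] by simp_all
		show "h : bmeas lebesgue" by (rule measurable_completion[OF m(2)])
		show "integrable lebesgue (%x. (h x)^2)" unfolding integrable_completion[OF m(1)] by (rule sqint_integrable[OF that])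
	 qed
	 then show ?thesis using sqint_subset[of UNIV Om h] Omb by (simp add: lebesgue_on_UNIV_eq)
	qed
	show "sqint ?M (conv (moll n) f')" for n by (intro sub sqint_conv_moll f')
	show "sqint ?M f'" by (intro sub f')
	have le: "l2norm ?M (%x. conv (moll n) f' x - f' x) <= sqrt (LBINT x. (conv (moll n) f' x - f' x)^2)" for n
	proof -
	 have m: "(%x. (conv (moll n) f' x - f' x)^2) : bmeas lborel" using conv_moll_measurable[OF f'(3), of n] f'(1) by simp
	 have i: "integrable lebesgue (%x. (conv (moll n) f' x - f' x)^2)" using sqint_integrable[OF sqint_diff[OF sqint_conv_moll[OF f'(2,3)] f'(2)], of n]
		 integrable_completion[OF m] by simp
	 have "(LINT x|?M. (conv (moll n) f' x - f' x)^2) <= (LINT x|lebesgue. (conv (moll n) f' x - f' x)^2)" unfolding lebesgue_on_indicator(1)[OF Omb(2)]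
		by (rule integral_mono[OF _ i]) (use integrable_mult_indicator[OF Omb(2) i] in "auto simp: indicator_def")
	 then show ?thesis using integral_completion[OF m] by (simp add: l2norm_def)
	qed
	show "(%n. l2norm ?M (%x. conv (moll n) f' x - f' x)) ----> 0"
	proof (rule tendsto_sandwich[OF _ _ tendsto_const])
	 show "(%n. sqrt (LBINT x. (conv (moll n) f' x - f' x)^2)) ----> 0" using tendsto_real_sqrt[OF conv_moll_tendsto[OF f'(2,3)]] by simp
	qed (use le in "auto simp: l2norm_nonneg")
 qed
 have "(%n. (LINT x|?M. conv (moll n) g' x * z x)) ----> - (LINT x|?M. w' x * gz x)"
 proof (rule Lim_transform_eventually[OF tendsto_minus[OF conv[OF w'(1,5,6) z(3)]]])
	show "\<forall>\<^sub>F n in sequentially. - (LINT x|?M. conv (moll n) w' x * gz x) = (LINT x|?M. conv (moll n) g' x * z x)"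
	proof (rule eventually_sequentiallyI)
	 fix n assume n: "n >= N"
	 have "(LINT x|?M. z x * fd (conv (moll n) w') (at x) b) = - (LINT x|?M. gz x * conv (moll n) w' x)" using z(1) N(2)[OF n] unfolding has_weak_deriv_def by blast
	 then show "- (LINT x|?M. conv (moll n) w' x * gz x) = (LINT x|?M. conv (moll n) g' x * z x)" by (simp add: N(1)[OF n] mult.commute)
	qed
 qed
 then have "(LINT x|?M. g' x * z x) = - (LINT x|?M. w' x * gz x)" using LIMSEQ_unique[OF conv[OF g'(1,5,6) z(2)]] by blast
 moreover have "(LINT x|?M. g' x * z x) = (LINT x|?M. z x * gw x)"
 proof (rule integral_cong_AE)
	show "AE x in ?M. g' x * z x = z x * gw x" using g'(3) by eventually_elim simp
 qed (use g'(4) sqint_measurable[OF z(2)] sqint_measurable[OF w(3)] in auto)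
 moreover have "(LINT x|?M. w' x * gz x) = (LINT x|?M. gz x * w x)"
 proof (rule integral_cong_AE)
	show "AE x in ?M. w' x * gz x = gz x * w x" using w'(3) by eventually_elim simp
 qed (use w'(4) sqint_measurable[OF z(3)] sqint_measurable[OF w(2)] in auto)
 ultimately show ?thesis by simp
qed

section \<open>Hausdorff measure is a Borel measure\<close>

lemma outer_measure_subadditive2:
 assumes "outer_measure_space (Pow UNIV) h"
 shows "h (A \<union> B) <= h A + h B"
proof -
 have "subadditive (Pow UNIV) h" by (rule ring_of_sets.countably_subadditive_subadditive[OF ring_of_sets_Pow]) (use assms in "simp_all add: outer_measure_space_def")
 moreover have "h (A \<union> B) = h (A \<union> (B - A))" by simp
 ultimately have "h (A \<union> B) <= h A + h (B - A)" unfolding subadditive_def by (metis Diff_disjoint Pow_UNIV UNIV_I)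
 also have "h (B - A) <= h B" using assms by (auto simp: outer_measure_space_def increasing_def)
 finally show ?thesis by (simp add: add_left_mono)
qed

text \<open>\<open>countably_subadditive\<close> speaks of disjoint families only;
  \<open>disjointed A\<close> has the same union, and monotonicity leads back to
  \<open>A\<close>.\<close>

lemma outer_measure_countable_subadditive:
 assumes "outer_measure_space (Pow UNIV) h"
 shows "h (\<Union>i::nat. A i) <= (\<Sum>i. h (A i))"
proof -
 have "h (\<Union>i. disjointed A i) <= (\<Sum>i. h (disjointed A i))" using assms disjoint_family_disjointed[of A]
	by (auto simp: outer_measure_space_def countably_subadditive_def)
 also have "... <= (\<Sum>i. h (A i))" using assms disjointed_subset[of A] by (intro suminf_le summableI) (auto simp: outer_measure_space_def increasing_def)
 finally show ?thesis by (simp add: UN_disjointed_eq)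
qed

lemma outer_measure_mono:
 assumes "outer_measure_space (Pow UNIV) h" "A \<subseteq> B"
 shows "h A <= h B" using assms by (auto simp: outer_measure_space_def increasing_def)

text \<open>Caratheodory's criterion: if separated sets add up, then the part of \<open>A\<close> outside a closed set
  \<open>S\<close> is exhausted by the parts \<open>R n\<close> at distance at least \<open>1 / (n + 1)\<close> from \<open>S\<close>; the differences of
  the \<open>R n\<close> of equal parity are separated, so the series of their measures converges.\<close>

lemma metric_outer_measure_closed:
 fixes h :: "'a::metric_space set => enn"
 assumes oms: "outer_measure_space (Pow UNIV) h"
	and sep: "!!A B eta. eta > 0 ==> (!!x y. x : A ==> y : B ==> dist x y >= eta) ==> h A + h B <= h (A \<union> B)"
	and S: "closed S"
 shows "h (A \<inter> S) + h (A - S) <= h A"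
proof (cases "S = {}")
 case True
 have "h {} = 0" using oms by (simp add: outer_measure_space_def positive_def)
 then show ?thesis using True by simp
next
 case ne: False
 note mono = outer_measure_mono[OF oms]
 define R where "R n = {x : A - S. infdist x S >= 1 / real (Suc n)}" for n
 define D where "D n = R (Suc n) - R n" for n
 have RA: "R n \<subseteq> A - S" for n by (auto simp: R_def)
 have Rmono: "R n \<subseteq> R m" if "n <= m" for n m
 proof -
	have "1 / real (Suc m) <= 1 / real (Suc n)" using that by (intro divide_left_mono) auto
	then show ?thesis unfolding R_def by auto
 qed
 have inf: "infdist x S <= infdist y S + dist x y" for x y by (rule infdist_triangle)
 have sepR: "h X + h Y <= h (X \<union> Y)" if "X \<subseteq> R n" "Y \<inter> R m = {}" "Y \<subseteq> A - S" "n < m" for X Y n m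
 proof (rule sep)
	show "1 / real (Suc n) - 1 / real (Suc m) > 0" using that(4) by (simp add: frac_less2)
	fix x y assume "x : X" "y : Y"
	then have "infdist x S >= 1 / real (Suc n)" "infdist y S < 1 / real (Suc m)" using that by (auto simp: R_def)
	then show "1 / real (Suc n) - 1 / real (Suc m) <= dist x y" using inf[of x y] by linarith
 qed
 have DR: "D n \<subseteq> R m" if "n < m" for n m
 proof -
	have "R (Suc n) \<subseteq> R m" using that by (intro Rmono) auto
	then show ?thesis by (auto simp: D_def)
 qed
 have DA: "D n \<subseteq> A - S" "D n \<inter> R n = {}" for n using RA by (auto simp: D_def)
 have partial: "(\<Sum>k<N. h (D (2 * k + p))) <= h A" for N p
 proof -
	have "(\<Sum>k<N. h (D (2 * k + p))) <= h (\<Union>k<N. D (2 * k + p))"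
	proof (induction N)
	 case 0 then show ?case by simp
	next
	 case (Suc N)
	 have "(\<Union>k<N. D (2 * k + p)) \<subseteq> R (2 * N + p - 1)"
	 proof (rule UN_least)
		fix k assume "k : {..<N}"
		then show "D (2 * k + p) \<subseteq> R (2 * N + p - 1)" by (intro DR) auto
	 qed
	 moreover have "(\<Union>k<N. D (2 * k + p)) = {}" if "N = 0" using that by simp
	 \<comment> \<open>For \<open>N = 0\<close> and \<open>p = 0\<close> the index
	   \<open>2 * N + p - 1\<close> is truncated to 0, so the strict inequality of indices in
	   \<open>sepR\<close> would fail; there the union is empty.\<close>
	 ultimately have "h (\<Union>k<N. D (2 * k + p)) + h (D (2 * N + p)) <= h ((\<Union>k<N. D (2 * k + p)) \<union> D (2 * N + p))"
	 proof (cases "N = 0")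
		case True
		then show ?thesis using oms by (simp add: outer_measure_space_def positive_def)
	 next
		case False
		then show ?thesis using \<open>(\<Union>k<N. D (2 * k + p)) \<subseteq> R (2 * N + p - 1)\<close> DA by (intro sepR[of _ "2 * N + p - 1" _ "2 * N + p"]) auto
	 qed
	 moreover have "(\<Union>k<Suc N. D (2 * k + p)) = (\<Union>k<N. D (2 * k + p)) \<union> D (2 * N + p)" by (auto simp: lessThan_Suc)
	 ultimately show ?case using order_trans[OF add_right_mono[OF Suc]] by simp
	qed
	also have "... <= h A" using DA by (intro mono) auto
	finally show ?thesis .
 qed
 define c where "c k = h (D (2 * k)) + h (D (2 * k + 1))" for k
 have csum: "(\<Sum>k. c k) <= h A + h A"
 proof (rule suminf_le_const[OF summableI])
	show "sum c {..<N} <= h A + h A" for N unfolding c_def sum.distrib using partial[of 0 N] partial[of 1 N] by (simp add: add_mono)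
 qed
 have cover: "A - S \<subseteq> R (2 * m) \<union> (\<Union>k. D (2 * (k + m)) \<union> D (2 * (k + m) + 1))" for m
 proof
	fix x assume x: "x : A - S"
	then have "infdist x S > 0" by (intro infdist_pos_not_in_closed[OF S ne]) simp
	then obtain n where n: "1 / real (Suc n) < infdist x S" using nat_approx_posE by blast
	then have "x : R n" using x by (auto simp: R_def)
	show "x : R (2 * m) \<union> (\<Union>k. D (2 * (k + m)) \<union> D (2 * (k + m) + 1))"
	proof (cases "x : R (2 * m)")
	 case False
	 define j where "j = (LEAST j. x : R j)"
	 have j: "x : R j" unfolding j_def using \<open>x : R n\<close> by (rule LeastI)
	 have "j > 2 * m" using j False Rmono[of j "2 * m"] by (meson in_mono not_le_imp_less)
	 then obtain i where i: "j = Suc i" "i >= 2 * m" by (cases j) auto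
	 have "x ~: R i" using not_less_Least[of i "%j. x : R j"] i(1) j_def by auto
	 then have xD: "x : D i" using j i by (simp add: D_def)
	 have "i = 2 * (i div 2 - m + m) \<or> i = 2 * (i div 2 - m + m) + 1" using i(2) by presburger
	 then have "x : D (2 * (i div 2 - m + m)) \<union> D (2 * (i div 2 - m + m) + 1)" using xD by auto
	 then show ?thesis by blast
	qed simp
 qed
 have bound: "h (A - S) <= h (R (2 * m)) + (\<Sum>k. c (k + m))" for m
 proof -
	have "h (A - S) <= h (R (2 * m)) + h (\<Union>k. D (2 * (k + m)) \<union> D (2 * (k + m) + 1))"
	 using order_trans[OF mono[OF cover] outer_measure_subadditive2[OF oms]] .
	also have "h (\<Union>k. D (2 * (k + m)) \<union> D (2 * (k + m) + 1)) <=
		(\<Sum>k. h (D (2 * (k + m)) \<union> D (2 * (k + m) + 1)))" by (rule outer_measure_countable_subadditive[OF oms])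
	also have "... <= (\<Sum>k. c (k + m))" unfolding c_def by (intro suminf_le summableI outer_measure_subadditive2[OF oms])
	finally show ?thesis by (simp add: add_left_mono)
 qed
 show ?thesis
 proof (rule ennreal_le_epsilon)
	fix e :: real assume fin: "h A < top" and e: "0 < e"
	then have S_fin: "(\<Sum>k. c k) < top" using csum by (simp add: order_le_less_trans)
	have "(%m. sum c {..<m}) ----> (\<Sum>k. c k)" by (rule summable_LIMSEQ[OF summableI])
	have "EX m. (\<Sum>k. c k) <= sum c {..<m} + enn e"
	proof (cases "(\<Sum>k. c k) < enn e")
	 case True
	 then show ?thesis by (intro exI[of _ 0]) auto
	next
	 case False
	 obtain t where t: "t >= 0" "(\<Sum>k. c k) = enn t" using S_fin by (cases "\<Sum>k. c k" rule: ennreal_cases) auto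
	 have "e <= t" using False t by (simp add: ennreal_less_iff)
	 have "enn (t - e) < (\<Sum>k. c k)" using t e \<open>e <= t\<close> by (simp add: ennreal_less_iff)
	 then have "\<forall>\<^sub>F m in sequentially. sum c {..<m} > enn (t - e)"
		using order_tendstoD(1)[OF \<open>(%m. sum c {..<m}) ----> (\<Sum>k. c k)\<close>] by blast
	 then obtain m where m: "enn (t - e) < sum c {..<m}" by (meson eventually_sequentially order_refl)
	 have "(\<Sum>k. c k) = enn (t - e) + enn e" using t e \<open>e <= t\<close> by (simp flip: ennreal_plus)
	 also have "... <= sum c {..<m} + enn e" by (rule add_right_mono[OF order_less_imp_le[OF m]])
	 finally show ?thesis by blast
	qed
	then obtain m where m: "(\<Sum>k. c k) <= sum c {..<m} + enn e" by blast
	have "(\<Sum>k. c k) = (\<Sum>k. c (k + m)) + sum c {..<m}" by (rule suminf_offset[OF summableI])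
	moreover have "sum c {..<m} < top" using sum_le_suminf[OF summableI, of "{..<m}" c] S_fin by (simp add: order_le_less_trans)
	ultimately have "sum c {..<m} + (\<Sum>k. c (k + m)) <= sum c {..<m} + enn e" "sum c {..<m} \<noteq> top" using m by (metis add.commute, metis less_irrefl)
	then have tail: "(\<Sum>k. c (k + m)) <= enn e" unfolding ennreal_add_left_cancel_le infinity_ennreal_def by blast
	have "h (A \<inter> S) + h (A - S) <= h (A \<inter> S) + (h (R (2 * m)) + enn e)" using bound[of m] tail by (meson add_left_mono order_trans)
	also have "... <= h ((A \<inter> S) \<union> R (2 * m)) + enn e"
	proof -
	 have "h (A \<inter> S) + h (R (2 * m)) <= h ((A \<inter> S) \<union> R (2 * m))"
	 proof (rule sep)
		show "1 / real (Suc (2 * m)) > 0" by simp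
		fix x y assume "x : A \<inter> S" "y : R (2 * m)"
		then have "infdist y S <= dist y x" "1 / real (Suc (2 * m)) <= infdist y S" by (auto simp: R_def intro: infdist_le)
		then show "1 / real (Suc (2 * m)) <= dist x y" by (simp add: dist_commute)
	 qed
	 then show ?thesis by (simp add: add.assoc[symmetric] add_right_mono)
	qed
	also have "h ((A \<inter> S) \<union> R (2 * m)) <= h A" using RA by (intro mono) auto
	finally show "h (A \<inter> S) + h (A - S) <= h A + enn e" by (simp add: add_right_mono)
 qed
qed

text \<open>The Caratheodory measurable sets form a sigma algebra on which \<open>h\<close> is
  countably additive. It contains the closed sets and therefore all Borel sets, so
  \<open>measure_of\<close> does not fall back to the zero measure.\<close>

lemma metric_outer_measure_borel:
 fixes h :: "'a::metric_space set => enn"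
 assumes oms: "outer_measure_space (Pow UNIV) h"
	and sep: "!!A B eta. eta > 0 ==> (!!x y. x : A ==> y : B ==> dist x y >= eta) ==> h A + h B <= h (A \<union> B)"
	and A: "A : sets borel"
 shows "emeasure (measure_of UNIV (sets borel) h) A = h A"
proof (rule emeasure_measure_of_sigma[OF _ _ _ A])
 interpret P: sigma_algebra "UNIV :: 'a set" "Pow UNIV" by (rule sigma_algebra_Pow)
 define L where "L = lambda_system UNIV (Pow UNIV) h"
 have ms: "measure_space UNIV L h" unfolding L_def by (rule P.caratheodory_lemma[OF oms])
 then interpret L: sigma_algebra UNIV L by (simp add: measure_space_def)
 have "S : L" if "closed S" for S
 proof -
	have "h (X \<inter> S) + h (X - S) = h X" for X
	proof (rule antisym)
	 show "h (X \<inter> S) + h (X - S) <= h X" by (rule metric_outer_measure_closed[OF oms sep that])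
	 show "h X <= h (X \<inter> S) + h (X - S)" using outer_measure_subadditive2[OF oms, of "X \<inter> S" "X - S"] by (simp add: Int_Diff_Un)
	qed
	then show ?thesis unfolding L_def P.lambda_system_eq by auto
 qed
 then have "sigma_sets UNIV (Collect closed) \<subseteq> L" by (intro L.sigma_sets_subset) auto
 then have sub: "sets borel \<subseteq> L" by (simp add: borel_eq_closed)
 show "sigma_algebra UNIV (sets (borel :: 'a measure))" using sets.sigma_algebra_axioms[of borel] by simp
 show "positive (sets borel) h" using oms by (simp add: outer_measure_space_def positive_def)
 have "countably_additive L h" using ms by (simp add: measure_space_def)
 with sub show "countably_additive (sets borel) h" unfolding countably_additive_def by (meson order_trans subset_eq)
qed

section \<open>The Hausdorff outer measure adds up on separated sets\<close>

definition hausdorff_covers :: "real => 'a::euclidean_space set => (nat => 'a set) set" where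
 "hausdorff_covers delta A = {C. A \<subseteq> (\<Union>i. C i) & (ALL i. bounded (C i) & diameter (C i) <= delta)}"

text \<open>The pre-measure at a fixed scale. It grows as \<open>delta\<close> decreases, so the
  supremum in \<open>hausdorff_outer\<close> is the limit of small scales.\<close>

definition hausdorff_pre :: "nat => real => 'a::euclidean_space set => enn" where
 "hausdorff_pre s delta A = (INF C\<in>hausdorff_covers delta A. \<Sum>i. hausdorff_weight s (C i))"

lemma hausdorff_outer_eq: "hausdorff_outer s A = (SUP delta\<in>{0<..}. hausdorff_pre s delta A)"
 by (simp add: hausdorff_outer_def hausdorff_pre_def hausdorff_covers_def)

lemma hausdorff_pre_le_outer: "delta > 0 ==> hausdorff_pre s delta A <= hausdorff_outer s A" unfolding hausdorff_outer_eq by (rule SUP_upper) simp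

lemma hausdorff_pre_antimono: "delta <= delta' ==> hausdorff_pre s delta' A <= hausdorff_pre s delta A"
 unfolding hausdorff_pre_def hausdorff_covers_def by (intro INF_superset_mono Collect_mono) (auto intro: order_trans)

lemma hausdorff_pre_mono: "A \<subseteq> B ==> hausdorff_pre s delta A <= hausdorff_pre s delta B"
 unfolding hausdorff_pre_def hausdorff_covers_def by (intro INF_superset_mono) auto

lemma hausdorff_outer_mono: "A \<subseteq> B ==> hausdorff_outer s A <= hausdorff_outer s B"
 unfolding hausdorff_outer_eq by (intro SUP_mono') (rule hausdorff_pre_mono)

text \<open>Near-optimal covers with errors e / 2^(i+1) are merged into one sequence by the pairing
  function on the naturals; the errors add up to e.\<close>

lemma hausdorff_pre_countable_subadditive:
 fixes A :: "nat => 'a::euclidean_space set"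
 assumes "delta > 0"
 shows "hausdorff_pre s delta (\<Union>i. A i) <= (\<Sum>i. hausdorff_pre s delta (A i))"
proof (rule ennreal_le_epsilon)
 fix e :: real assume fin: "(\<Sum>i. hausdorff_pre s delta (A i)) < top" and "0 < e"
 have "EX C:hausdorff_covers delta (A i). (\<Sum>j. hausdorff_weight s (C j)) < hausdorff_pre s delta (A i) + enn (e * (1/2) ^ Suc i)" for i
 proof (rule INF_approx_ennreal)
	show "0 < e * (1/2) ^ Suc i" using \<open>0 < e\<close> by simp
	show "hausdorff_pre s delta (A i) = (INF C\<in>hausdorff_covers delta (A i). \<Sum>j. hausdorff_weight s (C j))" by (simp add: hausdorff_pre_def)
	show "hausdorff_pre s delta (A i) \<noteq> \<infinity>" using ennreal_suminf_lessD[OF fin, of i] by simp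
 qed
 then obtain C where C: "!!i. C i : hausdorff_covers delta (A i)"
	"!!i. (\<Sum>j. hausdorff_weight s (C i j)) < hausdorff_pre s delta (A i) + enn (e * (1/2) ^ Suc i)" by metis
 define D where "D k = (case prod_decode k of (i, j) => C i j)" for k
 have "D : hausdorff_covers delta (\<Union>i. A i)"
 proof -
	have "EX k. x : D k" if x: "x : A i" for x i
	proof -
	 obtain j where "x : C i j" using C(1)[of i] x unfolding hausdorff_covers_def by blast
	 then show ?thesis by (intro exI[of _ "prod_encode (i, j)"]) (simp add: D_def)
	qed
	moreover have "bounded (D k) & diameter (D k) <= delta" for k using C(1) by (auto simp: D_def hausdorff_covers_def split: prod.split)
	ultimately show ?thesis by (auto simp: hausdorff_covers_def)
 qed
 then have "hausdorff_pre s delta (\<Union>i. A i) <= (\<Sum>k. hausdorff_weight s (D k))" unfolding hausdorff_pre_def by (rule INF_lower)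
 also have "... = (\<Sum>i. \<Sum>j. hausdorff_weight s (C i j))"
	using suminf_ennreal_2dimen[of "%i. \<Sum>j. hausdorff_weight s (C i j)" "%(i, j). hausdorff_weight s (C i j)"] by (simp add: D_def case_prod_unfold)
 also have "... <= (\<Sum>i. hausdorff_pre s delta (A i) + enn (e * (1/2) ^ Suc i))" by (intro suminf_le summableI order_less_imp_le C)
 also have "... = (\<Sum>i. hausdorff_pre s delta (A i)) + (\<Sum>i. enn (e * (1/2) ^ Suc i))" by (rule suminf_add[symmetric]) (rule summableI)+
 also have "(\<Sum>i. enn (e * (1/2) ^ Suc i)) = enn e" using \<open>0 < e\<close> sums_mult[OF power_half_series, of e] by (intro suminf_ennreal_eq) auto
 finally show "hausdorff_pre s delta (\<Union>i. A i) <= (\<Sum>i. hausdorff_pre s delta (A i)) + enn e" .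
qed

lemma hausdorff_pre_empty: "delta >= 0 ==> hausdorff_pre s delta ({} :: 'a::euclidean_space set) = 0"
proof -
 assume "delta >= 0"
 have "hausdorff_pre s delta ({} :: 'a set) <= (\<Sum>i. hausdorff_weight s ((%i::nat. {} :: 'a set) i))" unfolding hausdorff_pre_def
	by (rule INF_lower[of "%i::nat. {} :: 'a set"]) (use \<open>delta >= 0\<close> in "simp add: hausdorff_covers_def diameter_empty")
 then show ?thesis by (simp add: hausdorff_weight_def)
qed

lemma outer_measure_space_hausdorff: "outer_measure_space (Pow UNIV) (hausdorff_outer s)" unfolding outer_measure_space_def
proof (intro conjI)
 have "hausdorff_outer s ({} :: 'a set) <= 0" unfolding hausdorff_outer_eq by (rule SUP_least) (simp add: hausdorff_pre_empty)
 then show "positive (Pow UNIV) (hausdorff_outer s :: 'a set => _)" by (simp add: positive_def)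
 show "increasing (Pow UNIV) (hausdorff_outer s :: 'a set => _)" by (simp add: increasing_def hausdorff_outer_mono)
 have "hausdorff_outer s (\<Union>i. A i) <= (\<Sum>i. hausdorff_outer s (A i))" for A :: "nat => 'a set" unfolding hausdorff_outer_eq[of s "\<Union>i. A i"]
 proof (rule SUP_least)
	fix delta :: real assume "delta : {0<..}"
	then have "hausdorff_pre s delta (\<Union>i. A i) <= (\<Sum>i. hausdorff_pre s delta (A i))" by (intro hausdorff_pre_countable_subadditive) simp
	also have "... <= (\<Sum>i. hausdorff_outer s (A i))" using \<open>delta : {0<..}\<close> by (intro suminf_le summableI hausdorff_pre_le_outer) simp
	finally show "hausdorff_pre s delta (\<Union>i. A i) <= (\<Sum>i. hausdorff_outer s (A i))" .
 qed
 then show "countably_subadditive (Pow UNIV) (hausdorff_outer s :: 'a set => _)" by (simp add: countably_subadditive_def)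
qed

text \<open>A covering set of diameter at most \<open>delta < eta\<close> cannot meet both
  \<open>A\<close> and \<open>B\<close>, so every cover of the union splits into two covers without
  using a set twice.\<close>

lemma hausdorff_pre_separated:
 fixes A B :: "'a::euclidean_space set"
 assumes "0 < delta" "delta < eta" "!!x y. x : A ==> y : B ==> dist x y >= eta"
 shows "hausdorff_pre s delta A + hausdorff_pre s delta B <= hausdorff_pre s delta (A \<union> B)" unfolding hausdorff_pre_def[of s delta "A \<union> B"]
proof (rule INF_greatest)
 fix C assume C: "C : hausdorff_covers delta (A \<union> B)"
 \<comment> \<open>Discarded members become empty instead of being renumbered. This is free of cost
   because the empty set has weight 0 also for \<open>s = 0\<close>, where any other set has weight
   1.\<close>
 define P where "P X i = (if C i \<inter> X = {} then {} else C i)" for X i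
 have cov: "P X : hausdorff_covers delta X" if "X \<subseteq> A \<union> B" for X
 proof -
	have "EX i. x : P X i" if x: "x : X" for x
	proof -
	 obtain i where "x : C i" using C \<open>X \<subseteq> A \<union> B\<close> x unfolding hausdorff_covers_def by blast
	 then show ?thesis using x by (intro exI[of _ i]) (auto simp: P_def)
	qed
	moreover have "bounded (P X i) & diameter (P X i) <= delta" for i using C assms(1) by (auto simp: hausdorff_covers_def P_def diameter_empty)
	ultimately show ?thesis unfolding hausdorff_covers_def by blast
 qed
 have disj: "P A i = {} \<or> P B i = {}" for i
 proof (rule ccontr)
	assume "\<not> ?thesis"
	then obtain x y where xy: "x : C i" "x : A" "y : C i" "y : B" by (auto simp: P_def split: if_splits)
	have "bounded (C i)" "diameter (C i) <= delta" using C by (auto simp: hausdorff_covers_def)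
	then have "dist x y <= delta" using diameter_bounded_bound[of "C i" x y] xy by simp
	then show False using assms(2) assms(3)[OF xy(2,4)] by simp
 qed
 have "hausdorff_pre s delta A + hausdorff_pre s delta B <=
	 (\<Sum>i. hausdorff_weight s (P A i)) + (\<Sum>i. hausdorff_weight s (P B i))" unfolding hausdorff_pre_def by (intro add_mono INF_lower cov) auto
 also have "... = (\<Sum>i. hausdorff_weight s (P A i) + hausdorff_weight s (P B i))" by (rule suminf_add) (rule summableI)+
 also have "... <= (\<Sum>i. hausdorff_weight s (C i))"
 proof (intro suminf_le summableI)
	fix i
	show "hausdorff_weight s (P A i) + hausdorff_weight s (P B i) <= hausdorff_weight s (C i)"
	proof -
	 have "hausdorff_weight s (P X i) <= hausdorff_weight s (C i)" for X by (simp add: P_def hausdorff_weight_def)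
	 moreover have "hausdorff_weight s ({} :: 'a set) = 0" by (simp add: hausdorff_weight_def)
	 ultimately show ?thesis using disj[of i] by (metis add.right_neutral add_0)
	qed
 qed
 finally show "hausdorff_pre s delta A + hausdorff_pre s delta B <= (\<Sum>i. hausdorff_weight s (C i))" .
qed

lemma hausdorff_outer_separated:
 fixes A B :: "'a::euclidean_space set"
 assumes "eta > 0" "!!x y. x : A ==> y : B ==> dist x y >= eta"
 shows "hausdorff_outer s A + hausdorff_outer s B <= hausdorff_outer s (A \<union> B)"
proof -
 have *: "hausdorff_pre s d A + hausdorff_pre s d' B <= hausdorff_outer s (A \<union> B)" if "d > 0" "d' > 0" for d d'
 proof -
	define delta where "delta = min (min d d') (eta / 2)"
	have delta: "delta > 0" "delta < eta" "delta <= d" "delta <= d'" using that assms(1) by (auto simp: delta_def)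
	have "hausdorff_pre s d A + hausdorff_pre s d' B <= hausdorff_pre s delta A + hausdorff_pre s delta B" by (intro add_mono hausdorff_pre_antimono delta)
	also have "... <= hausdorff_pre s delta (A \<union> B)" by (rule hausdorff_pre_separated[OF delta(1,2) assms(2)])
	also have "... <= hausdorff_outer s (A \<union> B)" by (rule hausdorff_pre_le_outer[OF delta(1)])
	finally show ?thesis .
 qed
 have ne: "{0<..} \<noteq> ({} :: real set)" by (metis greaterThan_non_empty)
 have "hausdorff_outer s A + hausdorff_pre s d' B <= hausdorff_outer s (A \<union> B)" if "d' > 0" for d'
	unfolding hausdorff_outer_eq[of s A] ennreal_SUP_add_left[OF ne, symmetric] by (rule SUP_least) (use * that in auto)
 then have "(SUP d'\<in>{0<..}. hausdorff_pre s d' B + hausdorff_outer s A) <= hausdorff_outer s (A \<union> B)" by (intro SUP_least) (auto simp: add.commute)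
 then show ?thesis unfolding ennreal_SUP_add_left[OF ne] hausdorff_outer_eq[of s B] by (simp add: add.commute)
qed

lemma emeasure_hausdorff_measure:
 "A : sets borel ==> emeasure (hausdorff_measure s) A = hausdorff_outer s A" unfolding hausdorff_measure_def
 by (rule metric_outer_measure_borel[OF outer_measure_space_hausdorff]) (rule hausdorff_outer_separated)

lemma sets_hausdorff_measure [simp]: "sets (hausdorff_measure s) = sets borel"
 and space_hausdorff_measure [simp]: "space (hausdorff_measure s) = UNIV"
 using sets.sigma_sets_eq[of borel] by (simp_all add: hausdorff_measure_def sets_measure_of_conv space_measure_of_conv)

section \<open>Boundary strips\<close>

text \<open>Local picture at a boundary point: along \<open>e\<close> the defining function grows at
  rate at least \<open>c\<close>, so lines in this direction cross the boundary once. A signed basis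
  vector is used so that coordinate boxes are aligned with \<open>e\<close> and the derivative along
  \<open>e\<close> is a partial derivative up to sign. Strips lie in the ball of radius r, their
  segments to the boundary in radius 2r, and radius 4r leaves room for cutoffs inside
  \<open>U\<close>.\<close>

locale boundary_chart =
 fixes Om U :: "'a::euclidean_space set" and rho :: "'a => real" and p e :: 'a and c r :: real
 assumes open_domain: "open Om" and open_U: "open U" and smooth_rho: "smooth_on U rho"
	and inside: "Om \<inter> U = {x : U. rho x < 0}" and bdry: "frontier Om \<inter> U = {x : U. rho x = 0}"
	and direction: "e : Basis \<or> - e : Basis"
	and r_pos: "r > 0" and c_pos: "c > 0" and ball_U: "cball p (4 * r) \<subseteq> U"
	and gradient: "!!x. x : U ==> fd rho (at x) \<noteq> (%_. 0)"
	and slope: "!!x. x : cball p (2 * r) ==> c <= fd rho (at x) e"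
begin

text \<open>The depth \<open>2 * eps\<close> is measured by \<open>rho\<close>. The cutoff used
  later changes only where \<open>rho\<close> lies between \<open>- eps\<close> and
  \<open>- eps / 2\<close>, which is well inside.\<close>

definition strip :: "real => 'a set" where
 "strip eps = {x : ball p r \<inter> Om. - 2 * eps < rho x}"

lemma norm_e: "norm e = 1" using direction norm_Basis[of e] norm_Basis[of "- e"] by auto

lemma in_ball_step:
 assumes "x : ball p r" "0 <= t" "t <= r"
 shows "x + t *\<^sub>R e : ball p (2 * r)" "x + t *\<^sub>R e : U"
proof -
 have "dist p (x + t *\<^sub>R e) <= dist p x + dist x (x + t *\<^sub>R e)" by (rule dist_triangle)
 also have "... < 2 * r" using assms norm_e by (simp add: dist_norm)
 finally show "x + t *\<^sub>R e : ball p (2 * r)" by simp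
 then have "x + t *\<^sub>R e : cball p (4 * r)" using r_pos by simp
 then show "x + t *\<^sub>R e : U" using ball_U by blast
qed

lemma rho_increase:
 assumes x: "x : ball p r" and st: "0 <= s" "s < t" "t <= r"
 shows "c * (t - s) <= rho (x + t *\<^sub>R e) - rho (x + s *\<^sub>R e)"
proof -
 let ?D = "%t. fd rho (at (x + t *\<^sub>R e)) e"
 have der: "((%t. rho (x + t *\<^sub>R e)) has_real_derivative ?D t) (at t)" if "0 <= t" "t <= r" for t
 proof -
	have 1: "((%t. x + t *\<^sub>R e) has_derivative (%h. h *\<^sub>R e)) (at t)" by (auto intro!: derivative_eq_intros)
	have 2: "(rho has_derivative fd rho (at (x + t *\<^sub>R e))) (at (x + t *\<^sub>R e))"
	 by (rule smooth_on_has_derivative[OF open_U smooth_rho in_ball_step(2)[OF x that]])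
	have "(%h. fd rho (at (x + t *\<^sub>R e)) (h *\<^sub>R e)) = (%h. ?D t * h)" using linear_scale[OF has_derivative_linear[OF 2], of _ e] by (simp add: mult.commute)
	with has_derivative_compose[OF 1 2] show ?thesis by (simp add: has_field_derivative_def)
 qed
 obtain z where z: "s < z" "z < t" "rho (x + t *\<^sub>R e) - rho (x + s *\<^sub>R e) = (t - s) * ?D z"
	using MVT2[OF st(2), of "%t. rho (x + t *\<^sub>R e)" ?D] der st by force
 have "x + z *\<^sub>R e : cball p (2 * r)" using in_ball_step(1)[OF x, of z] z st by (auto simp: less_imp_le)
 then have "c <= ?D z" by (rule slope)
 then show ?thesis unfolding z(3) using st by (simp add: mult.commute mult_right_mono)
qed

lemma inside_iff: "x : U ==> x : Om \<longleftrightarrow> rho x < 0"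
 and bdry_iff: "x : U ==> x : frontier Om \<longleftrightarrow> rho x = 0" using inside bdry by blast+

text \<open>\<open>rho\<close> starts above \<open>- 2 * eps\<close> and grows at rate at least
  \<open>c\<close>, so it reaches zero before time \<open>2 * eps / c\<close>. Since it is strictly
  increasing, the line is inside before this time and outside from then on.\<close>

lemma strip_hit:
 assumes x: "x : strip eps" and eps: "0 < eps" "2 * eps / c <= r"
 obtains tau where "0 < tau" "tau < 2 * eps / c" "x + tau *\<^sub>R e : frontier Om"
	"!!t. 0 <= t ==> t < tau ==> x + t *\<^sub>R e : Om" "!!t. tau <= t ==> t <= r ==> x + t *\<^sub>R e ~: Om"
proof -
 let ?L = "2 * eps / c"
 have xb: "x : ball p r" "x : Om" "- 2 * eps < rho x" using x by (auto simp: strip_def)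
 have L: "0 < ?L" "?L <= r" using eps c_pos by auto
 have xU: "x : U" using in_ball_step(2)[OF xb(1), of 0] r_pos by simp
 have neg: "rho (x + 0 *\<^sub>R e) < 0" using xb(2) inside_iff[OF xU] by simp
 have "c * (?L - 0) <= rho (x + ?L *\<^sub>R e) - rho (x + 0 *\<^sub>R e)" by (rule rho_increase[OF xb(1)]) (use L in auto)
 then have pos: "0 < rho (x + ?L *\<^sub>R e)" using xb(3) c_pos by simp
 have cont: "continuous_on {0..?L} (%t. rho (x + t *\<^sub>R e))" by (rule continuous_on_compose2[OF smooth_on_continuous[OF smooth_rho]])
	 (use in_ball_step(2)[OF xb(1)] L in "auto intro!: continuous_intros")
 obtain tau where tau: "0 <= tau" "tau <= ?L" "rho (x + tau *\<^sub>R e) = 0" using IVT'[of "%t. rho (x + t *\<^sub>R e)" 0 0 ?L] neg pos cont L by force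
 show ?thesis
 proof (rule that[of tau])
	have "tau \<noteq> 0" using tau(3) neg by (intro notI) simp
	then show "0 < tau" using tau(1) by simp
	have "tau \<noteq> ?L" using tau(3) pos by (intro notI) simp
	then show "tau < ?L" using tau(2) by simp
	show "x + tau *\<^sub>R e : frontier Om" using bdry_iff[OF in_ball_step(2)[OF xb(1), of tau]] tau L by simp
	show "x + t *\<^sub>R e : Om" if "0 <= t" "t < tau" for t
	proof -
	 have "c * (tau - t) <= rho (x + tau *\<^sub>R e) - rho (x + t *\<^sub>R e)" by (rule rho_increase[OF xb(1)]) (use tau L that in auto)
	 moreover have "0 < c * (tau - t)" using that c_pos by simp
	 ultimately show ?thesis using inside_iff[OF in_ball_step(2)[OF xb(1), of t]] that tau L by simp
	qed
	show "x + t *\<^sub>R e ~: Om" if "tau <= t" "t <= r" for t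
	proof (cases "t = tau")
	 case True
	 then show ?thesis using inside_iff[OF in_ball_step(2)[OF xb(1), of tau]] tau L by simp
	next
	 case False
	 then have "c * (t - tau) <= rho (x + t *\<^sub>R e) - rho (x + tau *\<^sub>R e)" by (intro rho_increase[OF xb(1)]) (use tau L that in auto)
	 moreover have "0 <= c * (t - tau)" using that c_pos by simp
	 ultimately show ?thesis using inside_iff[OF in_ball_step(2)[OF xb(1), of t]] that tau L by simp
	qed
 qed
qed

definition hit :: "real => 'a => real" where
 "hit eps x = (if x : strip eps then (THE tau. 0 < tau & tau < 2 * eps / c & x + tau *\<^sub>R e : frontier Om &
	 (ALL t. 0 <= t --> t < tau --> x + t *\<^sub>R e : Om) & (ALL t. tau <= t --> t <= r --> x + t *\<^sub>R e ~: Om)) else 0)"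

lemma hit:
 assumes x: "x : strip eps" and eps: "0 < eps" "2 * eps / c <= r"
 shows "0 < hit eps x" "hit eps x < 2 * eps / c" "x + hit eps x *\<^sub>R e : frontier Om"
	"!!t. 0 <= t ==> t < hit eps x ==> x + t *\<^sub>R e : Om"
	"!!t. hit eps x <= t ==> t <= r ==> x + t *\<^sub>R e ~: Om"
proof -
 let ?P = "%tau. 0 < tau & tau < 2 * eps / c & x + tau *\<^sub>R e : frontier Om &
	 (ALL t. 0 <= t --> t < tau --> x + t *\<^sub>R e : Om) & (ALL t. tau <= t --> t <= r --> x + t *\<^sub>R e ~: Om)"
 have "EX tau. ?P tau" by (rule strip_hit[OF x eps]) blast
 then obtain tau where tau: "?P tau" by blast
 have uniq: "sigma = tau" if "?P sigma" for sigma
 proof (rule ccontr)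
	assume "sigma \<noteq> tau"
	then consider "sigma < tau" | "tau < sigma" by linarith
	then show False
	proof cases
	 case 1
	 then have "x + sigma *\<^sub>R e : Om" using tau that by simp
	 moreover have "x + sigma *\<^sub>R e ~: Om" using that eps by simp
	 ultimately show False by blast
	next
	 case 2
	 then have "x + tau *\<^sub>R e : Om" using tau that by simp
	 moreover have "x + tau *\<^sub>R e ~: Om" using tau eps by simp
	 ultimately show False by blast
	qed
 qed
 have "?P (THE tau. ?P tau)" by (rule theI[of ?P tau, OF tau]) (rule uniq)
 then have "?P (hit eps x)" unfolding hit_def if_P[OF x] .
 then show "0 < hit eps x" "hit eps x < 2 * eps / c" "x + hit eps x *\<^sub>R e : frontier Om"
	"!!t. 0 <= t ==> t < hit eps x ==> x + t *\<^sub>R e : Om"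
	"!!t. hit eps x <= t ==> t <= r ==> x + t *\<^sub>R e ~: Om" by blast+
qed

lemma open_strip: "open (strip eps)"
proof -
 have "open {x : U. rho x : {- 2 * eps<..}}" using continuous_open_preimage[OF smooth_on_continuous[OF smooth_rho] open_U, of "{- 2 * eps<..}"]
	by (simp add: vimage_def Int_def)
 moreover have "strip eps = ball p r \<inter> Om \<inter> {x : U. rho x : {- 2 * eps<..}}" using in_ball_step(2)[of _ 0] r_pos by (auto simp: strip_def)
 ultimately show ?thesis using open_domain by auto
qed

text \<open>For t between 0 and \<open>2 * eps / c\<close> the boundary is hit after time t exactly
  if the point at time t is still in the open set \<open>Om\<close>; so the superlevel sets are
  open.\<close>

lemma hit_measurable:
 assumes eps: "0 < eps" "2 * eps / c <= r"
 shows "hit eps : bmeas borel"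
proof (rule borel_measurableI_greater)
 fix t :: real
 show "{x : space borel. t < hit eps x} : sets borel"
 proof (cases "t < 0")
	case True
	have "0 <= hit eps x" for x using hit(1)[OF _ eps, of x] by (cases "x : strip eps") (auto simp: hit_def)
	then have "{x : space borel. t < hit eps x} = UNIV" using True by (auto intro: less_le_trans)
	then show ?thesis by simp
 next
	case False
	have "{x : space borel. t < hit eps x} = (if t < 2 * eps / c then strip eps \<inter> (%x. x + t *\<^sub>R e) -` Om else {})"
	proof (intro equalityI subsetI)
	 fix x assume "x : {x : space borel. t < hit eps x}"
	 then have t: "t < hit eps x" by simp
	 then have x: "x : strip eps" using False by (cases "x : strip eps") (auto simp: hit_def)
	 then show "x : (if t < 2 * eps / c then strip eps \<inter> (%x. x + t *\<^sub>R e) -` Om else {})" using hit(2,4)[OF x eps] t False by auto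
	next
	 fix x assume a: "x : (if t < 2 * eps / c then strip eps \<inter> (%x. x + t *\<^sub>R e) -` Om else {})"
	 then have x: "x : strip eps" "x + t *\<^sub>R e : Om" "t < 2 * eps / c" by (auto split: if_splits)
	 then have "\<not> hit eps x <= t" using hit(5)[OF x(1) eps, of t] eps(2) by auto
	 then show "x : {x : space borel. t < hit eps x}" by simp
	qed
	moreover have "open (strip eps \<inter> (%x. x + t *\<^sub>R e) -` Om)" by (intro open_Int open_strip open_vimage open_domain continuous_intros)
	ultimately show ?thesis by simp
 qed
qed

section \<open>Projection of a strip to the boundary along \<open>e\<close>\<close>

definition land :: "real => 'a => 'a" where
 "land eps x = x + hit eps x *\<^sub>R e"

lemma land_measurable:
 assumes "0 < eps" "2 * eps / c <= r"
 shows "land eps : bmeas borel" unfolding land_def[abs_def] using hit_measurable[OF assms] by measurable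

lemma land_in:
 assumes x: "x : strip eps" and eps: "0 < eps" "2 * eps / c <= r"
 shows "land eps x : frontier Om \<inter> ball p (2 * r)" using hit(1-3)[OF x eps] in_ball_step(1)[of x "hit eps x"] x eps by (auto simp: land_def strip_def)

text \<open>Up to a constant, the pushforward of Lebesgue measure on a strip under the projection to the
  boundary is bounded by the width of the strip times the surface measure: the preimage of a set of
  small diameter \<open>d\<close> lies in a box with one side comparable to the width and all others to \<open>d\<close>.\<close>

definition proj_const :: real where
 "proj_const = 4 * 4 ^ (DIM('a) - 1) / unit_ball_vol (real (DIM('a) - 1))"

lemma proj_const_pos: "proj_const > 0" by (simp add: proj_const_def)

lemma land_preimage_bound:
 assumes eps: "0 < eps" "2 * eps / c <= r" and C: "bounded C" "diameter C <= 2 * eps / c"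
 obtains B where "B : sets lborel" "{x : strip eps. land eps x : C} \<subseteq> B"
	"emeasure lborel B <= enn (proj_const * (2 * eps / c)) * hausdorff_weight (DIM('a) - 1) C"
proof (cases "C = {}")
 case True
 then show ?thesis by (intro that[of "{}"]) auto
next
 case False
 then obtain y where y: "y : C" by blast
 let ?L = "2 * eps / c" and ?s = "DIM('a) - 1"
 define d where "d = diameter C"
 have d: "0 <= d" "d <= ?L" using C diameter_ge_0 by (auto simp: d_def)
 obtain b sigma where b: "b : Basis" and sigma: "e = sigma *\<^sub>R b" "abs sigma = 1"
 proof -
	consider "e : Basis" | "- e : Basis" using direction by blast
	then show thesis
	proof cases
	 case 1 then show thesis by (intro that[of e 1]) auto
	next
	 case 2 then show thesis by (intro that[of "- e" "-1"]) auto
	qed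
 qed
 \<comment> \<open>Half sides of the box: across \<open>e\<close> a point and its landing point
   agree, so d suffices; along \<open>e\<close> the hitting time adds at most \<open>?L\<close> to
   d, and d is at most \<open>?L\<close>.\<close>
 define v where "v = (SUM i:Basis. (if i = b then 2 * ?L else d) *\<^sub>R i)"
 have v: "v \<bullet> i = (if i = b then 2 * ?L else d)" if "i : Basis" for i using that by (simp add: v_def)
 show ?thesis
 proof (rule that[of "cbox (y - v) (y + v)"])
	show "{x : strip eps. land eps x : C} \<subseteq> cbox (y - v) (y + v)"
	proof
	 fix x assume "x : {x : strip eps. land eps x : C}"
	 then have x: "x : strip eps" "land eps x : C" by auto
	 have n: "norm (land eps x - y) <= d" using diameter_bounded_bound[OF C(1) x(2) y] by (simp add: dist_norm d_def)
	 have "\<bar>(x - y) \<bullet> i\<bar> <= v \<bullet> i" if i: "i : Basis" for i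
	 proof -
		have 1: "\<bar>(land eps x - y) \<bullet> i\<bar> <= d" using Basis_le_norm[OF i, of "land eps x - y"] n by linarith
		have "e \<bullet> i = sigma * (b \<bullet> i)" by (simp add: sigma(1))
		moreover have "(x - y) \<bullet> i = (land eps x - y) \<bullet> i - hit eps x * (e \<bullet> i)" by (simp add: land_def inner_diff_left inner_add_left)
		ultimately have 2: "(x - y) \<bullet> i = (land eps x - y) \<bullet> i - hit eps x * (sigma * (b \<bullet> i))" by simp
		show ?thesis
		proof (cases "i = b")
		 case True
		 have "\<bar>hit eps x * (sigma * (b \<bullet> i))\<bar> <= ?L" using hit(1,2)[OF x(1) eps] sigma(2) b True by (simp add: abs_mult)
		 then show ?thesis using 1 2 d v[OF i] True by simp
		next
		 case False
		 then show ?thesis using 1 2 v[OF i] b i by (simp add: inner_Basis)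
		qed
	 qed
	 then show "x : cbox (y - v) (y + v)" unfolding mem_box by (fastforce simp: inner_diff_left inner_add_left abs_le_iff)
	qed
	have nonneg: "0 <= v \<bullet> i" if "i : Basis" for i using v[OF that] d eps c_pos by simp
	have "emeasure lborel (cbox (y - v) (y + v)) = enn (\<Prod>i\<in>Basis. 2 * (v \<bullet> i))" unfolding emeasure_lborel_cbox_eq using nonneg
	 by (auto simp: inner_diff_left inner_add_left intro!: arg_cong[of _ _ enn] prod.cong)
	also have "(\<Prod>i\<in>Basis. 2 * (v \<bullet> i)) = 2 * (2 * ?L) * (\<Prod>i\<in>Basis - {b}. 2 * d)"
	 using b by (subst prod.remove[OF _ b]) (auto simp: v intro!: prod.cong)
	also have "(\<Prod>i\<in>Basis - {b}. 2 * d) = (2 * d) ^ ?s" using b by simp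
	\<comment> \<open>Origin of \<open>proj_const\<close>: the volume 4 L (2d)^s is rewritten as a
	  multiple of the Hausdorff weight, which contains (d/2)^s and the volume of the unit ball.\<close>
	also have "2 * (2 * ?L) * (2 * d) ^ ?s = proj_const * ?L * (unit_ball_vol (real ?s) * (d / 2) ^ ?s)"
	proof -
	 have "(2 * d) ^ ?s = (4 * (d / 2)) ^ ?s" by simp
	 also have "... = 4 ^ ?s * (d / 2) ^ ?s" by (rule power_mult_distrib)
	 finally have "(2 * d) ^ ?s = 4 ^ ?s * (d / 2) ^ ?s" .
	 moreover have "unit_ball_vol (real ?s) \<noteq> 0" using unit_ball_vol_pos[of "real ?s"] by linarith
	 then have "proj_const * unit_ball_vol (real ?s) = 4 * 4 ^ ?s" by (simp add: proj_const_def)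
	 moreover have "proj_const * ?L * (unit_ball_vol (real ?s) * (d / 2) ^ ?s) =
		 proj_const * unit_ball_vol (real ?s) * ?L * (d / 2) ^ ?s" by (simp only: mult_ac)
	 ultimately show ?thesis by simp
	qed
	also have "ennreal ... = enn (proj_const * ?L) * hausdorff_weight ?s C"
	proof -
	 have "0 <= proj_const * ?L" using eps c_pos proj_const_pos by simp
	 then show ?thesis unfolding hausdorff_weight_def if_not_P[OF False] d_def by (rule ennreal_mult) (use d in "simp add: d_def")
	qed
	finally show "emeasure lborel (cbox (y - v) (y + v)) <= enn (proj_const * ?L) * hausdorff_weight ?s C" by simp
 qed simp
qed

text \<open>The scale of the covers equals the bound \<open>2 * eps / c\<close> on the hitting
  times, as the box estimate requires. One scale is enough, since the pre-measure at any scale is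
  below the Hausdorff measure.\<close>

lemma land_emeasure_bound:
 assumes eps: "0 < eps" "2 * eps / c <= r" and A: "A : sets borel"
 shows "emeasure lborel {x : strip eps. land eps x : A} <=
	enn (proj_const * (2 * eps / c)) * emeasure (hausdorff_measure (DIM('a) - 1)) A"
proof -
 let ?K = "enn (proj_const * (2 * eps / c))" and ?s = "DIM('a) - 1"
 have L: "2 * eps / c > 0" using eps c_pos by simp
 have K: "?K > 0" "?K < top" using mult_pos_pos[OF proj_const_pos L] by simp_all
 have "emeasure lborel {x : strip eps. land eps x : A} <= ?K * (\<Sum>i. hausdorff_weight ?s (C i))"
	if C: "C : hausdorff_covers (2 * eps / c) A" for C
 proof -
	have Ci: "bounded (C i)" "diameter (C i) <= 2 * eps / c" for i using C by (auto simp: hausdorff_covers_def)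
	have ex: "ALL i. EX B. B : sets lborel & {x : strip eps. land eps x : C i} \<subseteq> B &
		emeasure lborel B <= ?K * hausdorff_weight ?s (C i)" by (rule allI, rule land_preimage_bound[OF eps Ci]) blast
	obtain B where "ALL i. B i : sets lborel & {x : strip eps. land eps x : C i} \<subseteq> B i &
		emeasure lborel (B i) <= ?K * hausdorff_weight ?s (C i)" using choice[OF ex] by (elim exE)
	then have B: "!!i. B i : sets lborel" "!!i. {x : strip eps. land eps x : C i} \<subseteq> B i"
	 "!!i. emeasure lborel (B i) <= ?K * hausdorff_weight ?s (C i)" by blast+
	have "A \<subseteq> (\<Union>i. C i)" using C by (simp add: hausdorff_covers_def)
	then have "{x : strip eps. land eps x : A} \<subseteq> (\<Union>i. B i)" using B(2) by blast
	then have "emeasure lborel {x : strip eps. land eps x : A} <= emeasure lborel (\<Union>i. B i)" by (rule emeasure_mono) (use B(1) in blast)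
	also have "... <= (\<Sum>i. emeasure lborel (B i))" by (rule emeasure_subadditive_countably) (use B(1) in blast)
	also have "... <= (\<Sum>i. ?K * hausdorff_weight ?s (C i))" by (intro suminf_le summableI B(3))
	finally show ?thesis by simp
 qed
 then have "emeasure lborel {x : strip eps. land eps x : A} / ?K <= hausdorff_pre ?s (2 * eps / c) A" unfolding hausdorff_pre_def
	by (intro INF_greatest) (use K in "simp add: divide_le_posI_ennreal mult.commute")
 also have "... <= hausdorff_outer ?s A" by (rule hausdorff_pre_le_outer[OF L])
 finally have "?K * (emeasure lborel {x : strip eps. land eps x : A} / ?K) <= ?K * hausdorff_outer ?s A" by (rule mult_left_mono) simp
 then show ?thesis
 proof -
	have "?K * (X / ?K) = X" for X unfolding ennreal_times_divide using K by (subst mult.commute, intro ennreal_mult_divide_eq) auto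
	with \<open>?K * _ <= _\<close> show ?thesis by (simp only: emeasure_hausdorff_measure[OF A])
 qed
qed

text \<open>The estimate for sets is an inequality between two measures, the pushforward of the
  strip and a multiple of the surface measure; it therefore holds for integrals of all nonnegative
  functions.\<close>

lemma land_integral_bound:
 fixes phi :: "'a => enn"
 assumes eps: "0 < eps" "2 * eps / c <= r" and phi: "phi : bmeas borel"
 shows "(\<integral>\<^sup>+x\<in>strip eps. phi (land eps x) \<partial>lborel) <=
	enn (proj_const * (2 * eps / c)) * (\<integral>\<^sup>+x. phi x * ind (ball p (2 * r)) x \<partial>surface Om)"
proof -
 let ?K = "enn (proj_const * (2 * eps / c))" and ?H = "hausdorff_measure (DIM('a) - 1) :: 'a measure"
 let ?S = "frontier Om \<inter> ball p (2 * r)"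
 have lm: "land eps : bmeas borel" by (rule land_measurable[OF eps])
 have Ss: "?S : sets borel" by (auto intro: borel_closed)
 have st: "strip eps : sets borel" using open_strip by auto
 define \<nu> where "\<nu> = distr (density lborel (ind (strip eps))) borel (land eps)"
 define N where "N = scale_measure ?K (density ?H (ind ?S))"
 have ld: "land eps : density lborel (ind (strip eps)) \<rightarrow>\<^sub>M borel" using lm by simp
 have "\<nu> <= N"
 proof (rule le_measure[THEN iffD2])
	show "sets \<nu> = sets N" by (simp add: \<nu>_def N_def)
	show "ALL A:sets \<nu>. emeasure \<nu> A <= emeasure N A"
	proof
	 fix A assume "A : sets \<nu>"
	 then have A: "A : sets borel" by (simp add: \<nu>_def)
	 have pre: "land eps -` A : sets borel" using measurable_sets[OF lm A] by simp
	 have "emeasure \<nu> A = emeasure (density lborel (ind (strip eps))) (land eps -` A)" unfolding \<nu>_def by (subst emeasure_distr[OF ld A]) simp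
	 also have "... = emeasure lborel (strip eps \<inter> land eps -` A)"
		using st pre by (subst emeasure_density) (auto simp flip: indicator_inter_arith simp: nn_integral_indicator)
	 also have "strip eps \<inter> land eps -` A = {x : strip eps. land eps x : ?S \<inter> A}" using land_in[OF _ eps] by blast
	 also have "emeasure lborel ... <= ?K * emeasure ?H (?S \<inter> A)" by (rule land_emeasure_bound[OF eps]) (use Ss A in auto)
	 also have "... = emeasure N A"
	 proof -
		have im: "ind ?S : bmeas ?H" by (rule borel_measurable_indicator) (simp add: Ss)
		have "emeasure (density ?H (ind ?S)) A = (\<integral>\<^sup>+x. ind ?S x * ind A x \<partial>?H)" by (rule emeasure_density[OF im]) (simp add: A)
		also have "... = (\<integral>\<^sup>+x. ind (?S \<inter> A) x \<partial>?H)" by (rule nn_integral_cong) (simp add: indicator_def)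
		also have "... = emeasure ?H (?S \<inter> A)" by (rule nn_integral_indicator) (use Ss A in simp)
		finally show ?thesis by (simp add: N_def)
	 qed
	 finally show "emeasure \<nu> A <= emeasure N A" .
	qed
 qed
 then have "integral\<^sup>N \<nu> phi <= integral\<^sup>N N phi" by (intro nn_integral_mono_measure) (simp_all add: \<nu>_def N_def)
 moreover have "integral\<^sup>N \<nu> phi = (\<integral>\<^sup>+x\<in>strip eps. phi (land eps x) \<partial>lborel)" unfolding \<nu>_def using phi lm st
	by (subst nn_integral_distr[OF ld]) (simp_all add: nn_integral_density mult.commute)
 moreover have "integral\<^sup>N N phi = ?K * (\<integral>\<^sup>+x. phi x * ind (ball p (2 * r)) x \<partial>surface Om)"
 proof -
	have m: "phi : bmeas (density ?H (ind ?S))" using phi by (simp add: measurable_def)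
	have "integral\<^sup>N N phi = ?K * integral\<^sup>N (density ?H (ind ?S)) phi" unfolding N_def by (rule nn_integral_scale_measure[OF m])
	also have "integral\<^sup>N (density ?H (ind ?S)) phi = (\<integral>\<^sup>+x. ind ?S x * phi x \<partial>?H)"
	proof (rule nn_integral_density)
	 show "ind ?S : bmeas ?H" by (rule borel_measurable_indicator) (simp add: Ss)
	 show "phi : bmeas ?H" using phi by (simp add: measurable_def)
	qed
	also have "... = (\<integral>\<^sup>+x. phi x * ind (ball p (2 * r)) x * ind (frontier Om) x \<partial>?H)" by (rule nn_integral_cong) (auto simp: indicator_def)
	also have "... = (\<integral>\<^sup>+x. phi x * ind (ball p (2 * r)) x \<partial>surface Om)" unfolding surface_def by (subst nn_integral_restrict_space) auto
	finally show ?thesis .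
 qed
 ultimately show ?thesis by simp
qed

text \<open>Fundamental theorem of calculus from x to its landing point, with Cauchy-Schwarz. The
  integral runs over a fixed interval with an indicator instead of stopping at the hitting time, so
  that it can be integrated over x by translation invariance.\<close>

lemma segment_estimate:
 fixes G :: "'a => real"
 assumes G: "smooth_on UNIV G" and x: "x : strip eps" and eps: "0 < eps" "2 * eps / c <= r"
 defines "D \<equiv> %x. fd G (at x) e"
 shows "enn ((G x)^2) <= 2 * enn ((G (land eps x))^2) + enn (2 * (2 * eps / c)) *
	(\<integral>\<^sup>+t\<in>{0..2 * eps / c}. enn ((D (x + t *\<^sub>R e))^2) * ind (Om \<inter> ball p (2 * r)) (x + t *\<^sub>R e) \<partial>lborel)"
proof -
 let ?L = "2 * eps / c"
 define tau where "tau = hit eps x"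
 have tau: "0 < tau" "tau < ?L" using hit(1,2)[OF x eps] by (auto simp: tau_def)
 have Dc: "continuous_on UNIV D"
 proof -
	consider "e : Basis" | "- e : Basis" using direction by blast
	then show ?thesis
	proof cases
	 case 1
	 then show ?thesis unfolding D_def by (intro smooth_on_continuous smooth_on_frechet_derivative G open_UNIV)
	next
	 case 2
	 have "D x = - fd G (at x) (- e)" for x unfolding D_def using linear_neg[OF has_derivative_linear[OF smooth_on_has_derivative[OF open_UNIV G UNIV_I]], of x e] by simp
	 moreover have "continuous_on UNIV (%x. - fd G (at x) (- e))" by (intro continuous_intros smooth_on_continuous smooth_on_frechet_derivative G open_UNIV 2)
	 ultimately show ?thesis by presburger
	qed
 qed
 have der: "((%t. G (x + t *\<^sub>R e)) has_real_derivative D (x + t *\<^sub>R e)) (at t)" for t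
 proof -
	have 1: "((%t. x + t *\<^sub>R e) has_derivative (%h. h *\<^sub>R e)) (at t)" by (auto intro!: derivative_eq_intros)
	have 2: "(G has_derivative fd G (at (x + t *\<^sub>R e))) (at (x + t *\<^sub>R e))" by (rule smooth_on_has_derivative[OF open_UNIV G UNIV_I])
	have "(%h. fd G (at (x + t *\<^sub>R e)) (h *\<^sub>R e)) = (%h. D (x + t *\<^sub>R e) * h)"
	 unfolding D_def using linear_scale[OF has_derivative_linear[OF 2], of _ e] by (simp add: mult.commute)
	with has_derivative_compose[OF 1 2] show ?thesis by (simp add: has_field_derivative_def)
 qed
 have Dl: "continuous_on A (%t. D (x + t *\<^sub>R e))" for A by (intro continuous_on_compose2[OF Dc] continuous_intros) auto
 define f where "f t = ind {0..tau} t * D (x + t *\<^sub>R e)" for t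
 have bound: "EX B. ALL t:{0..tau}. \<bar>D (x + t *\<^sub>R e)\<bar> <= B"
 proof -
	have "compact ((%t. D (x + t *\<^sub>R e)) ` {0..tau})" by (intro compact_continuous_image Dl) auto
	then have "bounded ((%t. D (x + t *\<^sub>R e)) ` {0..tau})" by (rule compact_imp_bounded)
	then show ?thesis unfolding bounded_iff by simp
 qed
 have fm: "f : bmeas borel" unfolding f_def[abs_def] by (intro borel_measurable_times borel_measurable_indicator borel_measurable_continuous_onI[OF Dl]) auto
 obtain B where B: "!!t. t : {0..tau} ==> \<bar>D (x + t *\<^sub>R e)\<bar> <= B" using bound by blast
 have fb: "\<bar>f t\<bar> <= B * ind (cball 0 tau) t" for t
 proof (cases "t : {0..tau}")
	case True
	then show ?thesis using B[of t] by (simp add: f_def)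
 next
	case False
	have "0 <= B" using B[of 0] tau(1) by simp
	then show ?thesis using False by (auto simp: f_def indicator_def)
 qed
 note fs = sqint_bounded_support[OF fm fb]
 have one: "\<bar>ind {0..tau} t :: real\<bar> <= 1 * ind (cball 0 tau) t" for t by (auto simp: indicator_def)
 have isq: "sqint lborel (ind {0..tau} :: real => real)" by (rule sqint_bounded_support(1)[OF _ one]) simp
 have "G (land eps x) - G x = (LBINT t. f t)"
 proof -
	have "has_bochner_integral lborel (%t. D (x + t *\<^sub>R e) * ind {0..tau} t) (G (x + tau *\<^sub>R e) - G (x + 0 *\<^sub>R e))"
	proof (rule has_bochner_integral_FTC_Icc_real)
	 show "isCont (%t. D (x + t *\<^sub>R e)) t" for t using Dl[of UNIV] by (simp add: continuous_on_eq_continuous_at)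
	qed (use tau der in auto)
	then show ?thesis by (simp add: has_bochner_integral_iff f_def land_def tau_def mult.commute)
 qed
 also have "... = (LBINT t. ind {0..tau} t * f t)" by (intro bochner_integral_cong) (auto simp: f_def indicator_def)
 finally have "\<bar>G (land eps x) - G x\<bar> <= l2norm lborel (ind {0..tau} :: real => real) * l2norm lborel f" using l2_Cauchy_Schwarz[OF isq fs(1)] by simp
 then have "(G (land eps x) - G x)^2 <= (l2norm lborel (ind {0..tau} :: real => real) * l2norm lborel f)^2" by (simp add: abs_le_square_iff[symmetric] l2norm_nonneg)
 also have "... = tau * (LBINT t. (f t)^2)"
 proof -
	have "(ind {0..tau} t :: real)^2 = ind {0..tau} t" for t by (simp add: indicator_def)
	then show ?thesis using tau by (simp add: power_mult_distrib l2norm_sq)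
 qed
 also have "... <= ?L * (LBINT t. (f t)^2)" using tau by (intro mult_right_mono) auto
 finally have 1: "(G (land eps x) - G x)^2 <= ?L * (LBINT t. (f t)^2)" .
 have "(G x)^2 <= 2 * (G (land eps x))^2 + 2 * (G (land eps x) - G x)^2"
 proof -
	have "0 <= (2 * G (land eps x) - G x)^2" by simp
	then show ?thesis by (simp add: power2_eq_square algebra_simps)
 qed
 then have le: "(G x)^2 <= 2 * (G (land eps x))^2 + 2 * ?L * (LBINT t. (f t)^2)" using 1 by simp
 have L0: "0 <= 2 * ?L" using eps c_pos by simp
 have "enn ((G x)^2) <= enn (2 * (G (land eps x))^2 + 2 * ?L * (LBINT t. (f t)^2))" by (rule ennreal_leI[OF le])
 also have "... = 2 * enn ((G (land eps x))^2) + enn (2 * ?L) * enn (LBINT t. (f t)^2)"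
 proof -
	have "0 <= 2 * ?L * (LBINT t. (f t)^2)" by (intro mult_nonneg_nonneg L0) simp
	then have "enn (2 * (G (land eps x))^2 + 2 * ?L * (LBINT t. (f t)^2)) =
		enn (2 * (G (land eps x))^2) + enn (2 * ?L * (LBINT t. (f t)^2))" by (intro ennreal_plus) auto
	moreover have "enn (2 * (G (land eps x))^2) = 2 * enn ((G (land eps x))^2)" by (subst ennreal_mult') simp_all
	moreover have "enn (2 * ?L * (LBINT t. (f t)^2)) = enn (2 * ?L) * enn (LBINT t. (f t)^2)" by (rule ennreal_mult'[OF L0])
	ultimately show ?thesis by (simp only:)
 qed
 also have "enn (LBINT t. (f t)^2) = (nni lborel (%t. enn ((f t)^2)))" by (rule nn_integral_eq_integral[symmetric, OF sqint_integrable[OF fs(1)]]) simp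
 also have "... <= (\<integral>\<^sup>+t\<in>{0..?L}. enn ((D (x + t *\<^sub>R e))^2) * ind (Om \<inter> ball p (2 * r)) (x + t *\<^sub>R e) \<partial>lborel)"
 proof (rule nn_integral_mono_AE, rule AE_mp[OF AE_lborel_singleton[of tau]], rule AE_I2, rule impI)
	\<comment> \<open>At time \<open>tau\<close> the point lies on the boundary and not in
	  \<open>Om\<close>; a single time is a null set.\<close>
	fix t assume "t \<noteq> tau"
	show "enn ((f t)^2) <= enn ((D (x + t *\<^sub>R e))^2) * ind (Om \<inter> ball p (2 * r)) (x + t *\<^sub>R e) * ind {0..?L} t"
	proof (cases "t : {0..tau}")
	 case True
	 then have "x + t *\<^sub>R e : Om" using hit(4)[OF x eps, of t] \<open>t \<noteq> tau\<close> by (simp add: tau_def)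
	 moreover have "x + t *\<^sub>R e : ball p (2 * r)" by (rule in_ball_step(1)) (use x True tau eps in "auto simp: strip_def")
	 ultimately show ?thesis using True tau by (simp add: f_def)
	next
	 case False
	 then show ?thesis by (simp add: f_def)
	qed
 qed
 finally show ?thesis by (simp add: add_left_mono mult_left_mono)
qed

lemma direction_derivative:
 assumes "smooth_on UNIV G"
 obtains b sigma where "b : Basis" "abs sigma = 1" "!!G x. smooth_on UNIV G ==>
	fd G (at x) e = sigma * fd G (at x) b"
proof -
 consider "e : Basis" | "- e : Basis" using direction by blast
 then show thesis
 proof cases
	case 1
	then show thesis by (intro that[of e 1]) auto
 next
	case 2
	have "fd G (at x) e = (- 1) * fd G (at x) (- e)" if "smooth_on UNIV G" for G x
	 using linear_neg[OF has_derivative_linear[OF smooth_on_has_derivative[OF open_UNIV that UNIV_I]], of x e] by simp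
	then show thesis by (intro that[of "- e" "-1"] 2) simp_all
 qed
qed

text \<open>Integrated over the strip, the boundary values contribute the width times a surface
  integral. In the derivative term each t gives at most the same full integral, so the length of the
  segments enters twice and the factor is of order eps^2.\<close>

lemma strip_estimate:
 fixes G :: "'a => real"
 assumes G: "smooth_on UNIV G" and eps: "0 < eps" "2 * eps / c <= r"
 shows "(\<integral>\<^sup>+x\<in>strip eps. enn ((G x)^2) \<partial>lborel) <=
	enn (4 * proj_const / c * eps) * (\<integral>\<^sup>+x. enn ((G x)^2) * ind (ball p (2 * r)) x \<partial>surface Om) +
	enn (8 / c^2 * eps^2) * (\<integral>\<^sup>+x\<in>Om. enn ((fd G (at x) e)^2) \<partial>lborel)"
proof -
 let ?L = "2 * eps / c"
 let ?D = "%x. fd G (at x) e"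
 define \<Psi> where "\<Psi> x = enn ((?D x)^2) * ind (Om \<inter> ball p (2 * r)) x" for x
 have L: "0 < ?L" using eps c_pos by simp
 obtain b sigma where b: "b : Basis" "abs sigma = 1" "!!G x. smooth_on UNIV G ==>
	fd G (at x) e = sigma * fd G (at x) b" by (rule direction_derivative[OF G]) blast
 have Dm: "?D : bmeas borel" unfolding b(3)[OF G] by (intro borel_measurable_continuous_onI continuous_intros smooth_on_continuous
		smooth_on_frechet_derivative G b(1) open_UNIV)
 have os: "Om \<inter> ball p (2 * r) : sets borel" using open_domain by auto
 have \<Psi>m [measurable]: "\<Psi> : bmeas borel" unfolding \<Psi>_def[abs_def] using Dm os by measurable
 have st [measurable]: "strip eps : sets borel" using open_strip by auto
 have Gm [measurable]: "G : bmeas borel" by (intro borel_measurable_continuous_onI smooth_on_continuous G)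
 have lm [measurable]: "land eps : bmeas borel" by (rule land_measurable[OF eps])
 have "(\<integral>\<^sup>+x\<in>strip eps. enn ((G x)^2) \<partial>lborel) <=
	 (nni lborel (%x. 2 * (enn ((G (land eps x))^2) * ind (strip eps) x) +
		 enn (2 * ?L) * (nni lborel (%t. \<Psi> (x + t *\<^sub>R e) * ind {0..?L} t))))"
 proof (rule nn_integral_mono)
	fix x
	show "enn ((G x)^2) * ind (strip eps) x <= 2 * (enn ((G (land eps x))^2) * ind (strip eps) x) +
		 enn (2 * ?L) * (nni lborel (%t. \<Psi> (x + t *\<^sub>R e) * ind {0..?L} t))"
	 using segment_estimate[OF G _ eps, of x] by (cases "x : strip eps") (simp_all add: \<Psi>_def)
 qed
 also have "... = 2 * (\<integral>\<^sup>+x\<in>strip eps. enn ((G (land eps x))^2) \<partial>lborel) +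
	 enn (2 * ?L) * (nni lborel (%x. (nni lborel (%t. \<Psi> (x + t *\<^sub>R e) * ind {0..?L} t))))" by (subst nn_integral_add) (auto simp: nn_integral_cmult)
 also have "(nni lborel (%x. (nni lborel (%t. \<Psi> (x + t *\<^sub>R e) * ind {0..?L} t)))) =
	 (nni lborel (%t. (nni lborel (%x. \<Psi> (x + t *\<^sub>R e) * ind {0..?L} t))))" by (rule lborel_pair.Fubini') measurable
 also have "... = (nni lborel (%t. integral\<^sup>N lborel \<Psi> * ind {0..?L} t))"
 proof (rule nn_integral_cong)
	fix t :: real
	have "(nni lborel (%x. \<Psi> (x + t *\<^sub>R e) * ind {0..?L} t)) =
		(nni lborel (%x. \<Psi> (x + t *\<^sub>R e))) * ind {0..?L} t" by (rule nn_integral_multc) measurable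
	then show "(nni lborel (%x. \<Psi> (x + t *\<^sub>R e) * ind {0..?L} t)) = integral\<^sup>N lborel \<Psi> * ind {0..?L} t"
	 by (simp only: nn_integral_lborel_shift[OF \<Psi>m])
 qed
 also have "... = integral\<^sup>N lborel \<Psi> * enn ?L" using L by (subst nn_integral_cmult) auto
 also have "integral\<^sup>N lborel \<Psi> <= (\<integral>\<^sup>+x\<in>Om. enn ((?D x)^2) \<partial>lborel)"
	by (rule nn_integral_mono) (auto simp: \<Psi>_def indicator_def)
 also have "(\<integral>\<^sup>+x\<in>strip eps. enn ((G (land eps x))^2) \<partial>lborel) <=
	 enn (proj_const * ?L) * (\<integral>\<^sup>+x. enn ((G x)^2) * ind (ball p (2 * r)) x \<partial>surface Om)"
	by (rule land_integral_bound[OF eps, of "%x. enn ((G x)^2)"]) measurable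
 finally have le: "(\<integral>\<^sup>+x\<in>strip eps. enn ((G x)^2) \<partial>lborel) <=
	 2 * (enn (proj_const * ?L) * (\<integral>\<^sup>+x. enn ((G x)^2) * ind (ball p (2 * r)) x \<partial>surface Om)) +
	 enn (2 * ?L) * ((\<integral>\<^sup>+x\<in>Om. enn ((?D x)^2) \<partial>lborel) * enn ?L)" by (simp add: add_mono mult_left_mono mult_right_mono)
 have 1: "enn (4 * proj_const / c * eps) = 2 * enn (proj_const * ?L)"
 proof -
	have "4 * proj_const / c * eps = 2 * (proj_const * ?L)" by simp
	then show ?thesis by (simp only:) (subst ennreal_mult', simp_all)
 qed
 have 2: "enn (8 / c^2 * eps^2) = enn (2 * ?L) * enn ?L"
 proof -
	have "8 / c^2 * eps^2 = (2 * ?L) * ?L" by (simp add: power2_eq_square)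
	then show ?thesis using L by (simp only: ennreal_mult'') 
 qed
 show ?thesis using le unfolding 1 2 by (simp only: mult_ac)
qed

end

section \<open>Outward normals\<close>

lemma GDERIV_smooth:
 fixes rho :: "'a::euclidean_space => real"
 assumes "open U" "smooth_on U rho" "x : U"
 shows "GDERIV rho x :> (SUM b:Basis. fd rho (at x) b *\<^sub>R b)"
proof -
 have f: "(rho has_derivative fd rho (at x)) (at x)" by (rule smooth_on_has_derivative[OF assms])
 interpret bounded_linear "fd rho (at x)" using f by (rule has_derivative_bounded_linear)
 have "fd rho (at x) h = h \<bullet> (SUM b:Basis. fd rho (at x) b *\<^sub>R b)" for h
 proof -
	have "fd rho (at x) (SUM b:Basis. (h \<bullet> b) *\<^sub>R b) =
		h \<bullet> (SUM b:Basis. fd rho (at x) b *\<^sub>R b)" by (simp add: sum scale inner_sum_right mult.commute)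
	then show ?thesis by (simp add: euclidean_representation)
 qed
 then have "fd rho (at x) = (%h. h \<bullet> (SUM b:Basis. fd rho (at x) b *\<^sub>R b))" by (rule ext)
 with f show ?thesis unfolding gderiv_def by metis
qed

text \<open>If the normals differed, a small step along n2 - n1 would decrease \<open>rho1\<close>
  and increase \<open>rho2\<close>; the point reached would lie inside \<open>Om\<close> by one
  function and outside by the other.\<close>

lemma unit_normal_unique:
 fixes Om :: "'a::euclidean_space set"
 assumes 1: "boundary_defining Om x U1 rho1" "c1 > 0" "GDERIV rho1 x :> c1 *\<^sub>R n1" "norm n1 = 1"
	and 2: "boundary_defining Om x U2 rho2" "c2 > 0" "GDERIV rho2 x :> c2 *\<^sub>R n2" "norm n2 = 1"
	and x: "x : frontier Om"
 shows "n1 = n2"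
proof (rule ccontr)
 assume "n1 \<noteq> n2"
 define \<xi> where "\<xi> = n2 - n1"
 have nn: "n1 \<bullet> n1 = 1" "n2 \<bullet> n2 = 1" using 1(4) 2(4) by (simp_all add: dot_square_norm)
 have "0 < (n2 - n1) \<bullet> (n2 - n1)" using \<open>n1 \<noteq> n2\<close> by simp
 then have lt: "n1 \<bullet> n2 < 1" using nn by (simp add: inner_diff_left inner_diff_right inner_commute)
 have line: "((%t. x + t *\<^sub>R \<xi>) has_derivative (%h. h *\<^sub>R \<xi>)) (at 0)" by (auto intro!: derivative_eq_intros)
 have der: "((%t. rho (x + t *\<^sub>R \<xi>)) has_real_derivative (\<xi> \<bullet> v)) (at 0)" if "GDERIV rho x :> v" for rho v
 proof -
	have "(rho has_derivative (%h. h \<bullet> v)) (at (x + 0 *\<^sub>R \<xi>))" using that by (simp add: gderiv_def)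
	from has_derivative_compose[OF line this] show ?thesis by (simp add: has_field_derivative_def mult_commute_abs)
 qed
 have z: "rho1 x = 0" "rho2 x = 0" using x 1(1) 2(1) by (auto simp: boundary_defining_def)
 have "\<xi> \<bullet> (c1 *\<^sub>R n1) = c1 * (n1 \<bullet> n2 - 1)" by (simp add: \<xi>_def inner_diff_left inner_diff_right inner_commute nn)
 also have "... < 0" using 1(2) lt by (simp add: mult_pos_neg)
 finally obtain d1 where d1: "d1 > 0" "!!h. 0 < h ==> h < d1 ==> rho1 (x + h *\<^sub>R \<xi>) < 0" using DERIV_neg_dec_right[OF der[OF 1(3)]] z by auto
 have "\<xi> \<bullet> (c2 *\<^sub>R n2) = c2 * (1 - n1 \<bullet> n2)" by (simp add: \<xi>_def inner_diff_left nn)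
 then have "\<xi> \<bullet> (c2 *\<^sub>R n2) > 0" using 2(2) lt by simp
 then obtain d2 where d2: "d2 > 0" "!!h. 0 < h ==> h < d2 ==> rho2 (x + h *\<^sub>R \<xi>) > 0" using DERIV_pos_inc_right[OF der[OF 2(3)]] z by auto
 have "open (U1 \<inter> U2)" "x : U1 \<inter> U2" using 1(1) 2(1) by (auto simp: boundary_defining_def)
 then obtain d3 where d3: "d3 > 0" "ball x d3 \<subseteq> U1 \<inter> U2" using open_contains_ball by blast
 define t where "t = min (min (d1 / 2) (d2 / 2)) (d3 / (2 * (norm \<xi> + 1)))"
 have t: "0 < t" "t < d1" "t < d2" "t <= d3 / (2 * (norm \<xi> + 1))" using d1(1) d2(1) d3(1) by (auto simp: t_def add_nonneg_pos)
 have "t * norm \<xi> < d3"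
 proof -
	have "t * norm \<xi> <= d3 / (2 * (norm \<xi> + 1)) * norm \<xi>" using t(4) by (intro mult_right_mono) auto
	also have "... = d3 * (norm \<xi> / (2 * (norm \<xi> + 1)))" by simp
	also have "... < d3 * 1"
	proof (rule mult_strict_left_mono[OF _ d3(1)])
	 have "s / (2 * (s + 1)) < 1" if "0 <= s" for s :: real using that by (simp add: field_simps)
	 from this[OF norm_ge_zero[of \<xi>]] show "norm \<xi> / (2 * (norm \<xi> + 1)) < 1" .
	qed
	finally show ?thesis by simp
 qed
 then have "x + t *\<^sub>R \<xi> : U1 \<inter> U2" using d3(2) t by (auto simp: dist_norm subset_iff)
 then have y: "x + t *\<^sub>R \<xi> : U1" "x + t *\<^sub>R \<xi> : U2" by blast+
 have "Om \<inter> U1 = {x : U1. rho1 x < 0}" "Om \<inter> U2 = {x : U2. rho2 x < 0}" using 1(1) 2(1) unfolding boundary_defining_def by blast+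
 then have "x + t *\<^sub>R \<xi> : Om \<longleftrightarrow> rho1 (x + t *\<^sub>R \<xi>) < 0" "x + t *\<^sub>R \<xi> : Om \<longleftrightarrow> rho2 (x + t *\<^sub>R \<xi>) < 0"
	using y by blast+
 then show False using d1(2)[OF t(1,2)] d2(2)[OF t(1,3)] by linarith
qed

text \<open>Proportionality is all that matters: a field with vanishing normal component is
  orthogonal to the gradient of any local defining function, so the trace condition can be expressed
  without the normal.\<close>

lemma outward_normal_gradient:
 fixes Om :: "'a::euclidean_space set"
 assumes rho: "boundary_defining Om x U rho" and x: "x : frontier Om"
 obtains k where "!!b. b : Basis ==> fd rho (at x) b = k * (outward_normal Om x \<bullet> b)"
proof -
 define v where "v = (SUM b:Basis. fd rho (at x) b *\<^sub>R b)"
 have v: "GDERIV rho x :> v" unfolding v_def using rho by (intro GDERIV_smooth[of U]) (auto simp: boundary_defining_def)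
 have vb: "v \<bullet> b = fd rho (at x) b" if "b : Basis" for b using that by (simp add: v_def)
 have "v \<noteq> 0"
 proof
	assume "v = 0"
	then have "fd rho (at x) = (%_. 0)" using v frechet_derivative_at[of rho "%h. h \<bullet> v" x] by (simp add: gderiv_def)
	then show False using rho by (auto simp: boundary_defining_def)
 qed
 define n where "n = (1 / norm v) *\<^sub>R v"
 have n: "norm n = 1" "v = norm v *\<^sub>R n" using \<open>v \<noteq> 0\<close> by (auto simp: n_def)
 have "outward_normal Om x = n" unfolding outward_normal_def
 proof (rule the_equality)
	show "norm n = 1 & (EX U rho c. boundary_defining Om x U rho & c > 0 & GDERIV rho x :> c *\<^sub>R n)"
	 using n rho v \<open>v \<noteq> 0\<close> by (metis zero_less_norm_iff)
	fix n' assume "norm n' = 1 & (EX U rho c. boundary_defining Om x U rho & c > 0 & GDERIV rho x :> c *\<^sub>R n')"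
	then obtain U' rho' c' where n': "norm n' = 1" "boundary_defining Om x U' rho'" "c' > 0" "GDERIV rho' x :> c' *\<^sub>R n'" by blast
	show "n' = n" by (rule unit_normal_unique[OF n'(2-4,1) rho _ _ n(1) x, of "norm v"]) (use v n \<open>v \<noteq> 0\<close> in auto)
 qed
 then have "fd rho (at x) b = norm v * (outward_normal Om x \<bullet> b)" if "b : Basis" for b using vb[OF that] n(2) by (metis inner_scaleR_left)
 then show ?thesis by (rule that)
qed

section \<open>Green's formula\<close>

lemma sqint_continuous:
 fixes f :: "'a::euclidean_space => real"
 assumes "continuous_on UNIV f" "open Om" "bounded Om"
 shows "sqint (leb Om) f"
proof -
 obtain R where "ALL x:Om. norm x <= R" using assms(3) unfolding bounded_iff by blast
 then have R: "Om \<subseteq> cball 0 R" by auto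
 have "compact (f ` cball 0 R)" by (intro compact_continuous_image continuous_on_subset[OF assms(1)]) auto
 then have "bounded (f ` cball 0 R)" by (rule compact_imp_bounded)
 then obtain B where "ALL y:f ` cball 0 R. norm y <= B" unfolding bounded_iff by blast
 then have B: "\<bar>f x\<bar> <= B" if "x : cball 0 R" for x using that by simp
 interpret finite_measure "leb Om" using assms by (intro finite_measure_lebesgue_on bounded_set_imp_lmeasurable) auto
 have m: "f : bmeas (leb Om)" by (intro borel_measurable_lebesgue_on borel_measurable_continuous_onI assms)
 have "integrable (leb Om) (%x. (f x)^2)"
 proof (rule integrable_const_bound[of _ "B^2"])
	have "(f x)^2 <= B^2" if "x : Om" for x using B[of x] R that by (auto simp: abs_le_square_iff[symmetric])
	then show "AE x in leb Om. norm ((f x)^2) <= B^2" by (intro AE_I2) simp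
 qed (use m in simp)
 with m show ?thesis by (simp add: sqint_def)
qed

lemma smooth_step_derivative_bound:
 obtains C where "C > 0" "!!t. \<bar>fd smooth_step (at t) 1\<bar> <= C"
	"!!t. t < 1 \<or> t > 2 ==> fd smooth_step (at t) 1 = 0"
proof -
 let ?D = "%t. fd smooth_step (at t) 1"
 have z: "?D t = 0" if "t < 1 \<or> t > 2" for t
 proof (cases "t < 1")
	case True
	have "fd smooth_step (at t) = fd (%_. 1) (at t)" by (rule frechet_derivative_cong_open[of "{..<1}"]) (use True smooth_step_eq in auto)
	then show ?thesis by simp
 next
	case False
	have "fd smooth_step (at t) = fd (%_. 0) (at t)" by (rule frechet_derivative_cong_open[of "{2<..}"]) (use False that smooth_step_eq in auto)
	then show ?thesis by simp
 qed
 have c: "continuous_on UNIV ?D" by (intro smooth_on_continuous smooth_on_frechet_derivative smooth_step_smooth) auto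
 have 0: "?D t = 0" if "norm t > 2" for t using z[of t] that by (auto simp: abs_if split: if_splits)
 obtain C where "C > 0" "!!t. \<bar>?D t\<bar> <= C" by (rule continuous_compact_support_bounded[OF c 0]) (assumption, (rule that; assumption))
 then show ?thesis by (intro that[of C] z)
qed

lemma frechet_derivative_compose_step:
 fixes f :: "'a::euclidean_space => real"
 assumes "(f has_derivative f') (at x)"
 shows "((%x. smooth_step (f x)) has_derivative
	(%h. fd smooth_step (at (f x)) 1 * f' h)) (at x)"
proof -
 have g: "(smooth_step has_derivative fd smooth_step (at (f x))) (at (f x))" by (rule smooth_on_has_derivative[OF open_UNIV smooth_step_smooth UNIV_I])
 have eq: "fd smooth_step (at (f x)) t = fd smooth_step (at (f x)) 1 * t" for t using linear_scale[OF has_derivative_linear[OF g], of t 1] by (simp add: mult.commute)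
 show ?thesis using has_derivative_compose[OF assms g] by (subst eq[symmetric])
qed

text \<open>An H1 function together with explicit versions \<open>g\<close> of its weak derivatives.
  Unlike \<open>wderiv\<close>, these can be updated by the product rule when \<open>w\<close> is
  multiplied by a cutoff.\<close>

definition admissible :: "'a::euclidean_space set => ('a => real) => ('a => 'a => real) => bool" where
 "admissible Om w g \<longleftrightarrow> sqint (leb Om) w &
	 (ALL b:Basis. hwd Om b w (g b) & sqint (leb Om) (g b))"

text \<open>The integral of the divergence of w grad u, with \<open>g\<close> as the gradient of
  \<open>w\<close>. That it vanishes is Green's formula without boundary term.\<close>

definition green_form ::
	"'a::euclidean_space set => ('a => real) => ('a => real) => ('a => 'a => real) => real" where
 "green_form Om u w g =
	 (LINT x|leb Om. lap Om u x * w x + (SUM b:Basis. wderiv Om b u x * g b x))"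

lemma sqint_continuous_mult:
 fixes f h :: "'a::euclidean_space => real"
 assumes "bounded Om" "continuous_on UNIV h" "sqint (leb Om) f"
 shows "sqint (leb Om) (%x. h x * f x)"
proof -
 obtain R where "ALL x:Om. norm x <= R" using assms(1) unfolding bounded_iff by blast
 then have R: "Om \<subseteq> cball 0 R" by auto
 have "compact (h ` cball 0 R)" by (intro compact_continuous_image continuous_on_subset[OF assms(2)]) auto
 then have "bounded (h ` cball 0 R)" by (rule compact_imp_bounded)
 then obtain B where "ALL y:h ` cball 0 R. norm y <= B" unfolding bounded_iff by blast
 then have B: "\<bar>h x\<bar> <= B" if "x : Om" for x using that R by auto
 show ?thesis by (rule sqint_bounded_mult[OF assms(3)]) (use B assms(2) in "auto intro: borel_measurable_lebesgue_on borel_measurable_continuous_onI")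
qed

lemma admissible_mult:
 fixes w h :: "'a::euclidean_space => real"
 assumes "open Om" "bounded Om" "smooth_on UNIV h" "admissible Om w g"
 shows "admissible Om (%x. h x * w x) (%b x. h x * g b x + fd h (at x) b * w x)" using assms(4) unfolding admissible_def
 by (auto intro!: has_weak_deriv_mult_smooth sqint_add sqint_continuous_mult assms smooth_on_continuous
	 smooth_on_frechet_derivative)

lemma green_form_integrable:
 assumes Om: "open Om" and u: "u : H2 Om" and w: "admissible Om w g"
 shows "integrable (leb Om) (%x. lap Om u x * w x)"
	and "b : Basis ==> integrable (leb Om) (%x. wderiv Om b u x * g b x)"
	and "integrable (leb Om) (%x. SUM b:Basis. wderiv Om b u x * g b x)"
proof -
 show 1: "integrable (leb Om) (%x. lap Om u x * w x)" using w by (intro sqint_mult_integrable H2_sqint(3)[OF Om u]) (simp add: admissible_def)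
 show 2: "integrable (leb Om) (%x. wderiv Om b u x * g b x)" if "b : Basis" for b
	using w that by (intro sqint_mult_integrable H1_sqint(1)[OF Om H2_sqint(2)[OF Om u that] that]) (simp add: admissible_def)
 show "integrable (leb Om) (%x. SUM b:Basis. wderiv Om b u x * g b x)" by (intro bochner_integrable_sum 2)
qed

lemma green_form_compact:
 fixes w :: "'a::euclidean_space => real"
 assumes Om: "open Om" and u: "u : H2 Om" and w: "admissible Om w g"
	and K: "compact K" "K \<subseteq> Om" "!!x. x : Om ==> x ~: K ==> w x = 0"
	 "!!x b. x : Om ==> x ~: K ==> b : Basis ==> g b x = 0"
 shows "green_form Om u w g = 0"
proof -
 have dH: "wderiv Om b u : H1 Om" if "b : Basis" for b by (rule H2_sqint(2)[OF Om u that])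
 have ibp: "(LINT x|leb Om. wderiv Om b u x * g b x) = - (LINT x|leb Om. wderiv Om b (wderiv Om b u) x * w x)"
	if b: "b : Basis" for b by (rule weak_integration_by_parts[OF Om b H1_sqint(3,1,2)[OF Om dH[OF b] b] _ _ _ K(1,2)]) (use w b K(3,4) in "auto simp: admissible_def")
 have i: "integrable (leb Om) (%x. wderiv Om b (wderiv Om b u) x * w x)" if "b : Basis" for b
	using w by (intro sqint_mult_integrable H1_sqint(2)[OF Om dH[OF that] that]) (simp add: admissible_def)
 have "(LINT x|leb Om. lap Om u x * w x) =
	 (SUM b:Basis. (LINT x|leb Om. wderiv Om b (wderiv Om b u) x * w x))" unfolding wlaplacian_def sum_distrib_right by (rule bochner_integral_sum[OF i])
 moreover have "(\<integral>x. (SUM b:Basis. wderiv Om b u x * g b x) \<partial>leb Om) =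
	 (SUM b:Basis. (LINT x|leb Om. wderiv Om b u x * g b x))" by (rule bochner_integral_sum[OF green_form_integrable(2)[OF Om u w]])
 moreover have "green_form Om u w g = (LINT x|leb Om. lap Om u x * w x) +
	 (\<integral>x. (SUM b:Basis. wderiv Om b u x * g b x) \<partial>leb Om)" unfolding green_form_def
	by (rule bochner_integral_add[OF green_form_integrable(1,3)[OF Om u w]])
 ultimately show ?thesis by (simp add: ibp sum_negf)
qed

section \<open>Green's formula for functions supported near a boundary point\<close>

context boundary_chart
begin

lemma rho_smooth_extension:
 obtains q where "!!b. b : Basis ==> smooth_on UNIV (q b)"
	"!!b x. b : Basis ==> norm (x - p) <= 2 * r ==> q b x = fd rho (at x) b"
	"!!b x. b : Basis ==> norm (x - p) >= 4 * r ==> q b x = 0"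
proof -
 have "0 < 2 * r" using r_pos by simp
 obtain zeta :: "'a => real" where zeta: "smooth_on UNIV zeta" "!!x. 0 <= zeta x" "!!x. zeta x <= 1"
	"!!x. norm (x - p) <= 2 * r ==> zeta x = 1" "!!x. norm (x - p) >= 2 * (2 * r) ==> zeta x = 0" by (rule smooth_bump_exists[OF \<open>0 < 2 * r\<close>, of p]) blast
 show ?thesis
 proof (rule that[of "%b x. zeta x * fd rho (at x) b"])
	fix b :: 'a assume b: "b : Basis"
	show "smooth_on UNIV (%x. zeta x * fd rho (at x) b)"
	proof (rule smooth_on_extend_zero[OF open_U _ closed_cball[of p "4 * r"] ball_U])
	 show "smooth_on U (%x. zeta x * fd rho (at x) b)" by (intro smooth_on_mult open_U smooth_on_frechet_derivative smooth_rho b smooth_on_subset[OF zeta(1)]) auto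
	 show "zeta x * fd rho (at x) b = 0" if "x ~: cball p (4 * r)" for x using zeta(5)[of x] that by (simp add: dist_norm norm_minus_commute)
	qed
 qed (use zeta in auto)
qed

text \<open>The argument of the step function is 1 at \<open>rho = - eps\<close> and 2 at
  \<open>rho = - eps / 2\<close>: near \<open>p\<close> the cutoff is 1 deep inside, 0 close to the
  boundary, and its gradient is of order 1/eps in between. A bump around \<open>p\<close> makes it
  global.\<close>

lemma strip_cutoff:
 assumes eps: "eps > 0"
 obtains S where "smooth_on UNIV S" "!!x. \<bar>S x\<bar> <= 1"
	"!!x. norm (x - p) <= r / 2 ==> S x = smooth_step (2 * rho x / eps + 3)"
	"!!x b. norm (x - p) < r / 2 ==> b : Basis ==> fd S (at x) b =
	  fd smooth_step (at (2 * rho x / eps + 3)) 1 * (2 / eps * fd rho (at x) b)"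
proof -
 have "0 < r / 2" using r_pos by simp
 obtain zeta :: "'a => real" where zeta: "smooth_on UNIV zeta" "!!x. 0 <= zeta x" "!!x. zeta x <= 1"
	"!!x. norm (x - p) <= r / 2 ==> zeta x = 1" "!!x. norm (x - p) >= 2 * (r / 2) ==> zeta x = 0" by (rule smooth_bump_exists[OF \<open>0 < r / 2\<close>, of p]) blast
 define S where "S x = zeta x * smooth_step (3 + 2 / eps * rho x)" for x
 have arg: "2 * rho x / eps + 3 = 3 + 2 / eps * rho x" for x by simp
 have subU: "cball p r \<subseteq> U" using ball_U subset_cball[of r "4 * r" p] r_pos by auto
 have inU: "x : U" if "norm (x - p) <= r / 2" for x using that subU r_pos by (auto simp: dist_norm norm_minus_commute subset_iff)
 show ?thesis
 proof (rule that[of S])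
	show "smooth_on UNIV S"
	proof (rule smooth_on_extend_zero[OF open_U _ closed_cball[of p r] subU])
	 show "smooth_on U S" unfolding S_def[abs_def] by (intro smooth_on_mult open_U smooth_on_subset[OF zeta(1)]
			smooth_on_compose_real[OF open_U open_UNIV _ smooth_step_smooth] smooth_on_add
			smooth_on_const smooth_rho) auto
	 show "S x = 0" if "x ~: cball p r" for x using zeta(5)[of x] that by (simp add: dist_norm norm_minus_commute S_def)
	qed
	show "\<bar>S x\<bar> <= 1" for x unfolding S_def using zeta(2,3)[of x] smooth_step_bounds by (simp add: abs_mult mult_le_one)
	show "S x = smooth_step (2 * rho x / eps + 3)" if "norm (x - p) <= r / 2" for x unfolding arg by (simp add: S_def zeta(4)[OF that])
	fix x b :: 'a assume x: "norm (x - p) < r / 2" and b: "b : Basis"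
	have "(rho has_derivative fd rho (at x)) (at x)" by (rule smooth_on_has_derivative[OF open_U smooth_rho inU]) (use x in simp)
	then have "((%x. 3 + 2 / eps * rho x) has_derivative (%h. 2 / eps * fd rho (at x) h)) (at x)" using eps by (auto intro!: derivative_eq_intros)
	from frechet_derivative_compose_step[OF this]
	have "((%x. smooth_step (3 + 2 / eps * rho x)) has_derivative
		(%h. fd smooth_step (at (3 + 2 / eps * rho x)) 1 * (2 / eps * fd rho (at x) h))) (at x)" .
	then have "(S has_derivative
		(%h. fd smooth_step (at (3 + 2 / eps * rho x)) 1 * (2 / eps * fd rho (at x) h))) (at x)" by (rule has_derivative_transform_within_open[of _ _ _ _ "ball p (r / 2)"])
		(use x zeta(4) in "auto simp: dist_norm norm_minus_commute S_def")
	from frechet_derivative_at[OF this, symmetric] show "fd S (at x) b =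
	  fd smooth_step (at (2 * rho x / eps + 3)) 1 * (2 / eps * fd rho (at x) b)" unfolding arg by simp
 qed
qed

text \<open>Hardy type estimate: a function in \<open>H\<^sup>1\<close> with zero trace, here the normal derivative, has
  square integral of order \<open>eps\<^sup>2\<close> on the strip of width \<open>eps\<close>.\<close>

lemma normal_derivative_strip:
 assumes bd: "bounded Om" and u: "u : H2N Om"
	and q: "!!b. b : Basis ==> smooth_on UNIV (q b)"
	"!!b x. b : Basis ==> norm (x - p) <= 2 * r ==> q b x = fd rho (at x) b"
	"!!b x. b : Basis ==> norm (x - p) >= 4 * r ==> q b x = 0"
 defines "Fn \<equiv> %x. SUM b:Basis. wderiv Om b u x * q b x"
 obtains C where "C >= 0" "!!eps. 0 < eps ==> 2 * eps / c <= r ==>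
	l2norm (leb Om) (%x. ind (strip eps) x * Fn x) <= C * eps"
proof -
 let ?M = "leb Om"
 have u2: "u : H2 Om" using u by (simp add: H2N_def)
 define a where "a b = wderiv Om b u" for b
 have aH: "a b : H1 Om" if "b : Basis" for b unfolding a_def by (rule H2_sqint(2)[OF open_domain u2 that])
 have as: "sqint ?M (a b)" if "b : Basis" for b by (rule H1_sqint(1)[OF open_domain aH[OF that] that])
 obtain h :: "'a => 'a => real" where tr: "!!b. b : Basis ==> has_trace Om (a b) (h b)"
	and hn: "AE x in surface Om. (SUM b:Basis. h b x * (outward_normal Om x \<bullet> b)) = 0" using u unfolding H2N_def a_def by blast
 have "ALL b:Basis. EX U :: nat => 'a => real. (ALL k. smooth_on UNIV (U k)) &
		(%k. H1norm Om (%x. U k x - a b x)) ----> 0 &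
		(%k. \<integral>\<^sup>+x. enn ((U k x - h b x)^2) \<partial>surface Om) ----> 0" using tr unfolding has_trace_def by blast
 from bchoice[OF this] obtain V where V: "ALL b:Basis. (ALL k. smooth_on UNIV (V b k :: 'a => real)) &
		(%k::nat. H1norm Om (%x. V b k x - a b x)) ----> 0 &
		(%k. \<integral>\<^sup>+x. enn ((V b k x - h b x)^2) \<partial>surface Om) ----> 0" by (elim exE)
 have Vs: "smooth_on UNIV (V b k)" and VH: "(%k. H1norm Om (%x. V b k x - a b x)) ----> 0"
	and VT: "(%k. \<integral>\<^sup>+x. enn ((V b k x - h b x)^2) \<partial>surface Om) ----> 0" if "b : Basis" for b k using V that by blast+
 have hm: "h b : bmeas (surface Om)" if "b : Basis" for b using tr[OF that] by (simp add: has_trace_def)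
 have Vsq: "sqint ?M (V b k)" if "b : Basis" for b k by (intro sqint_continuous smooth_on_continuous Vs that open_domain bd)
 have VDsq: "sqint ?M (%x. fd (V b k) (at x) i)" if "b : Basis" "i : Basis" for b k i
	by (intro sqint_continuous smooth_on_continuous smooth_on_frechet_derivative Vs that open_domain bd open_UNIV)
 have H1le: "l2norm ?M w <= H1norm Om w" "i : Basis ==> l2norm ?M (wderiv Om i w) <= H1norm Om w" for w i
 proof -
	have s: "0 <= (SUM b:Basis. (L2norm Om (wderiv Om b w))^2)" by (intro sum_nonneg) simp
	have "(l2norm ?M w)^2 <= (H1norm Om w)^2" using s by (simp add: H1norm_def L2norm_eq)
	then show "l2norm ?M w <= H1norm Om w" by (rule power2_le_imp_le) (use s in "simp add: H1norm_def")
	assume i: "i : Basis"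
	have "(l2norm ?M (wderiv Om i w))^2 <= (SUM b:Basis. (l2norm ?M (wderiv Om b w))^2)" by (rule member_le_sum[OF i]) auto
	also have "... <= (H1norm Om w)^2" using s by (simp add: H1norm_def L2norm_eq)
	finally show "l2norm ?M (wderiv Om i w) <= H1norm Om w" by (rule power2_le_imp_le) (use s in "simp add: H1norm_def")
 qed
 have lim0: "(%k. l2norm ?M (%x. V b k x - a b x)) ----> 0" if b: "b : Basis" for b
	by (rule tendsto_sandwich[OF _ _ tendsto_const VH[OF b]]) (auto simp: l2norm_nonneg H1le)
 have lim1: "(%k. l2norm ?M (%x. fd (V b k) (at x) i - wderiv Om i (a b) x)) ----> 0"
	if b: "b : Basis" and i: "i : Basis" for b i
 proof (rule tendsto_sandwich[OF _ _ tendsto_const VH[OF b]])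
	have "l2norm ?M (%x. fd (V b k) (at x) i - wderiv Om i (a b) x) <=
		H1norm Om (%x. V b k x - a b x)" for k
	proof -
	 note H1_sqint(3)[OF open_domain aH[OF b] i]
	 then have wd: "hwd Om i (%x. V b k x - a b x)
		 (%x. fd (V b k) (at x) i - wderiv Om i (a b) x)" by (intro has_weak_deriv_diff open_domain i smooth_has_weak_deriv Vs b)
	 have "l2norm ?M (%x. fd (V b k) (at x) i - wderiv Om i (a b) x) =
		 l2norm ?M (wderiv Om i (%x. V b k x - a b x))"
	 proof (rule l2norm_cong_AE)
		show "(%x. fd (V b k) (at x) i - wderiv Om i (a b) x) : bmeas ?M" by (intro sqint_measurable sqint_diff VDsq H1_sqint(2) open_domain aH b i)
		show "wderiv Om i (%x. V b k x - a b x) : bmeas ?M" by (rule wderiv_measurable[OF open_domain wd])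
		show "AE x in ?M. fd (V b k) (at x) i - wderiv Om i (a b) x =
			wderiv Om i (%x. V b k x - a b x) x" using wderiv_AE[OF open_domain wd] by eventually_elim simp
	 qed
	 then show ?thesis using H1le(2)[OF i] by simp
	qed
	then show "\<forall>\<^sub>F k in sequentially. l2norm ?M (%x. fd (V b k) (at x) i - wderiv Om i (a b) x) <=
		H1norm Om (%x. V b k x - a b x)" by simp
 qed (simp add: l2norm_nonneg)
 \<comment> \<open>Smooth approximations of \<open>Fn\<close>, which near \<open>p\<close> is the
   derivative of \<open>u\<close> in the direction of the gradient of \<open>rho\<close>. The strip
   estimate applies to these.\<close>
 define G where "G k x = (SUM b:Basis. V b k x * q b x)" for k x
 have Gs: "smooth_on UNIV (G k)" for k unfolding G_def[abs_def] by (intro smooth_on_sum smooth_on_mult Vs q open_UNIV)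
 obtain i sigma where i: "i : Basis" "abs sigma = 1" "!!G x. smooth_on UNIV G ==>
	fd G (at x) e = sigma * fd G (at x) i" by (rule direction_derivative[OF smooth_on_const[OF open_UNIV, of 0]]) blast
 have "EX Q. Q > 0 & (ALL b:Basis. ALL x. \<bar>q b x\<bar> <= Q & \<bar>fd (q b) (at x) i\<bar> <= Q)"
 proof -
	have "EX Q>0. ALL x. \<bar>q b x\<bar> <= Q & \<bar>fd (q b) (at x) i\<bar> <= Q" if b: "b : Basis" for b
	proof -
	 have 0: "q b x = 0" if "norm x > norm p + 4 * r" for x by (rule q(3)[OF b]) (use norm_triangle_ineq2[of x p] that in linarith)
	 have 1: "fd (q b) (at x) i = 0" if "norm x > norm p + 4 * r" for x by (rule frechet_derivative_support[OF 0 that])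
	 obtain C0 where C0: "C0 > 0" "!!x. \<bar>q b x\<bar> <= C0" by (rule continuous_compact_support_bounded[OF smooth_on_continuous[OF q(1)[OF b]] 0])
		 (assumption, (rule that; assumption))
	 obtain C1 where C1: "C1 > 0" "!!x. \<bar>fd (q b) (at x) i\<bar> <= C1" by (rule continuous_compact_support_bounded[OF smooth_on_continuous[OF
				smooth_on_frechet_derivative[OF open_UNIV q(1)[OF b] i(1)]] 1])
		 (assumption, (rule that; assumption))
	 show ?thesis
	 proof (intro exI[of _ "max C0 C1"] conjI allI)
		show "0 < max C0 C1" using C0(1) by simp
		show "\<bar>q b x\<bar> <= max C0 C1" for x using C0(2)[of x] by simp
		show "\<bar>fd (q b) (at x) i\<bar> <= max C0 C1" for x using C1(2)[of x] by simp
	 qed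
	qed
	then obtain Q where Q: "!!b. b : Basis ==> Q b > 0"
	 "!!b x. b : Basis ==> \<bar>q b x\<bar> <= Q b & \<bar>fd (q b) (at x) i\<bar> <= Q b" by metis
	have "Q b <= sum Q Basis" if "b : Basis" for b by (rule member_le_sum[OF that]) (use Q(1) in "auto intro: less_imp_le")
	moreover have "0 < sum Q Basis" by (rule sum_pos) (use Q(1) in auto)
	ultimately show ?thesis using Q(2) by (intro exI[of _ "sum Q Basis"]) (meson order_trans)
 qed
 then obtain Q where Q: "Q > 0" "!!b x. b : Basis ==> \<bar>q b x\<bar> <= Q"
	"!!b x. b : Basis ==> \<bar>fd (q b) (at x) i\<bar> <= Q" by blast
 have qm: "q b : bmeas ?M" if "b : Basis" for b by (intro borel_measurable_lebesgue_on borel_measurable_continuous_onI smooth_on_continuous q that)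
 have Fs: "sqint ?M Fn"
 proof -
	have "sqint ?M (%x. q b x * a b x)" if b: "b : Basis" for b by (rule sqint_bounded_mult[OF as[OF b] qm[OF b] Q(2)[OF b]])
	then have "sqint ?M (%x. SUM b:Basis. q b x * a b x)" by (rule sqint_sum)
	then show ?thesis by (simp add: Fn_def a_def mult.commute)
 qed
 have Gsq: "sqint ?M (G k)" for k by (intro sqint_continuous smooth_on_continuous Gs open_domain bd)
 have lsum: "l2norm ?M (%x. SUM b:I. f b x) <= (SUM b:I. l2norm ?M (f b))"
	if "finite I" "!!b. b : I ==> sqint ?M (f b)" for I :: "'a set" and f using that
 proof (induction I rule: finite_induct)
	case empty then show ?case by (simp add: l2norm_def)
 next
	case (insert b I)
	have "l2norm ?M (%x. f b x + (SUM b:I. f b x)) <= l2norm ?M (f b) + l2norm ?M (%x. SUM b:I. f b x)" using insert by (intro l2norm_triangle sqint_sum) auto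
	then show ?case using insert by simp
 qed
 have lmult: "l2norm ?M (%x. g x * f x) <= K * l2norm ?M f"
	if f: "sqint ?M f" and g: "g : bmeas ?M" "!!x. \<bar>g x\<bar> <= K" for f g K
 proof -
	have K: "K >= 0" using g(2)[of undefined] by linarith
	have "(LINT x|?M. (g x * f x)^2) <= (LINT x|?M. K^2 * (f x)^2)"
	proof (rule integral_mono)
	 show "integrable ?M (%x. (g x * f x)^2)" by (intro sqint_integrable sqint_bounded_mult[OF f g])
	 show "integrable ?M (%x. K^2 * (f x)^2)" using sqint_integrable[OF f] by simp
	 show "(g x * f x)^2 <= K^2 * (f x)^2" for x
	 proof -
		have "\<bar>g x\<bar>\<^sup>2 <= K^2" by (intro power_mono g(2)) simp
		then show ?thesis by (simp add: power_mult_distrib mult_right_mono)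
	 qed
	qed
	then have "l2norm ?M (%x. g x * f x) <= sqrt (K^2 * (LINT x|?M. (f x)^2))" by (simp add: l2norm_def)
	then show ?thesis using K by (simp add: l2norm_def real_sqrt_mult)
 qed
 have limG: "(%k. l2norm ?M (%x. G k x - Fn x)) ----> 0"
 proof (rule tendsto_sandwich[OF _ _ tendsto_const])
	have "l2norm ?M (%x. G k x - Fn x) <= (SUM b:Basis. Q * l2norm ?M (%x. V b k x - a b x))" for k
	proof -
	 have "(%x. G k x - Fn x) = (%x. SUM b:Basis. q b x * (V b k x - a b x))" by (simp add: G_def Fn_def a_def sum_subtractf[symmetric] algebra_simps)
	 then have "l2norm ?M (%x. G k x - Fn x) <= (SUM b:Basis. l2norm ?M (%x. q b x * (V b k x - a b x)))"
		using lsum[OF finite_Basis, of "%b x. q b x * (V b k x - a b x)"]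
		 sqint_bounded_mult[OF sqint_diff[OF Vsq as] qm Q(2)] by simp
	 also have "... <= (SUM b:Basis. Q * l2norm ?M (%x. V b k x - a b x))" by (intro sum_mono lmult sqint_diff Vsq as qm Q(2))
	 finally show ?thesis .
	qed
	then show "\<forall>\<^sub>F k in sequentially. l2norm ?M (%x. G k x - Fn x) <= (SUM b:Basis. Q * l2norm ?M (%x. V b k x - a b x))" by simp
	have "(%k. SUM b:Basis. Q * l2norm ?M (%x. V b k x - a b x)) ----> (SUM b:(Basis::'a set). Q * 0)" by (intro tendsto_sum tendsto_mult tendsto_const lim0)
	then show "(%k. SUM b:Basis. Q * l2norm ?M (%x. V b k x - a b x)) ----> 0" by simp
 qed (simp add: l2norm_nonneg)
 \<comment> \<open>A bound independent of k for the derivative of \<open>G k\<close> along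
   \<open>e\<close>, valid for all large k; each + 1 absorbs the approximation error.\<close>
 define m where "m = (SUM b:(Basis::'a set). Q * ((l2norm ?M (wderiv Om i (a b)) + 1) + (l2norm ?M (a b) + 1)))"
 have m0: "m >= 0" unfolding m_def using Q(1) by (intro sum_nonneg mult_nonneg_nonneg) (auto intro!: add_nonneg_nonneg simp: l2norm_nonneg)
 have DG: "fd (G k) (at x) i =
	 (SUM b:Basis. q b x * fd (V b k) (at x) i + fd (q b) (at x) i * V b k x)" for k x
 proof -
	have "((%x. SUM b:Basis. V b k x * q b x) has_derivative (%h. SUM b:Basis. V b k x * fd (q b) (at x) h +
		fd (V b k) (at x) h * q b x)) (at x)" by (intro has_derivative_sum has_derivative_mult smooth_on_has_derivative[OF open_UNIV Vs UNIV_I]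
		 smooth_on_has_derivative[OF open_UNIV q(1) UNIV_I])
	from fun_cong[OF frechet_derivative_at[OF this, symmetric], of i] show ?thesis by (simp add: G_def[abs_def] algebra_simps)
 qed
 have DGm: "\<forall>\<^sub>F k in sequentially. l2norm ?M (%x. fd (G k) (at x) i) <= m"
 proof -
	have ev: "\<forall>\<^sub>F k in sequentially. ALL b:Basis. l2norm ?M (%x. fd (V b k) (at x) i) <= l2norm ?M (wderiv Om i (a b)) + 1 &
		l2norm ?M (V b k) <= l2norm ?M (a b) + 1"
	proof (intro eventually_ball_finite[OF finite_Basis] ballI)
	 fix b :: 'a assume b: "b : Basis"
	 have "\<forall>\<^sub>F k in sequentially. l2norm ?M (%x. V b k x - a b x) < 1" "\<forall>\<^sub>F k in sequentially.
		 l2norm ?M (%x. fd (V b k) (at x) i - wderiv Om i (a b) x) < 1" using order_tendstoD(2)[OF lim0[OF b], of 1] order_tendstoD(2)[OF lim1[OF b i(1)], of 1] by auto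
	 then show "\<forall>\<^sub>F k in sequentially. l2norm ?M (%x. fd (V b k) (at x) i) <= l2norm ?M (wderiv Om i (a b)) + 1 &
		l2norm ?M (V b k) <= l2norm ?M (a b) + 1"
	 proof eventually_elim
		case (elim k)
		then show ?case using l2norm_triangle_diff[OF Vsq[OF b, of k] as[OF b]]
			l2norm_triangle_diff[OF VDsq[OF b i(1), of k] H1_sqint(2)[OF open_domain aH[OF b] i(1)]] by linarith
	 qed
	qed
	then show ?thesis
	proof eventually_elim
	 case (elim k)
	 have s1: "sqint ?M (%x. q b x * fd (V b k) (at x) i)" if b: "b : Basis" for b by (rule sqint_bounded_mult[OF VDsq[OF b i(1)] qm[OF b] Q(2)[OF b]])
	 have qDm: "(%x. fd (q b) (at x) i) : bmeas ?M" if b: "b : Basis" for b by (intro borel_measurable_lebesgue_on borel_measurable_continuous_onI smooth_on_continuous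
			smooth_on_frechet_derivative q b i(1) open_UNIV)
	 have s2: "sqint ?M (%x. fd (q b) (at x) i * V b k x)" if b: "b : Basis" for b by (rule sqint_bounded_mult[OF Vsq[OF b] qDm[OF b] Q(3)[OF b]])
	 have "l2norm ?M (%x. fd (G k) (at x) i) <= (SUM b:Basis. l2norm ?M (%x.
		 q b x * fd (V b k) (at x) i + fd (q b) (at x) i * V b k x))" unfolding DG by (rule lsum[OF finite_Basis]) (intro sqint_add s1 s2)
	 also have "... <= m" unfolding m_def
	 proof (rule sum_mono)
		fix b :: 'a assume b: "b : Basis"
		have "l2norm ?M (%x. q b x * fd (V b k) (at x) i + fd (q b) (at x) i * V b k x)
		 <= Q * l2norm ?M (%x. fd (V b k) (at x) i) + Q * l2norm ?M (V b k)" using l2norm_triangle[OF s1[OF b] s2[OF b]] lmult[OF VDsq[OF b i(1), of k] qm[OF b] Q(2)[OF b]]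
			lmult[OF Vsq[OF b, of k] qDm[OF b] Q(3)[OF b]] by linarith
		also have "... = Q * (l2norm ?M (%x. fd (V b k) (at x) i) + l2norm ?M (V b k))" by (simp add: distrib_left)
		also have "... <= Q * ((l2norm ?M (wderiv Om i (a b)) + 1) + (l2norm ?M (a b) + 1))" using elim b Q(1) by (intro mult_left_mono add_mono) auto
		finally show "l2norm ?M (%x. q b x * fd (V b k) (at x) i + fd (q b) (at x) i * V b k x)
		 <= Q * ((l2norm ?M (wderiv Om i (a b)) + 1) + (l2norm ?M (a b) + 1))" .
	 qed
	 finally show ?case .
	qed
 qed
 define sigma' where "sigma' k = (\<integral>\<^sup>+x. enn ((G k x)^2) * ind (ball p (2 * r)) x \<partial>surface Om)" for k
 have fs: "frontier Om : sets borel" by (auto intro: borel_closed)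
 have surf_sp: "space (surface Om) = frontier Om" by (simp add: surface_def space_restrict_space)
 have surf_m: "f : bmeas (surface Om)" if "continuous_on UNIV f" for f :: "'a => real" unfolding surface_def using borel_measurable_continuous_onI[OF that]
	by (intro measurable_restrict_space1) (simp add: measurable_def)
 have limT: "sigma' ----> 0"
 proof (rule tendsto_sandwich[OF _ _ tendsto_const])
	let ?K = "real DIM('a) * Q^2"
	have le: "sigma' k <= enn ?K * (SUM b:Basis. \<integral>\<^sup>+x. enn ((V b k x - h b x)^2) \<partial>surface Om)" for k
	proof -
	 have "sigma' k <= (\<integral>\<^sup>+x. enn ?K * (SUM b:Basis. enn ((V b k x - h b x)^2)) \<partial>surface Om)" unfolding sigma'_def
	 proof (rule nn_integral_mono_AE)
		show "AE x in surface Om. enn ((G k x)^2) * ind (ball p (2 * r)) x <=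
			enn ?K * (SUM b:Basis. enn ((V b k x - h b x)^2))" using hn AE_space
		proof eventually_elim
		 case (elim x)
		 show ?case
		 proof (cases "x : ball p (2 * r)")
			case True
			have xf: "x : frontier Om" using elim(2) surf_sp by simp
			have xU: "x : U" using True ball_U r_pos by (auto simp: subset_iff)
			have "boundary_defining Om x U rho" using open_U xU smooth_rho inside bdry gradient by (auto simp: boundary_defining_def)
			then obtain k' where k': "!!b. b : Basis ==> fd rho (at x) b = k' * (outward_normal Om x \<bullet> b)" by (rule outward_normal_gradient[OF _ xf]) blast
			have qx: "q b x = k' * (outward_normal Om x \<bullet> b)" if "b : Basis" for b using q(2)[OF that, of x] True k'[OF that] by (simp add: dist_norm norm_minus_commute)
			\<comment> \<open>On the boundary the traces have no normal component, so \<open>G k\<close> only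
			  sees V - h there and tends to zero in L2 of the surface.\<close>
			have "(SUM b:Basis. h b x * q b x) = k' * (SUM b:Basis. h b x * (outward_normal Om x \<bullet> b))" unfolding sum_distrib_left by (intro sum.cong) (auto simp: qx)
			then have "G k x = (SUM b:Basis. (V b k x - h b x) * q b x)" using elim(1) by (simp add: G_def left_diff_distrib sum_subtractf)
			then have "(G k x)^2 <= (SUM b:(Basis::'a set). 1^2) * (SUM b:Basis. ((V b k x - h b x) * q b x)^2)"
			 using Cauchy_Schwarz_ineq_sum[of "%_. 1" "%b. (V b k x - h b x) * q b x" Basis] by simp
			also have "... <= real DIM('a) * (SUM b:Basis. (V b k x - h b x)^2 * Q^2)"
			proof -
			 have "((V b k x - h b x) * q b x)^2 <= (V b k x - h b x)^2 * Q^2" if "b : Basis" for b unfolding power_mult_distrib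
				using power_mono[OF Q(2)[OF that, of x], of 2] by (intro mult_left_mono) auto
			 then show ?thesis by (simp add: sum_mono mult_left_mono)
			qed
			also have "... = ?K * (SUM b:Basis. (V b k x - h b x)^2)" by (simp add: sum_distrib_right[symmetric])
			finally have "enn ((G k x)^2) <= enn (?K * (SUM b:Basis. (V b k x - h b x)^2))" by (rule ennreal_leI)
			also have "... = enn ?K * (SUM b:Basis. enn ((V b k x - h b x)^2))" by (subst ennreal_mult') (simp_all add: sum_ennreal)
			finally show ?thesis using True by simp
		 qed simp
		qed
	 qed
	 also have "... = enn ?K * (SUM b:Basis. \<integral>\<^sup>+x. enn ((V b k x - h b x)^2) \<partial>surface Om)"
	 proof -
		have mm: "(%x. enn ((V b k x - h b x)^2)) : bmeas (surface Om)" if "b : Basis" for b using surf_m[OF smooth_on_continuous[OF Vs[OF that]]] hm[OF that] by measurable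
		show ?thesis by (subst nn_integral_cmult, rule borel_measurable_sum, rule mm, assumption,
			 subst nn_integral_sum, rule mm, assumption, rule refl)
	 qed
	 finally show ?thesis .
	qed
	then show "\<forall>\<^sub>F k in sequentially. sigma' k <= enn ?K * (SUM b:Basis. \<integral>\<^sup>+x. enn ((V b k x - h b x)^2) \<partial>surface Om)" by simp
	have "(%k. enn ?K * (SUM b:Basis. \<integral>\<^sup>+x. enn ((V b k x - h b x)^2) \<partial>surface Om)) ---->
		enn ?K * (SUM b:(Basis::'a set). 0)" by (intro ennreal_tendsto_cmult tendsto_sum VT) auto
	then show "(%k. enn ?K * (SUM b:Basis. \<integral>\<^sup>+x. enn ((V b k x - h b x)^2) \<partial>surface Om)) ----> 0" by simp
 qed simp
 define B where "B = 8 / c^2"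
 have B0: "B >= 0" by (simp add: B_def)
 show ?thesis
 proof (rule that[of "sqrt B * m"])
	show "0 <= sqrt B * m" using B0 m0 by simp
	fix eps :: real assume eps: "0 < eps" "2 * eps / c <= r"
	let ?I = "ind (strip eps) :: 'a => real"
	have stb: "strip eps : sets borel" using open_strip by auto
	have Im: "?I : bmeas ?M" by (intro borel_measurable_lebesgue_on borel_measurable_indicator stb)
	have I1: "\<bar>?I x\<bar> <= 1" for x by (simp add: indicator_def)
	have strip_sub: "strip eps \<subseteq> Om" by (auto simp: strip_def)
	have toreal: "enn ((l2norm ?M (%x. ?I x * f x))^2) = (\<integral>\<^sup>+x\<in>strip eps. enn ((f x)^2) \<partial>lborel)"
	 "enn ((l2norm ?M f)^2) = (\<integral>\<^sup>+x\<in>Om. enn ((f x)^2) \<partial>lborel)"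
	 if fc: "continuous_on UNIV f" for f :: "'a => real"
	proof -
	 have fb: "f : bmeas borel" by (rule borel_measurable_continuous_onI[OF fc])
	 have gen: "enn ((l2norm ?M (%x. ind A x * f x))^2) = (\<integral>\<^sup>+x\<in>A. enn ((f x)^2) \<partial>lborel)"
		if A: "A : sets borel" "A \<subseteq> Om" for A
	 proof -
		have s: "sqint ?M (%x. ind A x * f x)" by (rule sqint_bounded_mult[of _ _ _ 1])
			(use A in "auto intro!: sqint_continuous fc open_domain bd borel_measurable_lebesgue_on simp: indicator_def")
		have i2: "(ind A x * f x)^2 = ind A x * (f x)^2" for x by (simp add: indicator_def)
		have bm: "(%x. (ind A x * f x)^2) : bmeas borel" using A fb by measurable
		have lb: "integral\<^sup>L ?M (%x. (ind A x * f x)^2) = (LBINT x. (ind A x * f x)^2)"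
		 "integrable ?M (%x. (ind A x * f x)^2) \<longleftrightarrow> integrable lborel (%x. (ind A x * f x)^2)"
		 by (rule lebesgue_on_borel[OF _ bm]; use open_domain A in "auto simp: indicator_def")+
		have "enn ((l2norm ?M (%x. ind A x * f x))^2) = enn (LBINT x. (ind A x * f x)^2)" unfolding l2norm_sq lb(1) ..
		also have "... = (nni lborel (%x. enn ((ind A x * f x)^2)))" by (rule nn_integral_eq_integral[symmetric]) (use lb(2) sqint_integrable[OF s] in auto)
		also have "... = (\<integral>\<^sup>+x\<in>A. enn ((f x)^2) \<partial>lborel)" by (rule nn_integral_cong) (simp add: indicator_def)
		finally show ?thesis .
	 qed
	 show "enn ((l2norm ?M (%x. ?I x * f x))^2) = (\<integral>\<^sup>+x\<in>strip eps. enn ((f x)^2) \<partial>lborel)" by (rule gen[OF stb strip_sub])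
	 have "l2norm ?M f = l2norm ?M (%x. ind Om x * f x)" unfolding l2norm_def by (rule arg_cong[of _ _ sqrt], rule bochner_integral_cong) auto
	 then show "enn ((l2norm ?M f)^2) = (\<integral>\<^sup>+x\<in>Om. enn ((f x)^2) \<partial>lborel)" using gen[of Om] open_domain by auto
	qed
	\<comment> \<open>The surface term disappears as k grows with \<open>eps\<close> fixed; what
	  remains is the term of order eps^2.\<close>
	have Gk: "\<forall>\<^sub>F k in sequentially. enn ((l2norm ?M (%x. ?I x * G k x))^2) <=
		enn (4 * proj_const / c * eps) * sigma' k + enn (B * eps^2 * m^2)" using DGm
	proof eventually_elim
	 case (elim k)
	 have "(\<integral>\<^sup>+x\<in>Om. enn ((fd (G k) (at x) e)^2) \<partial>lborel) =
		 (\<integral>\<^sup>+x\<in>Om. enn ((fd (G k) (at x) i)^2) \<partial>lborel)"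
	 proof -
		have "sigma\<^sup>2 = 1" using i(2) by (simp add: abs_square_eq_1)
		then have "(fd (G k) (at x) e)^2 = (fd (G k) (at x) i)^2" for x unfolding i(3)[OF Gs] by (simp add: power_mult_distrib)
		then show ?thesis by simp
	 qed
	 also have "... = enn ((l2norm ?M (%x. fd (G k) (at x) i))^2)" by (rule toreal(2)[symmetric])
		 (intro smooth_on_continuous smooth_on_frechet_derivative Gs i(1) open_UNIV)
	 also have "... <= enn (m^2)" by (intro ennreal_leI power_mono elim l2norm_nonneg)
	 finally have 2: "(\<integral>\<^sup>+x\<in>Om. enn ((fd (G k) (at x) e)^2) \<partial>lborel) <= enn (m^2)" .
	 have "enn ((l2norm ?M (%x. ?I x * G k x))^2) = (\<integral>\<^sup>+x\<in>strip eps. enn ((G k x)^2) \<partial>lborel)"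
		by (rule toreal(1)[OF smooth_on_continuous[OF Gs]])
	 also have "... <= enn (4 * proj_const / c * eps) * sigma' k + enn (B * eps^2) *
		 (\<integral>\<^sup>+x\<in>Om. enn ((fd (G k) (at x) e)^2) \<partial>lborel)" unfolding sigma'_def B_def by (rule strip_estimate[OF Gs eps])
	 also have "... <= enn (4 * proj_const / c * eps) * sigma' k + enn (B * eps^2) * enn (m^2)" by (intro add_left_mono mult_left_mono 2) simp
	 also have "enn (B * eps^2) * enn (m^2) = enn (B * eps^2 * m^2)" using B0 by (subst ennreal_mult[symmetric]) auto
	 finally show ?case .
	qed
	have IF: "sqint ?M (%x. ?I x * f x)" if "sqint ?M f" for f by (rule sqint_bounded_mult[OF that Im I1])
	have lim2: "(%k. enn ((l2norm ?M (%x. ?I x * G k x))^2)) ----> enn ((l2norm ?M (%x. ?I x * Fn x))^2)"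
	proof (intro tendsto_ennrealI tendsto_power)
	 show "(%k. l2norm ?M (%x. ?I x * G k x)) ----> l2norm ?M (%x. ?I x * Fn x)"
	 proof (rule LIM_zero_cancel, rule Lim_null_comparison[OF _ limG], rule always_eventually, rule)
		fix k
		have "\<bar>l2norm ?M (%x. ?I x * G k x) - l2norm ?M (%x. ?I x * Fn x)\<bar> <=
			l2norm ?M (%x. ?I x * G k x - ?I x * Fn x)" by (rule l2norm_triangle_diff[OF IF[OF Gsq] IF[OF Fs]])
		also have "... = l2norm ?M (%x. ?I x * (G k x - Fn x))" by (simp add: right_diff_distrib)
		also have "... <= 1 * l2norm ?M (%x. G k x - Fn x)" by (rule lmult[OF sqint_diff[OF Gsq Fs] Im I1])
		finally show "norm (l2norm ?M (%x. ?I x * G k x) - l2norm ?M (%x. ?I x * Fn x)) <= l2norm ?M (%x. G k x - Fn x)" by simp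
	 qed
	qed
	have "(%k. enn (4 * proj_const / c * eps) * sigma' k + enn (B * eps^2 * m^2)) ---->
		enn (4 * proj_const / c * eps) * 0 + enn (B * eps^2 * m^2)" by (intro tendsto_add tendsto_const ennreal_tendsto_cmult limT) simp
	from tendsto_le[OF _ this lim2 Gk]
	have "enn ((l2norm ?M (%x. ?I x * Fn x))^2) <= enn (B * eps^2 * m^2)" by simp
	then have "(l2norm ?M (%x. ?I x * Fn x))^2 <= B * eps^2 * m^2" using B0 by simp
	also have "... = (sqrt B * m * eps)^2" using B0 by (simp add: power_mult_distrib)
	finally show "l2norm ?M (%x. ?I x * Fn x) <= sqrt B * m * eps" by (rule power2_le_imp_le) (use B0 m0 eps in simp)
 qed
qed

text \<open>Multiply by a cutoff \<open>S n\<close> that vanishes near the boundary; the compactly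
  supported case applies. The error contains the gradient of the cutoff, of order 1/eps, times
  \<open>Fn\<close>, of L2 norm of order eps on the strip, times \<open>w1\<close>. The first two
  factors balance, and the L2 norm of \<open>w1\<close> on the shrinking strips tends to
  zero.\<close>

lemma boundary_green:
 assumes bd: "bounded Om" and u: "u : H2N Om" and w: "admissible Om w g"
	and zeta: "smooth_on UNIV zeta" "!!x. norm (x - p) >= r / 4 ==> zeta x = 0"
 shows "green_form Om u (%x. zeta x * w x) (%b x. zeta x * g b x + fd zeta (at x) b * w x) = 0"
proof -
 let ?M = "leb Om"
 have u2: "u : H2 Om" using u by (simp add: H2N_def)
 define w1 where "w1 x = zeta x * w x" for x
 define g1 where "g1 b x = zeta x * g b x + fd zeta (at x) b * w x" for b x
 have adm1: "admissible Om w1 g1" unfolding w1_def[abs_def] g1_def[abs_def] by (rule admissible_mult[OF open_domain bd zeta(1) w])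
 have out: "w1 x = 0" "g1 b x = 0" if "norm (x - p) > r / 4" for x b
 proof -
	have "fd zeta (at x) b = 0" by (rule frechet_derivative_zero_outside[OF closed_cball[of p "r / 4"]]) (use zeta(2) that in "auto simp: dist_norm norm_minus_commute")
	then show "w1 x = 0" "g1 b x = 0" using zeta(2)[of x] that by (auto simp: w1_def g1_def)
 qed
 obtain q where q: "!!b. b : Basis ==> smooth_on UNIV (q b)"
	"!!b x. b : Basis ==> norm (x - p) <= 2 * r ==> q b x = fd rho (at x) b"
	"!!b x. b : Basis ==> norm (x - p) >= 4 * r ==> q b x = 0" by (rule rho_smooth_extension) blast
 define Fn where "Fn x = (SUM b:Basis. wderiv Om b u x * q b x)" for x
 have "EX C>=0. ALL eps. 0 < eps --> 2 * eps / c <= r -->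
	l2norm ?M (%x. ind (strip eps) x * Fn x) <= C * eps" unfolding Fn_def by (rule normal_derivative_strip[OF bd u q]) (assumption | blast)+
 then obtain C where C: "C >= 0" "!!eps. 0 < eps ==> 2 * eps / c <= r ==>
	l2norm ?M (%x. ind (strip eps) x * Fn x) <= C * eps" by blast
 obtain C1 where C1: "C1 > 0" "!!t. \<bar>fd smooth_step (at t) 1\<bar> <= C1"
	"!!t. t < 1 \<or> t > 2 ==> fd smooth_step (at t) 1 = 0" by (rule smooth_step_derivative_bound) blast
 define X where "X x = lap Om u x * w1 x + (SUM b:Basis. wderiv Om b u x * g1 b x)" for x
 have Xi: "integrable ?M X" unfolding X_def[abs_def] by (intro bochner_integrable_add green_form_integrable[OF open_domain u2 adm1])
 have w1s: "sqint ?M w1" using adm1 by (simp add: admissible_def)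
 have dsq: "sqint ?M (wderiv Om b u)" if "b : Basis" for b by (rule H1_sqint(1)[OF open_domain H2_sqint(2)[OF open_domain u2 that] that])
 have Fs: "sqint ?M Fn" unfolding Fn_def[abs_def] mult.commute[of "wderiv _ _ _ _"] by (intro sqint_sum sqint_continuous_mult bd smooth_on_continuous q dsq)
 have inU: "x : U" if "norm (x - p) <= r" for x using that ball_U r_pos by (auto simp: dist_norm norm_minus_commute subset_iff)
 \<comment> \<open>Then \<open>2 * eps n / c\<close> is r / (n + 1), so the segments to the boundary
   are short enough for every n.\<close>
 define eps where "eps n = c * r / (2 * real (Suc n))" for n
 have eps: "0 < eps n" "2 * eps n / c <= r" for n
 proof -
	show "0 < eps n" using c_pos r_pos by (simp add: eps_def)
	have "2 * eps n / c = r / real (Suc n)" using c_pos by (simp add: eps_def del: of_nat_Suc)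
	also have "... <= r" using r_pos by (simp add: divide_le_eq)
	finally show "2 * eps n / c <= r" .
 qed
 have eps0: "eps ----> 0"
 proof -
	have "(%n. c * r / 2 * (1 / real (Suc n))) ----> c * r / 2 * 0" by (intro tendsto_mult tendsto_const LIMSEQ_Suc[OF lim_1_over_n])
	then show ?thesis by (simp add: eps_def[abs_def] field_simps)
 qed
 have "ALL n. EX S. smooth_on UNIV S & (ALL x. \<bar>S x\<bar> <= 1) &
	(ALL x. norm (x - p) <= r / 2 --> S x = smooth_step (2 * rho x / eps n + 3)) &
	(ALL x b. norm (x - p) < r / 2 --> b : Basis --> fd S (at x) b =
	  fd smooth_step (at (2 * rho x / eps n + 3)) 1 * (2 / eps n * fd rho (at x) b))" by (rule allI, rule strip_cutoff[OF eps(1)]) blast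
 from choice[OF this] obtain S where S: "ALL n. smooth_on UNIV (S n) & (ALL x. \<bar>S n x\<bar> <= 1) &
	(ALL x. norm (x - p) <= r / 2 --> S n x = smooth_step (2 * rho x / eps n + 3)) &
	(ALL x b. norm (x - p) < r / 2 --> b : Basis --> fd (S n) (at x) b =
	  fd smooth_step (at (2 * rho x / eps n + 3)) 1 * (2 / eps n * fd rho (at x) b))" by (elim exE)
 have S1: "smooth_on UNIV (S n)" "\<bar>S n x\<bar> <= 1" for n x using S by blast+
 have S2: "S n x = smooth_step (2 * rho x / eps n + 3)" if "norm (x - p) <= r / 4" for n x using S that r_pos by auto
 have S3: "fd (S n) (at x) b =
	  fd smooth_step (at (2 * rho x / eps n + 3)) 1 * (2 / eps n * fd rho (at x) b)"
	if "norm (x - p) <= r / 4" "b : Basis" for n x b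
 proof -
	have "norm (x - p) < r / 2" using that r_pos by simp
	then show ?thesis using S that(2) by blast
 qed
 define Y where "Y n x = (SUM b:Basis. wderiv Om b u x * (fd (S n) (at x) b * w1 x))" for n x
 have Yi: "integrable ?M (Y n)" for n unfolding Y_def[abs_def] by (intro bochner_integrable_sum sqint_mult_integrable dsq sqint_continuous_mult bd
		smooth_on_continuous smooth_on_frechet_derivative S1 w1s open_UNIV)
 have SXi: "integrable ?M (%x. S n x * X x)" for n
 proof (rule bochner_integrable_bound[OF Xi])
	show "(%x. S n x * X x) : bmeas ?M" by (rule borel_measurable_times[OF borel_measurable_lebesgue_on[OF borel_measurable_continuous_onI[OF
				smooth_on_continuous[OF S1(1)]]] borel_measurable_integrable[OF Xi]])
	have "\<bar>S n x\<bar> * \<bar>X x\<bar> <= 1 * \<bar>X x\<bar>" for x by (intro mult_right_mono S1) auto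
	then show "AE x in ?M. norm (S n x * X x) <= norm (X x)" by (simp add: abs_mult)
 qed
 have zero: "(LINT x|?M. S n x * X x) + (LINT x|?M. Y n x) = 0" for n
 proof -
	\<comment> \<open>Contains all points of the support of \<open>w1\<close> at which the cutoff or
	  its gradient can be nonzero.\<close>
	define K where "K = cball p (r / 4) \<inter> rho -` {.. - eps n / 2}"
	have subU: "cball p (r / 4) \<subseteq> U" using inU r_pos by (auto simp: dist_norm norm_minus_commute)
	have Kc: "compact K"
	proof -
	 have "closed K" unfolding K_def by (rule continuous_closed_preimage[OF continuous_on_subset[OF smooth_on_continuous[OF smooth_rho] subU]])
		 simp_all
	 moreover have "bounded K" by (rule bounded_subset[OF bounded_cball[of p "r / 4"]]) (auto simp: K_def)
	 ultimately show ?thesis by (simp add: compact_eq_bounded_closed)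
	qed
	have KOm: "K \<subseteq> Om"
	proof
	 fix x assume x: "x : K"
	 then have "x : U" "rho x < 0" using subU eps(1)[of n] by (auto simp: K_def)
	 then show "x : Om" by (simp add: inside_iff)
	qed
	have step: "2 * rho x / eps n + 3 > 2" if "norm (x - p) <= r / 4" "x ~: K" for x
	proof -
	 have "rho x > - eps n / 2" using that by (auto simp: K_def dist_norm norm_minus_commute)
	 then have "2 * rho x / eps n > - 1" using eps(1)[of n] by (simp add: field_simps)
	 then show ?thesis by simp
	qed
	have g0: "green_form Om u (%x. S n x * w1 x) (%b x. S n x * g1 b x + fd (S n) (at x) b * w1 x) = 0"
	proof (rule green_form_compact[OF open_domain u2 admissible_mult[OF open_domain bd S1(1) adm1] Kc KOm])
	 fix x b :: 'a assume x: "x : Om" "x ~: K"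
	 show "S n x * w1 x = 0" using out(1)[of x] S2[of x n] step[OF _ x(2)] smooth_step_eq(2) by (cases "norm (x - p) <= r / 4") auto
	 assume b: "b : Basis"
	 show "S n x * g1 b x + fd (S n) (at x) b * w1 x = 0"
	 proof (cases "norm (x - p) <= r / 4")
		case True
		have "S n x = 0" using S2[OF True, of n] step[OF True x(2)] smooth_step_eq(2) by simp
		moreover have "fd (S n) (at x) b = 0" using S3[OF True b, of n] C1(3)[of "2 * rho x / eps n + 3"] step[OF True x(2)] by simp
		ultimately show ?thesis by simp
	 next
		case False
		then show ?thesis using out[of x] by simp
	 qed
	qed
	have "green_form Om u (%x. S n x * w1 x) (%b x. S n x * g1 b x + fd (S n) (at x) b * w1 x) =
		(LINT x|?M. S n x * X x + Y n x)" unfolding green_form_def by (rule bochner_integral_cong)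
		(simp_all add: X_def Y_def distrib_left sum.distrib sum_distrib_left mult_ac)
	also have "... = (LINT x|?M. S n x * X x) + (LINT x|?M. Y n x)" by (rule bochner_integral_add[OF SXi Yi])
	finally show ?thesis using g0 by simp
 qed
 have stm: "(ind (strip (eps n)) :: 'a => real) : bmeas ?M" for n by (rule borel_measurable_lebesgue_on[OF borel_measurable_indicator]) (use open_strip in simp)
 have I1: "\<bar>ind (strip (eps n)) x :: real\<bar> <= 1" for n x by (simp add: indicator_def)
 have IF: "sqint ?M (%x. ind (strip (eps n)) x * Fn x)" "sqint ?M (%x. ind (strip (eps n)) x * w1 x)" for n
	by (rule sqint_bounded_mult[OF Fs stm I1] sqint_bounded_mult[OF w1s stm I1])+
 \<comment> \<open>The factor 2/eps of the cutoff gradient cancels against the bound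
   \<open>C * eps\<close> for \<open>Fn\<close>; the constant does not depend on n.\<close>
 have Yb: "\<bar>\<integral>x. Y n x \<partial>?M\<bar> <= 2 * C1 * C * l2norm ?M (%x. ind (strip (eps n)) x * w1 x)" for n
 proof -
	let ?I = "ind (strip (eps n)) :: 'a => real"
	have pw: "\<bar>Y n x\<bar> <= (2 * C1 / eps n) * (\<bar>?I x * Fn x\<bar> * \<bar>?I x * w1 x\<bar>)" if x: "x : Om" for x
	proof (cases "norm (x - p) <= r / 4")
	 case True
	 let ?d = "fd smooth_step (at (2 * rho x / eps n + 3)) 1"
	 have nr: "norm (x - p) <= 2 * r" using True r_pos by simp
	 have "Y n x = (SUM b:Basis. (?d * (2 / eps n) * w1 x) * (wderiv Om b u x * q b x))" unfolding Y_def by (rule sum.cong) (simp_all add: S3[OF True] q(2)[OF _ nr])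
	 also have "... = (?d * (2 / eps n) * w1 x) * Fn x" by (simp add: Fn_def sum_distrib_left)
	 finally have Y: "Y n x = (?d * (2 / eps n) * w1 x) * Fn x" .
	 show ?thesis
	 proof (cases "x : strip (eps n)")
		case True
		have "\<bar>Y n x\<bar> = \<bar>?d\<bar> * ((2 / eps n) * (\<bar>w1 x\<bar> * \<bar>Fn x\<bar>))" unfolding Y using eps(1)[of n] by (simp add: abs_mult)
		also have "... <= C1 * ((2 / eps n) * (\<bar>w1 x\<bar> * \<bar>Fn x\<bar>))" using eps(1)[of n] by (intro mult_right_mono C1(2)) auto
		finally show ?thesis using True by (simp add: mult_ac)
	 next
		case False
		have "x : ball p r" using True r_pos by (simp add: dist_norm norm_minus_commute)
		then have "rho x <= - 2 * eps n" using False x by (auto simp: strip_def)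
		then have "2 * rho x / eps n <= - 4" using eps(1)[of n] by (simp add: field_simps)
		then have "?d = 0" by (intro C1(3)) simp
		then show ?thesis using Y False by simp
	 qed
	next
	 case False
	 then show ?thesis using out(1)[of x] by (simp add: Y_def)
	qed
	have i: "integrable ?M (%x. \<bar>?I x * Fn x\<bar> * \<bar>?I x * w1 x\<bar>)"
	 using sqint_mult_integrable[OF IF(1)[of n] IF(2)[of n]] by (simp add: abs_mult[symmetric])
	have "norm (LINT x|?M. Y n x) <= (LINT x|?M. (2 * C1 / eps n) * (\<bar>?I x * Fn x\<bar> * \<bar>?I x * w1 x\<bar>))"
	 by (rule bochner_integral_norm_bound_integral[OF Yi integrable_mult_right[OF i]]) (use pw in simp)
	also have "... = (2 * C1 / eps n) * (LINT x|?M. \<bar>?I x * Fn x\<bar> * \<bar>?I x * w1 x\<bar>)" by simp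
	finally have 1: "norm (LINT x|?M. Y n x) <= (2 * C1 / eps n) * (LINT x|?M. \<bar>?I x * Fn x\<bar> * \<bar>?I x * w1 x\<bar>)" .
	have "(LINT x|?M. \<bar>?I x * Fn x\<bar> * \<bar>?I x * w1 x\<bar>) <=
		l2norm ?M (%x. ?I x * Fn x) * l2norm ?M (%x. ?I x * w1 x)"
	proof -
	 have a: "sqint ?M (%x. \<bar>?I x * Fn x\<bar>)" "sqint ?M (%x. \<bar>?I x * w1 x\<bar>)" using IF[of n] by (auto simp: sqint_def)
	 show ?thesis using l2_Cauchy_Schwarz[OF a] by (simp add: l2norm_def)
	qed
	also have "... <= (C * eps n) * l2norm ?M (%x. ?I x * w1 x)" by (intro mult_right_mono C(2) eps l2norm_nonneg)
	finally have 2: "(LINT x|?M. \<bar>?I x * Fn x\<bar> * \<bar>?I x * w1 x\<bar>) <= (C * eps n) * l2norm ?M (%x. ?I x * w1 x)" .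
	have "0 <= 2 * C1 / eps n" using C1(1) eps(1)[of n] by simp
	from order_trans[OF 1 mult_left_mono[OF 2 this]]
	have "norm (LINT x|?M. Y n x) <= 2 * C1 / eps n * ((C * eps n) * l2norm ?M (%x. ?I x * w1 x))" .
	also have "... = 2 * C1 * C * l2norm ?M (%x. ?I x * w1 x)" using eps(1)[of n] by simp
	finally show ?thesis by simp
 qed
 have ev: "\<forall>\<^sub>F n in sequentially. 2 * eps n < - rho x" if "rho x < 0" for x
	using order_tendstoD(2)[OF tendsto_mult[OF tendsto_const[of 2] eps0], of "- rho x"] that by simp
 have "(%n. (LINT x|?M. (ind (strip (eps n)) x * w1 x - 0)^2)) ----> 0"
 proof (rule l2_dominated_convergence)
	show "sqint ?M (%x. \<bar>w1 x\<bar>)" using w1s by (auto simp: sqint_def)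
	show "(%x. ind (strip (eps n)) x * w1 x) : bmeas ?M" for n by (rule sqint_measurable[OF IF(2)])
	have "(%n. ind (strip (eps n)) x * w1 x) ----> 0" if x: "x : Om" for x
	proof (cases "norm (x - p) <= r / 4")
	 case True
	 then have "rho x < 0" using inside_iff[OF inU[of x]] x r_pos by simp
	 show ?thesis by (rule tendsto_eventually, rule eventually_mono[OF ev[OF \<open>rho x < 0\<close>]]) (auto simp: strip_def)
	next
	 case False
	 then show ?thesis using out(1)[of x] by simp
	qed
	then show "AE x in ?M. (%n. ind (strip (eps n)) x * w1 x) ----> 0" by (intro AE_I2) simp
	show "AE x in ?M. \<bar>ind (strip (eps n)) x * w1 x - 0\<bar> <= \<bar>w1 x\<bar>" for n by (intro AE_I2) (simp add: indicator_def)
 qed simp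
 then have l0: "(%n. l2norm ?M (%x. ind (strip (eps n)) x * w1 x)) ----> 0" unfolding l2norm_def using tendsto_real_sqrt by fastforce
 have Y0: "(%n. (LINT x|?M. Y n x)) ----> 0"
 proof (rule Lim_null_comparison)
	show "\<forall>\<^sub>F n in sequentially. norm (LINT x|?M. Y n x) <= 2 * C1 * C * l2norm ?M (%x. ind (strip (eps n)) x * w1 x)" using Yb by simp
	show "(%n. 2 * C1 * C * l2norm ?M (%x. ind (strip (eps n)) x * w1 x)) ----> 0" using tendsto_mult[OF tendsto_const[of "2 * C1 * C"] l0] by simp
 qed
 have "(%n. (LINT x|?M. S n x * X x)) ----> (LINT x|?M. X x)"
 proof (rule integral_dominated_convergence)
	show "integrable ?M (%x. \<bar>X x\<bar>)" using Xi by simp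
	show "X : bmeas ?M" by (rule borel_measurable_integrable[OF Xi])
	show "(%x. S n x * X x) : bmeas ?M" for n by (rule borel_measurable_integrable[OF SXi])
	have "(%n. S n x * X x) ----> X x" if x: "x : Om" for x
	proof (cases "norm (x - p) <= r / 4")
	 case True
	 then have "rho x < 0" using inside_iff[OF inU[of x]] x r_pos by simp
	 have "S n x = 1" if "2 * eps n < - rho x" for n
	 proof -
		have "2 * rho x / eps n <= - 4" using that eps(1)[of n] by (simp add: field_simps)
		then show ?thesis using S2[OF True, of n] smooth_step_eq(1) by simp
	 qed
	 then show ?thesis by (intro tendsto_eventually eventually_mono[OF ev[OF \<open>rho x < 0\<close>]]) simp
	next
	 case False
	 then show ?thesis using out[of x] by (simp add: X_def)
	qed
	then show "AE x in ?M. (%n. S n x * X x) ----> X x" by (intro AE_I2) simp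
	have "\<bar>S n x\<bar> * \<bar>X x\<bar> <= 1 * \<bar>X x\<bar>" for n x by (intro mult_right_mono S1) auto
	then show "AE x in ?M. norm (S n x * X x) <= \<bar>X x\<bar>" for n by (simp add: abs_mult)
 qed
 from tendsto_add[OF this Y0] have "(LINT x|?M. X x) = 0" unfolding zero by (simp add: LIMSEQ_const_iff)
 then show ?thesis by (simp add: green_form_def X_def w1_def g1_def)
qed

end

text \<open>The gradient of \<open>rho\<close> at \<open>p\<close> is nonzero, so some partial
  derivative is; its sign orients \<open>e\<close>. Half of its modulus serves as \<open>c\<close>,
  which leaves room to extend the lower bound to a ball by continuity.\<close>

lemma boundary_chart_exists:
 fixes Om :: "'a::euclidean_space set"
 assumes Om: "open Om" and rho: "boundary_defining Om p U rho"
 obtains e c r where "boundary_chart Om U rho p e c r"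
proof -
 have U: "open U" "p : U" "smooth_on U rho" using rho by (auto simp: boundary_defining_def)
 have "EX b:Basis. fd rho (at p) b \<noteq> 0"
 proof (rule ccontr)
	assume "\<not> ?thesis"
	then have z: "fd rho (at p) b = 0" if "b : Basis" for b using that by blast
	have f: "(rho has_derivative fd rho (at p)) (at p)" by (rule smooth_on_has_derivative[OF U(1,3,2)])
	interpret bounded_linear "fd rho (at p)" using f by (rule has_derivative_bounded_linear)
	have "fd rho (at p) h = 0" for h
	proof -
	 have "fd rho (at p) (SUM b:Basis. (h \<bullet> b) *\<^sub>R b) = 0" by (simp add: sum scale z)
	 then show ?thesis by (simp add: euclidean_representation)
	qed
	then have "fd rho (at p) = (%_. 0)" by (rule ext)
	then show False using rho by (auto simp: boundary_defining_def)
 qed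
 then obtain b where b: "b : Basis" "fd rho (at p) b \<noteq> 0" by blast
 define s where "s = sgn (fd rho (at p) b)"
 have s: "s = 1 \<or> s = -1" using b(2) by (auto simp: s_def sgn_real_def)
 define e where "e = s *\<^sub>R b"
 have De: "fd rho (at x) e = s * fd rho (at x) b" if "x : U" for x unfolding e_def
	using linear_scale[OF has_derivative_linear[OF smooth_on_has_derivative[OF U(1,3) that]]] by simp
 define c where "c = s * fd rho (at p) b / 2"
 have c: "c > 0" "c < s * fd rho (at p) b" using b(2) by (auto simp: c_def s_def sgn_mult_self_eq abs_sgn_eq sgn_real_def zero_less_mult_iff)
 have "continuous_on U (%x. s * fd rho (at x) b)" by (intro continuous_intros smooth_on_continuous smooth_on_frechet_derivative U b)
 from continuous_open_preimage[OF this U(1) open_greaterThan[of c]]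
 have "open (U \<inter> (%x. s * fd rho (at x) b) -` {c<..})" .
 moreover have "p : U \<inter> (%x. s * fd rho (at x) b) -` {c<..}" using U c by simp
 ultimately obtain R where R: "R > 0" "cball p R \<subseteq> U \<inter> (%x. s * fd rho (at x) b) -` {c<..}" using open_contains_cball by blast
 show ?thesis
 proof (rule that[of e c "R / 4"])
	show "boundary_chart Om U rho p e c (R / 4)"
	proof
	 show "e : Basis \<or> - e : Basis" using s b(1) by (auto simp: e_def)
	 show "cball p (4 * (R / 4)) \<subseteq> U" using R(2) by auto
	 show "c <= fd rho (at x) e" if "x : cball p (2 * (R / 4))" for x
	 proof -
		have "x : cball p R" using that R(1) by simp
		then have "x : U" "c < s * fd rho (at x) b" using R(2) by blast+
		then show ?thesis using De[of x] by simp
	 qed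
	qed (use Om rho R c in "auto simp: boundary_defining_def")
 qed
qed

text \<open>Finitely many chart balls cover the compact boundary. Instead of building a partition of
  unity, one cutoff at a time is peeled off: zeta w is handled by the chart, (1 - zeta) w vanishes
  on one more ball, and \<open>green_form\<close> is additive.\<close>

lemma green_form_zero:
 fixes Om :: "'a::euclidean_space set"
 assumes Om: "smooth_domain Om" and u: "u : H2N Om" and w: "admissible Om w g"
 shows "green_form Om u w g = 0"
proof -
 have op: "open Om" and bd: "bounded Om" using Om by (auto simp: smooth_domain_def)
 have u2: "u : H2 Om" using u by (simp add: H2N_def)
 have "ALL p:frontier Om. EX r U rho e c. boundary_chart Om U rho p e c r" using Om boundary_chart_exists[OF op] unfolding smooth_domain_def by metis
 from bchoice[OF this] obtain r where r: "ALL p:frontier Om. EX U rho e c. boundary_chart Om U rho p e c (r p)" by (elim exE)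
 have rpos: "r p > 0" if "p : frontier Om" for p using r that by (auto simp: boundary_chart_def)
 have "compact (frontier Om)" using bd by (simp add: compact_frontier_bounded)
 then obtain P where P: "P \<subseteq> frontier Om" "finite P" "frontier Om \<subseteq> (\<Union>p\<in>P. ball p (r p / 8))"
 proof (rule compactE_image[of _ "frontier Om" "%p. ball p (r p / 8)"])
	show "frontier Om \<subseteq> (\<Union>p\<in>frontier Om. ball p (r p / 8))" using rpos by force
 qed auto
 define K where "K = closure Om - (\<Union>p\<in>P. ball p (r p / 8))"
 have Kc: "compact K" unfolding K_def using bd by (intro compact_diff open_UN ballI open_ball) simp
 have KOm: "K \<subseteq> Om" using P(3) op by (auto simp: K_def frontier_def interior_open)
 \<comment> \<open>Invariant of the peeling: outside \<open>K\<close> and the balls still to be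
   treated, \<open>w\<close> and its gradient vanish. With no ball left the support is in the
   compact set \<open>K\<close>. Radius r/8 is where the cutoff is 1, so that it vanishes beyond r/4
   as \<open>boundary_green\<close> requires.\<close>
 have main: "green_form Om u w g = 0"
	if "finite Q" "Q \<subseteq> frontier Om" "admissible Om w g"
	 "!!x. x : Om ==> x ~: K ==> (EX p:Q. norm (x - p) < r p / 8) \<or> (w x = 0 & (ALL b:Basis. g b x = 0))" for Q w g using that
 proof (induction Q arbitrary: w g rule: finite_induct)
	case empty
	show ?case by (rule green_form_compact[OF op u2 empty(2) Kc KOm]) (use empty(3) in auto)
 next
	case (insert p Q)
	have p: "p : frontier Om" using insert by simp
	have "0 < r p / 8" using rpos[OF p] by simp
	obtain zeta :: "'a => real" where zeta: "smooth_on UNIV zeta" "!!x. 0 <= zeta x" "!!x. zeta x <= 1"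
	 "!!x. norm (x - p) <= r p / 8 ==> zeta x = 1" "!!x. norm (x - p) >= 2 * (r p / 8) ==> zeta x = 0"
	 by (rule smooth_bump_exists[OF \<open>0 < r p / 8\<close>, of p]) blast
	obtain U rho e c where chart: "boundary_chart Om U rho p e c (r p)" using r p by blast
	have zeta0: "zeta x = 0" if "norm (x - p) >= r p / 4" for x using zeta(5)[of x] that by simp
	have z1: "green_form Om u (%x. zeta x * w x) (%b x. zeta x * g b x + fd zeta (at x) b * w x) = 0"
	 by (rule boundary_chart.boundary_green[OF chart bd u insert.prems(2) zeta(1) zeta0])
	define h where "h x = 1 - zeta x" for x
	have hs: "smooth_on UNIV h" unfolding h_def[abs_def] by (intro smooth_on_diff smooth_on_const zeta(1) open_UNIV)
	have hd: "fd h (at x) b = - fd zeta (at x) b" for x b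
	proof -
	 have "(h has_derivative (%v. 0 - fd zeta (at x) v)) (at x)" unfolding h_def[abs_def]
		by (intro has_derivative_diff has_derivative_const smooth_on_has_derivative[OF open_UNIV zeta(1) UNIV_I])
	 from fun_cong[OF frechet_derivative_at[OF this, symmetric], of b] show ?thesis by simp
	qed
	have adm: "admissible Om (%x. h x * w x) (%b x. h x * g b x + fd h (at x) b * w x)" by (rule admissible_mult[OF op bd hs insert.prems(2)])
	have z2: "green_form Om u (%x. h x * w x) (%b x. h x * g b x + fd h (at x) b * w x) = 0"
	proof (rule insert.IH[OF _ adm])
	 show "Q \<subseteq> frontier Om" using insert.prems by simp
	 fix x assume x: "x : Om" "x ~: K"
	 show "(EX p:Q. norm (x - p) < r p / 8) \<or>
		 (h x * w x = 0 & (ALL b:Basis. h x * g b x + fd h (at x) b * w x = 0))"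
	 proof (cases "norm (x - p) < r p / 8")
		case True
		have "h x = 0" using zeta(4)[of x] True by (simp add: h_def)
		moreover have "fd h (at x) b = 0" for b
		proof -
		 have "fd h (at x) = fd (%_. 0) (at x)" by (rule frechet_derivative_cong_open[of "ball p (r p / 8)"])
			 (use True zeta(4) in "auto simp: h_def dist_norm norm_minus_commute")
		 then show ?thesis by simp
		qed
		ultimately show ?thesis by simp
	 next
		case False
		then show ?thesis using insert.prems(3)[OF x] by auto
	 qed
	qed
	have adm1: "admissible Om (%x. zeta x * w x) (%b x. zeta x * g b x + fd zeta (at x) b * w x)" by (rule admissible_mult[OF op bd zeta(1) insert.prems(2)])
	have "green_form Om u w g =
		green_form Om u (%x. zeta x * w x) (%b x. zeta x * g b x + fd zeta (at x) b * w x) +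
		green_form Om u (%x. h x * w x) (%b x. h x * g b x + fd h (at x) b * w x)" unfolding green_form_def
	proof (subst bochner_integral_add[symmetric])
	 show "integrable (leb Om) (%x. lap Om u x * (zeta x * w x) +
		 (SUM b:Basis. wderiv Om b u x * (zeta x * g b x + fd zeta (at x) b * w x)))" by (intro bochner_integrable_add green_form_integrable[OF op u2 adm1])
	 show "integrable (leb Om) (%x. lap Om u x * (h x * w x) +
		 (SUM b:Basis. wderiv Om b u x * (h x * g b x + fd h (at x) b * w x)))" by (intro bochner_integrable_add green_form_integrable[OF op u2 adm])
	 have "lap Om u x * w x + (SUM b:Basis. wderiv Om b u x * g b x) =
		lap Om u x * (zeta x * w x) +
		 (SUM b:Basis. wderiv Om b u x * (zeta x * g b x + fd zeta (at x) b * w x)) +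
		(lap Om u x * (h x * w x) +
		 (SUM b:Basis. wderiv Om b u x * (h x * g b x + fd h (at x) b * w x)))" for x
	 proof -
		have "(SUM b:Basis. wderiv Om b u x * g b x) =
		 (SUM b:Basis. wderiv Om b u x * (zeta x * g b x + fd zeta (at x) b * w x)) +
		 (SUM b:Basis. wderiv Om b u x * (h x * g b x + fd h (at x) b * w x))" unfolding sum.distrib[symmetric] by (rule sum.cong) (simp_all add: hd h_def algebra_simps)
		moreover have "lap Om u x * w x = lap Om u x * (zeta x * w x) + lap Om u x * (h x * w x)" by (simp add: h_def algebra_simps)
		ultimately show ?thesis by simp
	 qed
	 then show "(LINT x|leb Om. lap Om u x * w x + (SUM b:Basis. wderiv Om b u x * g b x)) =
		(LINT x|leb Om. lap Om u x * (zeta x * w x) +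
		 (SUM b:Basis. wderiv Om b u x * (zeta x * g b x + fd zeta (at x) b * w x)) +
		(lap Om u x * (h x * w x) +
		 (SUM b:Basis. wderiv Om b u x * (h x * g b x + fd h (at x) b * w x))))" by (rule bochner_integral_cong[OF refl])
	qed
	then show ?case using z1 z2 by simp
 qed
 show ?thesis by (rule main[OF P(2,1) w]) (use closure_subset[of Om] in "auto simp: K_def dist_norm norm_minus_commute")
qed

lemma green_H2N:
 fixes Om :: "'a::euclidean_space set"
 assumes Om: "smooth_domain Om" and u: "u : H2N Om" and w: "w : H1 Om"
 shows "(LINT x|leb Om. lap Om u x * w x) =
	- (SUM b:Basis. (LINT x|leb Om. wderiv Om b u x * wderiv Om b w x))"
proof -
 have op: "open Om" using Om by (auto simp: smooth_domain_def)
 have u2: "u : H2 Om" using u by (simp add: H2N_def)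
 have "sqint (leb Om) w" using w by (simp add: H1_def L2_eq_sqint)
 then have adm: "admissible Om w (%b. wderiv Om b w)" using H1_sqint[OF op w] by (simp add: admissible_def)
 note i = green_form_integrable[OF op u2 adm]
 have "0 = green_form Om u w (%b. wderiv Om b w)" by (rule green_form_zero[OF Om u adm, symmetric])
 also have "... = (LINT x|leb Om. lap Om u x * w x) +
	 (SUM b:Basis. (LINT x|leb Om. wderiv Om b u x * wderiv Om b w x))" unfolding green_form_def using i by simp
 finally show ?thesis by simp
qed

section \<open>Weak time derivatives\<close>

lemma test_fun_tensor:
 fixes psi :: "real => real" and phi :: "'a::euclidean_space => real"
 assumes psi: "psi : test_fun S" and phi: "phi : test_fun Om"
 shows "(%z. psi (fst z) * phi (snd z)) : test_fun (S \<times> Om)"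
	and "fd (%z. psi (fst z) * phi (snd z)) (at z) (1, 0) =
	 fd psi (at (fst z)) 1 * phi (snd z)"
proof -
 obtain K where K: "smooth_on UNIV psi" "compact K" "K \<subseteq> S" "!!x. x ~: K ==> psi x = 0" by (rule test_funE[OF psi]) blast
 obtain K' where K': "smooth_on UNIV phi" "compact K'" "K' \<subseteq> Om" "!!x. x ~: K' ==> phi x = 0" by (rule test_funE[OF phi]) blast
 have 1: "smooth_on UNIV (%z::real \<times> 'a. psi (0 + fst z))" by (rule smooth_on_compose_affine[OF open_UNIV open_UNIV bounded_linear_fst K(1) UNIV_I])
 have 2: "smooth_on UNIV (%z::real \<times> 'a. phi (0 + snd z))" by (rule smooth_on_compose_affine[OF open_UNIV open_UNIV bounded_linear_snd K'(1) UNIV_I])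
 have "smooth_on UNIV (%z. psi (fst z) * phi (snd z))" using smooth_on_mult[OF open_UNIV 1 2] by simp
 moreover have "psi (fst z) * phi (snd z) = 0" if "z ~: K \<times> K'" for z using that K(4)[of "fst z"] K'(4)[of "snd z"] by (cases z) auto
 ultimately show "(%z. psi (fst z) * phi (snd z)) : test_fun (S \<times> Om)" using compact_Times[OF K(2) K'(2)] K(3) K'(3) unfolding test_fun_def by blast
 have d1: "((%z::real \<times> 'a. psi (fst z)) has_derivative (%h. fd psi (at (fst z)) (fst h))) (at z)"
	by (rule has_derivative_compose[OF bounded_linear_imp_has_derivative[OF bounded_linear_fst]
		 smooth_on_has_derivative[OF open_UNIV K(1) UNIV_I]])
 have d2: "((%z::real \<times> 'a. phi (snd z)) has_derivative (%h. fd phi (at (snd z)) (snd h))) (at z)"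
	by (rule has_derivative_compose[OF bounded_linear_imp_has_derivative[OF bounded_linear_snd]
		 smooth_on_has_derivative[OF open_UNIV K'(1) UNIV_I]])
 have "fd phi (at (snd z)) 0 = 0" by (rule linear_0[OF has_derivative_linear[OF smooth_on_has_derivative[OF open_UNIV K'(1) UNIV_I]]])
 then show "fd (%z. psi (fst z) * phi (snd z)) (at z) (1, 0) =
	 fd psi (at (fst z)) 1 * phi (snd z)" using fun_cong[OF frechet_derivative_at[OF has_derivative_mult[OF d1 d2], symmetric], of "(1, 0)"] by simp
qed

lemma test_fun_sqint:
 assumes "phi : test_fun Om"
 shows "sqint lborel phi" "integrable lborel phi"
proof -
 obtain K where K: "smooth_on UNIV phi" "compact K" "K \<subseteq> Om" "!!x. x ~: K ==> phi x = 0" by (rule test_funE[OF assms]) blast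
 obtain r where r: "!!x. x : K ==> norm x <= r" using compact_imp_bounded[OF K(2)] bounded_iff by metis
 have 0: "phi x = 0" if "norm x > r" for x using K(4) r that by force
 obtain C where C: "C > 0" "!!x. \<bar>phi x\<bar> <= C" by (rule continuous_compact_support_bounded[OF smooth_on_continuous[OF K(1)] 0])
	 (assumption, (rule that; assumption))
 have b: "\<bar>phi x\<bar> <= C * ind (cball 0 r) x" for x using C 0[of x] by (cases "norm x <= r") auto
 have m: "phi : bmeas borel" by (intro borel_measurable_continuous_onI smooth_on_continuous K(1))
 show "sqint lborel phi" "integrable lborel phi" by (rule sqint_bounded_support[OF m b])+
qed

text \<open>Rises smoothly from 0 at time s to 1 at time s + 1 / (n + 1). Its derivative is an
  approximate delta at s, and a difference of two ramps approximates the indicator of a half-open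
  time interval.\<close>

definition ramp :: "nat => real => real => real" where
 "ramp n s tau = 1 - smooth_step (real (Suc n) * (tau - s) + 1)"

lemma ramp_smooth: "smooth_on UNIV (ramp n s)"
proof -
 have "smooth_on UNIV (%tau. smooth_step ((1 - real (Suc n) * s) + real (Suc n) * tau))"
	by (rule smooth_on_compose_affine[OF open_UNIV open_UNIV bounded_linear_mult_right smooth_step_smooth UNIV_I])
 then have "smooth_on UNIV (%tau. 1 - smooth_step ((1 - real (Suc n) * s) + real (Suc n) * tau))" by (intro smooth_on_diff smooth_on_const open_UNIV)
 moreover have "ramp n s = (%tau. 1 - smooth_step ((1 - real (Suc n) * s) + real (Suc n) * tau))" by (simp add: ramp_def[abs_def] algebra_simps)
 ultimately show ?thesis by simp
qed

lemma ramp_bounds: "0 <= ramp n s tau" "ramp n s tau <= 1" using smooth_step_bounds by (simp_all add: ramp_def)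

lemma ramp_left: "tau <= s ==> ramp n s tau = 0"
 and ramp_right: "tau >= s + 1 / real (Suc n) ==> ramp n s tau = 1"
proof -
 assume "tau <= s"
 then have "real (Suc n) * (tau - s) <= 0" by (simp add: mult_nonneg_nonpos)
 then show "ramp n s tau = 0" by (simp add: ramp_def smooth_step_eq)
next
 assume "tau >= s + 1 / real (Suc n)"
 then have "real (Suc n) * (1 / real (Suc n)) <= real (Suc n) * (tau - s)" by (intro mult_left_mono) auto
 then have "2 <= real (Suc n) * (tau - s) + 1" by simp
 then show "ramp n s tau = 1" by (simp add: ramp_def smooth_step_eq)
qed

lemma ramp_tendsto: "(%n. ramp n s tau) ----> (if tau <= s then 0 else 1)"
proof (cases "tau <= s")
 case True
 then show ?thesis by (simp add: ramp_left)
next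
 case False
 then obtain N where N: "1 / real (Suc N) < tau - s" using nat_approx_posE[of "tau - s"] by auto
 have "ramp n s tau = 1" if "n >= N" for n
 proof -
	have "1 / real (Suc n) <= 1 / real (Suc N)" using that by (intro divide_left_mono) auto
	then show ?thesis using N by (intro ramp_right) linarith
 qed
 then have "(%n. ramp n s tau) ----> 1" by (intro tendsto_eventually eventually_sequentiallyI)
 then show ?thesis using False by simp
qed

lemma ramp_derivative:
 obtains C where "C > 0" "!!n s tau. \<bar>fd (ramp n s) (at tau) 1\<bar> <= C * real (Suc n) * ind {s..s + 1 / real (Suc n)} tau"
proof -
 obtain C where C: "C > 0" "!!t. \<bar>fd smooth_step (at t) 1\<bar> <= C"
	"!!t. t < 1 \<or> t > 2 ==> fd smooth_step (at t) 1 = 0" by (rule smooth_step_derivative_bound) blast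
 show ?thesis
 proof (rule that[OF C(1)])
	fix n s tau
	let ?N = "real (Suc n)"
	have "((%tau. ?N * (tau - s) + 1) has_derivative (%h. ?N * h)) (at tau)" by (auto intro!: derivative_eq_intros)
	from frechet_derivative_compose_step[OF this]
	have "((%tau. 1 - smooth_step (?N * (tau - s) + 1)) has_derivative
		(%h. 0 - fd smooth_step (at (?N * (tau - s) + 1)) 1 * (?N * h))) (at tau)" by (intro has_derivative_diff has_derivative_const)
	from fun_cong[OF frechet_derivative_at[OF this, symmetric], of 1]
	have eq: "fd (ramp n s) (at tau) 1 = - fd smooth_step (at (?N * (tau - s) + 1)) 1 * ?N" by (simp add: ramp_def[abs_def])
	show "\<bar>fd (ramp n s) (at tau) 1\<bar> <= C * ?N * ind {s..s + 1 / ?N} tau"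
	proof (cases "tau : {s..s + 1 / ?N}")
	 case True
	 have "\<bar>fd smooth_step (at (?N * (tau - s) + 1)) 1\<bar> * ?N <= C * ?N" by (intro mult_right_mono C(2)) simp
	 then show ?thesis using True unfolding eq by (simp add: abs_mult)
	next
	 case False
	 then consider "tau < s" | "tau - s > 1 / ?N" by fastforce
	 then have "?N * (tau - s) + 1 < 1 \<or> ?N * (tau - s) + 1 > 2"
	 proof cases
		case 1 then show ?thesis by (simp add: mult_pos_neg)
	 next
		case 2
		then have "?N * (1 / ?N) < ?N * (tau - s)" by (intro mult_strict_left_mono) auto
		then show ?thesis by simp
	 qed
	 from C(3)[OF this] show ?thesis using False unfolding eq by simp
	qed
 qed
qed

lemma ramp_derivative_integral:
 "integrable lborel (%tau. fd (ramp n s) (at tau) 1)"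
 "(LBINT tau. fd (ramp n s) (at tau) 1) = 1"
proof -
 let ?D = "%tau. fd (ramp n s) (at tau) 1"
 obtain C where C: "!!tau. \<bar>?D tau\<bar> <= C * real (Suc n) * ind {s..s + 1 / real (Suc n)} tau" by (rule ramp_derivative) blast
 have cont: "continuous_on UNIV ?D" by (intro smooth_on_continuous smooth_on_frechet_derivative ramp_smooth) auto
 have der: "(ramp n s has_real_derivative ?D tau) (at tau)" for tau
 proof -
	have f: "(ramp n s has_derivative fd (ramp n s) (at tau)) (at tau)" by (rule smooth_on_has_derivative[OF open_UNIV ramp_smooth UNIV_I])
	moreover have "fd (ramp n s) (at tau) = (%h. ?D tau * h)"
	proof
	 show "fd (ramp n s) (at tau) h = ?D tau * h" for h using linear_scale[OF has_derivative_linear[OF f], of h 1] by (simp add: mult.commute)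
	qed
	ultimately show ?thesis by (simp only: has_field_derivative_def)
 qed
 have "has_bochner_integral lborel (%tau. ?D tau * ind {s..s + 1 / real (Suc n)} tau)
	 (ramp n s (s + 1 / real (Suc n)) - ramp n s s)"
 proof (rule has_bochner_integral_FTC_Icc_real)
	show "isCont ?D tau" for tau using cont by (simp add: continuous_on_eq_continuous_at)
 qed (use der in auto)
 moreover have "?D tau * ind {s..s + 1 / real (Suc n)} tau = ?D tau" for tau using C[of tau] by (cases "tau : {s..s + 1 / real (Suc n)}") auto
 moreover have "ramp n s (s + 1 / real (Suc n)) - ramp n s s = 1" by (simp add: ramp_left ramp_right)
 ultimately have "has_bochner_integral lborel ?D 1" by (simp only:)
 then show "integrable lborel ?D" "integral\<^sup>L lborel ?D = 1" by (simp_all add: has_bochner_integral_iff)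
qed

section \<open>Fubini in space-time and time integrals of square integrable functions\<close>

lemma AE_lborel_pair:
 fixes P :: "real \<times> 'a::euclidean_space => bool"
 assumes "AE z in lborel. P z"
 shows "AE t in lborel. AE x in lborel. P (t, x)" by (rule lborel_pair.AE_pair) (unfold lborel_prod, rule assms)

lemma lborel_pair_integral:
 fixes f :: "real \<times> 'a::euclidean_space => real"
 assumes "integrable lborel f"
 shows "(LBINT t. (LBINT x. f (t, x))) = integral\<^sup>L lborel f"
	"(LBINT x. (LBINT t. f (t, x))) = integral\<^sup>L lborel f"
	"integrable lborel (%t. (LBINT x. f (t, x)))"
	"integrable lborel (%x. (LBINT t. f (t, x)))"
proof -
 have f: "integrable (lborel \<Otimes>\<^sub>M lborel) f" using assms by (simp add: lborel_prod)
 then have f': "integrable (lborel \<Otimes>\<^sub>M lborel) (%(t, x). f (t, x))" by simp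
 show "(LBINT t. (LBINT x. f (t, x))) = integral\<^sup>L lborel f" using lborel_pair.integral_fst[OF f'] by (simp add: lborel_prod)
 show "(LBINT x. (LBINT t. f (t, x))) = integral\<^sup>L lborel f" using lborel_pair.integral_snd[OF f'] by (simp add: lborel_prod)
 show "integrable lborel (%t. (LBINT x. f (t, x)))" by (rule lborel_pair.integrable_fst[OF f'])
 show "integrable lborel (%x. (LBINT t. f (t, x)))" by (rule lborel_pair.integrable_snd[OF f'])
qed

lemma sqint_pair_time_integral:
 fixes g :: "real \<times> 'a::euclidean_space => real"
 assumes g: "sqint lborel g" and st: "s <= t"
 shows "AE x in lborel. integrable lborel (%tau. (g (tau, x))^2)"
	and "enn ((LBINT tau. ind {s<..t} tau * g (tau, x))^2) <=
	 enn (t - s) * (\<integral>\<^sup>+tau\<in>{s<..t}. enn ((g (tau, x))^2) \<partial>lborel)"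
	and "(%x. (LBINT tau. ind {s<..t} tau * g (tau, x))) : bmeas borel"
proof -
 have gm: "g : bmeas borel" using sqint_measurable[OF g] by simp
 then have gm' [measurable]: "g : bmeas (borel \<Otimes>\<^sub>M borel)" by (simp add: borel_prod)
 have "integrable (lborel \<Otimes>\<^sub>M lborel) (%(tau, x). (g (tau, x))^2)" using sqint_integrable[OF g] by (simp add: lborel_prod case_prod_unfold)
 from lborel_pair.AE_integrable_snd[OF this]
 show "AE x in lborel. integrable lborel (%tau. (g (tau, x))^2)" by simp
 have "(%x. (LBINT tau. ind {s<..t} tau * g (tau, x))) : bmeas (borel :: 'a measure)" by measurable
 then show "(%x. (LBINT tau. ind {s<..t} tau * g (tau, x))) : bmeas borel" .
 show "enn ((LBINT tau. ind {s<..t} tau * g (tau, x))^2) <=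
	 enn (t - s) * (\<integral>\<^sup>+tau\<in>{s<..t}. enn ((g (tau, x))^2) \<partial>lborel)"
 proof (cases "s = t")
	case True
	then show ?thesis by simp
 next
	case False
	then have lt: "t - s > 0" using st by simp
	let ?K = "%tau. ind {s<..t} tau / (t - s) :: real"
	have i: "integrable lborel (%tau. ind {s<..t} tau :: real)" using st by (intro integrable_real_indicator) auto
	have "enn ((LBINT tau. ?K tau * g (tau, x))^2) <= (nni lborel (%tau. enn (?K tau * (g (tau, x))^2)))"
	proof (rule jensen_square)
	 show "0 <= ?K tau" for tau using lt by simp
	 show "integrable lborel ?K" using i by simp
	 have "(LBINT tau. ?K tau) = (LBINT tau. ind {s<..t} tau) / (t - s)" by (rule integral_divide_zero)
	 also have "... = 1" using lt by simp
	 finally show "integral\<^sup>L lborel ?K = 1" .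
	 show "(%tau. g (tau, x)) : bmeas lborel" by measurable
	qed
	also have "... = (nni lborel (%tau. enn (1 / (t - s)) * (enn ((g (tau, x))^2) * ind {s<..t} tau)))"
	 by (rule nn_integral_cong) (use lt in "auto simp: indicator_def ennreal_mult'[symmetric]")
	also have "... = enn (1 / (t - s)) * (\<integral>\<^sup>+tau\<in>{s<..t}. enn ((g (tau, x))^2) \<partial>lborel)" by (rule nn_integral_cmult) measurable
	finally have le: "enn ((LBINT tau. ?K tau * g (tau, x))^2) <=
		enn (1 / (t - s)) * (\<integral>\<^sup>+tau\<in>{s<..t}. enn ((g (tau, x))^2) \<partial>lborel)" .
	have "(LBINT tau. ind {s<..t} tau * g (tau, x)) = (t - s) * (LBINT tau. ?K tau * g (tau, x))" using lt by (simp add: integral_divide_zero)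
	then have "enn ((LBINT tau. ind {s<..t} tau * g (tau, x))^2) =
		enn ((t - s)^2) * enn ((LBINT tau. ?K tau * g (tau, x))^2)" by (simp only: power_mult_distrib ennreal_mult'[OF zero_le_power2])
	also have "... <= enn ((t - s)^2) * (enn (1 / (t - s)) * (\<integral>\<^sup>+tau\<in>{s<..t}. enn ((g (tau, x))^2) \<partial>lborel))"
	 by (rule mult_left_mono[OF le]) simp
	also have "... = enn ((t - s)^2 * (1 / (t - s))) * (\<integral>\<^sup>+tau\<in>{s<..t}. enn ((g (tau, x))^2) \<partial>lborel)"
	 by (simp only: ennreal_mult'[OF zero_le_power2] mult.assoc)
	also have "(t - s)^2 * (1 / (t - s)) = t - s" using lt by (simp add: power2_eq_square)
	finally show ?thesis .
 qed
qed

lemma sqint_time_integral_bound: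
 fixes g :: "real \<times> 'a::euclidean_space => real"
 assumes g: "sqint lborel g" and st: "s <= t"
 defines "f \<equiv> %x. (LBINT tau. ind {s<..t} tau * g (tau, x))"
 shows "(nni lborel (%x. enn ((f x)^2))) <=
	 enn (t - s) * (\<integral>\<^sup>+tau\<in>{s<..t}. (nni lborel (%x. enn ((g (tau, x))^2))) \<partial>lborel)"
proof -
 have "g : bmeas borel" using sqint_measurable[OF g] by simp
 then have gm' [measurable]: "g : bmeas (borel \<Otimes>\<^sub>M borel)" by (simp add: borel_prod)
 have "(nni lborel (%x. enn ((f x)^2))) <=
	 (nni lborel (%x. enn (t - s) * (\<integral>\<^sup>+tau\<in>{s<..t}. enn ((g (tau, x))^2) \<partial>lborel)))"
	unfolding f_def by (intro nn_integral_mono sqint_pair_time_integral(2)[OF g st])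
 also have "... = enn (t - s) * (nni lborel (%x. (\<integral>\<^sup>+tau\<in>{s<..t}. enn ((g (tau, x))^2) \<partial>lborel)))" by (rule nn_integral_cmult) measurable
 also have "(nni lborel (%x. (\<integral>\<^sup>+tau\<in>{s<..t}. enn ((g (tau, x))^2) \<partial>lborel))) =
	 (nni lborel (%tau. (nni lborel (%x. enn ((g (tau, x))^2) * ind {s<..t} tau))))" by (rule lborel_pair.Fubini') measurable
 also have "... = (\<integral>\<^sup>+tau\<in>{s<..t}. (nni lborel (%x. enn ((g (tau, x))^2))) \<partial>lborel)"
	by (intro nn_integral_cong nn_integral_multc) measurable
 finally show ?thesis .
qed

text \<open>Test with psi(t) phi(x), where psi is a difference of ramps. On the side of
  \<open>v\<close> the derivative of psi concentrates at the two end times, where continuity in time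
  evaluates the pairing \<open>H\<close>; on the side of \<open>G\<close> psi tends to an indicator.
  As phi is arbitrary, the fundamental lemma removes it.\<close>

lemma weak_time_derivative_increment:
 fixes v :: "real => 'a::euclidean_space => real" and g G :: "real \<times> 'a => real"
 assumes Om: "open Om" "bounded Om"
	and cont: "continuous_on ({0<..<T} \<times> Om) (%z. v (fst z) (snd z))"
	and bound: "!!t x. t : {0<..<T} ==> x : Om ==> \<bar>v t x\<bar> <= R"
	and unif: "!!eta. eta > 0 ==> EX delta>0. ALL s:{0<..<T}. ALL t:{0<..<T}. \<bar>s - t\<bar> < delta --> (ALL x:Om. \<bar>v s x - v t x\<bar> <= eta)"
	and wd: "hwd ({0<..<T} \<times> Om) (1, 0) (%z. v (fst z) (snd z)) g"
	and G: "sqint lborel G" "!!z. z ~: {0<..<T} \<times> Om ==> G z = 0" "AE z in leb ({0<..<T} \<times> Om). g z = G z"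
	and st: "0 < s" "s < t" "t < T"
 shows "AE x in leb Om. v t x - v s x = (LBINT tau. ind {s<..t} tau * G (tau, x))"
proof -
 let ?Q = "{0<..<T} \<times> Om" and ?M = "leb Om"
 have Q: "open ?Q" by (intro open_Times Om) simp
 have Qs: "?Q : sets borel" "?Q : sets lebesgue" using Q by auto
 have Oms: "Om : sets borel" "Om : sets lebesgue" using Om by auto
 \<comment> \<open>A Borel extension by zero, so that Fubini on the whole space-time
   applies.\<close>
 define V where "V z = ind ?Q z * v (fst z) (snd z)" for z
 have Vm: "V : bmeas borel" using borel_measurable_continuous_on_indicator[OF Qs(1) cont] by (simp add: V_def[abs_def])
 have Gm: "G : bmeas borel" using sqint_measurable[OF G(1)] by simp
 have Vm' [measurable]: "V : bmeas (borel \<Otimes>\<^sub>M borel)" using Vm by (simp add: borel_prod)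
 have Gm' [measurable]: "G : bmeas (borel \<Otimes>\<^sub>M borel)" using Gm by (simp add: borel_prod)
 have Vb: "\<bar>V z\<bar> <= abs R" for z using bound[of "fst z" "snd z"] by (cases "z : ?Q") (auto simp: V_def)
 have vm: "v tau : bmeas ?M" if "tau : {0<..<T}" for tau
 proof -
	have "continuous_on Om (%x. v (fst (tau, x)) (snd (tau, x)))" by (rule continuous_on_compose2[OF cont]) (use that in "auto intro!: continuous_intros")
	then show ?thesis using Oms by (intro continuous_imp_measurable_on_sets_lebesgue) auto
 qed
 have vs: "sqint ?M (v tau)" if "tau : {0<..<T}" for tau
 proof -
	interpret finite_measure ?M using Om by (intro finite_measure_lebesgue_on bounded_set_imp_lmeasurable) auto
	have "(v tau x)^2 <= R^2" if "x : Om" for x using power_mono[OF bound[OF \<open>tau : {0<..<T}\<close> that], of 2] by simp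
	then have "integrable ?M (%x. (v tau x)^2)" by (intro integrable_const_bound[of _ "R^2"] AE_I2) (use vm[OF that] in auto)
	then show ?thesis using vm[OF that] by (simp add: sqint_def)
 qed
 define f where "f x = (LBINT tau. ind {s<..t} tau * G (tau, x))" for x
 have fm: "f : bmeas borel" unfolding f_def[abs_def] by (rule sqint_pair_time_integral(3)[OF G(1)]) (use st in simp)
 have f0: "f x = 0" if "x ~: Om" for x using that G(2) by (simp add: f_def)
 have fs: "sqint lborel f"
 proof -
	have "(nni lborel (%x. enn ((f x)^2))) <=
		enn (t - s) * (\<integral>\<^sup>+tau\<in>{s<..t}. (nni lborel (%x. enn ((G (tau, x))^2))) \<partial>lborel)"
	 unfolding f_def by (rule sqint_time_integral_bound[OF G(1)]) (use st in simp)
	also have "... <= enn (t - s) * (nni lborel (%tau. (nni lborel (%x. enn ((G (tau, x))^2)))))" by (intro mult_left_mono nn_integral_mono) (auto simp: indicator_def)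
	also have "(nni lborel (%tau. (nni lborel (%x. enn ((G (tau, x))^2))))) =
		(\<integral>\<^sup>+z. enn ((G z)^2) \<partial>(lborel \<Otimes>\<^sub>M lborel))" by (rule lborel.nn_integral_fst[of "%z. enn ((G z)^2)"]) measurable
	also have "... = enn (LBINT z. (G z)^2)" unfolding lborel_prod by (rule nn_integral_eq_integral[OF sqint_integrable[OF G(1)]]) simp
	finally have "(nni lborel (%x. enn ((f x)^2))) < top" by (rule le_less_trans) (simp add: ennreal_mult_less_top)
	then have "integrable lborel (%x. (f x)^2)" by (intro integrableI_nonneg) (use fm in auto)
	then show ?thesis using fm by (simp add: sqint_def)
 qed
 have fM: "sqint ?M f" using fs lebesgue_on_borel(2)[OF Oms(2), of "%x. (f x)^2"] lebesgue_on_borel(3)[OF Oms(2) fm f0] fm f0 by (simp add: sqint_def)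
 have "AE x in ?M. v t x - v s x - f x = 0"
 proof (rule fundamental_lemma[OF Om(1)])
	show "loc_integrable Om (%x. v t x - v s x - f x)" by (intro loc_integrable_L2 Om sqint_diff vs fM) (use st in auto)
	fix phi assume phi: "phi : test_fun Om"
	obtain K where K: "smooth_on UNIV phi" "compact K" "K \<subseteq> Om" "!!x. x ~: K ==> phi x = 0" by (rule test_funE[OF phi]) blast
	note phis = test_fun_sqint[OF phi]
	have phim [measurable]: "phi : bmeas borel" using sqint_measurable[OF phis(1)] by simp
	have phi0: "phi x = 0" if "x ~: Om" for x using K that by blast
	have phiM: "sqint ?M phi" using phis(1) lebesgue_on_borel(2)[OF Oms(2), of "%x. (phi x)^2"] lebesgue_on_borel(3)[OF Oms(2) phim phi0] phim phi0
	 by (simp add: sqint_def)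
	define c where "c = (LBINT x. \<bar>phi x\<bar>)"
	have c0: "c >= 0" by (simp add: c_def)
	define H where "H tau = (LBINT x. V (tau, x) * phi x)" for tau
	define \<Gamma> where "\<Gamma> tau = (LBINT x. G (tau, x) * phi x)" for tau
	have VG: "integrable lborel (%x. V (tau, x) * phi x)" for tau
	proof (rule bochner_integrable_bound)
	 show "integrable lborel (%x. abs R * \<bar>phi x\<bar>)" using phis(2) by simp
	 show "(%x. V (tau, x) * phi x) : bmeas lborel" by measurable
	 show "AE x in lborel. norm (V (tau, x) * phi x) <= norm (abs R * \<bar>phi x\<bar>)" using Vb by (intro AE_I2) (simp add: abs_mult mult_right_mono)
	qed
	have Hv: "H tau = (LINT x|?M. v tau x * phi x)" if "tau : {0<..<T}" for tau
	proof -
	 have "H tau = (LINT x|?M. V (tau, x) * phi x)" unfolding H_def by (rule lebesgue_on_borel(1)[OF Oms(2), symmetric]) (use phi0 in auto)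
	 also have "... = (LINT x|?M. v tau x * phi x)" by (rule bochner_integral_cong) (use that in "auto simp: V_def")
	 finally show ?thesis .
	qed
	have Hb: "\<bar>H tau - H tau'\<bar> <= eta * c"
	 if tau: "tau : {0<..<T}" "tau' : {0<..<T}" "!!x. x : Om ==> \<bar>v tau x - v tau' x\<bar> <= eta" for tau tau' eta
	proof -
	 have "H tau - H tau' = (LBINT x. V (tau, x) * phi x - V (tau', x) * phi x)" unfolding H_def using VG by simp
	 also have "norm ... <= (LBINT x. eta * \<bar>phi x\<bar>)"
	 proof (rule bochner_integral_norm_bound_integral)
		show "integrable lborel (%x. V (tau, x) * phi x - V (tau', x) * phi x)" by (intro bochner_integrable_diff VG)
		show "norm (V (tau, x) * phi x - V (tau', x) * phi x) <= eta * \<bar>phi x\<bar>" for x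
		proof (cases "x : Om")
		 case True
		 then have "V (tau, x) * phi x - V (tau', x) * phi x = (v tau x - v tau' x) * phi x" using tau by (simp add: V_def left_diff_distrib)
		 then show ?thesis using tau(3)[OF True] by (simp add: abs_mult mult_right_mono)
		qed (simp add: phi0)
	 qed (use phis(2) in simp)
	 finally show ?thesis by (simp add: c_def)
	qed
	obtain C where C: "C > 0" "!!n s tau. \<bar>fd (ramp n s) (at tau) 1\<bar> <= C * real (Suc n) * ind {s..s + 1 / real (Suc n)} tau" by (rule ramp_derivative) blast
	have HVm: "H : bmeas borel" unfolding H_def[abs_def] by measurable
	have Hbd: "\<bar>H tau\<bar> <= abs R * c" for tau
	proof -
	 have "norm (LBINT x. V (tau, x) * phi x) <= (LBINT x. abs R * \<bar>phi x\<bar>)" by (rule bochner_integral_norm_bound_integral[OF VG])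
		 (use phis(2) Vb in "auto simp: abs_mult mult_right_mono")
	 then show ?thesis by (simp add: H_def c_def)
	qed
	have Di: "integrable lborel (%tau. fd (ramp n s) (at tau) 1 * H tau)" for n s
	proof (rule bochner_integrable_bound)
	 show "integrable lborel (%tau. (abs R * c) * fd (ramp n s) (at tau) 1)" using ramp_derivative_integral(1) by simp
	 show "(%tau. fd (ramp n s) (at tau) 1 * H tau) : bmeas lborel" using borel_measurable_integrable[OF ramp_derivative_integral(1)] HVm by simp
	 have "abs d * \<bar>H tau\<bar> <= (abs R * c) * abs d" for tau d using mult_left_mono[OF Hbd abs_ge_zero, of d] by (simp add: mult.commute)
	 then show "AE tau in lborel. norm (fd (ramp n s) (at tau) 1 * H tau) <=
		 norm ((abs R * c) * fd (ramp n s) (at tau) 1)" using c0 by (intro AE_I2) (simp only: real_norm_def abs_mult abs_abs abs_of_nonneg[OF c0])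
	qed
	\<comment> \<open>The derivative of the ramp has integral 1, size at most C (n + 1) and support of
	  length 1 / (n + 1); so only the oscillation of \<open>H\<close> on a shrinking interval
	  matters.\<close>
	have delta: "(%n. (LBINT tau. fd (ramp n s) (at tau) 1 * H tau)) ----> H s"
	 if s: "s : {0<..<T}" for s
	proof (rule LIMSEQ_I)
	 fix e :: real assume "e > 0"
	 define eta where "eta = e / (2 * (C * c + 1))"
	 have Cc: "C * c + 1 > 0" using C(1) c0 by (simp add: add_nonneg_pos)
	 have eta: "eta > 0" using \<open>e > 0\<close> Cc by (simp add: eta_def)
	 obtain delta where delta: "delta > 0" "ALL s:{0<..<T}. ALL t:{0<..<T}. \<bar>s - t\<bar> < delta --> (ALL x:Om. \<bar>v s x - v t x\<bar> <= eta)"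
		using unif[OF eta] by blast
	 have "min delta (T - s) > 0" using delta(1) s by simp
	 then obtain N where N: "1 / real (Suc N) < min delta (T - s)" using nat_approx_posE by blast
	 have "norm ((LBINT tau. fd (ramp n s) (at tau) 1 * H tau) - H s) < e" if n: "n >= N" for n
	 proof -
		let ?D = "%tau. fd (ramp n s) (at tau) 1" and ?N = "real (Suc n)"
		have n1: "1 / ?N <= 1 / real (Suc N)" using n by (intro divide_left_mono) auto
		have "(LBINT tau. ?D tau * H tau) - H s = (LBINT tau. ?D tau * H tau - ?D tau * H s)" using Di[of n s] ramp_derivative_integral[of n s] by simp
		also have "norm ... <= (LBINT tau. (C * ?N * (eta * c)) * ind {s..s + 1 / ?N} tau)"
		proof (rule bochner_integral_norm_bound_integral)
		 show "integrable lborel (%tau. ?D tau * H tau - ?D tau * H s)" using Di[of n s] ramp_derivative_integral(1)[of n s] by simp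
		 show "integrable lborel (%tau. (C * ?N * (eta * c)) * ind {s..s + 1 / ?N} tau)" by (intro integrable_mult_right integrable_real_indicator) auto
		 fix tau :: real
		 show "norm (?D tau * H tau - ?D tau * H s) <= (C * ?N * (eta * c)) * ind {s..s + 1 / ?N} tau"
		 proof (cases "tau : {s..s + 1 / ?N}")
			case True
			then have tau: "tau : {0<..<T}" "\<bar>tau - s\<bar> < delta" using s n1 N by auto
			then have "\<bar>H tau - H s\<bar> <= eta * c" using delta(2) s by (intro Hb) auto
			then have "\<bar>?D tau\<bar> * \<bar>H tau - H s\<bar> <= (C * ?N) * (eta * c)" using C(2)[of n s tau] True C(1) by (intro mult_mono) auto
			then show ?thesis using True by (simp only: right_diff_distrib[symmetric] real_norm_def abs_mult indicator_simps)
		 next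
			case False
			then show ?thesis using C(2)[of n s tau] by simp
		 qed
		qed
		also have "... = C * c * eta" by (simp add: mult_ac)
		also have "... <= (C * c + 1) * eta" using eta by (simp add: distrib_right)
		also have "... = e / 2" using mult_divide_mult_cancel_left[of "C * c + 1" e 2] Cc by (simp only: eta_def times_divide_eq_right mult.commute[of 2])
		also have "... < e" using \<open>e > 0\<close> by simp
		finally show ?thesis .
	 qed
	 then show "EX no. ALL n>=no. norm ((LBINT tau. fd (ramp n s) (at tau) 1 * H tau) - H s) < e" by blast
	qed
	have KS: "sqint lborel (%z. k (fst z) * phi (snd z))"
	 if k: "!!tau. \<bar>k tau\<bar> <= B * ind (cball 0 \<bar>T\<bar>) tau" "k : bmeas borel" for k :: "real => real" and B
	proof -
	 have ks: "sqint lborel k" by (rule sqint_bounded_support(1)[OF k(2,1)])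
	 have m: "(%z. k (fst z) * phi (snd z)) : bmeas borel"
	 proof -
		have [measurable]: "k : bmeas borel" by (rule k(2))
		have "(%z. k (fst z) * phi (snd z)) : bmeas (borel \<Otimes>\<^sub>M borel)" by measurable
		then show ?thesis by (simp add: borel_prod)
	 qed
	 have "(\<integral>\<^sup>+z. enn ((k (fst z) * phi (snd z))^2) \<partial>(lborel \<Otimes>\<^sub>M lborel)) =
		 (nni lborel (%tau. (nni lborel (%x. enn ((k tau)^2) * enn ((phi x)^2)))))"
	 proof -
		have [measurable]: "k : bmeas borel" by (rule k(2))
		have "(%z. enn ((k (fst z) * phi (snd z))^2)) : bmeas (lborel \<Otimes>\<^sub>M lborel)" by measurable
		from lborel.nn_integral_fst[OF this] show ?thesis by (simp add: power_mult_distrib ennreal_mult')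
	 qed
	 also have "... = (nni lborel (%tau. enn ((k tau)^2) * enn (LBINT x. (phi x)^2)))" using nn_integral_eq_integral[OF sqint_integrable[OF phis(1)]]
		by (intro nn_integral_cong) (simp add: nn_integral_cmult)
	 also have "... = enn (LBINT tau. (k tau)^2) * enn (LBINT x. (phi x)^2)"
		using nn_integral_eq_integral[OF sqint_integrable[OF ks]] k(2) by (simp add: nn_integral_multc)
	 also have "... < top" by (simp add: ennreal_mult_less_top)
	 finally have "integrable (lborel \<Otimes>\<^sub>M lborel) (%z. (k (fst z) * phi (snd z))^2)" by (intro integrableI_nonneg) (use m in "auto simp: lborel_prod")
	 then show ?thesis using m by (simp add: sqint_def lborel_prod)
	qed
	note GI = sqint_mult_integrable[OF KS G(1)]
	\<comment> \<open>The support ends at t + 1 / (n + 1), hence n must be large for psi to be a test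
	  function on the time interval. The limit is 0 at s and 1 at t, the indicator of the interval open
	  on the left and closed on the right.\<close>
	define psi where "psi n tau = ramp n s tau - ramp n t tau" for n tau
	obtain N where N: "1 / real (Suc N) < T - t" using nat_approx_posE[of "T - t"] st by auto
	have nN: "1 / real (Suc n) < T - t" if "n >= N" for n
	proof -
	 have "1 / real (Suc n) <= 1 / real (Suc N)" using that by (intro divide_left_mono) auto
	 then show ?thesis using N by linarith
	qed
	have psis: "smooth_on UNIV (psi n)" for n unfolding psi_def[abs_def] by (intro smooth_on_diff ramp_smooth open_UNIV)
	have psi0: "psi n tau = 0" if "tau ~: {s..t + 1 / real (Suc n)}" for n tau
	proof (cases "tau < s")
	 case True then show ?thesis using st by (simp add: psi_def ramp_left)
	next
	 case False
	 then have "tau >= t + 1 / real (Suc n)" "tau >= s + 1 / real (Suc n)" using that st by auto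
	 then show ?thesis by (simp add: psi_def ramp_right)
	qed
	have psit: "psi n : test_fun {0<..<T}" if "n >= N" for n unfolding test_fun_def
	 using psis[of n] psi0[of _ n] nN[OF that] st by (auto intro!: exI[of _ "{s..t + 1 / real (Suc n)}"])
	have psib: "\<bar>psi n tau\<bar> <= 1 * ind (cball 0 \<bar>T\<bar>) tau" if "n >= N" for n tau
	 using psi0[of tau n] ramp_bounds[of n s tau] ramp_bounds[of n t tau] nN[OF that] st by (cases "tau : {s..t + 1 / real (Suc n)}") (auto simp: psi_def indicator_def)
	have psim: "psi n : bmeas borel" for n by (intro borel_measurable_continuous_onI smooth_on_continuous psis)
	have psiD: "fd (psi n) (at tau) 1 = fd (ramp n s) (at tau) 1 - fd (ramp n t) (at tau) 1" for n tau using fun_cong[OF frechet_derivative_at[OF has_derivative_diff[OF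
			smooth_on_has_derivative[OF open_UNIV ramp_smooth[of n s] UNIV_I, of tau]
			smooth_on_has_derivative[OF open_UNIV ramp_smooth[of n t] UNIV_I, of tau]], symmetric], of 1] by (simp add: psi_def[abs_def])
	have weak: "(LBINT tau. fd (psi n) (at tau) 1 * H tau) = - (LBINT tau. psi n tau * \<Gamma> tau)"
	 if n: "n >= N" for n
	proof -
	 let ?\<Phi> = "%z. psi n (fst z) * phi (snd z)" and ?d = "%tau. fd (psi n) (at tau) 1"
	 have T1: "?\<Phi> : test_fun ?Q" by (rule test_fun_tensor(1)[OF psit[OF n] phi])
	 have T2: "fd ?\<Phi> (at z) (1, 0) = ?d (fst z) * phi (snd z)" for z by (rule test_fun_tensor(2)[OF psit[OF n] phi])
	 have dz: "?d tau = 0" if "tau ~: {0<..<T}" for tau by (rule frechet_derivative_zero_outside[of "{s..t + 1 / real (Suc n)}"])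
		 (use psi0[of _ n] that nN[OF n] st in auto)
	 have Dm: "?d : bmeas borel" by (intro borel_measurable_continuous_onI smooth_on_continuous smooth_on_frechet_derivative psis) auto
	 have main: "(LINT z|leb ?Q. v (fst z) (snd z) * fd ?\<Phi> (at z) (1, 0)) =
		 - (LINT z|leb ?Q. g z * ?\<Phi> z)" using wd T1 unfolding has_weak_deriv_def by blast
	 let ?F1 = "%z. V z * (?d (fst z) * phi (snd z))"
	 have m1: "?F1 : bmeas borel"
	 proof -
		have [measurable]: "?d : bmeas borel" by (rule Dm)
		have "?F1 : bmeas (borel \<Otimes>\<^sub>M borel)" by measurable
		then show ?thesis by (simp add: borel_prod)
	 qed
	 have "(LINT z|leb ?Q. v (fst z) (snd z) * fd ?\<Phi> (at z) (1, 0)) =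
		 (LINT z|leb ?Q. ?F1 z)" unfolding T2 by (rule bochner_integral_cong) (auto simp: V_def)
	 also have "... = integral\<^sup>L lborel ?F1" by (rule lebesgue_on_borel(1)[OF Qs(2) m1]) (simp add: V_def)
	 also have "... = (LBINT tau. (LBINT x. ?F1 (tau, x)))"
	 proof (rule lborel_pair_integral(1)[symmetric])
		obtain B where B: "!!tau. \<bar>?d tau\<bar> <= B"
		proof -
		 have "\<bar>?d tau\<bar> <= 2 * (C * real (Suc n))" for tau
		 proof -
			have "\<bar>fd (ramp n s) (at tau) 1\<bar> <= C * real (Suc n)" for s using C(2)[of n s tau] C(1) by (cases "tau : {s..s + 1 / real (Suc n)}") auto
			from this[of s] this[of t] show ?thesis unfolding psiD by linarith
		 qed
		 then show thesis by (rule that)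
		qed
		have db: "\<bar>?d tau\<bar> <= B * ind (cball 0 \<bar>T\<bar>) tau" for tau using B[of tau] dz[of tau] by (cases "tau : {0<..<T}") (auto simp: indicator_def)
		have "bounded ?Q" using bounded_subset[OF compact_imp_bounded[OF compact_Icc[of 0 T]], of "{0<..<T}"] Om(2) by (intro bounded_Times) auto
		then obtain r where "!!z. z : ?Q ==> norm z <= r" using bounded_iff by metis
		then have "\<bar>V z\<bar> <= abs R * ind (cball 0 r) z" for z using Vb[of z] by (cases "z : ?Q") (auto simp: V_def indicator_def)
		then have "sqint lborel V" by (rule sqint_bounded_support(1)[OF Vm])
		from sqint_mult_integrable[OF this KS[OF db Dm]] show "integrable lborel ?F1" .
	 qed
	 also have "... = (LBINT tau. ?d tau * H tau)"
	 proof (rule bochner_integral_cong[OF refl])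
		fix tau
		have "(LBINT x. ?F1 (tau, x)) = (LBINT x. ?d tau * (V (tau, x) * phi x))" by (simp add: mult_ac)
		then show "(LBINT x. ?F1 (tau, x)) = ?d tau * H tau" by (simp add: H_def)
	 qed
	 finally have L: "(LINT z|leb ?Q. v (fst z) (snd z) * fd ?\<Phi> (at z) (1, 0)) =
		 (LBINT tau. ?d tau * H tau)" .
	 have \<Phi>m: "?\<Phi> : bmeas borel" using T1 by (auto simp: test_fun_def intro!: borel_measurable_continuous_onI smooth_on_continuous)
	 have "(LINT z|leb ?Q. g z * ?\<Phi> z) = (LINT z|leb ?Q. ?\<Phi> z * G z)"
	 proof (rule integral_cong_AE)
		have "g : bmeas (leb ?Q)" using wd loc_integrable_measurable[OF Q] by (auto simp: has_weak_deriv_def)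
		then show "(%z. g z * ?\<Phi> z) : bmeas (leb ?Q)" using borel_measurable_lebesgue_on[OF \<Phi>m] by simp
		show "(%z. ?\<Phi> z * G z) : bmeas (leb ?Q)" using borel_measurable_lebesgue_on[OF \<Phi>m] borel_measurable_lebesgue_on[OF Gm] by simp
		show "AE z in leb ?Q. g z * ?\<Phi> z = ?\<Phi> z * G z" using G(3) by eventually_elim simp
	 qed
	 also have "... = (LBINT z. ?\<Phi> z * G z)" by (rule lebesgue_on_borel(1)[OF Qs(2)]) (use \<Phi>m Gm G(2) in auto)
	 also have "... = (LBINT tau. (LBINT x. ?\<Phi> (tau, x) * G (tau, x)))" by (rule lborel_pair_integral(1)[symmetric, OF GI[OF psib[OF n] psim]])
	 also have "... = (LBINT tau. psi n tau * \<Gamma> tau)"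
	 proof (rule bochner_integral_cong[OF refl])
		fix tau
		have "(LBINT x. ?\<Phi> (tau, x) * G (tau, x)) = (LBINT x. psi n tau * (G (tau, x) * phi x))" by (simp add: mult_ac)
		then show "(LBINT x. ?\<Phi> (tau, x) * G (tau, x)) = psi n tau * \<Gamma> tau" by (simp add: \<Gamma>_def)
	 qed
	 finally show ?thesis using L main by simp
	qed
	let ?I = "%tau. ind {s<..t} tau :: real"
	have Ib: "\<bar>?I tau\<bar> <= 1 * ind (cball 0 \<bar>T\<bar>) tau" for tau using st by (auto simp: indicator_def)
	have T1b: "\<bar>ind {0<..<T} tau :: real\<bar> <= 1 * ind (cball 0 \<bar>T\<bar>) tau" for tau by (auto simp: indicator_def)
	have G0: "\<Gamma> tau = 0" if "tau ~: {0<..<T}" for tau 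
	proof -
	 have "G (tau, x) = 0" for x using that by (intro G(2)) auto
	 then show ?thesis by (simp add: \<Gamma>_def)
	qed
	have \<Gamma>i: "integrable lborel \<Gamma>"
	proof -
	 have "integrable lborel (%tau. (LBINT x. (ind {0<..<T} (fst (tau, x)) * phi (snd (tau, x))) * G (tau, x)))" by (rule lborel_pair_integral(3)[OF GI[OF T1b]]) simp
	 moreover have "(LBINT x. (ind {0<..<T} (fst (tau, x)) * phi (snd (tau, x))) * G (tau, x)) = \<Gamma> tau" for tau
		using G0[of tau] by (cases "tau : {0<..<T}") (auto simp: \<Gamma>_def mult.commute)
	 ultimately show ?thesis by simp
	qed
	have lim1: "(%n. (LBINT tau. psi n tau * \<Gamma> tau)) ----> (LBINT tau. ?I tau * \<Gamma> tau)"
	proof (rule integral_dominated_convergence)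
	 show "integrable lborel (%tau. \<bar>\<Gamma> tau\<bar>)" using \<Gamma>i by simp
	 have "(%n. psi n tau) ----> (if tau <= s then 0 else 1) - (if tau <= t then 0 else 1)" for tau unfolding psi_def by (intro tendsto_diff ramp_tendsto)
	 moreover have "(if tau <= s then 0 else 1) - (if tau <= t then 0 else 1) = ?I tau" for tau using st by (auto simp: indicator_def)
	 ultimately have "(%n. psi n tau) ----> ?I tau" for tau by metis
	 then show "AE tau in lborel. (%n. psi n tau * \<Gamma> tau) ----> ?I tau * \<Gamma> tau" by (intro AE_I2 tendsto_mult tendsto_const)
	 have "\<bar>psi n tau\<bar> <= 1" for n tau using ramp_bounds[of n s tau] ramp_bounds[of n t tau] by (simp add: psi_def abs_le_iff)
	 then have "\<bar>psi n tau\<bar> * \<bar>\<Gamma> tau\<bar> <= 1 * \<bar>\<Gamma> tau\<bar>" for n tau by (intro mult_right_mono) auto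
	 then show "AE tau in lborel. norm (psi n tau * \<Gamma> tau) <= \<bar>\<Gamma> tau\<bar>" for n by (simp add: abs_mult)
	qed (use psim borel_measurable_integrable[OF \<Gamma>i] in auto)
	have "(%n. (LBINT tau. fd (ramp n s) (at tau) 1 * H tau) -
		(LBINT tau. fd (ramp n t) (at tau) 1 * H tau)) ----> H s - H t" by (intro tendsto_diff delta) (use st in auto)
	then have lim2: "(%n. (LBINT tau. fd (psi n) (at tau) 1 * H tau)) ----> H s - H t" unfolding psiD left_diff_distrib using Di by simp
	have "(%n. (LBINT tau. fd (psi n) (at tau) 1 * H tau)) ----> - (LBINT tau. ?I tau * \<Gamma> tau)" by (rule Lim_transform_eventually[OF tendsto_minus[OF lim1]])
		(rule eventually_sequentiallyI[of N], simp add: weak)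
	from LIMSEQ_unique[OF lim2 this] have HG: "H t - H s = (LBINT tau. ?I tau * \<Gamma> tau)" by simp
	have Ii: "integrable lborel (%z. (?I (fst z) * phi (snd z)) * G z)" by (rule GI[OF Ib]) simp
	have "(LBINT tau. ?I tau * \<Gamma> tau) = (LBINT tau. (LBINT x. (?I (fst (tau, x)) * phi (snd (tau, x))) * G (tau, x)))" by (rule bochner_integral_cong[OF refl])
		(simp add: \<Gamma>_def mult_ac flip: integral_mult_right_zero)
	also have "... = (LBINT x. (LBINT tau. (?I (fst (tau, x)) * phi (snd (tau, x))) * G (tau, x)))" using lborel_pair_integral(1,2)[OF Ii] by simp
	also have "... = (LBINT x. f x * phi x)" by (rule bochner_integral_cong[OF refl]) (simp add: f_def mult_ac flip: integral_mult_right_zero integral_mult_left_zero)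
	also have "... = (LINT x|?M. f x * phi x)" by (rule lebesgue_on_borel(1)[OF Oms(2), symmetric]) (use fm f0 in auto)
	finally have "H t - H s = (LINT x|?M. f x * phi x)" using HG by simp
	moreover have "(LINT x|?M. (v t x - v s x - f x) * phi x) = (LINT x|?M. v t x * phi x) - (LINT x|?M. v s x * phi x) - (LINT x|?M. f x * phi x)"
	 using sqint_mult_integrable[OF vs[of t] phiM] sqint_mult_integrable[OF vs[of s] phiM] sqint_mult_integrable[OF fM phiM] st by (simp add: left_diff_distrib)
	ultimately show "(LINT x|?M. (v t x - v s x - f x) * phi x) = 0" using Hv[of t] Hv[of s] st by simp
 qed
 then show ?thesis by (simp add: f_def)
qed

section \<open>Energy estimates at fixed times\<close>

definition ip :: "'b measure => ('b => real) => ('b => real) => real" where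
 "ip M f g = (LINT x|M. f x * g x)"

lemma ip_commute: "ip M f g = ip M g f" by (simp add: ip_def mult.commute)

lemma ip_self: "ip M f f = (l2norm M f)^2" unfolding l2norm_sq by (simp add: ip_def power2_eq_square)

lemma ip_bound: "sqint M f ==> sqint M g ==> \<bar>ip M f g\<bar> <= l2norm M f * l2norm M g" unfolding ip_def by (rule l2_Cauchy_Schwarz)


lemma ip_diff:
 assumes "sqint M f" "sqint M g" "sqint M k"
 shows "ip M (%x. f x - g x) k = ip M f k - ip M g k" "ip M k (%x. f x - g x) = ip M k f - ip M k g"
 using sqint_mult_integrable[OF assms(1,3)] sqint_mult_integrable[OF assms(2,3)] by (simp_all add: ip_def left_diff_distrib right_diff_distrib mult.commute[of "k _"])

lemma ip_cong_AE:
 assumes "f : bmeas M" "g : bmeas M" "k : bmeas M" "AE x in M. f x = g x"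
 shows "ip M f k = ip M g k" unfolding ip_def by (rule integral_cong_AE) (use assms in auto)

lemma l2norm_mono:
 assumes f: "sqint M f" and g: "sqint M g" and le: "!!x. x : space M ==> \<bar>f x\<bar> <= c * \<bar>g x\<bar>" and c: "c >= 0"
 shows "l2norm M f <= c * l2norm M g"
proof -
 have "(LINT x|M. (f x)^2) <= (LINT x|M. (c * g x)^2)"
 proof (rule integral_mono)
	show "integrable M (%x. (f x)^2)" by (rule sqint_integrable[OF f])
	show "integrable M (%x. (c * g x)^2)" by (rule sqint_integrable[OF sqint_scale[OF g]])
	show "(f x)^2 <= (c * g x)^2" if "x : space M" for x using le[OF that] c by (simp add: abs_le_square_iff[symmetric] abs_mult)
 qed
 then have "l2norm M f <= l2norm M (%x. c * g x)" unfolding l2norm_def by (rule real_sqrt_le_mono)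
 then show ?thesis using c by (simp add: l2norm_scale)
qed

section \<open>The double-well potential on a bounded range\<close>

lemma W_derivatives:
 "deriv (W a) = (%r. a * (r ^ 3 - r))"
 "deriv (deriv (W a)) = (%r. a * (3 * r^2 - 1))"
proof -
 have "(W a has_real_derivative a * (r ^ 3 - r)) (at r)" for r unfolding W_def[abs_def]
	by (auto intro!: derivative_eq_intros simp: algebra_simps power2_eq_square power3_eq_cube)
 then show 1: "deriv (W a) = (%r. a * (r ^ 3 - r))" by (intro ext DERIV_imp_deriv)
 have "((%r. a * (r ^ 3 - r)) has_real_derivative a * (3 * r^2 - 1)) (at r)" for r
	by (auto intro!: derivative_eq_intros simp: algebra_simps power2_eq_square power3_eq_cube)
 then show "deriv (deriv (W a)) = (%r. a * (3 * r^2 - 1))" unfolding 1 by (intro ext DERIV_imp_deriv)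
qed

lemma W_measurable [measurable]:
 "W a : bmeas borel" "deriv (W a) : bmeas borel" "deriv (deriv (W a)) : bmeas borel"
proof -
 show "W a : bmeas borel" unfolding W_def[abs_def] by measurable
 show "deriv (deriv (W a)) : bmeas borel" unfolding W_derivatives(2) by measurable
 show "deriv (W a) : bmeas borel" unfolding W_derivatives(1) by measurable
qed

text \<open>All three remainders factor exactly: p^2 + p q + q^2 - 1 times p - q for the difference
  of W', and q + 2p respectively (p^2 - q^2)/4 times (p - q)^2 for the Taylor and the trapezoidal
  remainder, up to a sign and the factor a. Since \<open>R >= 1\<close>, each polynomial factor is
  at most 4 R^3.\<close>

lemma W_estimates:
 fixes p q R :: real
 assumes a: "a > 0" and R: "R >= 1" and pq: "abs p <= R" "abs q <= R"
 defines "L \<equiv> 4 * a * R ^ 3"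
 shows "\<bar>deriv (W a) p - deriv (W a) q\<bar> <= L * \<bar>p - q\<bar>"
	and "\<bar>deriv (W a) p - deriv (W a) q - deriv (deriv (W a)) p * (p - q)\<bar> <= L * (p - q)^2"
	and "\<bar>W a p - W a q - 1 / 2 * (deriv (W a) p + deriv (W a) q) * (p - q)\<bar> <= L * (p - q)^2"
	and "\<bar>deriv (W a) p\<bar> <= L" "\<bar>deriv (deriv (W a)) p\<bar> <= L" "\<bar>W a p\<bar> <= a * (R^2 + 1)^2"
proof -
 have p2: "p^2 <= R^2" and q2: "q^2 <= R^2" using pq by (simp_all add: abs_le_square_iff[symmetric] R)
 have pqb: "\<bar>p * q\<bar> <= R^2" unfolding abs_mult power2_eq_square using pq by (intro mult_mono) auto
 have r1: "1 <= R^2" using R by simp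
 have r2: "R <= R^2" using R by (simp add: power2_eq_square)
 have r3: "R^2 <= R ^ 3" using R by (intro power_increasing) auto
 have le: "abs x * y <= R ^ 3 * 4 * y" if "abs x <= 4 * R ^ 3" "y >= 0" for x y using mult_right_mono[OF that] by (simp add: mult.commute)
 have b: "\<bar>p\<^sup>2 + p * q + q^2 - 1\<bar> <= 4 * R ^ 3"
	using pq p2 q2 pqb r1 r2 r3 R zero_le_power2[of p] zero_le_power2[of q] unfolding abs_le_iff by linarith
 have "deriv (W a) p - deriv (W a) q = a * ((p^2 + p * q + q^2 - 1) * (p - q))" by (simp add: W_derivatives algebra_simps power2_eq_square power3_eq_cube)
 then have "\<bar>deriv (W a) p - deriv (W a) q\<bar> = a * (\<bar>p\<^sup>2 + p * q + q^2 - 1\<bar> * \<bar>p - q\<bar>)" using a by (simp add: abs_mult)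
 also have "... <= a * (R ^ 3 * 4 * \<bar>p - q\<bar>)" by (intro mult_left_mono le b) (use a in auto)
 finally show "\<bar>deriv (W a) p - deriv (W a) q\<bar> <= L * \<bar>p - q\<bar>" by (simp add: L_def mult_ac)
 have b: "\<bar>q + 2 * p\<bar> <= 4 * R ^ 3" using pq p2 q2 pqb r1 r2 r3 R zero_le_power2[of p] zero_le_power2[of q] unfolding abs_le_iff by linarith
 have "deriv (W a) p - deriv (W a) q - deriv (deriv (W a)) p * (p - q) = - a * ((q + 2 * p) * (p - q)^2)"
	unfolding W_derivatives(2) unfolding W_derivatives(1) by algebra
 then have "\<bar>deriv (W a) p - deriv (W a) q - deriv (deriv (W a)) p * (p - q)\<bar> = a * (\<bar>q + 2 * p\<bar> * (p - q)^2)" using a by (simp add: abs_mult)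
 also have "... <= a * (R ^ 3 * 4 * (p - q)^2)" by (intro mult_left_mono le b) (use a in auto)
 finally show "\<bar>deriv (W a) p - deriv (W a) q - deriv (deriv (W a)) p * (p - q)\<bar> <= L * (p - q)^2" by (simp add: L_def mult_ac)
 have sq: "p^2 - q^2 <= R^2" "q^2 - p^2 <= R^2" "0 <= R^2" using p2 q2 zero_le_power2[of p] zero_le_power2[of q] by linarith+
 have b: "\<bar>(p^2 - q^2) / 4\<bar> <= 4 * R ^ 3"
 proof -
	have "\<bar>x / 4\<bar> <= 4 * z" if "x <= y" "- x <= y" "0 <= y" "y <= z" for x y z :: real using that by (simp add: abs_le_iff)
	from this[OF sq(1) _ sq(3) r3] sq(2) show ?thesis by simp
 qed
 have "W a p - W a q - 1 / 2 * (deriv (W a) p + deriv (W a) q) * (p - q) = - a * ((p^2 - q^2) / 4 * (p - q)^2)"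
	unfolding W_derivatives W_def by (simp add: field_simps) algebra
 then have "\<bar>W a p - W a q - 1 / 2 * (deriv (W a) p + deriv (W a) q) * (p - q)\<bar> = a * (\<bar>(p^2 - q^2) / 4\<bar> * (p - q)^2)"
	using a by (simp only: abs_mult abs_minus_cancel abs_power2 abs_of_pos)
 also have "... <= a * (R ^ 3 * 4 * (p - q)^2)" by (intro mult_left_mono le b) (use a in auto)
 finally show "\<bar>W a p - W a q - 1 / 2 * (deriv (W a) p + deriv (W a) q) * (p - q)\<bar> <= L * (p - q)^2" by (simp add: L_def mult_ac)
 have "\<bar>p ^ 3\<bar> <= R ^ 3" unfolding power_abs using pq by (intro power_mono) auto
 then have "\<bar>p ^ 3 - p\<bar> <= 4 * R ^ 3" using pq r2 r3 R by linarith
 then show "\<bar>deriv (W a) p\<bar> <= L" using a by (simp add: W_derivatives abs_mult L_def mult_ac)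
 have "\<bar>3 * p^2 - 1\<bar> <= 4 * R ^ 3" using p2 r1 r3 zero_le_power2[of p] by linarith
 then show "\<bar>deriv (deriv (W a)) p\<bar> <= L" using a unfolding W_derivatives(2) by (simp add: abs_mult L_def mult_ac)
 have "\<bar>p\<^sup>2 - 1\<bar> <= R^2 + 1" using p2 zero_le_power2[of p] by linarith
 then have "\<bar>p\<^sup>2 - 1\<bar>\<^sup>2 <= (R^2 + 1)^2" by (intro power_mono) auto
 then have "a / 4 * (p^2 - 1)^2 <= a * (R^2 + 1)^2" using a by (intro mult_mono) auto
 then show "\<bar>W a p\<bar> <= a * (R^2 + 1)^2" using a by (simp add: W_def)
qed

lemma H2N_H2: "u : H2N Om ==> u : H2 Om" by (simp add: H2N_def)

lemma green_symmetric:
 assumes Om: "smooth_domain Om" and u: "u : H2N Om" and w: "w : H2N Om"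
 shows "ip (leb Om) (lap Om u) w = ip (leb Om) u (lap Om w)"
proof -
 have "open Om" using Om by (simp add: smooth_domain_def)
 note H = H2_sqint(1)[OF this H2N_H2]
 show ?thesis using green_H2N[OF Om u H[OF w]] green_H2N[OF Om w H[OF u]] unfolding ip_def by (simp add: mult.commute)
qed

text \<open>Functions that agree almost everywhere satisfy the same predicate
  \<open>has_weak_deriv\<close>, so the choice in \<open>wderiv\<close> returns the very same
  function and all derived notions coincide literally. It transfers the constraints from the initial
  datum to \<open>v 0\<close>, which equals it only almost everywhere.\<close>

lemma M2_cong_AE:
 fixes u :: "'a::euclidean_space => real"
 assumes Om: "open Om" and w: "w : M2 Om a \<alpha> \<beta>" and u: "u : bmeas (leb Om)"
	and eq: "AE x in leb Om. u x = w x"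
 shows "u : M2 Om a \<alpha> \<beta>"
proof -
 have wN: "w : H2N Om" "avg Om w = \<alpha>" "F Om a w = \<beta>" using w by (simp_all add: M2_def)
 have wH: "w : H2 Om" by (rule H2N_H2[OF wN(1)])
 then have w1: "w : H1 Om" by (simp add: H2_def)
 then have wL: "sqint (leb Om) w" by (simp add: H1_def L2_eq_sqint)
 note wm = sqint_measurable[OF wL]
 have hw: "hwd Om b u = hwd Om b w" if "b : Basis" for b by (rule ext) (rule has_weak_deriv_cong_AE[OF Om u wm eq that])
 have wd: "wderiv Om b u = wderiv Om b w" if "b : Basis" for b unfolding wderiv_def hw[OF that] by (rule refl)
 have "u : L2 Om" using sqint_cong_AE[OF u wm eq] wL by (simp add: L2_eq_sqint)
 then have "u : H1 Om" using w1 hw by (simp add: H1_def)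
 then have "u : H2 Om" using wH wd by (simp add: H2_def)
 then have "u : H2N Om" using wN(1) wd by (simp add: H2N_def)
 moreover have "avg Om u = \<alpha>" using integral_cong_AE[OF u wm eq] wN(2) by (simp add: avg_def)
 moreover have "F Om a u = \<beta>"
 proof -
	have "AE x in leb Om. W a (u x) = W a (w x)" using eq by eventually_elim simp
	then have "(LINT x|leb Om. W a (u x)) = (LINT x|leb Om. W a (w x))" by (intro integral_cong_AE measurable_compose[OF u] measurable_compose[OF wm] W_measurable)
	then show ?thesis using wN(3) wd by (simp add: F_def)
 qed
 ultimately show ?thesis by (simp add: M2_def)
qed

lemma l2norm_le_H2norm:
 fixes w :: "'a::euclidean_space => real"
 shows "L2norm Om w <= H2norm Om w" "H2norm Om w >= 0"
proof -
 have "(L2norm Om w)^2 <= (L2norm Om w)^2 + (SUM b:Basis. (H1norm Om (wderiv Om b w))^2)" by (simp add: sum_nonneg)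
 then show "L2norm Om w <= H2norm Om w" unfolding H2norm_def by (rule real_le_rsqrt)
 show "H2norm Om w >= 0" by (simp add: H2norm_def sum_nonneg)
qed

lemma l2norm_sum_le:
 assumes "finite I" "!!i. i : I ==> sqint M (f i)"
 shows "l2norm M (%x. SUM i:I. f i x) <= (SUM i:I. l2norm M (f i))" using assms
proof (induction I)
 case empty
 then show ?case by (simp add: l2norm_def)
next
 case (insert i I)
 have "l2norm M (%x. f i x + (SUM i:I. f i x)) <= l2norm M (f i) + l2norm M (%x. SUM i:I. f i x)" by (intro l2norm_triangle sqint_sum insert.prems) auto
 also have "l2norm M (%x. SUM i:I. f i x) <= (SUM i:I. l2norm M (f i))" using insert by auto
 finally show ?case using insert.hyps by simp
qed

lemma l2norm_wlaplacian:
 fixes w :: "'a::euclidean_space => real"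
 assumes Om: "open Om" and w: "w : H2 Om"
 shows "l2norm (leb Om) (lap Om w) <= real DIM('a) * H2norm Om w"
proof -
 have b: "l2norm (leb Om) (wderiv Om b (wderiv Om b w)) <= H2norm Om w" if b: "b : Basis" for b
 proof -
	have "(L2norm Om (wderiv Om b (wderiv Om b w)))^2 <= (SUM c:Basis. (L2norm Om (wderiv Om c (wderiv Om b w)))^2)" using b by (intro member_le_sum) auto
	also have "... <= (H1norm Om (wderiv Om b w))^2" by (simp add: H1norm_def sum_nonneg)
	also have "... <= (SUM b:Basis. (H1norm Om (wderiv Om b w))^2)" using b by (intro member_le_sum) auto
	finally have "(L2norm Om (wderiv Om b (wderiv Om b w)))^2 <= (L2norm Om w)^2 + (SUM b:Basis. (H1norm Om (wderiv Om b w))^2)"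
	 using zero_le_power2[of "L2norm Om w"] by linarith
	then have "L2norm Om (wderiv Om b (wderiv Om b w)) <= H2norm Om w" unfolding H2norm_def by (rule real_le_rsqrt)
	then show ?thesis by (simp add: L2norm_eq)
 qed
 have "l2norm (leb Om) (lap Om w) <= (SUM b:Basis. l2norm (leb Om) (wderiv Om b (wderiv Om b w)))" unfolding wlaplacian_def[abs_def]
	by (intro l2norm_sum_le H1_sqint(2)[OF Om H2_sqint(2)[OF Om w]]) auto
 also have "... <= (SUM b:(Basis::'a set). H2norm Om w)" by (rule sum_mono) (rule b)
 finally show ?thesis by simp
qed

lemma test_fun_derivative:
 assumes "phi : test_fun Om" "b : Basis"
 shows "(%x. fd phi (at x) b) : test_fun Om"
proof -
 obtain K where K: "smooth_on UNIV phi" "compact K" "K \<subseteq> Om" "!!x. x ~: K ==> phi x = 0" by (rule test_funE[OF assms(1)]) blast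
 have "fd phi (at x) b = 0" if "x ~: K" for x by (rule frechet_derivative_zero_outside[OF compact_imp_closed[OF K(2)] K(4) that])
 then show ?thesis using K assms(2) smooth_on_frechet_derivative[OF open_UNIV K(1) assms(2)] by (auto simp: test_fun_def)
qed

text \<open>Both derivatives move to the test function, so the pairing depends on \<open>u\<close>
  alone and is continuous under L2 convergence.\<close>

lemma ip_wlaplacian_test_fun:
 fixes u :: "'a::euclidean_space => real"
 assumes Om: "open Om" and u: "u : H2 Om" and phi: "phi : test_fun Om"
 shows "ip (leb Om) (lap Om u) phi =
	ip (leb Om) u (%x. SUM b:Basis. fd (%x. fd phi (at x) b) (at x) b)"
proof -
 note uH = H2_sqint[OF Om u]
 let ?D = "%b x. fd (%x. fd phi (at x) b) (at x) b"
 have b: "(LINT x|leb Om. wderiv Om b (wderiv Om b u) x * phi x) = (LINT x|leb Om. u x * ?D b x)" if b: "b : Basis" for b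
 proof -
	have "(LINT x|leb Om. wderiv Om b u x * fd phi (at x) b) = - (LINT x|leb Om. wderiv Om b (wderiv Om b u) x * phi x)"
	 using H1_sqint(3)[OF Om uH(2)[OF b] b] phi by (simp add: has_weak_deriv_def)
	moreover have "(LINT x|leb Om. u x * ?D b x) = - (LINT x|leb Om. wderiv Om b u x * fd phi (at x) b)"
	 using H1_sqint(3)[OF Om uH(1) b] test_fun_derivative[OF phi b] by (simp add: has_weak_deriv_def)
	ultimately show ?thesis by simp
 qed
 have i1: "integrable (leb Om) (%x. wderiv Om b (wderiv Om b u) x * phi x)" if "b : Basis" for b
	by (rule test_fun_integrable(1)[OF Om loc_integrable_L2[OF Om H1_sqint(2)[OF Om uH(2)[OF that] that]] phi])
 have i2: "integrable (leb Om) (%x. u x * ?D b x)" if "b : Basis" for b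
	by (rule test_fun_integrable(2)[OF Om loc_integrable_L2[OF Om H1_sqint(1)[OF Om uH(1) that]] test_fun_derivative[OF phi that] that])
 have "ip (leb Om) (lap Om u) phi = (SUM b:Basis. (LINT x|leb Om. wderiv Om b (wderiv Om b u) x * phi x))"
	unfolding ip_def wlaplacian_def sum_distrib_right by (rule bochner_integral_sum) (rule i1)
 also have "... = (SUM b:Basis. (LINT x|leb Om. u x * ?D b x))" by (rule sum.cong[OF refl]) (rule b)
 also have "... = ip (leb Om) u (%x. SUM b:Basis. ?D b x)" unfolding ip_def sum_distrib_left by (rule bochner_integral_sum[symmetric]) (rule i2)
 finally show ?thesis .
qed

locale phase_field =
 fixes Om :: "'a::euclidean_space set" and a \<alpha> \<beta> R :: real
 assumes dom: "smooth_domain Om" and a: "a > 0" and R: "R >= 1"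
begin

text \<open>The common constant of \<open>W_estimates\<close> on the range from -R to R.\<close>

definition "L = 4 * a * R ^ 3"
text \<open>The L2 norm of the constant 1, that is the square root of the volume of
  \<open>Om\<close>.\<close>

definition "vol = l2norm (leb Om) (%_. 1)"
definition "adm = {u : M2 Om a \<alpha> \<beta>. ALL x:Om. \<bar>u x\<bar> <= R}"

lemma L_pos: "L > 0" using a R by (simp add: L_def)

lemma vol_nonneg: "vol >= 0" by (simp add: vol_def l2norm_nonneg)

lemma opn: "open Om" and bdd: "bounded Om" and leb: "Om : sets lebesgue" and brl: "Om : sets borel" using dom by (auto simp: smooth_domain_def)

lemma finite_measure_M: "finite_measure (leb Om)" using leb bdd by (intro finite_measure_lebesgue_on bounded_set_imp_lmeasurable) auto

lemma sqint_one: "sqint (leb Om) (%_. c)"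
 using finite_measure.emeasure_finite[OF finite_measure_M] by (simp add: sqint_def finite_measure.integrable_const[OF finite_measure_M])

lemma sqint_bounded:
 assumes "f : bmeas (leb Om)" "!!x. x : Om ==> \<bar>f x\<bar> <= c"
 shows "sqint (leb Om) f" using sqint_bounded_mult[OF sqint_one[of 1] assms(1), of c] assms(2) by simp

lemma l2norm_bounded:
 assumes "sqint (leb Om) f" "!!x. x : Om ==> \<bar>f x\<bar> <= c" "c >= 0"
 shows "l2norm (leb Om) f <= c * vol" unfolding vol_def by (rule l2norm_mono[OF assms(1) sqint_one]) (use assms in auto)

lemma adm:
 assumes "u : adm"
 shows "u : H2N Om" "u : H2 Om" "avg Om u = \<alpha>" "F Om a u = \<beta>" "x : Om ==> \<bar>u x\<bar> <= R"
	"sqint (leb Om) u" "sqint (leb Om) (lap Om u)"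
	"sqint (leb Om) (%x. deriv (W a) (u x))" "sqint (leb Om) (mu Om a u)"
	"integrable (leb Om) (%x. W a (u x))"
	"(%x. deriv (deriv (W a)) (u x)) : bmeas (leb Om)"
proof -
 show N: "u : H2N Om" "avg Om u = \<alpha>" "F Om a u = \<beta>" and b: "!!x. x : Om ==> \<bar>u x\<bar> <= R" using assms by (auto simp: adm_def M2_def)
 show H: "u : H2 Om" by (rule H2N_H2[OF N(1)])
 show u: "sqint (leb Om) u" using H by (simp add: H2_def H1_def L2_eq_sqint)
 note um = sqint_measurable[OF u]
 show l: "sqint (leb Om) (lap Om u)" by (rule H2_sqint(3)[OF opn H])
 show w: "sqint (leb Om) (%x. deriv (W a) (u x))" by (rule sqint_bounded[OF measurable_compose[OF um W_measurable(2)]]) (rule W_estimates(4)[OF a R b b])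
 have "mu Om a u = (%x. deriv (W a) (u x) - lap Om u x)" by (rule ext) (simp add: mu_def)
 then show "sqint (leb Om) (mu Om a u)" using sqint_diff[OF w l] by simp
 show "integrable (leb Om) (%x. W a (u x))" by (rule sqint_bounded_imp_integrable[OF leb bdd sqint_bounded[OF measurable_compose[OF um W_measurable(1)]]])
	 (rule W_estimates(6)[OF a R b b])
 show "(%x. deriv (deriv (W a)) (u x)) : bmeas (leb Om)" by (rule measurable_compose[OF um W_measurable(3)])
qed

lemma E_eq: "E Om a u = 1 / 2 * (l2norm (leb Om) (mu Om a u))^2" by (simp add: E_def l2norm_sq mu_def)

lemma ip_mu_diff:
 assumes u: "u : adm" and w: "w : adm" and f: "sqint (leb Om) f"
 shows "ip (leb Om) f (mu Om a u) - ip (leb Om) f (mu Om a w) =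
	- (ip (leb Om) f (lap Om u) - ip (leb Om) f (lap Om w)) +
	ip (leb Om) f (%x. deriv (W a) (u x) - deriv (W a) (w x))"
proof -
 have *: "ip (leb Om) f (mu Om a u) = ip (leb Om) f (%x. deriv (W a) (u x)) - ip (leb Om) f (lap Om u)"
	if "u : adm" for u
 proof -
	have "mu Om a u = (%x. deriv (W a) (u x) - lap Om u x)" by (rule ext) (simp add: mu_def)
	then show ?thesis using ip_diff(2)[OF adm(8,7)[OF that] f] by simp
 qed
 show ?thesis unfolding *[OF u] *[OF w] ip_diff(2)[OF adm(8)[OF u] adm(8)[OF w] f] by simp
qed

lemma l2norm_deriv_W_diff:
 assumes u: "u : adm" and w: "w : adm"
 shows "l2norm (leb Om) (%x. deriv (W a) (u x) - deriv (W a) (w x)) <= L * l2norm (leb Om) (%x. u x - w x)"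
 by (rule l2norm_mono[OF sqint_diff[OF adm(8)[OF u] adm(8)[OF w]] sqint_diff[OF adm(6)[OF u] adm(6)[OF w]]])
	(use W_estimates(1)[OF a R adm(5)[OF u] adm(5)[OF w]] L_pos in "auto simp: L_def")

text \<open>Both states have the same free energy \<open>\<beta>\<close>, and the trapezoidal rule for \<open>F\<close> is exact up to
  second order.\<close>

lemma conserved_free_energy:
 assumes u: "u : adm" and w: "w : adm"
 shows "\<bar>ip (leb Om) (mu Om a u) (%x. u x - w x) + ip (leb Om) (mu Om a w) (%x. u x - w x)\<bar>
	<= 2 * L * (l2norm (leb Om) (%x. u x - w x))^2"
proof -
 let ?M = "leb Om"
 let ?d = "%x. u x - w x"
 note ad = adm[OF u] and bd = adm[OF w]
 note dd = sqint_diff[OF ad(6) bd(6)]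
 define S where "S f g = (SUM b:Basis. (LINT x|?M. wderiv Om b f x * wderiv Om b g x))" for f g :: "'a => real"
 have green: "ip ?M (lap Om f) g = - S f g" if "f : adm" "g : adm" for f g
	using green_H2N[OF dom adm(1)[OF that(1)] H2_sqint(1)[OF opn adm(2)[OF that(2)]]] by (simp add: ip_def S_def)
 have S: "S w u = S u w" by (simp add: S_def mult.commute)
 have Fe: "S f f = 2 * (\<beta> - (LINT x|?M. W a (f x)))" if "f : adm" for f
	using adm(4)[OF that, unfolded F_def L2norm_eq l2norm_sq] by (simp add: S_def power2_eq_square)
 have m: "ip ?M (mu Om a f) ?d = ip ?M (%x. deriv (W a) (f x)) ?d + S f u - S f w" if f: "f : adm" for f
 proof -
	have "mu Om a f = (%x. deriv (W a) (f x) - lap Om f x)" by (rule ext) (simp add: mu_def)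
	then show ?thesis using ip_diff(1)[OF adm(8,7)[OF f] dd] ip_diff(2)[OF ad(6) bd(6) adm(7)[OF f]] green[OF f u] green[OF f w] by simp
 qed
 have i: "integrable ?M (%x. deriv (W a) (u x) * ?d x)" "integrable ?M (%x. deriv (W a) (w x) * ?d x)"
	using sqint_mult_integrable[OF ad(8) dd] sqint_mult_integrable[OF bd(8) dd] by simp_all
 let ?r = "%x. W a (u x) - W a (w x) - 1 / 2 * (deriv (W a) (u x) * ?d x + deriv (W a) (w x) * ?d x)"
 \<comment> \<open>The mixed Dirichlet terms cancel by symmetry. The two pure ones are eliminated
   through the common value of the free energy, which leaves only the trapezoidal remainder of
   \<open>W\<close>.\<close>
 have "ip ?M (mu Om a u) ?d + ip ?M (mu Om a w) ?d = - 2 * (LINT x|?M. ?r x)"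
	unfolding m[OF u] m[OF w] S Fe[OF u] Fe[OF w] using i ad(10) bd(10) by (simp add: ip_def)
 moreover have "\<bar>\<integral>x. ?r x \<partial>?M\<bar> <= (LINT x|?M. L * (?d x)^2)" unfolding real_norm_def[symmetric]
 proof (rule bochner_integral_norm_bound_integral)
	show "integrable ?M ?r" using i ad(10) bd(10) by simp
	show "integrable ?M (%x. L * (?d x)^2)" using sqint_integrable[OF dd] by simp
	show "norm (?r x) <= L * (?d x)^2" if "x : space ?M" for x using W_estimates(3)[OF a R ad(5) bd(5), of x x] that by (simp add: L_def distrib_right)
 qed
 ultimately show ?thesis using L_pos by (simp add: l2norm_sq abs_mult)
qed

text \<open>Start from 2 (E[u] - E[w]) = <m1, m1 - m2> + <m2, m1 - m2>, where m1 and m2 are the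
  chemical potentials; move the Laplacian in m1 - m2 onto m1 and m2 and insert the equation. The W''
  terms cancel the difference of W' up to second order. In the multiplier terms the sum of the two
  pairings is quadratic in the increment and their difference only linear, but the latter is
  multiplied by B1 - B2.\<close>

lemma energy_difference:
 assumes u: "u : adm" and w: "w : adm" and mN: "mu Om a u : H2N Om" "mu Om a w : H2N Om"
	and C: "l2norm (leb Om) (mu Om a u) <= C" "l2norm (leb Om) (mu Om a w) <= C"
	and omega: "!!x. x : Om ==> \<bar>u x - w x\<bar> <= omega"
	and G: "sqint (leb Om) G1" "sqint (leb Om) G2"
	 "AE x in leb Om. G1 x = lap Om (mu Om a u) x - deriv (deriv (W a)) (u x) * mu Om a u x + A1 + B1 * mu Om a u x"
	 "AE x in leb Om. G2 x = lap Om (mu Om a w) x - deriv (deriv (W a)) (w x) * mu Om a w x + A2 + B2 * mu Om a w x"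
 defines "D \<equiv> l2norm (leb Om) (%x. u x - w x)"
 shows "E Om a u - E Om a w <=
	- 1 / 2 * (ip (leb Om) G1 (%x. u x - w x) + ip (leb Om) G2 (%x. u x - w x))
	+ C * L * omega * D + 1 / 2 * (abs B1 + abs B2) * L * D^2 + 1 / 2 * \<bar>B1 - B2\<bar> * C * D"
proof -
 let ?M = "leb Om" and ?m1 = "mu Om a u" and ?m2 = "mu Om a w"
 let ?d = "%x. u x - w x" and ?w = "%x. deriv (W a) (u x) - deriv (W a) (w x)"
 note ad = adm[OF u] and bd = adm[OF w]
 note dd = sqint_diff[OF ad(6) bd(6)] and ww = sqint_diff[OF ad(8) bd(8)]
 have D0: "D >= 0" by (simp add: D_def l2norm_nonneg)
 have C0: "C >= 0" using C(1) l2norm_nonneg[of ?M ?m1] by linarith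
 have "avg Om u = avg Om w" using ad(3) bd(3) by simp
 moreover have "measure lebesgue Om \<noteq> 0"
 proof -
	have "\<not> negligible Om" using open_not_negligible[OF opn] dom by (simp add: smooth_domain_def)
	then show ?thesis using bounded_set_imp_lmeasurable[OF bdd leb] by (simp add: negligible_iff_measure)
 qed
 ultimately have i0: "(LINT x|?M. u x) = (LINT x|?M. w x)" by (simp add: avg_def)
 have d0: "(LINT x|?M. ?d x) = 0" using i0 sqint_bounded_imp_integrable[OF leb bdd ad(6)] sqint_bounded_imp_integrable[OF leb bdd bd(6)] by simp
 text \<open>The multiplier \<open>A\<close> drops out because the mean is conserved.\<close>
 have eqn: "ip ?M (lap Om (mu Om a z)) ?d = ip ?M G ?d + ip ?M (mu Om a z) (%x. deriv (deriv (W a)) (z x) * ?d x) - B * ip ?M (mu Om a z) ?d"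
	"sqint ?M (%x. deriv (deriv (W a)) (z x) * ?d x)"
	if z: "z : adm" "mu Om a z : H2N Om" "sqint ?M G"
	 "AE x in ?M. G x = lap Om (mu Om a z) x - deriv (deriv (W a)) (z x) * mu Om a z x + A + B * mu Om a z x" for z G A B
 proof -
	note zd = adm[OF z(1)]
	show w2: "sqint ?M (%x. deriv (deriv (W a)) (z x) * ?d x)"
	 by (rule sqint_bounded_mult[OF dd zd(11), of L]) (use W_estimates(5)[OF a R zd(5) zd(5)] in "auto simp: L_def")
	have ls: "sqint ?M (lap Om (mu Om a z))" by (rule H2_sqint(3)[OF opn H2N_H2[OF z(2)]])
	have "ip ?M (lap Om (mu Om a z)) ?d = (LINT x|?M. G x * ?d x + mu Om a z x * (deriv (deriv (W a)) (z x) * ?d x) - A * ?d x - B * (mu Om a z x * ?d x))"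
	 unfolding ip_def
	proof (rule integral_cong_AE)
	 show "AE x in ?M. lap Om (mu Om a z) x * ?d x = G x * ?d x + mu Om a z x * (deriv (deriv (W a)) (z x) * ?d x) - A * ?d x - B * (mu Om a z x * ?d x)"
		using z(4) by eventually_elim (simp (no_asm_simp) add: algebra_simps)
	 show "(%x. lap Om (mu Om a z) x * ?d x) : bmeas ?M" using sqint_measurable[OF ls] sqint_measurable[OF dd] by simp
	 show "(%x. G x * ?d x + mu Om a z x * (deriv (deriv (W a)) (z x) * ?d x) - A * ?d x - B * (mu Om a z x * ?d x)) : bmeas ?M"
		using sqint_measurable[OF z(3)] sqint_measurable[OF dd] sqint_measurable[OF zd(9)] zd(11) by simp
	qed
	also have "... = ip ?M G ?d + ip ?M (mu Om a z) (%x. deriv (deriv (W a)) (z x) * ?d x) - A * (LINT x|?M. ?d x) - B * ip ?M (mu Om a z) ?d" unfolding ip_def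
	 using sqint_mult_integrable[OF z(3) dd] sqint_mult_integrable[OF zd(9) w2] sqint_mult_integrable[OF zd(9) dd]
		sqint_bounded_imp_integrable[OF leb bdd dd] by (simp only: bochner_integral_add bochner_integral_diff bochner_integrable_add
		 bochner_integrable_diff integrable_mult_right integral_mult_right_zero)
	finally show "ip ?M (lap Om (mu Om a z)) ?d = ip ?M G ?d + ip ?M (mu Om a z) (%x. deriv (deriv (W a)) (z x) * ?d x) - B * ip ?M (mu Om a z) ?d" using d0 by simp
 qed
 note e1 = eqn[OF u mN(1) G(1,3)] and e2 = eqn[OF w mN(2) G(2,4)]
 have gs: "ip ?M (mu Om a z) (lap Om u) - ip ?M (mu Om a z) (lap Om w) = ip ?M (lap Om (mu Om a z)) ?d"
	if "mu Om a z : H2N Om" for z using green_symmetric[OF dom that ad(1)] green_symmetric[OF dom that bd(1)]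
	 ip_diff(2)[OF ad(6) bd(6) H2_sqint(3)[OF opn H2N_H2[OF that]]] by simp
 have rem: "\<bar>ip ?M (mu Om a z) ?w - ip ?M (mu Om a z) (%x. deriv (deriv (W a)) (z x) * ?d x)\<bar> <= C * L * omega * D"
	if z: "z : {u, w}" for z
 proof -
	have za: "z : adm" and zC: "l2norm ?M (mu Om a z) <= C" and
	 z2: "sqint ?M (%x. deriv (deriv (W a)) (z x) * ?d x)" using z u w C e1(2) e2(2) by auto
	let ?q = "%x. ?w x - deriv (deriv (W a)) (z x) * ?d x"
	have "\<bar>?q x\<bar> <= (L * omega) * \<bar>?d x\<bar>" if x: "x : Om" for x
	proof -
	 have "\<bar>?q x\<bar> <= L * (?d x)^2"
	 proof (cases "z = u")
		case True
		then show ?thesis using W_estimates(2)[OF a R ad(5)[OF x] bd(5)[OF x]] by (simp add: L_def)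
	 next
		case False
		then have "z = w" using z by simp
		then show ?thesis using W_estimates(2)[OF a R bd(5)[OF x] ad(5)[OF x]]
		 by (simp add: L_def power2_commute[of "u x"] abs_minus_commute[of "deriv (W a) (u x) - deriv (W a) (w x)"] algebra_simps)
	 qed
	 also have "... = (L * \<bar>?d x\<bar>) * \<bar>?d x\<bar>" by (simp add: power2_eq_square)
	 also have "... <= (L * omega) * \<bar>?d x\<bar>" by (intro mult_right_mono mult_left_mono omega[OF x]) (use L_pos in auto)
	 finally show ?thesis .
	qed
	moreover have "0 <= omega"
	proof -
	 obtain x where "x : Om" using dom by (auto simp: smooth_domain_def)
	 then show ?thesis using omega[of x] by linarith
	qed
	ultimately have "l2norm ?M ?q <= (L * omega) * D"
	 unfolding D_def by (intro l2norm_mono sqint_diff ww z2 dd[unfolded]) (use L_pos dd in "auto intro: sqint_diff ad bd")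
	moreover have "ip ?M (mu Om a z) ?w - ip ?M (mu Om a z) (%x. deriv (deriv (W a)) (z x) * ?d x) = ip ?M (mu Om a z) ?q"
	 using ip_diff(2)[OF ww z2 adm(9)[OF za]] by simp
	moreover have "\<bar>ip ?M (mu Om a z) ?q\<bar> <= l2norm ?M (mu Om a z) * l2norm ?M ?q" by (rule ip_bound[OF adm(9)[OF za] sqint_diff[OF ww z2]])
	moreover have "l2norm ?M (mu Om a z) * l2norm ?M ?q <= C * ((L * omega) * D)" by (intro mult_mono zC calculation(1)) (use C0 l2norm_nonneg in auto)
	ultimately show ?thesis by (simp add: mult_ac)
 qed
 let ?x = "ip ?M ?m1 ?d" and ?y = "ip ?M ?m2 ?d"
 have xy: "\<bar>?x + ?y\<bar> <= 2 * L * D^2" using conserved_free_energy[OF u w] by (simp add: D_def)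
 have "\<bar>?x\<bar> <= C * D" "\<bar>?y\<bar> <= C * D" using ip_bound[OF ad(9) dd] ip_bound[OF bd(9) dd] mult_right_mono[OF C(1) D0] mult_right_mono[OF C(2) D0]
	unfolding D_def by linarith+
 then have xmy: "\<bar>?x - ?y\<bar> <= 2 * (C * D)" by linarith
 have B: "B1 * ?x + B2 * ?y <= (abs B1 + abs B2) * L * D^2 + \<bar>B1 - B2\<bar> * (C * D)"
 proof -
	have "B1 * ?x + B2 * ?y = 1 / 2 * ((B1 + B2) * (?x + ?y)) + 1 / 2 * ((B1 - B2) * (?x - ?y))" by (simp add: field_simps)
	moreover have "(B1 + B2) * (?x + ?y) <= (abs B1 + abs B2) * (2 * L * D^2)"
	proof -
	 have "(B1 + B2) * (?x + ?y) <= \<bar>B1 + B2\<bar> * \<bar>?x + ?y\<bar>" by (simp only: abs_mult[symmetric] abs_ge_self)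
	 also have "... <= (abs B1 + abs B2) * (2 * L * D^2)" by (intro mult_mono xy abs_triangle_ineq) auto
	 finally show ?thesis .
	qed
	moreover have "(B1 - B2) * (?x - ?y) <= \<bar>B1 - B2\<bar> * (2 * (C * D))"
	proof -
	 have "(B1 - B2) * (?x - ?y) <= \<bar>B1 - B2\<bar> * \<bar>?x - ?y\<bar>" by (simp only: abs_mult[symmetric] abs_ge_self)
	 also have "... <= \<bar>B1 - B2\<bar> * (2 * (C * D))" by (intro mult_mono xmy) auto
	 finally show ?thesis .
	qed
	ultimately show ?thesis by (simp add: mult_ac)
 qed
 have "2 * (E Om a u - E Om a w) = (ip ?M ?m1 ?m1 - ip ?M ?m1 ?m2) + (ip ?M ?m2 ?m1 - ip ?M ?m2 ?m2)" by (simp add: E_eq ip_self ip_commute[of _ ?m1 ?m2])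
 also have "... = - ip ?M (lap Om ?m1) ?d + ip ?M ?m1 ?w - ip ?M (lap Om ?m2) ?d + ip ?M ?m2 ?w"
	unfolding ip_mu_diff[OF u w ad(9)] ip_mu_diff[OF u w bd(9)] gs[OF mN(1)] gs[OF mN(2)] by simp
 also have "... <= - (ip ?M G1 ?d + ip ?M G2 ?d) + 2 * (C * L * omega * D) + (B1 * ?x + B2 * ?y)"
	unfolding e1(1) e2(1) using rem[of u] rem[of w] by (simp add: abs_le_iff)
 also have "... <= - (ip ?M G1 ?d + ip ?M G2 ?d) + 2 * (C * L * omega * D) + ((abs B1 + abs B2) * L * D^2 + \<bar>B1 - B2\<bar> * (C * D))" using B by simp
 finally show ?thesis by (simp add: field_simps)
qed

text \<open>Convexity of the square gives E[u] - E[w] <= <m1, m1 - m2>, in which the Laplacian can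
  be moved to m1 alone. So only \<open>u\<close> needs a regular chemical potential, and
  \<open>w\<close> may be the state at an exceptional time or at time 0.\<close>

lemma energy_upper:
 assumes u: "u : adm" and w: "w : adm" and mN: "mu Om a u : H2N Om"
	and C: "l2norm (leb Om) (mu Om a u) <= C"
 shows "E Om a u - E Om a w <=
	(l2norm (leb Om) (lap Om (mu Om a u)) + C * L) * l2norm (leb Om) (%x. u x - w x)"
proof -
 let ?M = "leb Om" and ?m1 = "mu Om a u" and ?m2 = "mu Om a w"
 let ?d = "%x. u x - w x" and ?w = "%x. deriv (W a) (u x) - deriv (W a) (w x)"
 note ad = adm[OF u] and bd = adm[OF w]
 note dd = sqint_diff[OF ad(6) bd(6)] and ww = sqint_diff[OF ad(8) bd(8)]
 note ls = H2_sqint(3)[OF opn H2N_H2[OF mN]]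
 have "0 <= (l2norm ?M (%x. ?m1 x - ?m2 x))^2" by simp
 also have "... = ip ?M ?m1 ?m1 - 2 * ip ?M ?m1 ?m2 + ip ?M ?m2 ?m2"
	unfolding ip_self[symmetric] ip_diff(1)[OF ad(9) bd(9) sqint_diff[OF ad(9) bd(9)]] ip_diff(2)[OF ad(9) bd(9) ad(9)] ip_diff(2)[OF ad(9) bd(9) bd(9)]
	by (simp add: ip_commute[of _ ?m2 ?m1])
 finally have "E Om a u - E Om a w <= ip ?M ?m1 ?m1 - ip ?M ?m1 ?m2" by (simp add: E_eq ip_self[symmetric])
 also have "... = - ip ?M (lap Om ?m1) ?d + ip ?M ?m1 ?w" unfolding ip_mu_diff[OF u w ad(9)]
	using green_symmetric[OF dom mN ad(1)] green_symmetric[OF dom mN bd(1)] ip_diff(2)[OF ad(6) bd(6) ls] by simp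
 also have "... <= l2norm ?M (lap Om ?m1) * l2norm ?M ?d + l2norm ?M ?m1 * l2norm ?M ?w" using ip_bound[OF ls dd] ip_bound[OF ad(9) ww] by linarith
 also have "l2norm ?M ?m1 * l2norm ?M ?w <= C * (L * l2norm ?M ?d)"
	by (rule mult_mono[OF C l2norm_deriv_W_diff[OF u w]]) (use C order_trans[OF l2norm_nonneg C] in "auto simp: l2norm_nonneg")
 finally show ?thesis by (simp add: algebra_simps)
qed

text \<open>Convexity from the other side: E[u] - E[w] >= <m2, m1 - m2>. Here m2 is only in L2, so
  it is replaced by a test function, which takes over the Laplacian. The distance \<open>eta\<close>
  is uniform in all \<open>u\<close> with the same bound \<open>C\<close>.\<close>

lemma energy_lower:
 assumes w: "w : adm" and eps: "eps > 0" and C: "C >= 0"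
 obtains eta where "eta > 0"
	"!!u. u : adm ==> l2norm (leb Om) (mu Om a u) <= C ==> (!!x. x : Om ==> \<bar>u x - w x\<bar> <= eta) ==> E Om a w - eps <= E Om a u"
proof -
 let ?M = "leb Om" and ?m2 = "mu Om a w"
 note bd = adm[OF w]
 \<comment> \<open>Makes the error of replacing m2 by the test function at most
   \<open>eps / 2\<close>, since m1 - m2 has norm at most the bracket.\<close>
 define kappa where "kappa = eps / (2 * (C + l2norm ?M ?m2 + 1))"
 have c1: "C + l2norm ?M ?m2 + 1 > 0" using C l2norm_nonneg[of ?M ?m2] by linarith
 have kappa: "kappa > 0" using eps c1 by (simp add: kappa_def)
 obtain phi where phi: "phi : test_fun Om" "sqint ?M phi" "l2norm ?M (%x. phi x - ?m2 x) < kappa" by (rule sqint_dense_test_fun[OF opn bd(9) kappa]) blast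
 let ?D = "%x. SUM b:Basis. fd (%x. fd phi (at x) b) (at x) b"
 have Ds: "sqint ?M ?D"
 proof (rule sqint_sum)
	fix b :: 'a assume b: "b : Basis"
	have "(%x. fd (%x. fd phi (at x) b) (at x) b) : test_fun Om" by (intro test_fun_derivative phi b)
	then show "sqint ?M (%x. fd (%x. fd phi (at x) b) (at x) b)" by (intro sqint_continuous opn bdd smooth_on_continuous) (simp add: test_fun_def)
 qed
 \<comment> \<open>Lipschitz constant, with respect to the supremum distance of the states, of the
   pairing with the test function; + 1 makes it positive.\<close>
 define K where "K = vol * (l2norm ?M ?D + L * l2norm ?M phi) + 1"
 have K: "K > 0" using vol_nonneg L_pos l2norm_nonneg[of ?M ?D] l2norm_nonneg[of ?M phi]
	unfolding K_def by (intro add_nonneg_pos mult_nonneg_nonneg add_nonneg_nonneg) auto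
 show thesis
 proof (rule that[of "eps / (2 * K)"])
	show "eps / (2 * K) > 0" using eps K by simp
	fix u assume u: "u : adm" and uC: "l2norm ?M (mu Om a u) <= C"
	 and near: "!!x. x : Om ==> \<bar>u x - w x\<bar> <= eps / (2 * K)"
	let ?m1 = "mu Om a u"
	let ?d = "%x. u x - w x" and ?w = "%x. deriv (W a) (u x) - deriv (W a) (w x)"
	note ad = adm[OF u]
	note dd = sqint_diff[OF ad(6) bd(6)] and ww = sqint_diff[OF ad(8) bd(8)]
	have mm: "sqint ?M (%x. ?m1 x - ?m2 x)" by (rule sqint_diff[OF ad(9) bd(9)])
	have phim: "sqint ?M (%x. phi x - ?m2 x)" by (rule sqint_diff[OF phi(2) bd(9)])
	let ?e = "eps / (2 * K)"
	have D: "l2norm ?M ?d <= ?e * vol" by (rule l2norm_bounded[OF dd near]) (use eps K in auto)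
	have "0 <= (l2norm ?M (%x. ?m1 x - ?m2 x))^2" by simp
	also have "... = ip ?M ?m1 ?m1 - 2 * ip ?M ?m2 ?m1 + ip ?M ?m2 ?m2"
	 unfolding ip_self[symmetric] ip_diff(1)[OF ad(9) bd(9) mm] ip_diff(2)[OF ad(9) bd(9) ad(9)] ip_diff(2)[OF ad(9) bd(9) bd(9)] by (simp add: ip_commute[of _ ?m1 ?m2])
	finally have low: "ip ?M ?m2 ?m1 - ip ?M ?m2 ?m2 <= E Om a u - E Om a w" by (simp add: E_eq ip_self[symmetric])
	have split: "ip ?M ?m2 ?m1 - ip ?M ?m2 ?m2 = (ip ?M phi ?m1 - ip ?M phi ?m2) - ip ?M (%x. phi x - ?m2 x) (%x. ?m1 x - ?m2 x)"
	 unfolding ip_diff(1)[OF phi(2) bd(9) mm] ip_diff(2)[OF ad(9) bd(9) phi(2)] ip_diff(2)[OF ad(9) bd(9) bd(9)] by simp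
	have "\<bar>ip ?M (%x. phi x - ?m2 x) (%x. ?m1 x - ?m2 x)\<bar> <= l2norm ?M (%x. phi x - ?m2 x) * l2norm ?M (%x. ?m1 x - ?m2 x)" by (rule ip_bound[OF phim mm])
	also have "... <= kappa * (C + l2norm ?M ?m2 + 1)"
	proof (rule mult_mono)
	 have "l2norm ?M (%x. ?m1 x + (-1) * ?m2 x) <= l2norm ?M ?m1 + l2norm ?M (%x. (-1) * ?m2 x)" by (rule l2norm_triangle[OF ad(9) sqint_scale[OF bd(9)]])
	 then show "l2norm ?M (%x. ?m1 x - ?m2 x) <= C + l2norm ?M ?m2 + 1" using uC unfolding l2norm_scale by simp
	qed (use phi(3) kappa in "auto simp: l2norm_nonneg")
	also have "... = eps / 2" using c1 unfolding kappa_def by (simp add: field_simps)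
	finally have r1: "\<bar>ip ?M (%x. phi x - ?m2 x) (%x. ?m1 x - ?m2 x)\<bar> <= eps / 2" .
	have lap: "ip ?M phi (lap Om u) - ip ?M phi (lap Om w) = ip ?M ?d ?D"
	 unfolding ip_diff(1)[OF ad(6) bd(6) Ds] ip_commute[of _ phi] ip_wlaplacian_test_fun[OF opn ad(2) phi(1)] ip_wlaplacian_test_fun[OF opn bd(2) phi(1)] by simp
	have "\<bar>ip ?M phi ?m1 - ip ?M phi ?m2\<bar> <= \<bar>ip ?M ?d ?D\<bar> + \<bar>ip ?M phi ?w\<bar>" unfolding ip_mu_diff[OF u w phi(2)] lap by linarith
	also have "... <= l2norm ?M ?d * l2norm ?M ?D + l2norm ?M phi * l2norm ?M ?w" by (intro add_mono ip_bound dd Ds phi ww)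
	also have "... <= (?e * vol) * l2norm ?M ?D + l2norm ?M phi * (L * (?e * vol))"
	proof (intro add_mono mult_right_mono mult_left_mono D l2norm_nonneg)
	 have "l2norm ?M ?w <= L * l2norm ?M ?d" by (rule l2norm_deriv_W_diff[OF u w])
	 also have "... <= L * (?e * vol)" by (intro mult_left_mono D) (use L_pos in simp)
	 finally show "l2norm ?M ?w <= L * (?e * vol)" .
	qed
	also have "... = ?e * (K - 1)" by (simp only: K_def) algebra
	also have "... <= ?e * K" using eps K by (intro mult_left_mono) auto
	also have "... = eps / 2" using K by simp
	finally show "E Om a w - eps <= E Om a u" using low split r1 by linarith
 qed
qed

end

section \<open>Time averages and monotonicity\<close>

lemma jensen_square_const:
 assumes K: "!!x. 0 <= K x" "integrable M K" "integral\<^sup>L M K = (1::real)"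
	and f: "f : bmeas M"
 shows "enn ((m - (LINT x|M. K x * f x))^2) <= (\<integral>\<^sup>+x. enn (K x * (m - f x)^2) \<partial>M)"
proof (cases "(\<integral>\<^sup>+x. enn (K x * (m - f x)^2) \<partial>M) < \<infinity>")
 case True
 have Km: "K : bmeas M" using K(2) by simp
 have i2: "integrable M (%x. K x * (m - f x)^2)" by (rule integrableI_nonneg) (use K Km f True in auto)
 have i1: "integrable M (%x. K x * (m - f x))"
 proof (rule bochner_integrable_bound)
	show "integrable M (%x. K x + K x * (m - f x)^2)" using K(2) i2 by simp
	show "(%x. K x * (m - f x)) : bmeas M" using Km f by simp
	have "abs y <= 1 + y^2" for y :: real using zero_le_power2[of "abs y - 1"] zero_le_power2[of y] by (simp add: power2_diff)
	then have "K x * \<bar>m - f x\<bar> <= K x * (1 + (m - f x)^2)" for x by (intro mult_left_mono K)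
	then show "AE x in M. norm (K x * (m - f x)) <= norm (K x + K x * (m - f x)^2)" using K(1) by (intro AE_I2) (simp add: abs_mult distrib_left)
 qed
 have "integrable M (%x. K x * m - K x * (m - f x))" using K(2) i1 by simp
 then have i0: "integrable M (%x. K x * f x)" by (simp add: right_diff_distrib)
 have "(LINT x|M. K x * (m - f x)) = m - (LINT x|M. K x * f x)" using K i0 by (simp add: right_diff_distrib)
 then show ?thesis using jensen_square[OF K, of "%x. m - f x"] f by simp
next
 case False
 then have "(\<integral>\<^sup>+x. enn (K x * (m - f x)^2) \<partial>M) = \<infinity>" unfolding infinity_ennreal_def using less_top by blast
 then show ?thesis by simp
qed

text \<open>The mean of \<open>G\<close> over the time step of length h that ends at z. It is
  written with shifts of the whole space-time point, so that translation invariance and translation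
  continuity in space-time apply directly.\<close>

definition time_mean :: "real => (real \<times> 'a::euclidean_space => real) => real \<times> 'a => real" where
 "time_mean h G z = (LBINT tau. (ind {0..<h} tau / h) * G (z + (- tau, 0)))"

lemma time_shift_measurable:
 fixes G :: "real \<times> 'a::euclidean_space => real"
 assumes "G : bmeas borel"
 shows "(%p. G (snd p + (- fst p, 0))) : bmeas (borel \<Otimes>\<^sub>M borel)"
proof -
 have "(%p::real \<times> real \<times> 'a. snd p + (- fst p, 0)) : bmeas borel" by (intro borel_measurable_continuous_onI continuous_intros)
 from measurable_compose[OF this assms] show ?thesis by (simp add: borel_prod)
qed

text \<open>Jensen and Tonelli reduce everything to single shifts. In the last claim the shifts c
  and tau both lie between 0 and h, so they differ by at most h; it is applied with c = 0 and c = h,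
  the two ends of the time step.\<close>

lemma time_mean:
 fixes G :: "real \<times> 'a::euclidean_space => real"
 assumes G: "sqint lborel G" and h: "h > 0"
 shows "time_mean h G : bmeas borel"
	and "(nni lborel (%z. enn ((time_mean h G z)^2))) <= (nni lborel (%z. enn ((G z)^2)))"
	and "[|!!y. abs y <= h ==> (LBINT z. (G (z + (y, 0)) - G z)^2) <= kappa; 0 <= c; c <= h|] ==>
	 (nni lborel (%z. enn ((G (z + (- c, 0)) - time_mean h G z)^2))) <= ennreal kappa"
proof -
 let ?K = "%tau. ind {0..<h} tau / h :: real"
 have Gm: "G : bmeas borel" using sqint_measurable[OF G] by simp
 have [measurable]: "(%p. G (snd p + (- fst p, 0))) : bmeas (borel \<Otimes>\<^sub>M borel)" by (rule time_shift_measurable[OF Gm])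
 have Gs [measurable]: "(%z. G (z + (y, 0))) : bmeas borel" for y by (rule measurable_compose[OF _ Gm]) simp
 have [measurable]: "(%tau. G (z + (- tau, 0))) : bmeas borel" for z
 proof -
	have "(%tau. z + (- tau, 0)) : bmeas borel" by (intro borel_measurable_continuous_onI continuous_intros)
	from measurable_compose[OF this Gm] show ?thesis .
 qed
 have [measurable]: "(%(z, tau). G (z + (- tau, 0))) : bmeas (borel \<Otimes>\<^sub>M borel)"
 proof -
	have "(%p::(real \<times> 'a) \<times> real. fst p + (- snd p, 0)) : bmeas borel" by (intro borel_measurable_continuous_onI continuous_intros)
	from measurable_compose[OF this Gm] show ?thesis by (simp add: borel_prod case_prod_unfold)
 qed
 show m: "time_mean h G : bmeas borel" unfolding time_mean_def[abs_def] by measurable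
 have i: "integrable lborel (%tau. ind {0..<h} tau :: real)" using h by (intro integrable_real_indicator) auto
 have K: "0 <= ?K tau" "integrable lborel ?K" "integral\<^sup>L lborel ?K = 1" for tau
 proof -
	show "0 <= ?K tau" using h by simp
	show "integrable lborel ?K" using i by simp
	have "integral\<^sup>L lborel ?K = (LBINT tau. ind {0..<h} tau) / h" by (rule integral_divide_zero)
	also have "... = 1" using h by simp
	finally show "integral\<^sup>L lborel ?K = 1" .
 qed
 have nnK: "(nni lborel (%tau. enn (?K tau) * c)) = c" for c using nn_integral_eq_integral[OF K(2) AE_I2[OF K(1)]] K(3) by (simp add: nn_integral_multc)
 have "(nni lborel (%z. enn ((time_mean h G z)^2))) <=
	 (nni lborel (%z. (nni lborel (%tau. enn (?K tau * (G (z + (- tau, 0)))^2)))))" unfolding time_mean_def by (intro nn_integral_mono jensen_square K) measurable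
 also have "... = (nni lborel (%tau. (nni lborel (%z. enn (?K tau * (G (z + (- tau, 0)))^2)))))" by (rule lborel_pair.Fubini'[symmetric]) measurable
 also have "... = (nni lborel (%tau. enn (?K tau) * (nni lborel (%z. enn ((G z)^2)))))"
 proof (rule nn_integral_cong)
	fix tau
	have "(nni lborel (%z. enn (?K tau * (G (z + (- tau, 0)))^2))) = enn (?K tau) * (nni lborel (%z. enn ((G (z + (- tau, 0)))^2)))"
	 unfolding ennreal_mult'[OF K(1)] by (rule nn_integral_cmult) measurable
	also have "(nni lborel (%z. enn ((G (z + (- tau, 0)))^2))) = (nni lborel (%z. enn ((G z)^2)))"
	 using nn_integral_lborel_shift[of "%z. enn ((G z)^2)" "(- tau, 0)"] Gm by simp
	finally show "(nni lborel (%z. enn (?K tau * (G (z + (- tau, 0)))^2))) = enn (?K tau) * (nni lborel (%z. enn ((G z)^2)))" .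
 qed
 also have "... = (nni lborel (%z. enn ((G z)^2)))" by (rule nnK)
 finally show "(nni lborel (%z. enn ((time_mean h G z)^2))) <= (nni lborel (%z. enn ((G z)^2)))" .
 assume kappa: "!!y. abs y <= h ==> (LBINT z. (G (z + (y, 0)) - G z)^2) <= kappa" and c: "0 <= c" "c <= h"
 have "(nni lborel (%z. enn ((G (z + (- c, 0)) - time_mean h G z)^2))) <=
	 (nni lborel (%z. (nni lborel (%tau. enn (?K tau * (G (z + (- c, 0)) - G (z + (- tau, 0)))^2)))))"
	unfolding time_mean_def by (intro nn_integral_mono jensen_square_const K) measurable
 also have "... = (nni lborel (%tau. (nni lborel (%z. enn (?K tau * (G (z + (- c, 0)) - G (z + (- tau, 0)))^2)))))"
	by (rule lborel_pair.Fubini'[symmetric]) measurable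
 also have "... <= (nni lborel (%tau. enn (?K tau) * ennreal kappa))"
 proof (rule nn_integral_mono)
	fix tau
	have "(nni lborel (%z. enn (?K tau * (G (z + (- c, 0)) - G (z + (- tau, 0)))^2))) =
		enn (?K tau) * (nni lborel (%z. enn ((G (z + (- c, 0)) - G (z + (- tau, 0)))^2)))" unfolding ennreal_mult'[OF K(1)] by (rule nn_integral_cmult) measurable
	also have "... <= enn (?K tau) * ennreal kappa"
	proof (cases "tau : {0..<h}")
	 case True
	 have eq: "z + (- tau, 0) + (tau - c, 0) = z + (- c, 0)" for z :: "real \<times> 'a" by (simp add: prod_eq_iff)
	 have sq: "sqint lborel (%z. G (z + (tau - c, 0)) - G z)" by (intro sqint_diff sqint_shift G)
	 have "(nni lborel (%z. enn ((G (z + (- c, 0)) - G (z + (- tau, 0)))^2))) =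
		 (nni lborel (%z. enn ((G (z + (tau - c, 0)) - G z)^2)))" using nn_integral_lborel_shift[of "%z. enn ((G (z + (tau - c, 0)) - G z)^2)" "(- tau, 0)"] Gm
		unfolding eq by simp
	 also have "... = enn (LBINT z. (G (z + (tau - c, 0)) - G z)^2)" by (rule nn_integral_eq_integral[OF sqint_integrable[OF sq]]) simp
	 also have "... <= ennreal kappa" by (intro ennreal_leI kappa) (use True c in auto)
	 finally show ?thesis by (rule mult_left_mono) simp
	qed simp
	finally show "(nni lborel (%z. enn (?K tau * (G (z + (- c, 0)) - G (z + (- tau, 0)))^2))) <= enn (?K tau) * ennreal kappa" .
 qed
 also have "... = ennreal kappa" by (rule nnK)
 finally show "(nni lborel (%z. enn ((G (z + (- c, 0)) - time_mean h G z)^2))) <= ennreal kappa" .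
qed

lemma time_mean_eq:
 assumes "h > 0"
 shows "(LBINT tau. ind {t - h<..t} tau * G (tau, x)) = h * time_mean h G (t, x)"
proof -
 have "(LBINT tau. ind {t - h<..t} tau * G (tau, x)) =
	 (LBINT tau. ind {t - h<..t} (t + (- 1) * tau) * G (t + (- 1) * tau, x))"
	using lborel_integral_real_affine[of "- 1" "%tau. ind {t - h<..t} tau * G (tau, x)" t] by simp
 also have "... = (LBINT tau. h * ((ind {0..<h} tau / h) * G ((t, x) + (- tau, 0))))"
	by (rule bochner_integral_cong[OF refl]) (use assms in "auto simp: indicator_def")
 also have "... = h * time_mean h G (t, x)" unfolding time_mean_def by (rule integral_mult_right_zero)
 finally show ?thesis .
qed

lemma AE_lborel_shift:
 fixes P :: "real => bool"
 assumes "AE t in lborel. P t"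
 shows "AE t in lborel. P (t - h)"
proof -
 obtain N where N: "N : null_sets lborel" "{t : space lborel. \<not> P t} \<subseteq> N" using assms by (auto simp: eventually_ae_filter)
 have "AE t in lborel. t ~: N" by (rule AE_not_in[OF N(1)])
 then have "AE t in lborel. - h + 1 * t ~: N" by (rule AE_borel_affine[rotated 2]) (use N(1) in auto)
 then show ?thesis by eventually_elim (use N(2) in auto)
qed

text \<open>\<open>ennreal\<close> maps negative values to 0, so the right side is the integral of
  the positive part. An upper bound valid almost everywhere can thus be integrated without knowing
  the sign.\<close>

lemma integral_le_nn_integral:
 fixes f :: "'b => real"
 assumes "integrable M f"
 shows "enn (integral\<^sup>L M f) <= (\<integral>\<^sup>+x. enn (f x) \<partial>M)"
proof -
 have m: "integrable M (%x. max 0 (f x))" using assms by simp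
 have "integral\<^sup>L M f <= (LINT x|M. max 0 (f x))" by (rule integral_mono[OF assms m]) simp
 then have "enn (integral\<^sup>L M f) <= enn (LINT x|M. max 0 (f x))" by (rule ennreal_leI)
 also have "... = (\<integral>\<^sup>+x. enn (max 0 (f x)) \<partial>M)" by (rule nn_integral_eq_integral[OF m, symmetric]) simp
 also have "... = (\<integral>\<^sup>+x. enn (f x) \<partial>M)" by (simp add: ennreal_max_0)
 finally show ?thesis .
qed

lemma integral_small_interval:
 fixes g :: "real => real"
 assumes g: "integrable lborel g" "!!t. g t >= 0" and "eps > 0"
 obtains delta where "delta > 0" "!!h. 0 < h ==> h < delta ==> (LBINT t. ind {s<..s + h} t * g t) < eps"
proof -
 have gm [measurable]: "g : bmeas borel" using g(1) by simp
 have i: "integrable lborel (%t. ind {s<..s + h} t * g t)" for h using integrable_mult_indicator[OF _ g(1), of "{s<..s + h}"] by simp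
 have "(%n. (LBINT t. ind {s<..s + 1 / real (Suc n)} t * g t)) ----> (\<integral>t. 0 \<partial>(lborel :: real measure))"
 proof (rule integral_dominated_convergence[OF _ _ g(1)])
	have "(%n. ind {s<..s + 1 / real (Suc n)} t * g t) ----> 0" for t
	proof (cases "t <= s")
	 case True
	 then show ?thesis by simp
	next
	 case False
	 then obtain n where n: "1 / real (Suc n) < t - s" using nat_approx_posE[of "t - s"] by auto
	 have "ind {s<..s + 1 / real (Suc k)} t * g t = 0" if "k >= n" for k
	 proof -
		have "1 / real (Suc k) <= 1 / real (Suc n)" using that by (intro divide_left_mono) auto
		then have "t ~: {s<..s + 1 / real (Suc k)}" using n by auto
		then show ?thesis by simp
	 qed
	 then show ?thesis by (intro tendsto_eventually eventually_sequentiallyI)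
	qed
	then show "AE t in lborel. (%n. ind {s<..s + 1 / real (Suc n)} t * g t) ----> 0" by simp
	show "AE t in lborel. norm (ind {s<..s + 1 / real (Suc n)} t * g t) <= g t" for n using g(2) by (intro AE_I2) (auto simp: indicator_def)
 qed auto
 then have "eventually (%n. (LBINT t. ind {s<..s + 1 / real (Suc n)} t * g t) < eps) sequentially" using \<open>eps > 0\<close> by (intro order_tendstoD(2)) auto
 then obtain n where n: "(LBINT t. ind {s<..s + 1 / real (Suc n)} t * g t) < eps" by (auto simp: eventually_sequentially)
 show thesis
 proof (rule that[of "1 / real (Suc n)"])
	fix h :: real assume h: "0 < h" "h < 1 / real (Suc n)"
	have "(LBINT t. ind {s<..s + h} t * g t) <= (LBINT t. ind {s<..s + 1 / real (Suc n)} t * g t)"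
	 by (rule integral_mono[OF i i]) (use h g(2) in "auto simp: indicator_def")
	then show "(LBINT t. ind {s<..s + h} t * g t) < eps" using n by linarith
 qed simp
qed

text \<open>The data extracted from a solution on a time interval: \<open>G\<close> is a Borel
  version of the time derivative extended by zero, \<open>C\<close> bounds the chemical potential in
  L2, \<open>N\<close> is an integrable bound for the squared norm of its Laplacian, and
  \<open>e\<close> is a measurable version of the energy. Regularity and equation hold for almost
  every time only, whereas the states are admissible at every time.\<close>

locale flow_data = phase_field Om a \<alpha> \<beta> R for Om :: "'a::euclidean_space set" and a \<alpha> \<beta> R +
 fixes v :: "real => 'a => real" and T C :: real and G :: "real \<times> 'a => real" and A B N e :: "real => real"
 assumes C: "C >= 0"
	and v_adm: "!!t. 0 <= t ==> t <= T ==> v t : adm"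
	and unif: "!!eta. eta > 0 ==> EX delta>0. ALL s:{0..T}. ALL t:{0..T}. \<bar>s - t\<bar> < delta --> (ALL x:Om. \<bar>v s x - v t x\<bar> <= eta)"
	and G: "sqint lborel G" and G0: "!!z. z ~: {0<..<T} \<times> Om ==> G z = 0"
	and incr: "!!s t. 0 < s ==> s < t ==> t < T ==>
	 AE x in leb Om. v t x - v s x = (LBINT tau. ind {s<..t} tau * G (tau, x))"
	and B: "sqint lborel B" and N: "integrable lborel N" "!!t. N t >= 0" and e: "integrable lborel e"
	and good: "AE t in lborel. t : {0<..<T} --> mu Om a (v t) : H2N Om &
	 l2norm (leb Om) (mu Om a (v t)) <= C &
	 (l2norm (leb Om) (lap Om (mu Om a (v t))))\<^sup>2 <= N t & e t = E Om a (v t) &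
	 (AE x in leb Om. G (t, x) = lap Om (mu Om a (v t)) x
		- deriv (deriv (W a)) (v t x) * mu Om a (v t) x + A t + B t * mu Om a (v t) x)"
begin

definition "Dist t s = l2norm (leb Om) (%x. v t x - v s x)"
definition "\<gamma> t = (LBINT x. (G (t, x))^2)"

section \<open>Time slices of \<open>G\<close> and the size of increments\<close>

lemma Gm: "G : bmeas borel" using sqint_measurable[OF G] by simp

lemma Gm_pair [measurable]: "G : bmeas (borel \<Otimes>\<^sub>M borel)" using Gm by (simp add: borel_prod)

lemma nn_integral_pair:
 fixes f :: "real \<times> 'a => real"
 assumes "f : bmeas borel"
 shows "(nni lborel (%t. (nni lborel (%x. enn ((f (t, x))^2))))) = (nni lborel (%z. enn ((f z)^2)))"
proof -
 have "(%z. enn ((f z)^2)) : bmeas (lborel \<Otimes>\<^sub>M lborel)" using assms by (simp add: lborel_prod)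
 from lborel.nn_integral_fst[OF this] show ?thesis by (simp add: lborel_prod)
qed

lemma slice:
 fixes f :: "'a => real"
 assumes f: "f : bmeas borel" "!!x. x ~: Om ==> f x = 0" and fin: "(nni lborel (%x. enn ((f x)^2))) < \<infinity>"
 shows "sqint (leb Om) f" "enn ((l2norm (leb Om) f)^2) = (nni lborel (%x. enn ((f x)^2)))"
	"(l2norm (leb Om) f)^2 = (LBINT x. (f x)^2)"
proof -
 have i: "integrable lborel (%x. (f x)^2)" by (rule integrableI_nonneg) (use f fin in auto)
 have z: "(f x)^2 = 0" if "x ~: Om" for x using f(2)[OF that] by simp
 have m: "(%x. (f x)^2) : bmeas borel" using f(1) by simp
 show "sqint (leb Om) f" using lebesgue_on_borel(3)[OF leb f] lebesgue_on_borel(2)[OF leb m z] i by (simp add: sqint_def)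
 show l: "(l2norm (leb Om) f)^2 = (LBINT x. (f x)^2)" unfolding l2norm_sq by (rule lebesgue_on_borel(1)[OF leb m z])
 show "enn ((l2norm (leb Om) f)^2) = (nni lborel (%x. enn ((f x)^2)))" unfolding l by (rule nn_integral_eq_integral[OF i, symmetric]) simp
qed

lemma slice_finite:
 fixes f :: "real \<times> 'a => real"
 assumes f: "f : bmeas borel" and fin: "(nni lborel (%z. enn ((f z)^2))) < \<infinity>"
 shows "AE t in lborel. (nni lborel (%x. enn ((f (t, x))^2))) < \<infinity>"
proof -
 have [measurable]: "f : bmeas (borel \<Otimes>\<^sub>M borel)" using f by (simp add: borel_prod)
 have "AE t in lborel. (nni lborel (%x. enn ((f (t, x))^2))) \<noteq> \<infinity>"
	by (rule nn_integral_noteq_infinite) (use fin nn_integral_pair[OF f] in "auto simp: less_top")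
 then show ?thesis by eventually_elim (simp add: less_top)
qed

lemma slice_measurable:
 fixes f :: "real \<times> 'a => real"
 assumes "f : bmeas borel"
 shows "(%x. f (t, x)) : bmeas borel"
proof -
 have [measurable]: "f : bmeas (borel \<Otimes>\<^sub>M borel)" using assms by (simp add: borel_prod)
 show ?thesis by measurable
qed

lemma G_finite: "(nni lborel (%z. enn ((G z)^2))) = enn (LBINT z. (G z)^2)" by (rule nn_integral_eq_integral[OF sqint_integrable[OF G]]) simp

lemma G_slice: "x ~: Om ==> G (t, x) = 0" by (rule G0) auto

lemma \<gamma>: "integrable lborel \<gamma>" "\<gamma> t >= 0" "AE t in lborel. (nni lborel (%x. enn ((G (t, x))^2))) = enn (\<gamma> t)"
proof -
 show "integrable lborel \<gamma>" using lborel_pair_integral(3)[OF sqint_integrable[OF G]] by (simp add: \<gamma>_def[abs_def])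
 show "\<gamma> t >= 0" by (simp add: \<gamma>_def)
 have "AE t in lborel. (nni lborel (%x. enn ((G (t, x))^2))) < \<infinity>" by (rule slice_finite[OF Gm]) (simp add: G_finite)
 then show "AE t in lborel. (nni lborel (%x. enn ((G (t, x))^2))) = enn (\<gamma> t)"
	by eventually_elim (use slice(2,3)[OF slice_measurable[OF Gm] G_slice] in "simp add: \<gamma>_def")
qed

lemma vd: "0 <= s ==> s <= T ==> 0 <= t ==> t <= T ==> sqint (leb Om) (%x. v t x - v s x)" by (intro sqint_diff adm(6) v_adm)

lemma interval_integrable:
 assumes "integrable lborel f" "I : sets borel"
 shows "integrable lborel (%t. ind I t * f t :: real)" using integrable_mult_indicator[of I lborel f] assms by simp

lemma increment_bound_interior:
 assumes st: "0 < s" "s < t" "t < T"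
 shows "(Dist t s)^2 <= (t - s) * (LBINT tau. ind {s<..t} tau * \<gamma> tau)"
proof -
 define f where "f x = (LBINT tau. ind {s<..t} tau * G (tau, x))" for x
 have st': "s <= t" using st by simp
 have fm: "f : bmeas borel" unfolding f_def[abs_def] by (rule sqint_pair_time_integral(3)[OF G st'])
 have f0: "f x = 0" if "x ~: Om" for x using G_slice[OF that] by (simp add: f_def)
 have i: "integrable lborel (%tau. ind {s<..t} tau * \<gamma> tau)" by (rule interval_integrable[OF \<gamma>(1)]) simp
 have "(nni lborel (%x. enn ((f x)^2))) <=
	 enn (t - s) * (\<integral>\<^sup>+tau\<in>{s<..t}. (nni lborel (%x. enn ((G (tau, x))^2))) \<partial>lborel)"
	unfolding f_def by (rule sqint_time_integral_bound[OF G st'])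
 also have "(\<integral>\<^sup>+tau\<in>{s<..t}. (nni lborel (%x. enn ((G (tau, x))^2))) \<partial>lborel) = (nni lborel (%tau. enn (ind {s<..t} tau * \<gamma> tau)))"
	by (rule nn_integral_cong_AE) (use \<gamma>(3) in "eventually_elim, auto simp: indicator_def")
 also have "... = enn (LBINT tau. ind {s<..t} tau * \<gamma> tau)" by (rule nn_integral_eq_integral[OF i]) (simp add: \<gamma>(2))
 also have "enn (t - s) * ... = enn ((t - s) * (LBINT tau. ind {s<..t} tau * \<gamma> tau))" using st by (simp add: ennreal_mult')
 finally have le: "(nni lborel (%x. enn ((f x)^2))) <= enn ((t - s) * (LBINT tau. ind {s<..t} tau * \<gamma> tau))" .
 then have fin: "(nni lborel (%x. enn ((f x)^2))) < \<infinity>" by (rule le_less_trans) simp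
 have sl: "sqint (leb Om) f" "enn ((l2norm (leb Om) f)^2) = (nni lborel (%x. enn ((f x)^2)))" by (rule slice(1,2)[OF fm _ fin]; rule f0; assumption)+
 have dm: "sqint (leb Om) (%x. v t x - v s x)" by (rule vd) (use st in auto)
 have "Dist t s = l2norm (leb Om) f" unfolding Dist_def by (rule l2norm_cong_AE[OF sqint_measurable[OF dm] sqint_measurable[OF sl(1)]])
	 (unfold f_def, rule incr[OF st])
 then have "enn ((Dist t s)^2) <= enn ((t - s) * (LBINT tau. ind {s<..t} tau * \<gamma> tau))" using sl(2) le by simp
 moreover have "0 <= (t - s) * (LBINT tau. ind {s<..t} tau * \<gamma> tau)" using st \<gamma>(2) by (intro mult_nonneg_nonneg integral_nonneg_AE) auto
 ultimately show ?thesis by (simp add: ennreal_le_iff)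
qed

text \<open>The integral formula for increments needs a positive initial time; uniform continuity in
  time extends the bound to s = 0.\<close>

lemma increment_bound:
 assumes st: "0 <= s" "s < t" "t < T"
 shows "(Dist t s)^2 <= (t - s) * (LBINT tau. ind {s<..t} tau * \<gamma> tau)"
proof -
 define I where "I = (t - s) * (LBINT tau. ind {s<..t} tau * \<gamma> tau)"
 have "Dist t s <= sqrt I + eps" if "eps > 0" for eps
 proof -
	have "eps / (vol + 1) > 0" using \<open>eps > 0\<close> vol_nonneg by simp
	from unif[OF this] obtain delta where delta: "delta > 0"
	 "ALL s:{0..T}. ALL t:{0..T}. \<bar>s - t\<bar> < delta --> (ALL x:Om. \<bar>v s x - v t x\<bar> <= eps / (vol + 1))" by blast
	define s' where "s' = s + min (delta / 2) ((t - s) / 2)"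
	have s': "s < s'" "s' < t" "\<bar>s' - s\<bar> < delta"
	proof -
	 show "s < s'" using delta(1) st by (simp add: s'_def)
	 have "s' <= s + (t - s) / 2" "s' <= s + delta / 2" using min.cobounded1[of "delta / 2" "(t - s) / 2"] min.cobounded2[of "delta / 2" "(t - s) / 2"]
		unfolding s'_def by linarith+
	 then show "s' < t" "\<bar>s' - s\<bar> < delta" using delta(1) st \<open>s < s'\<close> by (auto simp: field_simps)
	qed
	have d1: "sqint (leb Om) (%x. v t x - v s' x)" and d2: "sqint (leb Om) (%x. v s' x - v s x)" by (rule vd; use st s' in simp)+
	have "Dist s' s <= eps / (vol + 1) * vol" unfolding Dist_def by (rule l2norm_bounded[OF d2]) (use delta(2) s' st \<open>eps > 0\<close> vol_nonneg in auto)
	also have "... <= eps" using \<open>eps > 0\<close> vol_nonneg by (simp add: field_simps)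
	finally have "Dist s' s <= eps" .
	moreover have "Dist t s <= Dist t s' + Dist s' s" using l2norm_triangle[OF d1 d2] by (simp add: Dist_def)
	moreover have "Dist t s' <= sqrt I"
	proof (rule real_le_rsqrt)
	 have "(Dist t s')^2 <= (t - s') * (LBINT tau. ind {s'<..t} tau * \<gamma> tau)" by (rule increment_bound_interior) (use s' st in auto)
	 also have "... <= I" unfolding I_def
	 proof (rule mult_mono)
		show "(LBINT tau. ind {s'<..t} tau * \<gamma> tau) <= (LBINT tau. ind {s<..t} tau * \<gamma> tau)"
		proof (rule integral_mono)
		 show "ind {s'<..t} tau * \<gamma> tau <= ind {s<..t} tau * \<gamma> tau" for tau using s' \<gamma>(2)[of tau] by (auto simp: indicator_def)
		qed (rule interval_integrable[OF \<gamma>(1)], simp)+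
		show "0 <= (LBINT tau. ind {s'<..t} tau * \<gamma> tau)" using \<gamma>(2) by (intro integral_nonneg_AE) auto
	 qed (use s' st in auto)
	 finally show "(Dist t s')^2 <= I" .
	qed
	ultimately show ?thesis by linarith
 qed
 then have "Dist t s <= sqrt I" by (rule field_le_epsilon)
 then have "(Dist t s)^2 <= (sqrt I)^2" by (rule power_mono) (simp add: Dist_def l2norm_nonneg)
 moreover have "I >= 0" unfolding I_def using st \<gamma>(2) by (intro mult_nonneg_nonneg integral_nonneg_AE) auto
 ultimately show ?thesis by (simp add: I_def)
qed

text \<open>\<open>energy_upper\<close> compares every later time with s. The increment is of order
  sqrt h times a small factor, and the norm of the Laplacian of \<open>mu\<close> is only square
  integrable in time; their product integrates to h times the integral of \<open>?g\<close> over a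
  short interval, which is small.\<close>

lemma energy_average_upper:
 assumes s: "0 <= s" "s < T" and eps: "eps > 0"
 obtains delta where "delta > 0"
	"!!h. 0 < h ==> h < delta ==> (LBINT t. ind {s<..s + h} t * e t) <= h * (E Om a (v s) + eps)"
proof -
 let ?g = "%t. N t + \<gamma> t"
 have g: "integrable lborel ?g" "?g t >= 0" for t using N(1) \<gamma>(1) add_nonneg_nonneg[OF N(2) \<gamma>(2), of t t] by simp_all
 have CL: "C * L + 1 > 0" using C L_pos by (simp add: add_nonneg_pos)
 define k where "k = eps / (2 * (C * L + 1))"
 have k: "k > 0" using CL eps by (simp add: k_def)
 have "min (eps / 2) (k^2) > 0" using eps k by simp
 then obtain delta where delta: "delta > 0" "!!h. 0 < h ==> h < delta ==> (LBINT t. ind {s<..s + h} t * ?g t) < min (eps / 2) (k^2)"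
	by (rule integral_small_interval[OF g]) blast
 show thesis
 proof (rule that[of "min delta (min 1 (T - s))"])
	show "min delta (min 1 (T - s)) > 0" using delta(1) s by simp
	fix h assume h: "0 < h" "h < min delta (min 1 (T - s))"
	define I where "I f = (LBINT t. ind {s<..s + h} t * f t)" for f :: "real => real"
	have ii: "integrable lborel (%t. ind {s<..s + h} t * f t)" if "integrable lborel f" for f :: "real => real" by (rule interval_integrable[OF that]) simp
	have I1: "integrable lborel (%t. ind {s<..s + h} t :: real)" using h by (intro integrable_real_indicator) auto
	have I1v: "(LBINT t. ind {s<..s + h} t) = h" using h by simp
	have "I N + I \<gamma> = I ?g" unfolding I_def using ii[OF N(1)] ii[OF \<gamma>(1)] by (simp add: distrib_left)
	moreover have "I ?g < min (eps / 2) (k^2)" unfolding I_def using delta(2)[of h] h by simp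
	moreover have "I N >= 0" "I \<gamma> >= 0" unfolding I_def using N(2) \<gamma>(2) by (auto intro!: integral_nonneg_AE)
	ultimately have sm: "I N + I \<gamma> < eps / 2" "I \<gamma> < k^2" "I \<gamma> >= 0" by auto
	have D: "(Dist t s)^2 <= h * I \<gamma>" if t: "t : {s<..s + h}" for t
	proof -
	 have "(Dist t s)^2 <= (t - s) * (LBINT tau. ind {s<..t} tau * \<gamma> tau)" by (rule increment_bound) (use t s h in auto)
	 also have "... <= h * I \<gamma>" unfolding I_def
	 proof (rule mult_mono)
		show "(LBINT tau. ind {s<..t} tau * \<gamma> tau) <= (LBINT tau. ind {s<..s + h} tau * \<gamma> tau)"
		proof (rule integral_mono)
		 show "ind {s<..t} tau * \<gamma> tau <= ind {s<..s + h} tau * \<gamma> tau" for tau using t \<gamma>(2)[of tau] by (auto simp: indicator_def)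
		qed (rule interval_integrable[OF \<gamma>(1)], simp)+
		show "0 <= (LBINT tau. ind {s<..t} tau * \<gamma> tau)" using \<gamma>(2) by (intro integral_nonneg_AE) auto
	 qed (use t h in auto)
	 finally show ?thesis .
	qed
	have Dk: "Dist t s <= k" if t: "t : {s<..s + h}" for t
	proof (rule power2_le_imp_le)
	 have "(Dist t s)^2 <= h * I \<gamma>" by (rule D[OF t])
	 also have "... <= 1 * I \<gamma>" using h sm by (intro mult_right_mono) auto
	 finally show "(Dist t s)^2 <= k^2" using sm by simp
	qed (use k in simp)
	let ?b = "%t. E Om a (v s) + 1 / 2 * (h * N t + I \<gamma>) + C * L * k"
	have le: "AE t in lborel. ind {s<..s + h} t * e t <= ind {s<..s + h} t * ?b t" using good
	proof eventually_elim
	 case (elim t)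
	 show ?case
	 proof (cases "t : {s<..s + h}")
		case True
		have tT: "t : {0<..<T}" using True s h by auto
		let ?l = "l2norm (leb Om) (lap Om (mu Om a (v t)))"
		have "e t - E Om a (v s) <= (?l + C * L) * Dist t s" unfolding Dist_def using elim tT s by (auto intro!: energy_upper v_adm)
		moreover have "C * L * Dist t s <= C * L * k" using C L_pos by (intro mult_left_mono Dk[OF True]) auto
		moreover have "?l * Dist t s <= 1 / 2 * (h * N t + I \<gamma>)"
		proof -
		 \<comment> \<open>Young's inequality with weight h: the squared distance carries one factor h, so
		   after division by h neither term is singular.\<close>
		 have "0 <= (h * ?l - Dist t s)^2" by simp
		 then have "2 * h * (?l * Dist t s) <= h^2 * ?l\<^sup>2 + (Dist t s)^2" by (simp add: power2_diff power_mult_distrib mult_ac)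
		 also have "... <= h^2 * N t + h * I \<gamma>" using elim tT by (intro add_mono mult_left_mono D[OF True]) auto
		 also have "... = h * (h * N t + I \<gamma>)" by (simp add: power2_eq_square distrib_left)
		 finally have "h * (2 * (?l * Dist t s)) <= h * (h * N t + I \<gamma>)" by (simp add: mult_ac)
		 then have "2 * (?l * Dist t s) <= h * N t + I \<gamma>" using h by (simp only: mult_le_cancel_left_pos)
		 then show ?thesis by simp
		qed
		ultimately have "e t <= ?b t" unfolding distrib_right by linarith
		then show ?thesis using True by simp
	 qed simp
	qed
	have beq: "ind {s<..s + h} t * ?b t = (E Om a (v s) + 1 / 2 * I \<gamma> + C * L * k) * ind {s<..s + h} t + (h / 2) * (ind {s<..s + h} t * N t)" for t
	 by (simp add: field_simps)
	have bi: "integrable lborel (%t. ind {s<..s + h} t * ?b t)" unfolding beq using ii[OF N(1)] I1 by simp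
	have "I e <= (LBINT t. ind {s<..s + h} t * ?b t)" unfolding I_def[of e] by (rule integral_mono_AE[OF ii[OF e] bi le])
	also have "... = (LBINT t. (E Om a (v s) + 1 / 2 * I \<gamma> + C * L * k) * ind {s<..s + h} t + (h / 2) * (ind {s<..s + h} t * N t))"
	 by (rule bochner_integral_cong[OF refl beq])
	also have "... = (E Om a (v s) + 1 / 2 * I \<gamma> + C * L * k) * h + (h / 2) * I N" using ii[OF N(1)] I1 I1v by (simp add: I_def)
	also have "... = h * (E Om a (v s) + (1 / 2 * (I N + I \<gamma>) + C * L * k))" by (simp add: field_simps)
	also have "... <= h * (E Om a (v s) + eps)"
	proof -
	 have "C * L * k <= (C * L + 1) * k" using k by simp
	 also have "... = eps / 2" using CL unfolding k_def by (simp add: field_simps)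
	 finally have "1 / 2 * (I N + I \<gamma>) + C * L * k <= eps" using sm(1) eps by argo
	 then show ?thesis using h by (intro mult_left_mono) auto
	qed
	finally show "(LBINT t. ind {s<..s + h} t * e t) <= h * (E Om a (v s) + eps)" by (simp add: I_def)
 qed
qed

lemma energy_average_lower:
 assumes b: "0 < b" "b < T" and eps: "eps > 0"
 obtains delta where "delta > 0"
	"!!h. 0 < h ==> h < delta ==> h * (E Om a (v b) - eps) <= (LBINT t. ind {b - h<..b} t * e t)"
proof -
 have vb: "v b : adm" using b by (intro v_adm) auto
 obtain eta where eta: "eta > 0"
	"!!u. u : adm ==> l2norm (leb Om) (mu Om a u) <= C ==> (!!x. x : Om ==> \<bar>u x - v b x\<bar> <= eta) ==> E Om a (v b) - eps <= E Om a u"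
	by (rule energy_lower[OF vb eps C]) blast
 from unif[OF eta(1)] obtain delta where delta: "delta > 0"
	"ALL s:{0..T}. ALL t:{0..T}. \<bar>s - t\<bar> < delta --> (ALL x:Om. \<bar>v s x - v t x\<bar> <= eta)" by blast
 show thesis
 proof (rule that[of "min delta b"])
	show "min delta b > 0" using delta(1) b by simp
	fix h assume h: "0 < h" "h < min delta b"
	have I1: "integrable lborel (%t. ind {b - h<..b} t :: real)" using h by (intro integrable_real_indicator) auto
	have "h * (E Om a (v b) - eps) = (LBINT t. ind {b - h<..b} t * (E Om a (v b) - eps))" using h by simp
	also have "... <= (LBINT t. ind {b - h<..b} t * e t)"
	proof (rule integral_mono_AE)
	 show "integrable lborel (%t. ind {b - h<..b} t * (E Om a (v b) - eps))" using I1 by simp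
	 show "integrable lborel (%t. ind {b - h<..b} t * e t)" by (rule interval_integrable[OF e]) simp
	 show "AE t in lborel. ind {b - h<..b} t * (E Om a (v b) - eps) <= ind {b - h<..b} t * e t" using good
	 proof eventually_elim
		case (elim t)
		show ?case
		proof (cases "t : {b - h<..b}")
		 case True
		 then have t: "t : {0<..<T}" "\<bar>t - b\<bar> < delta" using h b by auto
		 have "E Om a (v b) - eps <= E Om a (v t)"
		 proof (rule eta(2))
			show "v t : adm" using t by (intro v_adm) auto
			show "l2norm (leb Om) (mu Om a (v t)) <= C" using elim t by blast
			show "\<bar>v t x - v b x\<bar> <= eta" if "x : Om" for x using delta(2) t b that by auto
		 qed
		 moreover have "e t = E Om a (v t)" using elim t by blast
		 ultimately show ?thesis using True by simp
		qed simp
	 qed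
	qed
	finally show "h * (E Om a (v b) - eps) <= (LBINT t. ind {b - h<..b} t * e t)" .
 qed
qed

text \<open>Here the flow enters: testing the equation at the times \<open>t\<close> and \<open>t - h\<close> with the increment,
  which is \<open>h\<close> times the mean of \<open>G\<close> over the time step.\<close>

lemma energy_step:
 assumes h: "0 < h" and th: "0 < t - h" "t < T"
	and g1: "mu Om a (v t) : H2N Om" "l2norm (leb Om) (mu Om a (v t)) <= C"
	 "AE x in leb Om. G (t, x) = lap Om (mu Om a (v t)) x
		- deriv (deriv (W a)) (v t x) * mu Om a (v t) x + A t + B t * mu Om a (v t) x"
	and g2: "mu Om a (v (t - h)) : H2N Om" "l2norm (leb Om) (mu Om a (v (t - h))) <= C"
	 "AE x in leb Om. G (t - h, x) = lap Om (mu Om a (v (t - h))) x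
		- deriv (deriv (W a)) (v (t - h) x) * mu Om a (v (t - h)) x + A (t - h) + B (t - h) * mu Om a (v (t - h)) x"
	and G1: "sqint (leb Om) (%x. G (t, x))" and G2: "sqint (leb Om) (%x. G (t - h, x))"
	and r: "sqint (leb Om) (%x. time_mean h G (t, x))"
	and omega: "!!x. x : Om ==> \<bar>v t x - v (t - h) x\<bar> <= omega" "omega > 0" and eta: "eta > 0"
 defines "rho \<equiv> (l2norm (leb Om) (%x. time_mean h G (t, x)))^2"
	and "p1 \<equiv> (l2norm (leb Om) (%x. G (t, x) - time_mean h G (t, x)))^2"
	and "p2 \<equiv> (l2norm (leb Om) (%x. G (t - h, x) - time_mean h G (t, x)))^2"
	and "k \<equiv> L * (vol + C) * omega"
 shows "E Om a (v t) - E Om a (v (t - h)) <=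
	h * (p1 + p2 + (k + C * eta) * rho + k * ((B t)^2 + (B (t - h))^2) + C / eta * (B (t - h) - B t)^2 + k)"
proof -
 let ?M = "leb Om" and ?r = "%x. time_mean h G (t, x)"
 let ?d = "%x. v t x - v (t - h) x"
 have dd: "sqint ?M ?d" by (rule vd) (use h th in auto)
 have deq: "AE x in ?M. ?d x = h * ?r x" using incr[of "t - h" t] h th unfolding time_mean_eq[OF h] by simp
 have hr: "sqint ?M (%x. h * ?r x)" by (rule sqint_scale[OF r])
 define q where "q = l2norm ?M ?r"
 have q0: "q >= 0" by (simp add: q_def l2norm_nonneg)
 have D: "l2norm ?M ?d = h * q" using l2norm_cong_AE[OF sqint_measurable[OF dd] sqint_measurable[OF hr] deq] h by (simp add: l2norm_scale q_def)
 have ipd: "ip ?M g ?d = h * ip ?M g ?r" if g: "sqint ?M g" for g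
 proof -
	have "ip ?M ?d g = ip ?M (%x. h * ?r x) g" by (rule ip_cong_AE[OF sqint_measurable[OF dd] sqint_measurable[OF hr] sqint_measurable[OF g] deq])
	also have "... = h * ip ?M ?r g" by (simp add: ip_def mult.assoc)
	finally show ?thesis by (simp add: ip_commute[of _ g])
 qed
 \<comment> \<open>By polarization -<g, r> is half of |g - r|^2 - |g|^2 - |r|^2 in norms. The
   dissipation is simply dropped; only the deviation of the time derivative from its mean
   remains.\<close>
 have low: "- ip ?M g ?r <= 1 / 2 * (l2norm ?M (%x. g x - ?r x))^2" if g: "sqint ?M g" for g
 proof -
	have "(l2norm ?M (%x. g x - ?r x))^2 = (l2norm ?M g)^2 - 2 * ip ?M g ?r + (l2norm ?M ?r)^2"
	 unfolding ip_self[symmetric] ip_diff(1)[OF g r sqint_diff[OF g r]] ip_diff(2)[OF g r g] ip_diff(2)[OF g r r] by (simp add: ip_commute[of _ ?r g])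
	then show ?thesis using zero_le_power2[of "l2norm ?M g"] zero_le_power2[of "l2norm ?M ?r"] by simp
 qed
 \<comment> \<open>In the term quadratic in the increment, one of its two factors is estimated by
   the uniform modulus of continuity \<open>omega\<close>; this makes the term small although
   \<open>B\<close> is unbounded.\<close>
 have hqv: "h * q <= omega * vol" unfolding D[symmetric] by (rule l2norm_bounded[OF dd omega(1)]) (use omega(2) in auto)
 have "E Om a (v t) - E Om a (v (t - h)) <=
	 - 1 / 2 * (ip ?M (%x. G (t, x)) ?d + ip ?M (%x. G (t - h, x)) ?d)
	 + C * L * omega * l2norm ?M ?d + 1 / 2 * (\<bar>B t\<bar> + \<bar>B (t - h)\<bar>) * L * (l2norm ?M ?d)^2 + 1 / 2 * \<bar>B t - B (t - h)\<bar> * C * l2norm ?M ?d"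
	by (rule energy_difference[OF v_adm v_adm g1(1) g2(1) g1(2) g2(2) omega(1) G1 G2 g1(3) g2(3)]) (use h th in auto)
 also have "... = h * (1 / 2 * (- ip ?M (%x. G (t, x)) ?r - ip ?M (%x. G (t - h, x)) ?r)
	 + C * L * omega * q + 1 / 2 * (\<bar>B t\<bar> + \<bar>B (t - h)\<bar>) * L * (h * q) * q + 1 / 2 * \<bar>B t - B (t - h)\<bar> * C * q)"
	unfolding D ipd[OF G1] ipd[OF G2] by (simp add: field_simps power2_eq_square)
 also have "... <= h * (p1 + p2 + (k + C * eta) * rho + k * ((B t)^2 + (B (t - h))^2) + C / eta * (B (t - h) - B t)^2 + k)"
 proof (rule mult_left_mono)
	have y1: "1 / 2 * (- ip ?M (%x. G (t, x)) ?r - ip ?M (%x. G (t - h, x)) ?r) <= p1 + p2"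
	proof -
	 have "- ip ?M (%x. G (t, x)) ?r <= 1 / 2 * p1" unfolding p1_def by (rule low[OF G1])
	 moreover have "- ip ?M (%x. G (t - h, x)) ?r <= 1 / 2 * p2" unfolding p2_def by (rule low[OF G2])
	 moreover have "0 <= p1" "0 <= p2" by (simp_all add: p1_def p2_def)
	 moreover have "1 / 2 * (- x - y) <= p + q" if "- x <= 1 / 2 * p" "- y <= 1 / 2 * q" "0 <= p" "0 <= q" for x y p q :: real using that by argo
	 ultimately show ?thesis by blast
	qed
	have k1: "k = L * omega * vol + C * L * omega" by (simp add: k_def algebra_simps)
	have c0: "0 <= C * L * omega" "0 <= L * omega * vol" using C L_pos omega(2) vol_nonneg by simp_all
	have yc: "x * y <= x^2 + y^2" for x y :: real
	proof -
	 have "2 * (x * y) <= x^2 + y^2" using zero_le_power2[of "x - y"] by (simp add: power2_diff)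
	 moreover have "0 <= x^2 + y^2" by simp
	 ultimately show ?thesis by argo
	qed
	have "C * L * omega * q <= C * L * omega * (1 + q^2)" using yc[of 1 q] c0 by (intro mult_left_mono) auto
	then have y2: "C * L * omega * q <= C * L * omega + C * L * omega * rho" by (simp add: rho_def q_def distrib_left)
	have y3: "1 / 2 * (\<bar>B t\<bar> + \<bar>B (t - h)\<bar>) * L * (h * q) * q <= L * omega * vol * ((B t)^2 + (B (t - h))^2 + rho)"
	proof -
	 have "1 / 2 * (\<bar>B t\<bar> + \<bar>B (t - h)\<bar>) * L * (h * q) * q = (h * q) * (L * (1 / 2 * (\<bar>B t\<bar> * q + \<bar>B (t - h)\<bar> * q)))"
		by (simp add: field_simps)
	 also have "... <= (omega * vol) * (L * ((B t)^2 + (B (t - h))^2 + rho))"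
	 proof (rule mult_mono[OF hqv], rule mult_left_mono)
		show "1 / 2 * (\<bar>B t\<bar> * q + \<bar>B (t - h)\<bar> * q) <= (B t)^2 + (B (t - h))^2 + rho"
		proof -
		 have "\<bar>B s\<bar> * q <= (B s)^2 + rho" for s using yc[of "\<bar>B s\<bar>" q] by (simp add: rho_def q_def)
		 from this[of t] this[of "t - h"] show ?thesis using zero_le_power2[of "B t"] zero_le_power2[of "B (t - h)"] by argo
		qed
	 qed (use L_pos omega(2) vol_nonneg q0 in auto)
	 finally show ?thesis by (simp add: mult_ac)
	qed
	have y4: "1 / 2 * \<bar>B t - B (t - h)\<bar> * C * q <= C / eta * (B (t - h) - B t)^2 + C * eta * rho"
	proof -
	 let ?b = "\<bar>B t - B (t - h)\<bar>"
	 have "0 <= (?b - eta * q)^2" by simp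
	 then have "2 * eta * (?b * q) <= ?b\<^sup>2 + eta\<^sup>2 * q^2" by (simp add: power2_diff power_mult_distrib mult_ac)
	 then have "eta * (1 / 2 * (?b * q)) <= ?b\<^sup>2 + eta\<^sup>2 * q^2"
		using zero_le_power2[of ?b] zero_le_power2[of "eta * q"] mult_nonneg_nonneg[OF less_imp_le[OF eta] mult_nonneg_nonneg[OF abs_ge_zero q0], of "B t - B (t - h)"]
		by linarith
	 also have "... = eta * (?b\<^sup>2 / eta + eta * q^2)" using eta by (simp add: field_simps power2_eq_square)
	 finally have "1 / 2 * (?b * q) <= ?b\<^sup>2 / eta + eta * q^2" using eta by (simp only: mult_le_cancel_left_pos)
	 then have "C * (1 / 2 * (?b * q)) <= C * (?b\<^sup>2 / eta + eta * q^2)" by (intro mult_left_mono C)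
	 then show ?thesis by (simp add: rho_def q_def power2_commute[of "B t"] algebra_simps)
	qed
	show "1 / 2 * (- ip ?M (%x. G (t, x)) ?r - ip ?M (%x. G (t - h, x)) ?r)
	 + C * L * omega * q + 1 / 2 * (\<bar>B t\<bar> + \<bar>B (t - h)\<bar>) * L * (h * q) * q + 1 / 2 * \<bar>B t - B (t - h)\<bar> * C * q <=
	 p1 + p2 + (k + C * eta) * rho + k * ((B t)^2 + (B (t - h))^2) + C / eta * (B (t - h) - B t)^2 + k"
	proof -
	 have "0 <= C * L * omega * ((B t)^2 + (B (t - h))^2)" by (rule mult_nonneg_nonneg[OF c0(1)]) simp
	 moreover have "(k + C * eta) * rho + k * ((B t)^2 + (B (t - h))^2) + k =
		 L * omega * vol * ((B t)^2 + (B (t - h))^2 + rho) + L * omega * vol + C * L * omega * ((B t)^2 + (B (t - h))^2) + (C * L * omega + C * L * omega * rho) + C * eta * rho"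
		unfolding k1 by algebra
	 ultimately show ?thesis using y1 y2 y3 y4 c0(2) by linarith
	qed
 qed (use h in simp)
 finally show ?thesis .
qed

end

lemma (in flow_data) slice_nn_measurable:
 fixes f :: "real \<times> 'a => real"
 assumes "f : bmeas borel"
 shows "(%t. \<integral>\<^sup>+x. enn ((f (t, x))^2) \<partial>lborel) : bmeas borel"
proof -
 have [measurable]: "f : bmeas (borel \<Otimes>\<^sub>M borel)" using assms by (simp add: borel_prod)
 show ?thesis by measurable
qed

lemma ennreal_combination:
 assumes "0 <= h" "0 <= p1" "0 <= p2" "0 <= c" "0 <= rho" "0 <= k" "0 <= b1" "0 <= b2" "0 <= c'" "0 <= b3"
 shows "enn (h * (p1 + p2 + c * rho + k * (b1 + b2) + c' * b3 + k)) =
	enn h * (enn p1 + enn p2 + enn c * ennreal rho + enn k * (enn b1 + enn b2) + enn c' * enn b3 + enn k)" using assms by (simp add: ennreal_mult)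

text \<open>The difference of the two end integrals telescopes into the integral of e(t) - e(t - h)
  over the times between s + h and b. There \<open>energy_step\<close> bounds the integrand by h
  times quantities whose time integrals are small with h.\<close>

lemma (in flow_data) energy_average_decay:
 assumes sb: "0 <= s" "s < b" "b < T" and eps: "eps > 0"
 obtains delta where "delta > 0"
	"!!h. 0 < h ==> h < delta ==> (LBINT t. ind {b - h<..b} t * e t) - (LBINT t. ind {s<..s + h} t * e t) <= h * eps"
proof -
 define \<Gamma>0 where "\<Gamma>0 = (LBINT z. (G z)^2)"
 define b0 where "b0 = (LBINT t. (B t)^2)"
 have g0: "\<Gamma>0 >= 0" "b0 >= 0" by (simp_all add: \<Gamma>0_def b0_def)
 have T0: "T > 0" using sb by simp
 \<comment> \<open>Budget: the deviations from the mean get \<open>eps / 8\<close> twice, and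
   \<open>eta\<close>, \<open>omega\<close> and \<open>kappa\<close> make the three other
   contributions at most \<open>eps / 4\<close> each. \<open>eta\<close> is fixed before
   \<open>kappa\<close>, since Young's inequality puts 1 / eta in front of the translation error of
   \<open>B\<close>.\<close>
 define eta where "eta = eps / (4 * ((C + 1) * (\<Gamma>0 + 1)))"
 define K where "K = L * (vol + C)"
 have K: "K >= 0" using L_pos vol_nonneg C by (simp add: K_def)
 define S where "S = \<Gamma>0 + 2 * b0 + T"
 have S: "S >= 0" using g0 T0 by (simp add: S_def)
 define omega where "omega = eps / (4 * ((K + 1) * (S + 1)))"
 define k where "k = L * (vol + C) * omega"
 define kappa where "kappa = eps * eta / (4 * (C + 1))"
 have p: "(C + 1) * (\<Gamma>0 + 1) > 0" "(K + 1) * (S + 1) > 0" using C g0 K S by (simp_all add: add_nonneg_pos)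
 have pos: "eta > 0" "omega > 0" using eps p by (simp_all add: eta_def omega_def)
 have kappa: "kappa > 0" using eps pos C by (simp add: kappa_def)
 have k0: "k >= 0" using K pos by (simp add: k_def K_def)
 have div: "x * (eps / (4 * y)) <= eps / 4" if "0 <= x" "x <= y" "0 < y" for x y
 proof -
	have "x * (eps / (4 * y)) <= y * (eps / (4 * y))" using that eps by (intro mult_right_mono) auto
	then show ?thesis using that by simp
 qed
 have s1: "C * eta * \<Gamma>0 <= eps / 4"
 proof -
	have "C * \<Gamma>0 <= (C + 1) * (\<Gamma>0 + 1)" using C g0 by (intro mult_mono) auto
	then have "C * \<Gamma>0 * eta <= eps / 4" unfolding eta_def by (intro div p) (use C g0 in auto)
	then show ?thesis by (simp add: mult_ac)
 qed
 have s2: "k * S <= eps / 4"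
 proof -
	have "K * S <= (K + 1) * (S + 1)" using K S by (intro mult_mono) auto
	then have "K * S * omega <= eps / 4" unfolding omega_def by (intro div p) (use K S in auto)
	then show ?thesis by (simp add: k_def K_def mult_ac)
 qed
 have s3: "C / eta * kappa <= eps / 4"
 proof -
	have "C / eta * kappa = C * (eps / (4 * (C + 1)))" using pos by (simp add: kappa_def)
	then show ?thesis using div[of C "C + 1"] C by simp
 qed
 obtain delta1 where delta1: "delta1 > 0"
	"ALL s:{0..T}. ALL t:{0..T}. \<bar>s - t\<bar> < delta1 --> (ALL x:Om. \<bar>v s x - v t x\<bar> <= omega)" using unif[OF pos(2)] by blast
 have "eps / 8 > 0" using eps by simp
 then obtain delta2 where delta2: "delta2 > 0" "!!y. norm y < delta2 ==> (LBINT z. (G (z + y) - G z)^2) < eps / 8" by (rule l2_translation_continuous[OF G]) blast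
 obtain delta3 where delta3: "delta3 > 0" "!!y. norm y < delta3 ==> (LBINT t. (B (t + y) - B t)^2) < kappa" by (rule l2_translation_continuous[OF B kappa]) blast
 show thesis
 proof (rule that[of "min (min delta1 delta2) (min delta3 (b - s))"])
	show "min (min delta1 delta2) (min delta3 (b - s)) > 0" using delta1(1) delta2(1) delta3(1) sb by simp
	fix h assume h0: "0 < h" and "h < min (min delta1 delta2) (min delta3 (b - s))"
	then have h: "h < delta1" "h < delta2" "h < delta3" "h < b - s" by auto
	let ?J = "{s + h<..b}" and ?r = "time_mean h G"
	have Bm [measurable]: "B : bmeas borel" using sqint_measurable[OF B] by simp
	have rm: "?r : bmeas borel" by (rule time_mean(1)[OF G h0])
	define f where "f c z = G (z + (- c, 0)) - ?r z" for c z
	have fm: "f c : bmeas borel" for c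
	proof -
	 have "(%z. G (z + (- c, 0))) : bmeas borel" by (rule measurable_compose[OF _ Gm]) simp
	 then show ?thesis using rm by (simp add: f_def[abs_def])
	qed
	have fle: "(nni lborel (%z. enn ((f c z)^2))) <= enn (eps / 8)" if c: "0 <= c" "c <= h" for c unfolding f_def
	proof (rule time_mean(3)[OF G h0 _ c])
	 fix y :: real assume "abs y <= h"
	 then have "norm (y, 0 :: 'a) < delta2" using h by simp
	 from delta2(2)[OF this] show "(LBINT z. (G (z + (y, 0)) - G z)^2) <= eps / 8" by simp
	qed
	have rle: "(nni lborel (%z. enn ((?r z)^2))) <= ennreal \<Gamma>0" using time_mean(2)[OF G h0] G_finite by (simp add: \<Gamma>0_def)
	have r0: "?r (t, x) = 0" if "x ~: Om" for t x by (simp add: time_mean_def G_slice[OF that])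
	have f0: "f c (t, x) = 0" if "x ~: Om" for c t x by (simp add: f_def r0[OF that] G_slice[OF that])
	define P where "P c t = (nni lborel (%x. enn ((f c (t, x))^2)))" for c t
	define Q where "Q t = (nni lborel (%x. enn ((?r (t, x))^2)))" for t
	have Pm [measurable]: "P c : bmeas borel" for c unfolding P_def[abs_def] by (rule slice_nn_measurable[OF fm])
	have Qm [measurable]: "Q : bmeas borel" unfolding Q_def[abs_def] by (rule slice_nn_measurable[OF rm])
	define \<Phi> where "\<Phi> t = P 0 t + P h t + enn (k + C * eta) * Q t + enn k * (enn ((B t)^2) + enn ((B (t - h))^2))
	 + enn (C / eta) * enn ((B (t - h) - B t)^2) + enn k * ind ?J t" for t
	have AE: "AE t in lborel. enn (ind ?J t * (e t - e (t - h))) <= enn h * \<Phi> t"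
	proof -
	 have "AE t in lborel. P c t < \<infinity>" if "0 <= c" "c <= h" for c unfolding P_def by (rule slice_finite[OF fm]) (rule le_less_trans[OF fle[OF that]], simp)
	 then have a: "AE t in lborel. P 0 t < \<infinity>" "AE t in lborel. P h t < \<infinity>" using h0 by auto
	 have b: "AE t in lborel. Q t < \<infinity>" unfolding Q_def by (rule slice_finite[OF rm]) (rule le_less_trans[OF rle], simp)
	 have c: "AE t in lborel. (nni lborel (%x. enn ((G (t, x))^2))) < \<infinity>" by (rule slice_finite[OF Gm]) (simp add: G_finite)
	 show ?thesis using a b c AE_lborel_shift[OF c, of h] good AE_lborel_shift[OF good, of h]
	 proof eventually_elim
		case (elim t)
		show ?case
		proof (cases "t : ?J")
		 case True
		 then have t: "0 < t - h" "t < T" "t : {0<..<T}" "t - h : {0<..<T}" using sb h0 by auto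
		 have r: "sqint (leb Om) (%x. ?r (t, x))" "enn ((l2norm (leb Om) (%x. ?r (t, x)))^2) = Q t"
			using slice(1,2)[OF slice_measurable[OF rm] r0] elim(3) by (auto simp: Q_def)
		 have G1: "sqint (leb Om) (%x. G (t, x))" using slice(1)[OF slice_measurable[OF Gm] G_slice] elim(4) by auto
		 have G2: "sqint (leb Om) (%x. G (t - h, x))" using slice(1)[OF slice_measurable[OF Gm] G_slice] elim(5) by auto
		 have fP: "enn ((l2norm (leb Om) (%x. f c (t, x)))^2) = P c t" if "P c t < \<infinity>" for c using slice(2)[OF slice_measurable[OF fm] f0] that by (auto simp: P_def)
		 have fe: "(%x. f 0 (t, x)) = (%x. G (t, x) - ?r (t, x))" "(%x. f h (t, x)) = (%x. G (t - h, x) - ?r (t, x))" by (simp_all add: f_def)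
		 have omega': "\<bar>v t x - v (t - h) x\<bar> <= omega" if "x : Om" for x using delta1(2) t h h0 that by auto
		 have "E Om a (v t) - E Om a (v (t - h)) <=
			h * ((l2norm (leb Om) (%x. G (t, x) - ?r (t, x)))^2 + (l2norm (leb Om) (%x. G (t - h, x) - ?r (t, x)))^2
			 + (k + C * eta) * (l2norm (leb Om) (%x. ?r (t, x)))^2 + k * ((B t)^2 + (B (t - h))^2) + C / eta * (B (t - h) - B t)^2 + k)"
			unfolding k_def by (rule energy_step[OF h0 t(1,2) _ _ _ _ _ _ G1 G2 r(1) omega' pos(2,1)]) (use elim(6,7) t in "blast+")
		 then have "enn (e t - e (t - h)) <= enn (h * ((l2norm (leb Om) (%x. G (t, x) - ?r (t, x)))^2 + (l2norm (leb Om) (%x. G (t - h, x) - ?r (t, x)))^2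
			 + (k + C * eta) * (l2norm (leb Om) (%x. ?r (t, x)))^2 + k * ((B t)^2 + (B (t - h))^2) + C / eta * (B (t - h) - B t)^2 + k))"
			using elim(6,7) t by (intro ennreal_leI) auto
		 also have "... = enn h * \<Phi> t" unfolding \<Phi>_def fP[OF elim(1), unfolded fe, symmetric] fP[OF elim(2), unfolded fe, symmetric] r(2)[symmetric]
			using True by (subst ennreal_combination) (use h0 k0 C pos in auto)
		 finally show ?thesis using True by simp
		qed simp
	 qed
	qed
	have i: "integrable lborel (%t. ind I t * e t)" if "I : sets borel" for I by (rule interval_integrable[OF e that])
	have em: "e : bmeas borel" using e by simp
	have gm: "(%t. ind {s<..b - h} t * e t) : bmeas borel" using em by simp
	have shift: "ind {s<..b - h} (t + - h) * e (t + - h) = ind ?J t * e (t - h)" for t by (auto simp: indicator_def)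
	have ish: "integrable lborel (%t. ind ?J t * e (t - h))"
	 "(LBINT t. ind ?J t * e (t - h)) = (LBINT t. ind {s<..b - h} t * e t)" using integral_lborel_shift[OF gm, of "- h"] i[of "{s<..b - h}"] unfolding shift by auto
	have idiff: "integrable lborel (%t. ind ?J t * (e t - e (t - h)))" using i[of ?J] ish(1) by (simp add: right_diff_distrib)
	have "(LBINT t. ind {b - h<..b} t * e t) - (LBINT t. ind {s<..s + h} t * e t) =
		(LBINT t. ind {b - h<..b} t * e t - ind {s<..s + h} t * e t)" using i by simp
	\<comment> \<open>Both sides complete the same interval from s to b: adding the two subtracted
	  parts gives its indicator in either decomposition.\<close>
	also have "... = (LBINT t. ind ?J t * e t - ind {s<..b - h} t * e t)" by (rule bochner_integral_cong[OF refl]) (use h h0 in "auto simp: indicator_def")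
	also have "... = (LBINT t. ind ?J t * (e t - e (t - h)))" using i[of ?J] i[of "{s<..b - h}"] ish by (simp add: right_diff_distrib)
	finally have eq: "(LBINT t. ind {b - h<..b} t * e t) - (LBINT t. ind {s<..s + h} t * e t) =
		(LBINT t. ind ?J t * (e t - e (t - h)))" .
	have "enn (LBINT t. ind ?J t * (e t - e (t - h))) <= (nni lborel (%t. enn (ind ?J t * (e t - e (t - h)))))" by (rule integral_le_nn_integral[OF idiff])
	also have "... <= (nni lborel (%t. enn h * \<Phi> t))" by (rule nn_integral_mono_AE[OF AE])
	also have "... = enn h * (nni lborel (%t. \<Phi> t))" unfolding \<Phi>_def by (rule nn_integral_cmult) measurable
	also have "(nni lborel (%t. \<Phi> t)) = (nni lborel (%t. P 0 t)) + (nni lborel (%t. P h t)) + enn (k + C * eta) * (nni lborel (%t. Q t))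
		+ enn k * ((nni lborel (%t. enn ((B t)^2))) + (nni lborel (%t. enn ((B (t - h))^2))))
		+ enn (C / eta) * (nni lborel (%t. enn ((B (t - h) - B t)^2))) + enn k * emeasure lborel ?J"
	 unfolding \<Phi>_def by (simp add: nn_integral_add nn_integral_cmult nn_integral_cmult_indicator)
	also have "... <= enn (eps / 8) + enn (eps / 8) + enn (k + C * eta) * ennreal \<Gamma>0
		+ enn k * (enn b0 + enn b0) + enn (C / eta) * ennreal kappa + enn k * enn T"
	proof (intro add_mono mult_left_mono)
	 show "(nni lborel (%t. P 0 t)) <= enn (eps / 8)" "(nni lborel (%t. P h t)) <= enn (eps / 8)" unfolding P_def nn_integral_pair[OF fm] by (rule fle; use h0 in simp)+
	 show "(nni lborel (%t. Q t)) <= ennreal \<Gamma>0" unfolding Q_def nn_integral_pair[OF rm] by (rule rle)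
	 have Bn: "(nni lborel (%t. enn ((B t)^2))) = enn b0" unfolding b0_def by (rule nn_integral_eq_integral[OF sqint_integrable[OF B]]) simp
	 then show "(nni lborel (%t. enn ((B t)^2))) <= enn b0" by simp
	 show "(nni lborel (%t. enn ((B (t - h))^2))) <= enn b0" using nn_integral_lborel_shift[of "%t. enn ((B t)^2)" "- h"] Bn by simp
	 have "sqint lborel (%t. B (t + - h) - B t)" by (rule sqint_diff[OF sqint_shift[OF B] B])
	 then have "(nni lborel (%t. enn ((B (t + - h) - B t)^2))) = enn (LBINT t. (B (t + - h) - B t)^2)" by (intro nn_integral_eq_integral sqint_integrable) auto
	 also have "... <= ennreal kappa" using delta3(2)[of "- h"] h h0 by (intro ennreal_leI) auto
	 finally show "(nni lborel (%t. enn ((B (t - h) - B t)^2))) <= ennreal kappa" by simp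
	 show "emeasure lborel ?J <= enn T" using h sb h0 by (simp add: ennreal_leI)
	qed auto
	also have "... = enn (eps / 8 + eps / 8 + (k + C * eta) * \<Gamma>0 + k * (b0 + b0) + C / eta * kappa + k * T)"
	proof -
	 have n: "0 <= eps / 8" "0 <= k + C * eta" "0 <= C / eta" "0 <= kappa" "0 <= T" "0 <= b0 + b0" using eps k0 C pos kappa T0 g0 by auto
	 show ?thesis using n g0 k0 by (simp only: ennreal_plus ennreal_mult add_nonneg_nonneg mult_nonneg_nonneg)
	qed
	also have "... <= enn eps"
	proof (rule ennreal_leI)
	 have "(k + C * eta) * \<Gamma>0 + k * (b0 + b0) + k * T = k * S + C * eta * \<Gamma>0" by (simp add: S_def algebra_simps)
	 then show "eps / 8 + eps / 8 + (k + C * eta) * \<Gamma>0 + k * (b0 + b0) + C / eta * kappa + k * T <= eps" using s1 s2 s3 eps by linarith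
	qed
	finally have "enn (LBINT t. ind ?J t * (e t - e (t - h))) <= enn (h * eps)" using h0 eps by (simp add: ennreal_mult mult_left_mono)
	then show "(LBINT t. ind {b - h<..b} t * e t) - (LBINT t. ind {s<..s + h} t * e t) <= h * eps" unfolding eq using h0 eps by (simp add: ennreal_le_iff)
 qed
qed

lemma (in flow_data) energy_decreasing:
 assumes sb: "0 <= s" "s < b" "b < T"
 shows "E Om a (v b) <= E Om a (v s)"
proof (rule field_le_epsilon)
 fix eps :: real assume "eps > 0"
 then have eps: "eps / 3 > 0" by simp
 have b0: "0 < b" and sT: "s < T" using sb by auto
 obtain d1 where d1: "d1 > 0" "!!h. 0 < h ==> h < d1 ==> (LBINT t. ind {s<..s + h} t * e t) <= h * (E Om a (v s) + eps / 3)"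
	by (rule energy_average_upper[OF sb(1) sT eps]) blast
 obtain d2 where d2: "d2 > 0" "!!h. 0 < h ==> h < d2 ==> h * (E Om a (v b) - eps / 3) <= (LBINT t. ind {b - h<..b} t * e t)"
	by (rule energy_average_lower[OF b0 sb(3) eps]) blast
 obtain d3 where d3: "d3 > 0" "!!h. 0 < h ==> h < d3 ==> (LBINT t. ind {b - h<..b} t * e t) - (LBINT t. ind {s<..s + h} t * e t) <= h * (eps / 3)"
	by (rule energy_average_decay[OF sb eps]) blast
 define h where "h = min d1 (min d2 d3) / 2"
 have h: "0 < h" "h < d1" "h < d2" "h < d3" using d1(1) d2(1) d3(1) by (auto simp: h_def)
 have "h * (E Om a (v b) - eps / 3) <= h * (E Om a (v s) + eps / 3) + h * (eps / 3)" using d1(2)[OF h(1,2)] d2(2)[OF h(1,3)] d3(2)[OF h(1,4)] by linarith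
 also have "... = h * (E Om a (v s) + eps / 3 + eps / 3)" by (simp add: distrib_left)
 finally have "E Om a (v b) - eps / 3 <= E Om a (v s) + eps / 3 + eps / 3" using h(1) by (simp only: mult_le_cancel_left_pos)
 then show "E Om a (v b) <= E Om a (v s) + eps" by argo
qed

section \<open>Solutions of the constrained flow\<close>

lemma (in phase_field) l2norm_mu_le:
 assumes "u : adm"
 shows "l2norm (leb Om) (mu Om a u) <= real DIM('a) * H2norm Om u + L * vol"
proof -
 note ad = adm[OF assms]
 have "mu Om a u = (%x. (- 1) * lap Om u x + deriv (W a) (u x))" by (rule ext) (simp add: mu_def)
 then have "l2norm (leb Om) (mu Om a u) <=
	 l2norm (leb Om) (%x. (- 1) * lap Om u x) + l2norm (leb Om) (%x. deriv (W a) (u x))" using l2norm_triangle[OF sqint_scale[OF ad(7), of "- 1"] ad(8)] by simp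
 also have "l2norm (leb Om) (%x. (- 1) * lap Om u x) <= real DIM('a) * H2norm Om u" unfolding l2norm_scale using l2norm_wlaplacian[OF opn ad(2)] by simp
 also have "l2norm (leb Om) (%x. deriv (W a) (u x)) <= L * vol"
	by (rule l2norm_bounded[OF ad(8)]) (use W_estimates(4)[OF a R ad(5) ad(5)] L_pos in "auto simp: L_def")
 finally show ?thesis by simp
qed

text \<open>Every summand of the bound is integrable over a bounded time interval, which makes the
  time derivative square integrable in space-time. The factor 4 comes from squaring a sum of four
  norms.\<close>

lemma (in phase_field) flow_rhs_bound:
 assumes u: "u : adm" and mN: "mu Om a u : H2N Om" and C: "l2norm (leb Om) (mu Om a u) <= C"
	and N: "(l2norm (leb Om) (lap Om (mu Om a u)))^2 <= N"
	and f: "f : bmeas (leb Om)"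
	 "AE x in leb Om. f x = lap Om (mu Om a u) x - deriv (deriv (W a)) (u x) * mu Om a u x + A + B * mu Om a u x"
 shows "sqint (leb Om) f"
	"(l2norm (leb Om) f)^2 <= 4 * (N + (L * C)^2 + A^2 * vol^2 + B^2 * C^2)"
proof -
 let ?M = "leb Om" and ?m = "mu Om a u" and ?l = "lap Om (mu Om a u)"
 note ad = adm[OF u]
 have l: "sqint ?M ?l" by (rule H2_sqint(3)[OF opn H2N_H2[OF mN]])
 have w: "\<bar>deriv (deriv (W a)) (u x)\<bar> <= L" if "x : Om" for x using W_estimates(5)[OF a R ad(5)[OF that] ad(5)[OF that]] by (simp add: L_def)
 have wm: "sqint ?M (%x. deriv (deriv (W a)) (u x) * ?m x)" by (rule sqint_bounded_mult[OF ad(9) ad(11), of L]) (use w in auto)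
 note s1 = sqint_diff[OF l wm] and A = sqint_one[of A] and Bm = sqint_scale[OF ad(9), of B]
 note s2 = sqint_add[OF s1 A]
 note s3 = sqint_add[OF s2 Bm]
 show "sqint ?M f" using sqint_cong_AE[OF f(1) sqint_measurable[OF s3] f(2)] s3 by simp
 have t1: "l2norm ?M (%x. deriv (deriv (W a)) (u x) * ?m x) <= L * C"
 proof -
	have "l2norm ?M (%x. deriv (deriv (W a)) (u x) * ?m x) <= L * l2norm ?M ?m"
	 by (rule l2norm_mono[OF wm ad(9)]) (use w L_pos in "auto simp: abs_mult intro: mult_right_mono")
	also have "... <= L * C" using C L_pos by (intro mult_left_mono) auto
	finally show ?thesis .
 qed
 have t2: "l2norm ?M (%_. A) = abs A * vol" using l2norm_scale[of ?M A "%_. 1"] by (simp add: vol_def)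
 have t3: "l2norm ?M (%x. B * ?m x) <= abs B * C" unfolding l2norm_scale by (intro mult_left_mono C) simp
 have "l2norm ?M f = l2norm ?M (%x. ?l x - deriv (deriv (W a)) (u x) * ?m x + A + B * ?m x)" by (rule l2norm_cong_AE[OF f(1) sqint_measurable[OF s3] f(2)])
 also have "... <= l2norm ?M (%x. ?l x - deriv (deriv (W a)) (u x) * ?m x) + l2norm ?M (%_. A) + l2norm ?M (%x. B * ?m x)"
	using l2norm_triangle[OF s2 Bm] l2norm_triangle[OF s1 A] by linarith
 also have "l2norm ?M (%x. ?l x - deriv (deriv (W a)) (u x) * ?m x) <= l2norm ?M ?l + l2norm ?M (%x. deriv (deriv (W a)) (u x) * ?m x)"
	using l2norm_triangle[OF l sqint_scale[OF wm, of "- 1"]] unfolding l2norm_scale by simp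
 finally have le: "l2norm ?M f <= l2norm ?M ?l + L * C + abs A * vol + abs B * C" using t1 t2 t3 by linarith
 have sq: "(p + q + r + s)^2 <= 4 * (p^2 + q^2 + r^2 + s^2)" for p q r s :: real
 proof -
	have "4 * (p^2 + q^2 + r^2 + s^2) - (p + q + r + s)^2 =
		(p - q)\<^sup>2 + (p - r)^2 + (p - s)^2 + (q - r)^2 + (q - s)^2 + (r - s)^2" by algebra
	moreover have "0 <= (p - q)^2 + (p - r)^2 + (p - s)^2 + (q - r)^2 + (q - s)^2 + (r - s)^2" by simp
	ultimately show ?thesis by linarith
 qed
 have "(l2norm ?M f)^2 <= (l2norm ?M ?l + L * C + abs A * vol + abs B * C)^2" by (rule power_mono[OF le l2norm_nonneg])
 also have "... <= 4 * ((l2norm ?M ?l)^2 + (L * C)^2 + (abs A * vol)^2 + (abs B * C)^2)" by (rule sq)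
 also have "... <= 4 * (N + (L * C)^2 + A^2 * vol^2 + B^2 * C^2)" using N by (simp add: power_mult_distrib)
 finally show "(l2norm ?M f)^2 <= 4 * (N + (L * C)^2 + A^2 * vol^2 + B^2 * C^2)" .
qed

text \<open>The chemical potential is chosen separately at each time, so measurability of its norm
  in time is not evident. The norms of the approximating simple functions are measurable and
  converge almost everywhere.\<close>

lemma strongly_measurable_L2norm:
 fixes u :: "real => 'a::euclidean_space => real"
 assumes u: "strongly_measurable I X (H2norm Om) u" and I: "I : sets lebesgue" and X: "X \<subseteq> L2 Om"
 obtains f where "f : bmeas (leb I)" "AE t in leb I. f t = L2norm Om (u t)"
proof -
 obtain s :: "nat => real => 'a => real" where
	s1: "ALL k. finite (s k ` I) & s k ` I \<subseteq> X & (ALL f. {t\<in>I. s k t = f} : sets lebesgue)" and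
	s2: "AE t in leb I. u t : X & (%k. H2norm Om (%x. s k t x - u t x)) ----> 0" using u unfolding strongly_measurable_def by blast
 have m: "(%t. L2norm Om (s k t)) : bmeas (leb I)" for k
 proof -
	have "simple_function (leb I) (s k)" unfolding simple_function_def
	proof (intro conjI ballI)
	 show "finite (s k ` space (leb I))" using s1 by simp
	 fix f
	 have "s k -` {f} \<inter> space (leb I) = {t\<in>I. s k t = f}" by auto
	 moreover have "{t\<in>I. s k t = f} : sets lebesgue" using s1 by blast
	 ultimately show "s k -` {f} \<inter> space (leb I) : sets (leb I)" using I by (simp add: sets_restrict_space_iff)
	qed
	from simple_function_compose1[OF this, of "L2norm Om"] show ?thesis by (rule borel_measurable_simple_function)
 qed
 show thesis
 proof (rule that[of "%t. lim (%k. L2norm Om (s k t))"])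
	show "(%t. lim (%k. L2norm Om (s k t))) : bmeas (leb I)" by (rule borel_measurable_lim_metric) (rule m)
	have "AE t in leb I. t : I" by (rule AE_I2) simp
	with s2 show "AE t in leb I. lim (%k. L2norm Om (s k t)) = L2norm Om (u t)"
	proof eventually_elim
	 case (elim t)
	 have us: "sqint (leb Om) (u t)" using elim X by (auto simp: L2_eq_sqint[symmetric])
	 have ss: "sqint (leb Om) (s k t)" for k using s1 elim X by (auto simp: L2_eq_sqint[symmetric])
	 have lim: "(%k. H2norm Om (%x. s k t x - u t x)) ----> 0" using elim by blast
	 have "(%k. L2norm Om (s k t) - L2norm Om (u t)) ----> 0"
	 proof (rule Lim_null_comparison[OF _ lim], rule eventually_sequentiallyI[of 0])
		fix k
		have "\<bar>L2norm Om (s k t) - L2norm Om (u t)\<bar> <= L2norm Om (%x. s k t x - u t x)" unfolding L2norm_eq by (rule l2norm_triangle_diff[OF ss us])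
		also have "... <= H2norm Om (%x. s k t x - u t x)" by (rule l2norm_le_H2norm)
		finally show "norm (L2norm Om (s k t) - L2norm Om (u t)) <= H2norm Om (%x. s k t x - u t x)" by simp
	 qed
	 then show ?case by (intro limI) (simp add: LIM_zero_iff)
	qed
 qed
qed

lemma sqint_borel_representative:
 fixes f :: "'a::euclidean_space => real"
 assumes A: "A : sets borel" and f: "sqint (leb A) f"
 obtains f' where "sqint lborel f'" "AE x in leb A. f x = f' x"
proof -
 have As: "A : sets lebesgue" using A by simp
 obtain f' where f': "f' : bmeas borel" "!!x. x ~: A ==> f' x = 0" "AE x in leb A. f x = f' x" by (rule borel_representative[OF A sqint_measurable[OF f]]) blast
 have "sqint (leb A) f'" using sqint_cong_AE[OF sqint_measurable[OF f] borel_measurable_lebesgue_on[OF f'(1)] f'(3)] f by simp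
 moreover have "integrable (leb A) (%x. (f' x)^2) \<longleftrightarrow> integrable lborel (%x. (f' x)^2)" by (rule lebesgue_on_borel(2)[OF As]) (use f' in auto)
 ultimately have "sqint lborel f'" using f'(1) by (simp add: sqint_def)
 from that[OF this f'(3)] show thesis .
qed

lemma flow_solution_energy_decreasing:
 fixes Om :: "'a::euclidean_space set"
 assumes dom: "smooth_domain Om" and a: "a > 0" and v0: "v0 : M2 Om a \<alpha> \<beta>"
	and flow: "flow_solution Om a \<alpha> \<beta> v0 v" and sb: "0 <= s" "s < b"
 shows "E Om a (v b) <= E Om a (v s)"
proof -
 \<comment> \<open>The monotonicity result needs b strictly before the end of the time
   interval.\<close>
 define T where "T = b + 1"
 let ?I = "{0<..<T}" and ?Q = "{0<..<T} \<times> Om" and ?M = "leb Om"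
 have T: "T > 0" "b < T" using sb by (auto simp: T_def)
 have Om: "open Om" "bounded Om" "Om : sets borel" "Om : sets lebesgue" using dom by (auto simp: smooth_domain_def)
 have Is: "?I : sets borel" "?I : sets lebesgue" by auto
 have Q: "open ?Q" by (intro open_Times Om) simp
 have Qs: "?Q : sets borel" "?Q : sets lebesgue" using Q by auto
 have cont: "continuous_on ({0..} \<times> closure Om) (%z. v (fst z) (snd z))"
	and Linf: "v : Linf_time {0<..} (H2 Om) (H2norm Om)"
	and init: "AE x in ?M. v 0 x = v0 x"
	and vM: "!!t. t > 0 ==> v t : M2 Om a \<alpha> \<beta>"
	and muL: "(%s. mu Om a (v s)) : L2_time ?I (H2N Om) (H2norm Om)"
	and eqn: "EX A:L2 ?I. EX B:L2 ?I. EX g.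
		  hwd ?Q (1, 0) (%z. v (fst z) (snd z)) g &
		  (AE s in leb ?I. AE x in ?M.
			 g (s, x) = lap Om (mu Om a (v s)) x
				- deriv (deriv (W a)) (v s x) * mu Om a (v s) x + A s + B s * mu Om a (v s) x)" using flow T(1) unfolding flow_solution_def case_prod_unfold by blast+
 \<comment> \<open>Continuity on this compact cylinder yields both the uniform bound
   \<open>R\<close> and the modulus of continuity in time.\<close>
 define Kc where "Kc = {0..T} \<times> closure Om"
 have Kc: "compact Kc" unfolding Kc_def using Om(2) by (intro compact_Times) (auto simp: compact_closure)
 have contK: "continuous_on Kc (%z. v (fst z) (snd z))" by (rule continuous_on_subset[OF cont]) (auto simp: Kc_def)
 obtain R0 where R0: "!!z. z : Kc ==> norm (v (fst z) (snd z)) <= R0" using compact_imp_bounded[OF compact_continuous_image[OF contK Kc]] by (auto simp: bounded_iff)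
 define R where "R = max 1 R0"
 have inK: "(t, x) : Kc" if "0 <= t" "t <= T" "x : Om" for t x using that closure_subset[of Om] by (auto simp: Kc_def)
 have vR: "\<bar>v t x\<bar> <= R" if "0 <= t" "t <= T" "x : Om" for t x using R0[OF inK[OF that]] by (simp add: R_def)
 have unif: "EX delta>0. ALL s:{0..T}. ALL t:{0..T}. \<bar>s - t\<bar> < delta --> (ALL x:Om. \<bar>v s x - v t x\<bar> <= eta)" if eta: "eta > 0" for eta
 proof -
	obtain delta where delta: "delta > 0" "!!z z'. z : Kc ==> z' : Kc ==> dist z' z < delta ==> dist (v (fst z') (snd z')) (v (fst z) (snd z)) < eta"
	 using compact_uniformly_continuous[OF contK Kc] eta unfolding uniformly_continuous_on_def by metis
	have "\<bar>v s x - v t x\<bar> <= eta" if "s : {0..T}" "t : {0..T}" "\<bar>s - t\<bar> < delta" "x : Om" for s t x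
	 using delta(2)[of "(t, x)" "(s, x)"] inK[of s x] inK[of t x] that by (simp add: dist_Pair_Pair dist_real_def)
	then show ?thesis using delta(1) by blast
 qed
 \<comment> \<open>The definition of a solution places \<open>v t\<close> in the constraint set for
   positive times only.\<close>
 have v0M: "v 0 : M2 Om a \<alpha> \<beta>"
 proof (rule M2_cong_AE[OF Om(1) v0 _ init])
	have "continuous_on Om (%x. v (fst (0::real, x)) (snd (0::real, x)))"
	 by (rule continuous_on_compose2[OF cont]) (use closure_subset[of Om] in "auto intro!: continuous_intros")
	then show "v 0 : bmeas ?M" using Om by (intro continuous_imp_measurable_on_sets_lebesgue) auto
 qed
 interpret pf: phase_field Om a \<alpha> \<beta> R by unfold_locales (use dom a in "auto simp: R_def")
 have adm: "v t : pf.adm" if "0 <= t" "t <= T" for t unfolding pf.adm_def using vR[OF that] vM[of t] v0M that(1) by (cases "t = 0") auto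
 obtain Ch where Ch: "AE t in leb {0<..}. H2norm Om (v t) <= Ch" using Linf unfolding Linf_time_def by blast
 define C where "C = real DIM('a) * abs Ch + pf.L * pf.vol"
 have C: "C >= 0" using pf.L_pos pf.vol_nonneg by (simp add: C_def)
 have "AE t in lborel. t : {0<..} --> H2norm Om (v t) <= Ch" using Ch by (subst (asm) AE_lebesgue_on_iff) auto
 then have aeC: "AE t in lborel. t : ?I --> l2norm ?M (mu Om a (v t)) <= C"
 proof eventually_elim
	case (elim t)
	show ?case
	proof
	 assume t: "t : ?I"
	 then have "H2norm Om (v t) <= abs Ch" using elim by auto
	 then have "real DIM('a) * H2norm Om (v t) <= real DIM('a) * abs Ch" by (intro mult_left_mono) auto
	 moreover have "l2norm ?M (mu Om a (v t)) <= real DIM('a) * H2norm Om (v t) + pf.L * pf.vol" by (rule pf.l2norm_mu_le[OF adm]) (use t in auto)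
	 ultimately show "l2norm ?M (mu Om a (v t)) <= C" unfolding C_def by linarith
	qed
 qed
 have sm: "strongly_measurable ?I (H2N Om) (H2norm Om) (%s. mu Om a (v s))"
	and muI: "integrable (leb ?I) (%t. (H2norm Om (mu Om a (v t)))^2)" using muL by (auto simp: L2_time_def)
 have "AE t in leb ?I. mu Om a (v t) : H2N Om"
 proof -
	obtain s :: "nat => real => 'a => real" where
	 "AE t in leb ?I. mu Om a (v t) : H2N Om & (%k. H2norm Om (%x. s k t x - mu Om a (v t) x)) ----> 0" using sm unfolding strongly_measurable_def by blast
	then show ?thesis by eventually_elim blast
 qed
 then have aeH: "AE t in lborel. t : ?I --> mu Om a (v t) : H2N Om" by (simp only: AE_lebesgue_on_iff[OF Is(2)])
 have "H2N Om \<subseteq> L2 Om" by (auto simp: H2N_def H2_def H1_def)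
 then obtain n where n: "n : bmeas (leb ?I)" "AE t in leb ?I. n t = L2norm Om (mu Om a (v t))" by (rule strongly_measurable_L2norm[OF sm Is(2)]) blast
 obtain n' where n': "n' : bmeas borel" "!!t. t ~: ?I ==> n' t = 0" "AE t in leb ?I. n t = n' t" by (rule borel_representative[OF Is(1) n(1)]) blast
 \<comment> \<open>A Borel version of the energy in time, zero outside the interval.\<close>
 define e where "e t = 1 / 2 * (n' t)^2" for t
 have "AE t in leb ?I. n' t = l2norm ?M (mu Om a (v t))" using n(2) n'(3) by eventually_elim (simp add: L2norm_eq)
 then have aen: "AE t in lborel. t : ?I --> n' t = l2norm ?M (mu Om a (v t))" by (simp only: AE_lebesgue_on_iff[OF Is(2)])
 have e: "integrable lborel e"
 proof (rule bochner_integrable_bound)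
	show "integrable lborel (%t. 1 / 2 * C^2 * ind ?I t)" using T by (intro integrable_mult_right integrable_real_indicator) auto
	show "e : bmeas lborel" using n'(1) by (simp add: e_def[abs_def])
	show "AE t in lborel. norm (e t) <= norm (1 / 2 * C^2 * ind ?I t)" using aen aeC
	proof eventually_elim
	 case (elim t)
	 show ?case
	 proof (cases "t : ?I")
		case True
		then have "(n' t)^2 <= C^2" using elim by (auto intro!: power_mono l2norm_nonneg)
		then show ?thesis using True by (simp add: e_def)
	 next
		case False
		then show ?thesis using n'(2)[OF False] by (simp add: e_def)
	 qed
	qed
 qed
 let ?N0 = "%t. (real DIM('a))^2 * (H2norm Om (mu Om a (v t)))^2"
 have N0: "integrable (leb ?I) ?N0" using muI by simp
 obtain N' where N': "N' : bmeas borel" "!!t. t ~: ?I ==> N' t = 0" "AE t in leb ?I. ?N0 t = N' t"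
	by (rule borel_representative[OF Is(1) borel_measurable_integrable[OF N0]]) blast
 define N where "N t = \<bar>N' t\<bar>" for t
 have "integrable (leb ?I) N'" using integrable_cong_AE[OF borel_measurable_integrable[OF N0] borel_measurable_lebesgue_on[OF N'(1)] N'(3)] N0 by blast
 moreover have "integrable (leb ?I) N' \<longleftrightarrow> integrable lborel N'" by (rule lebesgue_on_borel(2)[OF Is(2) N'(1)]) (rule N'(2))
 ultimately have N: "integrable lborel N" unfolding N_def by simp
 have aeN: "AE t in lborel. t : ?I --> (l2norm ?M (lap Om (mu Om a (v t))))^2 <= N t"
 proof -
	have "AE t in lborel. t : ?I --> ?N0 t = N' t" using N'(3) by (simp only: AE_lebesgue_on_iff[OF Is(2)])
	with aeH show ?thesis
	proof eventually_elim
	 case (elim t)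
	 show ?case
	 proof
		assume t: "t : ?I"
		have "l2norm ?M (lap Om (mu Om a (v t))) <= real DIM('a) * H2norm Om (mu Om a (v t))" using elim t by (intro l2norm_wlaplacian[OF Om(1)] H2N_H2) auto
		then have "(l2norm ?M (lap Om (mu Om a (v t))))^2 <= ?N0 t" unfolding power_mult_distrib[symmetric] by (rule power_mono[OF _ l2norm_nonneg])
		then show "(l2norm ?M (lap Om (mu Om a (v t))))^2 <= N t" using elim t by (auto simp: N_def)
	 qed
	qed
 qed
 obtain A0 B0 g where AB0: "A0 : L2 ?I" "B0 : L2 ?I" and g: "hwd ?Q (1, 0) (%z. v (fst z) (snd z)) g"
	and geq: "AE s in leb ?I. AE x in ?M. g (s, x) = lap Om (mu Om a (v s)) x
				- deriv (deriv (W a)) (v s x) * mu Om a (v s) x + A0 s + B0 s * mu Om a (v s) x" using eqn by blast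
 obtain A where A: "sqint lborel A" "AE t in leb ?I. A0 t = A t" by (rule sqint_borel_representative[OF Is(1) AB0(1)[unfolded L2_eq_sqint]]) blast
 obtain B where B: "sqint lborel B" "AE t in leb ?I. B0 t = B t" by (rule sqint_borel_representative[OF Is(1) AB0(2)[unfolded L2_eq_sqint]]) blast
 have "g : bmeas (leb ?Q)" using g loc_integrable_measurable[OF Q] by (auto simp: has_weak_deriv_def)
 then obtain G where G: "G : bmeas borel" "!!z. z ~: ?Q ==> G z = 0" "AE z in leb ?Q. g z = G z" by (rule borel_representative[OF Qs(1)]) blast
 have aeG: "AE t in lborel. t : ?I --> (AE x in ?M. G (t, x) = lap Om (mu Om a (v t)) x
				- deriv (deriv (W a)) (v t x) * mu Om a (v t) x + A t + B t * mu Om a (v t) x)"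
 proof -
	have "AE z in lborel. z : ?Q --> g z = G z" using G(3) by (simp only: AE_lebesgue_on_iff[OF Qs(2)])
	from AE_lborel_pair[OF this] have 1: "AE t in lborel. AE x in lborel. (t, x) : ?Q --> g (t, x) = G (t, x)" .
	have 2: "AE t in lborel. t : ?I --> A0 t = A t" "AE t in lborel. t : ?I --> B0 t = B t" using A(2) B(2) by (simp_all only: AE_lebesgue_on_iff[OF Is(2)])
	have 3: "AE t in lborel. t : ?I --> (AE x in ?M. g (t, x) = lap Om (mu Om a (v t)) x
				- deriv (deriv (W a)) (v t x) * mu Om a (v t) x + A0 t + B0 t * mu Om a (v t) x)" using geq by (simp only: AE_lebesgue_on_iff[OF Is(2)])
	show ?thesis using 1 2 3
	proof eventually_elim
	 case (elim t)
	 show ?case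
	 proof
		assume t: "t : ?I"
		have "AE x in lborel. x : Om --> g (t, x) = G (t, x)" using elim(1) by eventually_elim (use t in blast)
		then have "AE x in ?M. g (t, x) = G (t, x)" by (simp only: AE_lebesgue_on_iff[OF Om(4)])
		moreover have "AE x in ?M. g (t, x) = lap Om (mu Om a (v t)) x
				- deriv (deriv (W a)) (v t x) * mu Om a (v t) x + A t + B t * mu Om a (v t) x" using elim(2,3,4) t by simp
		ultimately show "AE x in ?M. G (t, x) = lap Om (mu Om a (v t)) x
				- deriv (deriv (W a)) (v t x) * mu Om a (v t) x + A t + B t * mu Om a (v t) x" by eventually_elim (simp only:)
	 qed
	qed
 qed
 have Gs: "sqint lborel G"
 proof -
	have Gp: "(%z. enn ((G z)^2)) : bmeas (lborel \<Otimes>\<^sub>M lborel)" using G(1) by (simp add: lborel_prod)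
	have [measurable]: "G : bmeas (borel \<Otimes>\<^sub>M borel)" using G(1) by (simp add: borel_prod)
	have Gt: "(%x. G (t, x)) : bmeas borel" for t by measurable
	\<comment> \<open>The constant term is confined to the time interval so that the bound is
	  integrable on the whole line.\<close>
	let ?b = "%t. 4 * (N t + ind ?I t * (pf.L * C)^2 + (A t)^2 * pf.vol\<^sup>2 + (B t)^2 * C^2)"
	have bi: "integrable lborel ?b" using N sqint_integrable[OF A(1)] sqint_integrable[OF B(1)] T
	 by (intro integrable_mult_right integrable_mult_left bochner_integrable_add integrable_real_indicator) auto
	have b0: "0 <= ?b t" for t by (simp add: N_def)
	have "AE t in lborel. (nni lborel (%x. enn ((G (t, x))^2))) <= enn (?b t)" using aeG aeH aeC aeN
	proof eventually_elim
	 case (elim t)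
	 show ?case
	 proof (cases "t : ?I")
		case True
		have t: "0 <= t" "t <= T" using True by auto
		have m: "mu Om a (v t) : H2N Om" "l2norm ?M (mu Om a (v t)) <= C" "(l2norm ?M (lap Om (mu Om a (v t))))^2 <= N t"
		 and ae: "AE x in ?M. G (t, x) = lap Om (mu Om a (v t)) x
				- deriv (deriv (W a)) (v t x) * mu Om a (v t) x + A t + B t * mu Om a (v t) x" using elim True by blast+
		note fb = pf.flow_rhs_bound[OF adm[OF t] m borel_measurable_lebesgue_on[OF Gt] ae]
		have z: "(G (t, x))^2 = 0" if "x ~: Om" for x using G(2)[of "(t, x)"] that by simp
		have mt: "(%x. (G (t, x))^2) : bmeas borel" using Gt[of t] by simp
		have i: "integrable lborel (%x. (G (t, x))^2)" using lebesgue_on_borel(2)[OF Om(4) mt z] sqint_integrable[OF fb(1)] by simp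
		have "(nni lborel (%x. enn ((G (t, x))^2))) = enn (LBINT x. (G (t, x))^2)" by (rule nn_integral_eq_integral[OF i]) simp
		also have "(LBINT x. (G (t, x))^2) = (l2norm ?M (%x. G (t, x)))^2" using lebesgue_on_borel(1)[OF Om(4) mt z] by (simp add: l2norm_sq)
		also have "ennreal ... <= enn (?b t)" using fb(2) True by (intro ennreal_leI) simp
		finally show ?thesis .
	 next
		case False
		then have "G (t, x) = 0" for x by (intro G(2)) auto
		then show ?thesis by simp
	 qed
	qed
	then have "(nni lborel (%t. (nni lborel (%x. enn ((G (t, x))^2))))) <= (nni lborel (%t. enn (?b t)))" by (rule nn_integral_mono_AE)
	also have "... = enn (integral\<^sup>L lborel ?b)" by (rule nn_integral_eq_integral[OF bi]) (use b0 in auto)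
	also have "... < \<infinity>" by simp
	finally have "(\<integral>\<^sup>+z. enn ((G z)^2) \<partial>(lborel \<Otimes>\<^sub>M lborel)) < \<infinity>" unfolding lborel.nn_integral_fst[OF Gp] .
	then have "integrable lborel (%z. (G z)^2)" unfolding lborel_prod by (intro integrableI_nonneg) (use G(1) in auto)
	then show ?thesis using G(1) by (simp add: sqint_def)
 qed
 have "flow_data Om a \<alpha> \<beta> R v T C G A B N e"
 proof unfold_locales
	show "AE x in ?M. v t x - v s x = (LBINT tau. ind {s<..t} tau * G (tau, x))"
	 if st: "0 < s" "s < t" "t < T" for s t
	proof (rule weak_time_derivative_increment[OF Om(1,2) _ _ _ g Gs _ G(3) st])
	 show "continuous_on ?Q (%z. v (fst z) (snd z))" by (rule continuous_on_subset[OF cont]) (use closure_subset[of Om] in auto)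
	 show "\<bar>v t x\<bar> <= R" if "t : ?I" "x : Om" for t x by (rule vR) (use that in auto)
	 show "EX delta>0. ALL s:?I. ALL t:?I. \<bar>s - t\<bar> < delta --> (ALL x:Om. \<bar>v s x - v t x\<bar> <= eta)" if eta: "eta > 0" for eta
	 proof -
		obtain delta where "delta > 0" "ALL s:{0..T}. ALL t:{0..T}. \<bar>s - t\<bar> < delta --> (ALL x:Om. \<bar>v s x - v t x\<bar> <= eta)" using unif[OF eta] by blast
		moreover have "?I \<subseteq> {0..T}" by auto
		ultimately show ?thesis by blast
	 qed
	qed (rule G(2))
	show "AE t in lborel. t : ?I --> mu Om a (v t) : H2N Om & l2norm ?M (mu Om a (v t)) <= C &
	 (l2norm ?M (lap Om (mu Om a (v t))))\<^sup>2 <= N t & e t = E Om a (v t) &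
	 (AE x in ?M. G (t, x) = lap Om (mu Om a (v t)) x
		- deriv (deriv (W a)) (v t x) * mu Om a (v t) x + A t + B t * mu Om a (v t) x)" using aeH aeC aeN aen aeG
	proof eventually_elim
	 case (elim t)
	 show ?case
	 proof (intro impI conjI)
		assume t: "t : ?I"
		show "e t = E Om a (v t)" using elim(4) t unfolding e_def pf.E_eq by auto
	 qed (use elim in blast)+
	qed
 qed (fact C adm unif Gs G(2) B(1) N e | simp add: N_def)+
 from flow_data.energy_decreasing[OF this sb T(2)] show ?thesis .
qed

theorem corollary1p2:
  fixes \<Omega> :: "'a::euclidean_space set"
    and a \<alpha> \<beta> :: real
    and v0 :: "'a \<Rightarrow> real"
    and v :: "real \<Rightarrow> 'a \<Rightarrow> real"
  assumes "DIM('a) \<le> 3"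
    and "smooth_domain \<Omega>"
    and "a > 0"
    and "\<beta> > beta_min \<Omega> a \<alpha>"
    and "Z \<Omega> a \<alpha> \<beta> = {}"
    and "v0 \<in> M2 \<Omega> a \<alpha> \<beta>"
    and "flow_solution \<Omega> a \<alpha> \<beta> v0 v"
  shows "(\<forall>t\<ge>0. E \<Omega> a (v t) = 1 / 2 * (L2norm \<Omega> (mu \<Omega> a (v t)))\<^sup>2) \<and>
         antimono_on {0..} (\<lambda>t. E \<Omega> a (v t))"
proof (intro conjI allI impI)
  show "E \<Omega> a (v t) = 1 / 2 * (L2norm \<Omega> (mu \<Omega> a (v t)))\<^sup>2" for t
    by (simp add: E_def L2norm_eq l2norm_sq mu_def)
  show "antimono_on {0..} (\<lambda>t. E \<Omega> a (v t))"
  proof (rule monotone_onI)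
    fix s t :: real
    assume st: "s \<in> {0..}" "t \<in> {0..}" "s \<le> t"
    show "E \<Omega> a (v t) \<le> E \<Omega> a (v s)"
    proof (cases "s = t")
      case False
      then have "0 \<le> s" "s < t" using st by auto
      then show ?thesis by (rule flow_solution_energy_decreasing[OF assms(2,3,6,7)])
    qed simp
  qed
qed

end
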